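(* Suppose $m_+(x)/m(x)\to0$ as $x\to\infty$. Then, as $Q\wedge R\to\infty$, $$P\big[\sigma^x_{\mathbb Z\setminus(-Q,R)}<\sigma^x_0\big]=P\big[\sigma^x_{\{-Q,R\}}<\sigma^x_0\big]\{1+o(1)\}$$ uniformly for integers $x\in(-Q,R)$ subject to the condition $$\frac{a(-R)-a(-R+x)}{a^\dagger(x)}\longrightarrow0 .$$
   Context: Let $X,X_1,X_2,\dots$ be i.i.d. integer-valued random variables, $S_n=X_1+\dots+X_n$, $S_0=0$, and $S^x_n=x+S_n$ for $x\in\mathbb Z$. Standing assumptions: the random walk is irreducible on $\mathbb Z$, $EX=0$, $EX^2=\infty$, and $P[X\ge2]>0$. The potential function is $a(x)=\sum_{n=0}^\infty\big(P[S_n=0]-P[S_n=-x]\big)$ (the series converges), and $a^\dagger(x)=\delta_{x,0}+a(x)$ with $\delta_{x,0}$ the Kronecker delta (note $a(0)=0$). For real $x\ge0$: $\mu_-(x)=P[X<-x]$, $\mu_+(x)=P[X>x]$; $\eta_\pm(x)=\int_x^\infty\mu_\pm(y)\,dy$; $m_\pm(x)=\int_0^x\eta_\pm(s)\,ds$, $m=m_++m_-$. $\sigma^x_B=\inf\{n\ge1:S^x_n\in B\}$ and $\sigma^x_0=\sigma^x_{\{0\}}$. $Q,R$ denote positive integers, $Q\wedge R=\min(Q,R)$, and $\mathbb Z\setminus(-Q,R)$ is the set of integers in $(-\infty,-Q]\cup[R,\infty)$. "Uniformly subject to the condition $D(x,R)\to0$" means: for every $\varepsilon>0$ there are $\delta>0$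 and $N$ such that the $o(1)$ term is less than $\varepsilon$ in absolute value whenever $Q\wedge R\ge N$, $-Q<x<R$ and $|D(x,R)|<\delta$. *)

theory Defs
  imports "HOL-Probability.Probability"
begin

text \<open>
  An i.i.d. sequence \<open>X, X\<^sub>1, X\<^sub>2, \<dots>\<close> of integer-valued random variables is a family
  \<open>X :: nat \<Rightarrow> 'a \<Rightarrow> int\<close>: \<open>X 0\<close> is the generic copy \<open>X\<close>, and only \<open>X 1, X 2, \<dots>\<close>
  are used as the steps of the walk.
\<close>

definition iid_int :: "'a measure \<Rightarrow> (nat \<Rightarrow> 'a \<Rightarrow> int) \<Rightarrow> bool" where
  "iid_int M X \<longleftrightarrow>
     prob_space.indep_vars M (\<lambda>_. count_space UNIV) X UNIV \<and>
     (\<forall>i. distr M (count_space UNIV) (X i) = distr M (count_space UNIV) (X 0))"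

definition walk :: "(nat \<Rightarrow> 'a \<Rightarrow> int) \<Rightarrow> int \<Rightarrow> nat \<Rightarrow> 'a \<Rightarrow> int" where
  "walk X x n \<omega> = x + (\<Sum>i=1..n. X i \<omega>)"

definition irreducible_walk :: "'a measure \<Rightarrow> (nat \<Rightarrow> 'a \<Rightarrow> int) \<Rightarrow> bool" where
  "irreducible_walk M X \<longleftrightarrow>
     (\<forall>x y. \<exists>n. measure M {\<omega> \<in> space M. walk X x n \<omega> = y} > 0)"

text \<open>
  The series below converges only conditionally in general; \<open>suminf\<close> is the limit
  of its partial sums.
\<close>

definition potential :: "'a measure \<Rightarrow> (nat \<Rightarrow> 'a \<Rightarrow> int) \<Rightarrow> int \<Rightarrow> real" where
  "potential M X x =
     (\<Sum>n. measure M {\<omega> \<in> space M. walk X 0 n \<omega> = 0}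
         - measure M {\<omega> \<in> space M. walk X 0 n \<omega> = - x})"

definition potential_dagger :: "'a measure \<Rightarrow> (nat \<Rightarrow> 'a \<Rightarrow> int) \<Rightarrow> int \<Rightarrow> real" where
  "potential_dagger M X x = (if x = 0 then 1 else 0) + potential M X x"

definition mu_minus :: "'a measure \<Rightarrow> ('a \<Rightarrow> int) \<Rightarrow> real \<Rightarrow> real" where
  "mu_minus M Y x = measure M {\<omega> \<in> space M. real_of_int (Y \<omega>) < - x}"

definition mu_plus :: "'a measure \<Rightarrow> ('a \<Rightarrow> int) \<Rightarrow> real \<Rightarrow> real" where
  "mu_plus M Y x = measure M {\<omega> \<in> space M. real_of_int (Y \<omega>) > x}"

definition eta_minus :: "'a measure \<Rightarrow> ('a \<Rightarrow> int) \<Rightarrow> real \<Rightarrow> real" where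
  "eta_minus M Y x = (LBINT y:{x..}. mu_minus M Y y)"

definition eta_plus :: "'a measure \<Rightarrow> ('a \<Rightarrow> int) \<Rightarrow> real \<Rightarrow> real" where
  "eta_plus M Y x = (LBINT y:{x..}. mu_plus M Y y)"

definition m_minus :: "'a measure \<Rightarrow> ('a \<Rightarrow> int) \<Rightarrow> real \<Rightarrow> real" where
  "m_minus M Y x = (LBINT s:{0..x}. eta_minus M Y s)"

definition m_plus :: "'a measure \<Rightarrow> ('a \<Rightarrow> int) \<Rightarrow> real \<Rightarrow> real" where
  "m_plus M Y x = (LBINT s:{0..x}. eta_plus M Y s)"

definition m_total :: "'a measure \<Rightarrow> ('a \<Rightarrow> int) \<Rightarrow> real \<Rightarrow> real" where
  "m_total M Y x = m_plus M Y x + m_minus M Y x"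

text \<open>
  Time \<open>0\<close> is excluded, so for \<open>x \<in> B\<close> this is a return time; it is \<open>\<infinity>\<close> if \<open>B\<close> is
  never visited.
\<close>

definition hit_time :: "(nat \<Rightarrow> 'a \<Rightarrow> int) \<Rightarrow> int \<Rightarrow> int set \<Rightarrow> 'a \<Rightarrow> enat" where
  "hit_time X x B \<omega> = Inf {enat n |n. n \<ge> 1 \<and> walk X x n \<omega> \<in> B}"

definition prob_hit_before ::
  "'a measure \<Rightarrow> (nat \<Rightarrow> 'a \<Rightarrow> int) \<Rightarrow> int \<Rightarrow> int set \<Rightarrow> int set \<Rightarrow> real" where
  "prob_hit_before M X x A B =
     measure M {\<omega> \<in> space M. hit_time X x A \<omega> < hit_time X x B \<omega>}"

end

theory Submission
  imports Defs
begin

text \<open>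
  Write \<open>A = a(R) + a(-R)\<close> and let \<open>E\<^sub>x[f]\<close> be the expectation of \<open>f\<close> at the exit position from
  \<open>(-Q, R)\<close>, on the event that the exit occurs before the return to \<open>0\<close>.  Discounted Green
  functions give \<open>A P\<^sub>z[\<sigma>\<^sub>R < \<sigma>\<^sub>0] = a\<^sup>\<dagger>(z) + a(-R) - a(z - R)\<close>; applying \<open>E\<^sub>x\<close> to both sides and
  using \<open>E\<^sub>x[a] \<le> a\<^sup>\<dagger>(x)\<close> bounds the overshoot term \<open>E\<^sub>x[a(\<cdot> - R); \<cdot> > R]\<close> by a small multiple of
  \<open>a\<^sup>\<dagger>(x)\<close>, provided that \<open>a(-n)/a(n)\<close> tends to \<open>0\<close>.  Hence a walk that jumps over \<open>R\<close> comes back to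
  \<open>R\<close> before visiting \<open>0\<close>, up to an event that is negligible compared with
  \<open>P\<^sub>x[\<sigma>\<^sub>R < \<sigma>\<^sub>0] \<sim> a\<^sup>\<dagger>(x)/A\<close>; the overshoot below \<open>-Q\<close> is controlled by \<open>a(-Q)/a(Q)\<close> in the same way.

  The limit \<open>a(-n)/a(n) \<rightarrow> 0\<close> comes from the Fourier representation of \<open>a\<close>.  Replacing all positive
  jumps by jumps of size \<open>1\<close> with the same mean gives a walk that is skip-free upwards; its
  potential vanishes on the negative half-line and is at least of order \<open>1 / (n J(1/n))\<close> at \<open>n\<close>, where
  \<open>x\<^sup>2 J(1/x)\<close> is comparable to \<open>m(x)\<close>.  As \<open>m\<^sub>+/m \<rightarrow> 0\<close>, the two potentials differ, up to a
  constant factor, by \<open>o(1 / (n J(1/n)))\<close>.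
\<close>

section \<open>Expectations at a hitting time\<close>

text \<open>The hypotheses place \<open>J\<close> between \<open>t^2\<close> (infinite variance) and
  \<open>t\<close> (finite mean) near 0 and give no regular variation. Bounding the difference of
  the potentials by the integral of \<open>\<epsilon>/J\<close> may therefore lose a logarithm
  against \<open>1/(n J(1/n))\<close>. The way out is the identity \<open>t J' = J + r\<close>,
  where \<open>r\<close> is the mean of \<open>rho\<close> and \<open>i = J - r\<close> that of
  \<open>iota\<close>: it makes \<open>r/J^2\<close> and \<open>t i/J^2\<close> the derivatives of
  \<open>-t/J\<close> and \<open>t^2/J\<close>, so that their integrals have the right order. This
  is why real and imaginary parts are estimated separately throughout. Left dominance enters a
  second time through the lower bound \<open>|psi| >= J/40\<close>: negative jumps contribute with
  the same sign to \<open>Re psi\<close> and to \<open>- Im psi\<close>, so nothing cancels. The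
  discount is there because the walk is recurrent and its Green function diverges at
  \<open>s = 1\<close>; only differences of Green functions survive the limit.\<close>

text \<open>
  In terms of \<open>\<sigma>\<close>, the first time \<open>n \<ge> 1\<close> at which the walk started at \<open>x\<close> is in \<open>D\<close>, \<open>hit_exp\<close> is the
  expectation of \<open>s ^ \<sigma> * f (S \<sigma>)\<close> on \<open>\<sigma> < \<infinity>\<close>, and \<open>hit_upto\<close> is its restriction to \<open>\<sigma> \<le> n\<close>.
\<close>

fun hit_upto :: "int pmf \<Rightarrow> ennreal \<Rightarrow> int set \<Rightarrow> (int \<Rightarrow> ennreal) \<Rightarrow> nat \<Rightarrow> int \<Rightarrow> ennreal" where
  "hit_upto p s D f 0 x = 0"
| "hit_upto p s D f (Suc n) x =
     s * (\<integral>\<^sup>+v. (if x + v \<in> D then f (x + v) else hit_upto p s D f n (x + v)) \<partial>measure_pmf p)"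

definition hit_exp :: "int pmf \<Rightarrow> ennreal \<Rightarrow> int set \<Rightarrow> (int \<Rightarrow> ennreal) \<Rightarrow> int \<Rightarrow> ennreal" where
  "hit_exp p s D f x = (SUP n. hit_upto p s D f n x)"

lemma hit_upto_Suc_mono: "hit_upto p s D f n x \<le> hit_upto p s D f (Suc n) x"
proof (induction n arbitrary: x)
  case (Suc n)
  show ?case
    by (subst (1 2) hit_upto.simps(2)) (intro mult_left_mono nn_integral_mono, auto simp del: hit_upto.simps intro: Suc.IH)
qed simp

text \<open>In the discount limit the factor \<open>s\<close> and the integral both grow with the
  same index; \<open>max k l\<close> reduces two indices to one.\<close>

lemma SUP_mult_incseq_ennreal:
  fixes f g :: "nat \<Rightarrow> ennreal"
  assumes "incseq f" "incseq g"
  shows "(SUP k. f k * g k) = (SUP k. f k) * (SUP k. g k)"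
proof (rule antisym)
  show "(SUP k. f k * g k) \<le> (SUP k. f k) * (SUP k. g k)"
    by (intro SUP_least mult_mono SUP_upper) auto
  have "f k * g l \<le> (SUP k. f k * g k)" for k l
    using assms by (intro SUP_upper2[of "max k l"] mult_mono) (auto simp: incseq_def)
  then show "(SUP k. f k) * (SUP k. g k) \<le> (SUP k. f k * g k)"
    by (simp add: SUP_mult_left_ennreal SUP_mult_right_ennreal SUP_least)
qed

lemma incseq_hit_upto: "incseq (\<lambda>n. hit_upto p s D f n x)"
  by (intro incseq_SucI hit_upto_Suc_mono)

text \<open>First-step analysis: dropping the first member of an increasing sequence keeps its
  supremum, and monotone convergence carries the supremum through the mean.\<close>

lemma hit_exp_unfold:
  "hit_exp p s D f x =
     s * (\<integral>\<^sup>+v. (if x + v \<in> D then f (x + v) else hit_exp p s D f (x + v)) \<partial>measure_pmf p)"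
proof -
  have "hit_exp p s D f x = (SUP n. hit_upto p s D f (Suc n) x)"
    unfolding hit_exp_def
    by (intro antisym SUP_least) (meson SUP_upper2 UNIV_I hit_upto_Suc_mono SUP_upper)+
  also have "\<dots> = s * (SUP n. \<integral>\<^sup>+v. (if x + v \<in> D then f (x + v) else hit_upto p s D f n (x + v)) \<partial>measure_pmf p)"
    by (simp add: SUP_mult_left_ennreal)
  also have "(SUP n. \<integral>\<^sup>+v. (if x + v \<in> D then f (x + v) else hit_upto p s D f n (x + v)) \<partial>measure_pmf p)
    = (\<integral>\<^sup>+v. (SUP n. (if x + v \<in> D then f (x + v) else hit_upto p s D f n (x + v))) \<partial>measure_pmf p)"
    using incseq_hit_upto[of p s D f]
    by (intro nn_integral_monotone_convergence_SUP[symmetric]) (auto simp: incseq_def le_fun_def)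
  also have "\<dots> = (\<integral>\<^sup>+v. (if x + v \<in> D then f (x + v) else hit_exp p s D f (x + v)) \<partial>measure_pmf p)"
    by (intro nn_integral_cong) (auto simp: hit_exp_def)
  finally show ?thesis .
qed

text \<open>\<open>hit_exp\<close> is the least solution of its first-step equation, so it lies
  below every supersolution \<open>V\<close>. The upper bounds on hitting expectations below are
  obtained by exhibiting such a \<open>V\<close>.\<close>

lemma hit_exp_least:
  assumes "\<And>x. s * (\<integral>\<^sup>+v. (if x + v \<in> D then f (x + v) else V (x + v)) \<partial>measure_pmf p) \<le> V x"
  shows "hit_exp p s D f x \<le> V x"
proof -
  have "hit_upto p s D f n x \<le> V x" for n x
  proof (induction n arbitrary: x)
    case (Suc n)
    have "hit_upto p s D f (Suc n) x \<le> s * (\<integral>\<^sup>+v. (if x + v \<in> D then f (x + v) else V (x + v)) \<partial>measure_pmf p)"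
      unfolding hit_upto.simps by (intro mult_left_mono nn_integral_mono) (auto simp: Suc.IH)
    then show ?case using assms[of x] by (rule order_trans)
  qed simp
  then show ?thesis unfolding hit_exp_def by (intro SUP_least)
qed

lemma hit_exp_mono:
  assumes "\<And>z. z \<in> D \<Longrightarrow> f z \<le> g z"
  shows "hit_exp p s D f x \<le> hit_exp p s D g x"
proof (rule hit_exp_least)
  fix x
  show "s * (\<integral>\<^sup>+v. (if x + v \<in> D then f (x + v) else hit_exp p s D g (x + v)) \<partial>measure_pmf p) \<le> hit_exp p s D g x"
    by (subst (2) hit_exp_unfold, intro mult_left_mono nn_integral_mono) (auto intro: assms)
qed

lemma hit_exp_cong:
  assumes "\<And>z. z \<in> D \<Longrightarrow> f z = g z"
  shows "hit_exp p s D f x = hit_exp p s D g x"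
  by (intro antisym hit_exp_mono) (auto simp: assms)

lemma hit_exp_add: "hit_exp p s D (\<lambda>z. f z + g z) x = hit_exp p s D f x + hit_exp p s D g x"
proof -
  have "hit_upto p s D (\<lambda>z. f z + g z) n x = hit_upto p s D f n x + hit_upto p s D g n x" for n x
  proof (induction n arbitrary: x)
    case (Suc n)
    show ?case unfolding hit_upto.simps distrib_left[symmetric]
      by (subst nn_integral_add[symmetric]) (auto intro!: arg_cong2[where f="(*)"] nn_integral_cong simp: Suc.IH)
  qed simp
  then show ?thesis unfolding hit_exp_def
    by (simp add: ennreal_SUP_add incseq_hit_upto)
qed

lemma hit_exp_cmult: "hit_exp p s D (\<lambda>z. c * f z) x = c * hit_exp p s D f x"
proof -
  have "hit_upto p s D (\<lambda>z. c * f z) n x = c * hit_upto p s D f n x" for n x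
  proof (induction n arbitrary: x)
    case (Suc n)
    have "hit_upto p s D (\<lambda>z. c * f z) (Suc n) x =
       s * (\<integral>\<^sup>+v. c * (if x + v \<in> D then f (x + v) else hit_upto p s D f n (x + v)) \<partial>measure_pmf p)"
      unfolding hit_upto.simps
      by (auto intro!: arg_cong2[where f="(*)"] nn_integral_cong simp: Suc.IH)
    then show ?case by (subst (asm) nn_integral_cmult) (auto simp: mult.left_commute)
  qed simp
  then show ?thesis unfolding hit_exp_def by (simp add: SUP_mult_left_ennreal)
qed

lemma hit_exp_le_1:
  assumes "\<And>z. z \<in> D \<Longrightarrow> f z \<le> 1"
  shows "hit_exp p 1 D f x \<le> 1"
proof (rule hit_exp_least)
  fix x
  have "(\<integral>\<^sup>+v. (if x + v \<in> D then f (x + v) else 1) \<partial>measure_pmf p) \<le> (\<integral>\<^sup>+v. 1 \<partial>measure_pmf p)"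
    by (intro nn_integral_mono) (auto simp: assms)
  then show "1 * (\<integral>\<^sup>+v. (if x + v \<in> D then f (x + v) else 1) \<partial>measure_pmf p) \<le> 1"
    by simp
qed

text \<open>A first visit to the smaller set passes through the first visit to the larger one. No
  stopping times are involved: each side is a supersolution of the first-step equation of the other,
  and minimality gives both inequalities.\<close>

lemma hit_exp_strong_markov:
  assumes "D \<subseteq> D'"
  shows "hit_exp p s D f x = hit_exp p s D' (\<lambda>z. if z \<in> D then f z else hit_exp p s D f z) x"
    (is "?L x = ?R x")
proof (rule antisym)
  have le: "?R x \<le> ?L x" for x
  proof (rule hit_exp_least)
    fix x
    show "s * (\<integral>\<^sup>+v. (if x + v \<in> D' then (if x + v \<in> D then f (x + v) else ?L (x + v)) else ?L (x + v)) \<partial>measure_pmf p) \<le> ?L x"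
      by (subst (3) hit_exp_unfold, intro mult_left_mono nn_integral_mono) (use assms in auto)
  qed
  then show "?R x \<le> ?L x" .
  \<comment> \<open>On \<open>D' - D\<close> the payoff of \<open>?R\<close> is \<open>?L\<close>,
    so this direction uses the inequality just proved.\<close>
  show "?L x \<le> ?R x"
  proof (rule hit_exp_least)
    fix x
    show "s * (\<integral>\<^sup>+v. (if x + v \<in> D then f (x + v) else ?R (x + v)) \<partial>measure_pmf p) \<le> ?R x"
      by (subst (2) hit_exp_unfold, intro mult_left_mono nn_integral_mono) (use assms le in auto)
  qed
qed

text \<open>Identities are proved with a discount, where Green functions are finite, and reach the
  undiscounted walk through this limit. Everything increases with the discount, so it amounts to
  interchanging two suprema.\<close>

lemma hit_exp_discount_limit:
  fixes s :: "nat \<Rightarrow> ennreal"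
  assumes "incseq s" "(SUP k. s k) = t"
  shows "(\<lambda>k. hit_exp p (s k) D f x) \<longlonglongrightarrow> hit_exp p t D f x"
proof -
  have mono: "s k \<le> s l" if "k \<le> l" for k l using assms(1) that by (auto simp: incseq_def)
  have inc: "hit_upto p (s k) D f n x \<le> hit_upto p (s l) D f n x" if "k \<le> l" for k l n x
  proof (induction n arbitrary: x)
    case (Suc n)
    show ?case unfolding hit_upto.simps
      by (intro mult_mono nn_integral_mono) (auto simp: Suc.IH mono that)
  qed simp
  have sup: "(SUP k. hit_upto p (s k) D f n x) = hit_upto p t D f n x" for n x
  proof (induction n arbitrary: x)
    case (Suc n)
    let ?g = "\<lambda>k v. if x + v \<in> D then f (x + v) else hit_upto p (s k) D f n (x + v)"
    have ig: "incseq ?g" using inc by (auto simp: incseq_def le_fun_def)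
    have "(SUP k. hit_upto p (s k) D f (Suc n) x) = (SUP k. s k * integral\<^sup>N p (?g k))" by simp
    also have "\<dots> = (SUP k. s k) * (SUP k. integral\<^sup>N p (?g k))"
      using ig by (intro SUP_mult_incseq_ennreal) (auto simp: incseq_def le_fun_def mono intro!: nn_integral_mono)
    also have "(SUP k. integral\<^sup>N p (?g k)) = (\<integral>\<^sup>+v. (SUP k. ?g k v) \<partial>measure_pmf p)"
      using ig by (intro nn_integral_monotone_convergence_SUP[symmetric]) auto
    also have "\<dots> = (\<integral>\<^sup>+v. (if x + v \<in> D then f (x + v) else hit_upto p t D f n (x + v)) \<partial>measure_pmf p)"
      by (intro nn_integral_cong) (auto simp: Suc.IH)
    finally show ?case using assms(2) by simp
  qed simp
  have "incseq (\<lambda>k. hit_exp p (s k) D f x)"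
    unfolding hit_exp_def incseq_def by (auto intro!: SUP_mono inc)
  moreover have "(SUP k. hit_exp p (s k) D f x) = hit_exp p t D f x"
    unfolding hit_exp_def by (subst SUP_commute) (simp add: sup)
  ultimately show ?thesis by (metis LIMSEQ_SUP)
qed

text \<open>The bound is the mean of \<open>V\<close> after one step instead of \<open>V x\<close>,
  because superharmonicity may fail at 0. For the potential the one-step mean at 0 exceeds the value
  by 1, which is the origin of the dagger.\<close>

lemma hit_exp_superharmonic:
  assumes "\<And>x. x \<noteq> 0 \<Longrightarrow> (\<integral>\<^sup>+v. V (x + v) \<partial>measure_pmf p) \<le> V x" "0 \<in> D"
  shows "hit_exp p 1 D (\<lambda>z. if z = 0 then 0 else V z) x \<le> (\<integral>\<^sup>+v. V (x + v) \<partial>measure_pmf p)"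
proof (rule hit_exp_least)
  fix x
  show "1 * (\<integral>\<^sup>+v. (if x + v \<in> D then if x + v = 0 then 0 else V (x + v)
        else \<integral>\<^sup>+w. V (x + v + w) \<partial>measure_pmf p) \<partial>measure_pmf p) \<le> (\<integral>\<^sup>+v. V (x + v) \<partial>measure_pmf p)"
    unfolding mult_1 by (intro nn_integral_mono) (use assms in auto)
qed

section \<open>Hitting probabilities in terms of the potential\<close>

text \<open>Abel's theorem along a sequence of discounts. The potential series converges only
  conditionally in general, so the limit cannot be taken term by term under a summable
  bound.\<close>

lemma Abel_summation_limit:
  fixes d :: "nat \<Rightarrow> real"
  assumes d: "d sums l" and s: "\<And>k::nat. 0 \<le> s k" "\<And>k. s k < 1" "s \<longlonglongrightarrow> 1"
  shows "(\<lambda>k. \<Sum>n. d n * s k ^ n) \<longlonglongrightarrow> l"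
proof -
  define D where "D = (\<lambda>n. \<Sum>i\<le>n. d i)"
  have D: "D \<longlonglongrightarrow> l" using d unfolding D_def sums_def_le .
  obtain B0 where B0: "\<And>n. \<bar>d n\<bar> \<le> B0"
    using Bseq_conv_Bfun[of d] summable_imp_Bseq[OF sums_summable[OF d]] by (metis BseqE real_norm_def)
  have B0pos: "0 \<le> B0" using B0[of 0] by linarith
  obtain B1 where B1: "\<And>n. \<bar>D n\<bar> \<le> B1"
    using convergent_imp_Bseq[of D] D by (metis BseqE real_norm_def convergentI)
  have ds: "summable (\<lambda>n. norm (d n * r ^ n))" if r: "0 \<le> r" "r < 1" for r
  proof (rule summable_comparison_test')
    show "summable (\<lambda>n. B0 * r ^ n)" using r by (intro summable_mult summable_geometric) auto
    show "norm (norm (d n * r ^ n)) \<le> B0 * r ^ n" for n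
      using B0[of n] r by (auto simp: abs_mult intro!: mult_right_mono)
  qed
  have geo: "(\<lambda>n. r ^ n) sums (1 / (1 - r))" if "0 \<le> r" "r < 1" for r :: real
    using that by (intro geometric_sums) auto
  \<comment> \<open>Summation by parts, read off from the Cauchy product with the geometric
    series.\<close>
  have prod: "(\<lambda>n. D n * r ^ n) sums ((\<Sum>n. d n * r ^ n) * (1 / (1 - r)))" if r: "0 \<le> r" "r < 1" for r
  proof -
    have "(\<lambda>k. \<Sum>i\<le>k. (d i * r ^ i) * r ^ (k - i)) sums ((\<Sum>n. d n * r ^ n) * (\<Sum>n. r ^ n))"
      using r by (intro Cauchy_product_sums ds) (auto intro: summable_geometric)
    moreover have "(\<Sum>i\<le>k. (d i * r ^ i) * r ^ (k - i)) = D k * r ^ k" for k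
      unfolding D_def sum_distrib_right by (intro sum.cong) (auto simp: power_add[symmetric])
    ultimately show ?thesis using sums_unique[OF geo[OF r]] by simp
  qed
  \<comment> \<open>Each of the first \<open>N\<close> partial sums has weight at most
    \<open>1 - r\<close>; all later ones are within \<open>e\<close> of the limit.\<close>
  have key: "\<bar>(\<Sum>n. d n * r ^ n) - l\<bar> \<le> (1 - r) * (\<Sum>n<N. \<bar>D n - l\<bar>) + e"
    if r: "0 \<le> r" "r < 1" and e: "e > 0" and N: "\<And>n. n \<ge> N \<Longrightarrow> \<bar>D n - l\<bar> \<le> e" for r e N
  proof -
    let ?c = "\<lambda>n. if n < N then \<bar>D n - l\<bar> else 0"
    have 1: "(\<lambda>n. (D n - l) * r ^ n) sums ((\<Sum>n. d n * r ^ n) * (1 / (1 - r)) - l * (1 / (1 - r)))"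
      unfolding left_diff_distrib by (intro sums_diff prod r sums_mult geo)
    have 2: "(\<lambda>n. ?c n + e * r ^ n) sums ((\<Sum>n<N. \<bar>D n - l\<bar>) + e * (1 / (1 - r)))"
    proof (intro sums_add sums_mult geo r)
      show "?c sums (\<Sum>n<N. \<bar>D n - l\<bar>)"
        using sums_If_finite_set[of "{..<N}" "\<lambda>n. \<bar>D n - l\<bar>"] by (simp add: lessThan_def)
    qed
    have le: "\<bar>(D n - l) * r ^ n\<bar> \<le> ?c n + e * r ^ n" for n
    proof (cases "n < N")
      case True
      have "\<bar>D n - l\<bar> * r ^ n \<le> \<bar>D n - l\<bar>" using r by (intro mult_left_le power_le_one) auto
      then show ?thesis using True r e by (simp add: abs_mult add_increasing2)
    next
      case False
      then show ?thesis using N[of n] r by (auto simp: abs_mult intro!: mult_right_mono)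
    qed
    have "\<bar>(\<Sum>n. d n * r ^ n) * (1 / (1 - r)) - l * (1 / (1 - r))\<bar> \<le> (\<Sum>n<N. \<bar>D n - l\<bar>) + e * (1 / (1 - r))"
      using sums_le[OF _ 1 2] sums_le[OF _ sums_minus[OF 1] 2] le by (smt (verit, best) abs_le_iff)
    then have "(1 - r) * \<bar>((\<Sum>n. d n * r ^ n) - l) / (1 - r)\<bar> \<le> (1 - r) * ((\<Sum>n<N. \<bar>D n - l\<bar>) + e * (1 / (1 - r)))"
      using r by (intro mult_left_mono) (auto simp: diff_divide_distrib)
    then show ?thesis using r by (simp add: abs_div distrib_left)
  qed
  show ?thesis
  proof (rule LIMSEQ_I)
    fix e :: real assume e: "e > 0"
    obtain N where N: "\<And>n. n \<ge> N \<Longrightarrow> \<bar>D n - l\<bar> \<le> e / 2"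
      using LIMSEQ_D[OF D, of "e/2"] e by (force simp: less_imp_le)
    define S where "S = (\<Sum>n<N. \<bar>D n - l\<bar>)"
    have "(\<lambda>k. (1 - s k) * S) \<longlonglongrightarrow> (1 - 1) * S" by (intro tendsto_intros s)
    then obtain K where K: "\<And>k. k \<ge> K \<Longrightarrow> \<bar>(1 - s k) * S\<bar> < e / 2"
      using LIMSEQ_D[of "\<lambda>k. (1 - s k) * S" 0 "e/2"] e by auto
    have "\<bar>(\<Sum>n. d n * s k ^ n) - l\<bar> < e" if "k \<ge> K" for k
    proof -
      have "\<bar>(\<Sum>n. d n * s k ^ n) - l\<bar> \<le> (1 - s k) * S + e / 2"
        unfolding S_def using e N by (intro key s) auto
      then show ?thesis using K[OF that] by linarith
    qed
    then show "\<exists>no. \<forall>n\<ge>no. norm ((\<Sum>na. d na * s n ^ na) - l) < e" by auto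
  qed
qed

section \<open>Discounted Green functions\<close>

primrec step_pow :: "int pmf \<Rightarrow> nat \<Rightarrow> int pmf" where
  "step_pow p 0 = return_pmf 0"
| "step_pow p (Suc n) = bind_pmf p (\<lambda>v. map_pmf ((+) v) (step_pow p n))"

lemma pmf_map_plus: "pmf (map_pmf ((+) v) q) z = pmf q (z - v)" for v z :: int
  using pmf_map_inj'[of "(+) v" q "z - v"] by (simp add: inj_on_def)

lemma step_pow_Suc_integral: "pmf (step_pow p (Suc n)) z = (\<integral>v. pmf (step_pow p n) (z - v) \<partial>measure_pmf p)"
  by (simp add: pmf_bind pmf_map_plus)

lemma step_pow_Suc_nn_integral:
  "ennreal (pmf (step_pow p (Suc n)) z) = (\<integral>\<^sup>+v. ennreal (pmf (step_pow p n) (z - v)) \<partial>measure_pmf p)"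
  by (simp add: ennreal_pmf_bind pmf_map_plus)

definition green :: "int pmf \<Rightarrow> real \<Rightarrow> int \<Rightarrow> real" where
  "green p s x = (\<Sum>n. pmf (step_pow p n) x * s ^ n)"

lemma summable_green:
  assumes "0 \<le> s" "s < 1"
  shows "summable (\<lambda>n. pmf (step_pow p n) x * s ^ n)"
proof (rule summable_comparison_test')
  show "summable (\<lambda>n. s ^ n)" using assms by (intro summable_geometric) auto
  show "norm (pmf (step_pow p n) x * s ^ n) \<le> s ^ n" for n
    using assms by (auto simp: abs_mult pmf_le_1 intro!: mult_left_le_one_le)
qed

lemma green_nonneg: "0 \<le> s \<Longrightarrow> s < 1 \<Longrightarrow> 0 \<le> green p s x"
  unfolding green_def by (intro suminf_nonneg summable_green) auto

lemma green_le:
  assumes "0 \<le> s" "s < 1"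
  shows "green p s x \<le> 1 / (1 - s)"
proof -
  have "green p s x \<le> (\<Sum>n. s ^ n)"
    unfolding green_def using assms
    by (intro suminf_le summable_green summable_geometric) (auto simp: pmf_le_1 intro!: mult_left_le_one_le)
  then show ?thesis using suminf_geometric[of s] assms by simp
qed

lemma ennreal_green:
  assumes "0 \<le> s" "s < 1"
  shows "ennreal (green p s x) = (\<Sum>n. ennreal (s ^ n * pmf (step_pow p n) x))"
  unfolding green_def using assms summable_green[OF assms, of p x]
  by (subst suminf_ennreal2) (auto simp: mult.commute)

lemma green_step:
  assumes s: "0 \<le> s" "s < 1"
  shows "ennreal (green p s x) =
    (if x = 0 then 1 else 0) + ennreal s * (\<integral>\<^sup>+v. ennreal (green p s (x - v)) \<partial>measure_pmf p)"
proof -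
  let ?f = "\<lambda>n x. ennreal (s ^ n * pmf (step_pow p n) x)"
  have "(\<Sum>n. ?f n x) = ?f 0 x + (\<Sum>n. ?f (Suc n) x)"
    using sums_Suc[of "\<lambda>n. ?f n x", OF summable_sums[OF summableI]]
    by (intro sums_unique[symmetric]) (simp add: add.commute)
  moreover have "?f 0 x = (if x = 0 then 1 else 0)" by (auto simp: pmf_return)
  moreover have "?f (Suc n) x = ennreal s * (\<integral>\<^sup>+v. ?f n (x - v) \<partial>measure_pmf p)" for n
  proof -
    have "?f (Suc n) x = ennreal s * (ennreal (s ^ n) * ennreal (pmf (step_pow p (Suc n)) x))"
      using s by (simp add: ennreal_mult mult.assoc del: step_pow.simps)
    also have "ennreal (s ^ n) * ennreal (pmf (step_pow p (Suc n)) x) = (\<integral>\<^sup>+v. ?f n (x - v) \<partial>measure_pmf p)"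
      unfolding step_pow_Suc_nn_integral using s by (subst nn_integral_cmult[symmetric]) (auto simp: ennreal_mult)
    finally show ?thesis .
  qed
  moreover have "(\<Sum>n. ennreal s * (\<integral>\<^sup>+v. ?f n (x - v) \<partial>measure_pmf p)) =
      ennreal s * (\<integral>\<^sup>+v. (\<Sum>n. ?f n (x - v)) \<partial>measure_pmf p)"
    by (subst nn_integral_suminf) auto
  ultimately show ?thesis unfolding ennreal_green[OF s] by simp
qed

text \<open>Optional stopping made elementary by the discount: what has not been stopped within
  \<open>n\<close> steps contributes at most \<open>s^n C\<close>.\<close>

lemma hit_exp_bounded_harmonic:
  fixes s :: real and g :: "int \<Rightarrow> ennreal"
  assumes s: "0 \<le> s" "s < 1" and C: "\<And>z. g z \<le> ennreal C" "0 \<le> C"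
    and sup: "\<And>z. ennreal s * (\<integral>\<^sup>+v. g (z + v) \<partial>measure_pmf p) \<le> g z"
    and harm: "\<And>z. z \<notin> D \<Longrightarrow> ennreal s * (\<integral>\<^sup>+v. g (z + v) \<partial>measure_pmf p) = g z"
  shows "hit_exp p s D g x = ennreal s * (\<integral>\<^sup>+v. g (x + v) \<partial>measure_pmf p)"
proof (rule antisym)
  show "hit_exp p s D g x \<le> ennreal s * (\<integral>\<^sup>+v. g (x + v) \<partial>measure_pmf p)"
    by (rule hit_exp_least) (auto intro!: mult_left_mono nn_integral_mono sup)
  have ge: "ennreal s * (\<integral>\<^sup>+v. g (x + v) \<partial>measure_pmf p) \<le> hit_upto p s D g n x + ennreal (s ^ n * C)" for n x
  proof (induction n arbitrary: x)
    case 0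
    have "ennreal s * (\<integral>\<^sup>+v. g (x + v) \<partial>measure_pmf p) \<le> 1 * (\<integral>\<^sup>+v. ennreal C \<partial>measure_pmf p)"
      using s C by (intro mult_mono nn_integral_mono) auto
    then show ?case by simp
  next
    case (Suc n)
    have "ennreal s * (\<integral>\<^sup>+v. g (x + v) \<partial>measure_pmf p) \<le>
       ennreal s * (\<integral>\<^sup>+v. (if x + v \<in> D then g (x + v) else hit_upto p s D g n (x + v)) + ennreal (s ^ n * C) \<partial>measure_pmf p)"
      using Suc.IH harm by (intro mult_left_mono nn_integral_mono) (auto simp: add_increasing2, metis)
    also have "\<dots> = hit_upto p s D g (Suc n) x + ennreal (s ^ Suc n * C)"
      using s C(2) by (subst nn_integral_add) (auto simp: distrib_left ennreal_mult[symmetric] mult.assoc)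
    finally show ?case .
  qed
  show "ennreal s * (\<integral>\<^sup>+v. g (x + v) \<partial>measure_pmf p) \<le> hit_exp p s D g x"
  proof (rule LIMSEQ_le[OF tendsto_const])
    have "(\<lambda>n. s ^ n * C) \<longlonglongrightarrow> 0 * C" using s by (intro tendsto_mult LIMSEQ_realpow_zero tendsto_const) auto
    then have "(\<lambda>n. ennreal (s ^ n * C)) \<longlonglongrightarrow> ennreal 0" by (intro tendsto_ennrealI) simp
    then have "(\<lambda>n. hit_upto p s D g n x + ennreal (s ^ n * C)) \<longlonglongrightarrow> hit_exp p s D g x + ennreal 0"
      unfolding hit_exp_def by (intro tendsto_add LIMSEQ_SUP incseq_hit_upto)
    then show "(\<lambda>n. hit_upto p s D g n x + ennreal (s ^ n * C)) \<longlonglongrightarrow> hit_exp p s D g x" by simp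
  qed (use ge in auto)
qed

text \<open>As a function of the starting point, the Green function towards \<open>y\<close> is
  harmonic for the discounted walk except at \<open>y\<close>, hence off \<open>D\<close>. The
  indicator is the visit at time 0, which \<open>hit_exp\<close> does not count.\<close>

lemma hit_exp_green:
  assumes s: "0 \<le> s" "s < 1" and y: "y \<in> D"
  shows "hit_exp p s D (\<lambda>z. ennreal (green p s (y - z))) x + (if x = y then 1 else 0) = ennreal (green p s (y - x))"
proof -
  let ?g = "\<lambda>z. ennreal (green p s (y - z))"
  have step: "?g z = (if z = y then 1 else 0) + ennreal s * (\<integral>\<^sup>+v. ?g (z + v) \<partial>measure_pmf p)" for z
    using green_step[OF s, of p "y - z"] by (simp add: diff_diff_eq)
  have "hit_exp p s D ?g x = ennreal s * (\<integral>\<^sup>+v. ?g (x + v) \<partial>measure_pmf p)"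
  proof (rule hit_exp_bounded_harmonic[OF s, where C="1 / (1 - s)"])
    show "?g z \<le> ennreal (1 / (1 - s))" for z using green_le[OF s] by (intro ennreal_leI)
    show "ennreal s * (\<integral>\<^sup>+v. ?g (z + v) \<partial>measure_pmf p) \<le> ?g z" for z
      by (subst (2) step) auto
    show "ennreal s * (\<integral>\<^sup>+v. ?g (z + v) \<partial>measure_pmf p) = ?g z" if "z \<notin> D" for z
      using that y by (subst (2) step) auto
  qed (use s in auto)
  then show ?thesis using step[of x] by (simp add: add.commute)
qed

lemma hit_exp_le_1':
  assumes "0 \<le> s" "s \<le> 1" "\<And>z. z \<in> D \<Longrightarrow> f z \<le> 1"
  shows "hit_exp p (ennreal s) D f x \<le> 1"
proof (rule hit_exp_least)
  fix x
  have "(\<integral>\<^sup>+v. (if x + v \<in> D then f (x + v) else 1) \<partial>measure_pmf p) \<le> (\<integral>\<^sup>+v. 1 \<partial>measure_pmf p)"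
    by (intro nn_integral_mono) (auto simp: assms)
  then show "ennreal s * (\<integral>\<^sup>+v. (if x + v \<in> D then f (x + v) else 1) \<partial>measure_pmf p) \<le> 1"
    using mult_mono[of "ennreal s" 1 _ 1] assms by simp
qed

section \<open>Discounted probabilities of hitting one set before another\<close>

definition disc_hit :: "int pmf \<Rightarrow> real \<Rightarrow> int set \<Rightarrow> int set \<Rightarrow> int \<Rightarrow> real" where
  "disc_hit p s A B x = enn2real (hit_exp p (ennreal s) (A \<union> B) (indicator A) x)"

abbreviation "hit_before p \<equiv> disc_hit p 1"

lemma ennreal_disc_hit:
  assumes "0 \<le> s" "s \<le> 1"
  shows "ennreal (disc_hit p s A B x) = hit_exp p (ennreal s) (A \<union> B) (indicator A) x"
proof -
  have "hit_exp p (ennreal s) (A \<union> B) (indicator A) x \<le> 1"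
    using assms by (intro hit_exp_le_1') (auto simp: indicator_def)
  then show ?thesis unfolding disc_hit_def
    by (metis ennreal_enn2real ennreal_one_less_top leD le_less_trans less_top)
qed

lemma disc_hit_nonneg: "0 \<le> disc_hit p s A B x"
  unfolding disc_hit_def by simp

lemma disc_hit_le_1: "0 \<le> s \<Longrightarrow> s \<le> 1 \<Longrightarrow> disc_hit p s A B x \<le> 1"
  using hit_exp_le_1'[of s "A \<union> B" "indicator A" p x] unfolding disc_hit_def
  by (intro enn2real_leI) (auto simp: indicator_def)

text \<open>The choices \<open>w = y\<close> and \<open>w = z\<close> give two linear equations for
  the two hitting probabilities; it is their difference that survives the limit
  \<open>s -> 1\<close>.\<close>

lemma disc_hit_green:
  assumes s: "0 \<le> s" "s < 1" and y: "y \<noteq> z" "w = y \<or> w = z"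
  shows "green p s (w - x) - (if x = w then 1 else 0) =
    disc_hit p s {y} {z} x * green p s (w - y) + disc_hit p s {z} {y} x * green p s (w - z)"
proof -
  let ?D = "{y, z}" and ?g = "\<lambda>u. ennreal (green p s (w - u))"
  note nn = green_nonneg[OF s, of p]
  have "hit_exp p s ?D ?g x = hit_exp p s ?D (\<lambda>u. ?g y * indicator {y} u + ?g z * indicator {z} u) x"
    using y(1) by (intro hit_exp_cong) (auto simp: indicator_def)
  also have "\<dots> = ?g y * hit_exp p s ?D (indicator {y}) x + ?g z * hit_exp p s ?D (indicator {z}) x"
    by (simp add: hit_exp_add hit_exp_cmult)
  also have "\<dots> = ?g y * ennreal (disc_hit p s {y} {z} x) + ?g z * ennreal (disc_hit p s {z} {y} x)"
    using s by (simp add: ennreal_disc_hit insert_commute)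
  finally have "?g y * ennreal (disc_hit p s {y} {z} x) + ?g z * ennreal (disc_hit p s {z} {y} x)
      + (if x = w then 1 else 0) = ennreal (green p s (w - x))"
    using hit_exp_green[OF s, of w ?D p x] y(2) by auto
  then have "ennreal (green p s (w - y) * disc_hit p s {y} {z} x + green p s (w - z) * disc_hit p s {z} {y} x
      + (if x = w then 1 else 0)) = ennreal (green p s (w - x))"
    by (cases "x = w") (simp_all add: ennreal_mult nn disc_hit_nonneg)
  then have "green p s (w - y) * disc_hit p s {y} {z} x + green p s (w - z) * disc_hit p s {z} {y} x
      + (if x = w then 1 else 0) = green p s (w - x)"
    by (subst (asm) ennreal_inj) (auto simp: nn disc_hit_nonneg)
  then show ?thesis by (simp add: mult.commute)
qed

text \<open>A visit to \<open>x\<close> is preceded by a first hit of \<open>x\<close>, from where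
  the discounted number of visits is that of 0. In the limit this makes the potential
  nonnegative.\<close>

lemma green_le_0:
  assumes s: "0 \<le> s" "s < 1"
  shows "green p s x \<le> green p s 0"
proof (cases "x = 0")
  case False
  have "hit_exp p s {x} (\<lambda>z. ennreal (green p s (x - z))) 0 + 0 = ennreal (green p s x)"
    using hit_exp_green[OF s, of x "{x}" p 0] False by auto
  moreover have "hit_exp p s {x} (\<lambda>z. ennreal (green p s (x - z))) 0 = hit_exp p s {x} (\<lambda>z. ennreal (green p s 0) * 1) 0"
    by (intro hit_exp_cong) auto
  moreover have "\<dots> = ennreal (green p s 0) * hit_exp p s {x} (\<lambda>z. 1) 0"
    by (rule hit_exp_cmult)
  moreover have "ennreal (green p s 0) * hit_exp p s {x} (\<lambda>z. 1) 0 \<le> ennreal (green p s 0) * 1"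
    using s by (intro mult_left_mono hit_exp_le_1') auto
  ultimately have "ennreal (green p s x) \<le> ennreal (green p s 0)" by (simp del: ennreal_le_iff)
  then show ?thesis using green_nonneg[OF s, of p 0] by (simp add: ennreal_le_iff)
qed simp

text \<open>The facts on which the probabilistic argument rests; Fourier analysis supplies them
  later. The linear bound on the partial sums is the dominating function in the proof of
  harmonicity, and \<open>green_at_top\<close> expresses recurrence.\<close>

locale recurrent_potential =
  fixes p :: "int pmf" and a :: "int \<Rightarrow> real"
  assumes potential_sums: "(\<lambda>n. pmf (step_pow p n) 0 - pmf (step_pow p n) (- x)) sums a x"
    and potential_partial_sum_bound: "\<exists>C. \<forall>N x. \<bar>\<Sum>n<N. pmf (step_pow p n) 0 - pmf (step_pow p n) (- x)\<bar> \<le> C * \<bar>real_of_int x\<bar>"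
    and green_at_top: "filterlim (\<lambda>s. green p s 0) at_top (at_left 1)"
    and step_pow_tendsto_0: "(\<lambda>n. pmf (step_pow p n) x) \<longlonglongrightarrow> 0"
    and integrable_step: "integrable (measure_pmf p) real_of_int"
begin

section \<open>The undiscounted limit and the calculus of the potential\<close>

definition disc :: "nat \<Rightarrow> real" where "disc k = 1 - inverse (real (Suc k))"

lemma disc: "0 \<le> disc k" "disc k < 1" "disc \<longlonglongrightarrow> 1" "incseq (\<lambda>k. ennreal (disc k))"
   "(SUP k. ennreal (disc k)) = ennreal 1"
proof -
  show 0: "0 \<le> disc k" "disc k < 1" for k
    unfolding disc_def using le_imp_inverse_le[of 1 "real (Suc k)"] by simp_all
  have "(\<lambda>k. 1 - inverse (real (Suc k))) \<longlonglongrightarrow> 1 - 0"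
    by (intro tendsto_intros LIMSEQ_inverse_real_of_nat)
  then show 1: "disc \<longlonglongrightarrow> 1" by (simp add: disc_def[abs_def])
  show 2: "incseq (\<lambda>k. ennreal (disc k))"
    unfolding disc_def by (intro incseq_SucI ennreal_leI diff_mono le_imp_inverse_le) auto
  show "(SUP k. ennreal (disc k)) = ennreal 1"
    by (rule LIMSEQ_unique[OF LIMSEQ_SUP[OF 2]]) (intro tendsto_ennrealI 1)
qed

lemma potential_0 [simp]: "a 0 = 0"
  using sums_unique[OF potential_sums[of 0]] by simp

lemma green_diff_tendsto: "(\<lambda>k. green p (disc k) 0 - green p (disc k) (- x)) \<longlonglongrightarrow> a x"
proof -
  have "(\<lambda>k. \<Sum>n. (pmf (step_pow p n) 0 - pmf (step_pow p n) (- x)) * disc k ^ n) \<longlonglongrightarrow> a x"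
    by (rule Abel_summation_limit[OF potential_sums disc(1-3)])
  moreover have "(\<Sum>n. (pmf (step_pow p n) 0 - pmf (step_pow p n) (- x)) * disc k ^ n)
      = green p (disc k) 0 - green p (disc k) (- x)" for k
    unfolding green_def left_diff_distrib
    by (intro suminf_diff[symmetric] summable_green disc)
  ultimately show ?thesis by simp
qed

lemma potential_nonneg: "0 \<le> a x"
  by (rule LIMSEQ_le_const[OF green_diff_tendsto]) (auto intro!: green_le_0 disc)

lemma green_disc_at_top: "filterlim (\<lambda>k. green p (disc k) 0) at_top sequentially"
proof (rule filterlim_compose[OF green_at_top])
  show "filterlim disc (at_left 1) sequentially"
    unfolding filterlim_at using disc(2,3) by (auto intro!: always_eventually simp: less_imp_neq)
qed

lemma disc_hit_tendsto: "(\<lambda>k. disc_hit p (disc k) A B x) \<longlonglongrightarrow> hit_before p A B x"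
proof -
  have "(\<lambda>k. hit_exp p (ennreal (disc k)) (A \<union> B) (indicator A) x) \<longlonglongrightarrow> hit_exp p (ennreal 1) (A \<union> B) (indicator A) x"
    by (rule hit_exp_discount_limit) (use disc in auto)
  then have "(\<lambda>k. ennreal (disc_hit p (disc k) A B x)) \<longlonglongrightarrow> ennreal (hit_before p A B x)"
    using disc(1,2) by (simp add: ennreal_disc_hit less_imp_le)
  then show ?thesis by (subst (asm) tendsto_ennreal_iff) (auto simp: disc_hit_nonneg)
qed

text \<open>Recurrence: in the Green identity at \<open>y\<close> every term other than
  \<open>(\<alpha> + \<beta> - 1) G(0)\<close> stays bounded, and \<open>G(0)\<close> tends to
  infinity.\<close>

lemma hit_before_total:
  assumes "y \<noteq> z"
  shows "hit_before p {y} {z} x + hit_before p {z} {y} x = 1"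
proof -
  let ?G = "\<lambda>k. green p (disc k)" and ?A = "\<lambda>k x. green p (disc k) 0 - green p (disc k) (- x)"
  define \<alpha> where "\<alpha> = (\<lambda>k. disc_hit p (disc k) {y} {z} x)"
  define \<beta> where "\<beta> = (\<lambda>k. disc_hit p (disc k) {z} {y} x)"
  define c :: real where "c = (if x = y then 1 else 0)"
  have eq: "\<alpha> k + \<beta> k - 1 = (\<beta> k * ?A k (z - y) - ?A k (x - y) - c) * inverse (?G k 0)" if "?G k 0 > 0" for k
  proof -
    have "?G k (y - x) - c = \<alpha> k * ?G k 0 + \<beta> k * ?G k (y - z)"
      using disc_hit_green[OF disc(1,2)[of k] assms, of y p x] by (simp add: \<alpha>_def \<beta>_def c_def)
    then show ?thesis using that by (simp add: field_simps)
  qed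
  have inv: "(\<lambda>k. inverse (?G k 0)) \<longlonglongrightarrow> 0"
    by (rule tendsto_inverse_0_at_top[OF green_disc_at_top])
  have al: "\<alpha> \<longlonglongrightarrow> hit_before p {y} {z} x" and be: "\<beta> \<longlonglongrightarrow> hit_before p {z} {y} x"
    unfolding \<alpha>_def \<beta>_def by (rule disc_hit_tendsto)+
  have "(\<lambda>k. (\<beta> k * ?A k (z - y) - ?A k (x - y) - c) * inverse (?G k 0)) \<longlonglongrightarrow>
    (hit_before p {z} {y} x * a (z - y) - a (x - y) - c) * 0"
    by (intro tendsto_intros be inv green_diff_tendsto)
  moreover have "eventually (\<lambda>k. ?G k 0 > 0) sequentially"
    using green_disc_at_top unfolding filterlim_at_top_dense by auto
  then have "eventually (\<lambda>k. \<alpha> k + \<beta> k - 1 = (\<beta> k * ?A k (z - y) - ?A k (x - y) - c) * inverse (?G k 0)) sequentially"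
    by eventually_elim (rule eq)
  ultimately have "(\<lambda>k. \<alpha> k + \<beta> k - 1) \<longlonglongrightarrow> 0"
    by (simp add: filterlim_cong)
  moreover have "(\<lambda>k. \<alpha> k + \<beta> k - 1) \<longlonglongrightarrow> hit_before p {y} {z} x + hit_before p {z} {y} x - 1"
    by (intro tendsto_intros al be)
  ultimately show ?thesis using LIMSEQ_unique by fastforce
qed

text \<open>Subtracting the Green identities at \<open>y\<close> and at 0 cancels the divergent
  value \<open>G(0)\<close>, and the remaining differences converge to the potential. The Kronecker
  term comes from the visit to 0 at time 0.\<close>

lemma hit_before_potential:
  assumes y: "y \<noteq> 0" and x: "x \<noteq> y"
  shows "hit_before p {y} {0} x * (a y + a (- y)) = (if x = 0 then 1 else 0) + a x + a (- y) - a (x - y)"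
proof -
  let ?G = "\<lambda>k. green p (disc k)" and ?A = "\<lambda>k x. green p (disc k) 0 - green p (disc k) (- x)"
  define \<alpha> where "\<alpha> = (\<lambda>k. disc_hit p (disc k) {y} {0} x)"
  define \<beta> where "\<beta> = (\<lambda>k. disc_hit p (disc k) {0} {y} x)"
  define c :: real where "c = (if x = 0 then 1 else 0)"
  have eq: "c + ?A k x - ?A k (x - y) = \<alpha> k * ?A k y - \<beta> k * ?A k (- y)" for k
  proof -
    have "?G k (y - x) = \<alpha> k * ?G k 0 + \<beta> k * ?G k y"
      using disc_hit_green[OF disc(1,2)[of k] y, of y p x] x by (simp add: \<alpha>_def \<beta>_def)
    moreover have "?G k (- x) - c = \<alpha> k * ?G k (- y) + \<beta> k * ?G k 0"
      using disc_hit_green[OF disc(1,2)[of k] y, of 0 p x] by (simp add: \<alpha>_def \<beta>_def c_def)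
    ultimately show ?thesis by (simp add: algebra_simps)
  qed
  have al: "\<alpha> \<longlonglongrightarrow> hit_before p {y} {0} x" and be: "\<beta> \<longlonglongrightarrow> hit_before p {0} {y} x"
    unfolding \<alpha>_def \<beta>_def by (rule disc_hit_tendsto)+
  have "(\<lambda>k. c + ?A k x - ?A k (x - y)) \<longlonglongrightarrow> c + a x - a (x - y)"
    by (intro tendsto_intros green_diff_tendsto)
  moreover have "(\<lambda>k. \<alpha> k * ?A k y - \<beta> k * ?A k (- y)) \<longlonglongrightarrow>
      hit_before p {y} {0} x * a y - hit_before p {0} {y} x * a (- y)"
    by (intro tendsto_intros al be green_diff_tendsto)
  ultimately have "c + a x - a (x - y) = hit_before p {y} {0} x * a y - hit_before p {0} {y} x * a (- y)"
    unfolding eq by (rule LIMSEQ_unique)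
  moreover have "hit_before p {0} {y} x = 1 - hit_before p {y} {0} x"
    using hit_before_total[OF y, of x] by simp
  ultimately show ?thesis by (simp add: c_def algebra_simps)
qed

text \<open>The difference of the two sides is the probability of hitting \<open>-y\<close> before 0
  from \<open>x\<close>, times a nonnegative factor.\<close>

lemma potential_subadditive: "a (x + y) \<le> a x + a y"
proof (cases "x = 0 \<or> y = 0 \<or> x = - y")
  case True then show ?thesis using potential_nonneg[of x] potential_nonneg[of y] by auto
next
  case False
  have "0 \<le> hit_before p {- y} {0} x * (a (- y) + a (- (- y)))"
    by (intro mult_nonneg_nonneg add_nonneg_nonneg disc_hit_nonneg potential_nonneg)
  also have "\<dots> = a x + a y - a (x + y)"
    using hit_before_potential[of "- y" x] False by simp
  finally show ?thesis by simp
qed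

text \<open>One step applied to the truncated series telescopes to the Kronecker term minus
  \<open>?q N (- x)\<close>, which tends to 0. The limit passes through the mean by domination with
  \<open>C |x + v|\<close>, integrable because the step has a first moment.\<close>

lemma potential_harmonic:
  shows "integrable (measure_pmf p) (\<lambda>v. a (x + v))"
    and "(\<integral>v. a (x + v) \<partial>measure_pmf p) = (if x = 0 then 1 else 0) + a x"
proof -
  let ?q = "\<lambda>n x. pmf (step_pow p n) x"
  define AN where "AN = (\<lambda>N x. \<Sum>n<N. ?q n 0 - ?q n (- x))"
  obtain C where C: "\<And>N x. \<bar>AN N x\<bar> \<le> C * \<bar>real_of_int x\<bar>"
    using potential_partial_sum_bound unfolding AN_def by blast
  have lim: "(\<lambda>N. AN N x) \<longlonglongrightarrow> a x" for x
    using potential_sums[of x] unfolding AN_def sums_def .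
  have intx: "integrable (measure_pmf p) (\<lambda>v. C * \<bar>real_of_int (x + v)\<bar>)"
    using integrable_step by auto
  have m: "(\<lambda>v. AN N (x + v)) \<in> borel_measurable (measure_pmf p)" for N by simp
  have dom: "AE v in measure_pmf p. (\<lambda>N. AN N (x + v)) \<longlonglongrightarrow> a (x + v)" using lim by simp
  have bd: "AE v in measure_pmf p. norm (AN N (x + v)) \<le> C * \<bar>real_of_int (x + v)\<bar>" for N
    using C by (simp add: AE_measure_pmf_iff del: of_int_add)
  show int: "integrable (measure_pmf p) (\<lambda>v. a (x + v))"
    by (rule integrable_dominated_convergence[OF _ m intx dom bd]) auto
  have L: "(\<lambda>N. \<integral>v. AN N (x + v) \<partial>measure_pmf p) \<longlonglongrightarrow> (\<integral>v. a (x + v) \<partial>measure_pmf p)"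
    by (rule integral_dominated_convergence[OF _ m intx dom bd]) auto
  have qint: "integrable (measure_pmf p) (\<lambda>v. ?q n (z - v))" for n z
    by (rule measure_pmf.integrable_const_bound[where B=1]) (auto simp: pmf_le_1)
  have step: "(\<integral>v. AN N (x + v) \<partial>measure_pmf p) = AN N x + (if x = 0 then 1 else 0) - ?q N (- x)" for N
  proof -
    have "(\<integral>v. AN N (x + v) \<partial>measure_pmf p) = (\<Sum>n<N. ?q n 0 - (\<integral>v. ?q n (- x - v) \<partial>measure_pmf p))"
    proof -
      have e: "- (x + v) = - x - v" for v by simp
      show ?thesis unfolding AN_def e using qint by (subst Bochner_Integration.integral_sum) auto
    qed
    also have "\<dots> = (\<Sum>n<N. ?q n 0 - ?q (Suc n) (- x))"
      by (simp only: step_pow_Suc_integral)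
    also have "\<dots> = AN N x + (\<Sum>n<N. ?q n (- x) - ?q (Suc n) (- x))"
      unfolding AN_def by (simp add: sum.distrib[symmetric] del: step_pow.simps)
    also have "(\<Sum>n<N. ?q n (- x) - ?q (Suc n) (- x)) = ?q 0 (- x) - ?q N (- x)"
      by (rule sum_lessThan_telescope')
    also have "?q 0 (- x) = (if x = 0 then 1 else 0)" by (auto simp: pmf_return)
    finally show ?thesis by simp
  qed
  have "(\<lambda>N. AN N x + (if x = 0 then 1 else 0) - ?q N (- x)) \<longlonglongrightarrow> a x + (if x = 0 then 1 else 0) - 0"
    by (intro tendsto_intros lim step_pow_tendsto_0)
  with L show "(\<integral>v. a (x + v) \<partial>measure_pmf p) = (if x = 0 then 1 else 0) + a x"
    unfolding step using LIMSEQ_unique by fastforce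
qed

lemma potential_superharmonic_nn:
  "(\<integral>\<^sup>+v. ennreal (a (x + v)) \<partial>measure_pmf p) = ennreal ((if x = 0 then 1 else 0) + a x)"
  using potential_harmonic[of x] by (subst nn_integral_eq_integral) (auto simp: potential_nonneg)

lemma hit_exp_potential_le:
  assumes "0 \<in> D"
  shows "hit_exp p 1 D (\<lambda>z. if z = 0 then 0 else ennreal (a z)) x \<le> ennreal ((if x = 0 then 1 else 0) + a x)"
  using hit_exp_superharmonic[of p "\<lambda>z. ennreal (a z)" D x] assms
  by (simp add: potential_superharmonic_nn)

text \<open>Of the mean of the potential at the first visit to \<open>{z, 0}\<close> only the part
  at \<open>z\<close> is present, and that mean is bounded by superharmonicity.\<close>

lemma hit_before_mult_potential_le:
  assumes "z \<noteq> 0"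
  shows "hit_before p {z} {0} x * a z \<le> (if x = 0 then 1 else 0) + a x"
proof -
  have "ennreal (a z) * hit_exp p 1 {z, 0} (indicator {z}) x = hit_exp p 1 {z, 0} (\<lambda>w. ennreal (a z) * indicator {z} w) x"
    by (rule hit_exp_cmult[symmetric])
  also have "\<dots> \<le> hit_exp p 1 {z, 0} (\<lambda>z. if z = 0 then 0 else ennreal (a z)) x"
    using assms by (intro hit_exp_mono) (auto simp: indicator_def)
  also have "\<dots> \<le> ennreal ((if x = 0 then 1 else 0) + a x)" by (rule hit_exp_potential_le) simp
  finally have "ennreal (a z * hit_before p {z} {0} x) \<le> ennreal ((if x = 0 then 1 else 0) + a x)"
    using ennreal_disc_hit[of 1 p "{z}" "{0}" x]
    by (simp add: ennreal_mult potential_nonneg disc_hit_nonneg insert_commute del: ennreal_plus)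
  then show ?thesis by (subst (asm) ennreal_le_iff) (auto simp: potential_nonneg mult.commute)
qed

text \<open>A shift by \<open>y\<close> lowers the potential at \<open>-z\<close> by at most
  \<open>a(y)\<close> times the ratio \<open>a(-z)/a(z)\<close>, which is small for large positive
  \<open>z\<close>. The hitting formula turns the increment into the probability of hitting
  \<open>z\<close> from \<open>y\<close>, and that is at most \<open>a(y)/a(z)\<close>.\<close>

lemma potential_increment_le:
  assumes "y \<noteq> 0" "z \<noteq> 0"
  shows "(a (- z) - a (y - z)) * a z \<le> a y * a (- z)"
proof (cases "y = z")
  case True then show ?thesis by (simp add: mult.commute)
next
  case False
  let ?h = "hit_before p {z} {0} y"
  have "?h * (a z + a (- z)) = a y + a (- z) - a (y - z)"
    using hit_before_potential[of z y] assms False by simp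
  then have "(a y + a (- z) - a (y - z)) * a z = ?h * a z * (a z + a (- z))"
    by (metis mult.commute mult.left_commute)
  also have "\<dots> \<le> a y * (a z + a (- z))"
    using hit_before_mult_potential_le[of z y] assms potential_nonneg[of z] potential_nonneg[of "- z"]
    by (intro mult_right_mono) auto
  finally show ?thesis by (simp add: algebra_simps)
qed

end

section \<open>Truncated moments\<close>

text \<open>
  \<open>x\<^sup>2 E[hub(X/x)]\<close> is comparable to \<open>m(x)\<close>.  In the splitting \<open>hub = rho + iota\<close>, the kernel \<open>rho\<close>
  controls \<open>1 - cos u\<close> and \<open>iota\<close> controls \<open>u - sin u\<close>, that is, the real and the imaginary part
  of one minus the characteristic function.
\<close>

definition hub :: "real \<Rightarrow> real" where "hub u = u\<^sup>2 / (1 + \<bar>u\<bar>)"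
definition rho :: "real \<Rightarrow> real" where "rho u = u\<^sup>2 / (1 + \<bar>u\<bar>)\<^sup>2"
definition iota :: "real \<Rightarrow> real" where "iota u = \<bar>u\<bar> ^ 3 / (1 + \<bar>u\<bar>)\<^sup>2"

lemma kernel_nonneg [simp]: "0 \<le> hub u" "0 \<le> rho u" "0 \<le> iota u"
  by (auto simp: hub_def rho_def iota_def intro!: divide_nonneg_nonneg)

lemma kernel_0 [simp]: "hub 0 = 0" "rho 0 = 0" "iota 0 = 0"
  by (auto simp: hub_def rho_def iota_def)

lemma kernel_minus [simp]: "hub (- u) = hub u" "rho (- u) = rho u" "iota (- u) = iota u"
  by (auto simp: hub_def rho_def iota_def)

lemma kernel_abs [simp]: "hub \<bar>u\<bar> = hub u" "rho \<bar>u\<bar> = rho u" "iota \<bar>u\<bar> = iota u"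
  by (auto simp: hub_def rho_def iota_def)

lemma hub_eq: "hub u = rho u + iota u"
proof -
  have *: "1 + \<bar>u\<bar> > 0" by linarith
  then have "1 + \<bar>u\<bar> \<noteq> 0" by linarith
  then have "rho u + iota u = (\<bar>u\<bar>\<^sup>2 * (1 + \<bar>u\<bar>)) / (1 + \<bar>u\<bar>)\<^sup>2"
    by (simp add: rho_def iota_def add_divide_distrib[symmetric] power2_eq_square power3_eq_cube algebra_simps)
  also have "\<dots> = hub u" using \<open>1 + \<bar>u\<bar> \<noteq> 0\<close> by (simp add: hub_def power2_eq_square)
  finally show ?thesis by simp
qed

lemma kernel_cont: "continuous_on UNIV hub" "continuous_on UNIV rho" "continuous_on UNIV iota"
proof -
  have "1 + \<bar>u\<bar> \<noteq> 0" for u :: real by linarith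
  then show "continuous_on UNIV hub" "continuous_on UNIV rho" "continuous_on UNIV iota"
    unfolding hub_def rho_def iota_def by (auto intro!: continuous_intros)
qed

lemma hub_le_abs: "hub u \<le> \<bar>u\<bar>"
proof -
  have "u\<^sup>2 = \<bar>u\<bar> * \<bar>u\<bar>" by (simp add: power2_eq_square)
  also have "\<dots> \<le> \<bar>u\<bar> * (1 + \<bar>u\<bar>)" by (intro mult_left_mono) auto
  finally have "u\<^sup>2 / (1 + \<bar>u\<bar>) \<le> \<bar>u\<bar> * (1 + \<bar>u\<bar>) / (1 + \<bar>u\<bar>)" by (intro divide_right_mono) auto
  moreover have "1 + \<bar>u\<bar> \<noteq> 0" by linarith
  ultimately show ?thesis by (simp add: hub_def)
qed

lemma hub_le_square: "hub u \<le> u\<^sup>2"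
proof -
  have "u\<^sup>2 / (1 + \<bar>u\<bar>) \<le> u\<^sup>2 / 1" by (intro divide_left_mono) auto
  then show ?thesis by (simp add: hub_def)
qed

lemma rho_le_hub: "rho u \<le> hub u" and iota_le_hub: "iota u \<le> hub u"
  by (auto simp: hub_eq)

text \<open>The constant 8 comes from \<open>u > 1\<close>, where \<open>rho u >= 1/4\<close> stands
  against the cap 2.\<close>

lemma min_le_rho:
  assumes "0 \<le> u" shows "min 2 (u\<^sup>2 / 2) \<le> 8 * rho u"
proof (cases "u \<le> 1")
  case True
  have "(1 + u)\<^sup>2 \<le> 2\<^sup>2" using assms True by (intro power_mono) auto
  then have "u\<^sup>2 / 4 \<le> u\<^sup>2 / (1 + u)\<^sup>2" using assms by (intro divide_left_mono) auto
  then have "u\<^sup>2 / 4 \<le> rho u" using assms by (simp add: rho_def)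
  moreover have "min 2 (u\<^sup>2 / 2) \<le> u\<^sup>2 / 2" by simp
  moreover have "0 \<le> u\<^sup>2" by simp
  ultimately show ?thesis by linarith
next
  case False
  have "(1 + u)\<^sup>2 \<le> (2 * u)\<^sup>2" using False by (intro power_mono) auto
  then have "u\<^sup>2 / (2 * u)\<^sup>2 \<le> u\<^sup>2 / (1 + u)\<^sup>2" using False by (intro divide_left_mono) auto
  then have "1 / 4 \<le> rho u" using False by (simp add: rho_def power_mult_distrib)
  then show ?thesis by (simp add: min_def)
qed

lemma one_minus_cos_le: "1 - cos u \<le> min 2 (u\<^sup>2 / 2)" for u :: real
proof -
  have "1 - cos u = 2 * (sin (u / 2))\<^sup>2" using cos_double_sin[of "u / 2"] by simp
  moreover have "(sin (u / 2))\<^sup>2 \<le> (u / 2)\<^sup>2"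
    unfolding abs_le_square_iff[symmetric] by (rule abs_sin_x_le_abs_x)
  moreover have "-1 \<le> cos u" by simp
  ultimately show ?thesis by (simp add: power_divide del: cos_ge_minus_one)
qed

lemma one_minus_cos_le_rho: "1 - cos u \<le> 8 * rho u"
  using order_trans[OF one_minus_cos_le[of "\<bar>u\<bar>"] min_le_rho[of "\<bar>u\<bar>"]] by simp

lemma u_minus_sin_bounds:
  fixes u :: real
  assumes "0 \<le> u" shows "0 \<le> u - sin u" "u - sin u \<le> u ^ 3 / 6"
proof -
  show "0 \<le> u - sin u" using sin_x_le_x[OF assms] by simp
  have "(\<lambda>u. u ^ 3 / 6 - u + sin u) 0 \<le> (\<lambda>u. u ^ 3 / 6 - u + sin u) u"
  proof (rule DERIV_nonneg_imp_nondecreasing[OF assms])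
    fix x :: real
    have "((\<lambda>u. u ^ 3 / 6 - u + sin u) has_real_derivative x\<^sup>2 / 2 - 1 + cos x) (at x)"
      by (auto intro!: derivative_eq_intros simp: power2_eq_square)
    moreover have "0 \<le> x\<^sup>2 / 2 - 1 + cos x" using one_minus_cos_le[of x] by simp
    ultimately show "\<exists>y. ((\<lambda>u. u ^ 3 / 6 - u + sin u) has_real_derivative y) (at x) \<and> 0 \<le> y" by blast
  qed
  then show "u - sin u \<le> u ^ 3 / 6" by simp
qed

lemma one_minus_cos_ge: "u\<^sup>2 / 2 - u ^ 4 / 24 \<le> 1 - cos u" for u :: real
proof -
  have pos: "v\<^sup>2 / 2 - v ^ 4 / 24 \<le> 1 - cos v" if "0 \<le> v" for v :: real
  proof -
    have "(\<lambda>u. 1 - cos u - u\<^sup>2 / 2 + u ^ 4 / 24) 0 \<le> (\<lambda>u. 1 - cos u - u\<^sup>2 / 2 + u ^ 4 / 24) v"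
    proof (rule DERIV_nonneg_imp_nondecreasing[OF that])
      fix x :: real assume x: "0 \<le> x"
      have "((\<lambda>u. 1 - cos u - u\<^sup>2 / 2 + u ^ 4 / 24) has_real_derivative sin x - x + x ^ 3 / 6) (at x)"
        by (auto intro!: derivative_eq_intros simp: power2_eq_square power3_eq_cube)
      moreover have "0 \<le> sin x - x + x ^ 3 / 6" using u_minus_sin_bounds[OF x] by simp
      ultimately show "\<exists>y. ((\<lambda>u. 1 - cos u - u\<^sup>2 / 2 + u ^ 4 / 24) has_real_derivative y) (at x) \<and> 0 \<le> y" by blast
    qed
    then show ?thesis by simp
  qed
  from pos[of "\<bar>u\<bar>"] show ?thesis by simp
qed

lemma min_le_iota:
  assumes "0 \<le> u" shows "min (2 * u) (u ^ 3 / 6) \<le> 8 * iota u"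
proof (cases "u \<le> 1")
  case True
  have "(1 + u)\<^sup>2 \<le> 2\<^sup>2" using assms True by (intro power_mono) auto
  then have "u ^ 3 / 4 \<le> u ^ 3 / (1 + u)\<^sup>2" using assms by (intro divide_left_mono) auto
  then have "u ^ 3 / 4 \<le> iota u" using assms by (simp add: iota_def)
  moreover have "0 \<le> u ^ 3" using assms by simp
  moreover have "min (2 * u) (u ^ 3 / 6) \<le> u ^ 3 / 6" by simp
  ultimately show ?thesis by linarith
next
  case False
  have "(1 + u)\<^sup>2 \<le> (2 * u)\<^sup>2" using False by (intro power_mono) auto
  then have "u ^ 3 / (2 * u)\<^sup>2 \<le> u ^ 3 / (1 + u)\<^sup>2" using False by (intro divide_left_mono) auto
  then have "u / 4 \<le> iota u" using False by (simp add: iota_def power_mult_distrib power2_eq_square power3_eq_cube)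
  then show ?thesis by (simp add: min_def)
qed

lemma u_minus_sin_le_iota: "\<bar>u - sin u\<bar> \<le> 8 * iota u"
proof -
  have pos: "\<bar>v - sin v\<bar> \<le> 8 * iota v" if "0 \<le> v" for v
  proof -
    have "v - sin v \<le> min (2 * v) (v ^ 3 / 6)"
      using u_minus_sin_bounds[OF that] sin_x_ge_neg_x[OF that] by simp
    then show ?thesis using min_le_iota[OF that] u_minus_sin_bounds[OF that] by simp
  qed
  show ?thesis using pos[of u] pos[of "- u"] by (cases "0 \<le> u") auto
qed

text \<open>Applied to \<open>u = - t k\<close> for negative jumps \<open>k\<close>. Both summands
  are nonnegative there: the real part and the negated imaginary part of \<open>psi\<close> add up
  without cancellation.\<close>

lemma hub_le_trig:
  assumes "0 \<le> u" shows "hub u / 10 \<le> (1 - cos u) + (u - sin u)"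
proof -
  note ge = u_minus_sin_bounds(1)[OF assms] one_minus_cos_ge[of u]
  consider "u \<le> 1" | "1 \<le> u" "u \<le> 2" | "2 \<le> u" by linarith
  then show ?thesis
  proof cases
    case 1
    have "u\<^sup>2 * u\<^sup>2 \<le> u\<^sup>2 * 1" using assms 1 by (intro mult_left_mono) (auto simp: power_le_one)
    moreover have "u\<^sup>2 * u\<^sup>2 = u ^ 4" by simp
    ultimately show ?thesis using ge hub_le_square[of u] zero_le_power2[of u] by linarith
  next
    case 2
    have "u\<^sup>2 * u\<^sup>2 \<le> u\<^sup>2 * 2\<^sup>2" using 2 by (intro mult_left_mono power_mono) auto
    moreover have "1\<^sup>2 \<le> u\<^sup>2" using 2 by (intro power_mono) auto
    moreover have "u\<^sup>2 * u\<^sup>2 = u ^ 4" by simp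
    moreover have "hub u \<le> u" using hub_le_abs[of u] 2 by simp
    ultimately show ?thesis using ge 2 by (simp only: power2_eq_square)
  next
    case 3
    \<comment> \<open>For \<open>u >= 2\<close> the second summand alone is at least
      \<open>u - 1\<close>, already a multiple of \<open>u\<close>.\<close>
    have "sin u \<le> 1" "cos u \<le> 1" by auto
    then show ?thesis using 3 hub_le_abs[of u] by linarith
  qed
qed

text \<open>\<open>hub\<close> is quadratic at 0 and linear at infinity, so a dilation by
  \<open>l\<close> multiplies it by a factor between \<open>l\<close> and \<open>l^2\<close>. This
  takes the place of regular variation.\<close>

lemma hub_scale:
  assumes "1 \<le> l"
  shows "l * hub u \<le> hub (l * u)" "hub (l * u) \<le> l\<^sup>2 * hub u"
proof -
  have p: "0 < 1 + \<bar>u\<bar>" "0 < 1 + \<bar>l * u\<bar>" by linarith+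
  have "\<bar>l * u\<bar> = l * \<bar>u\<bar>" using assms by (simp add: abs_mult)
  moreover have "1 * \<bar>u\<bar> \<le> l * \<bar>u\<bar>" using assms by (intro mult_right_mono) auto
  ultimately have a: "1 + \<bar>u\<bar> \<le> 1 + \<bar>l * u\<bar>" "1 + \<bar>l * u\<bar> \<le> l * (1 + \<bar>u\<bar>)"
    using assms by (auto simp: distrib_left)
  have "l\<^sup>2 * u\<^sup>2 / (l * (1 + \<bar>u\<bar>)) \<le> l\<^sup>2 * u\<^sup>2 / (1 + \<bar>l * u\<bar>)"
    using a p assms by (intro divide_left_mono mult_pos_pos) auto
  moreover have "l\<^sup>2 * u\<^sup>2 / (l * (1 + \<bar>u\<bar>)) = l * hub u"
    using assms by (simp add: hub_def power2_eq_square)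
  ultimately show "l * hub u \<le> hub (l * u)" by (simp add: hub_def power_mult_distrib)
  have "l\<^sup>2 * u\<^sup>2 / (1 + \<bar>l * u\<bar>) \<le> l\<^sup>2 * u\<^sup>2 / (1 + \<bar>u\<bar>)"
    using a p by (intro divide_left_mono mult_pos_pos) auto
  then show "hub (l * u) \<le> l\<^sup>2 * hub u" by (simp add: hub_def power_mult_distrib)
qed

lemma kernel_mono:
  assumes "0 \<le> u" "u \<le> v" shows "rho u \<le> rho v" "iota u \<le> iota v"
proof -
  have "u / (1 + u) \<le> v / (1 + v)" using assms by (simp add: frac_le_eq divide_le_eq field_simps)
  then have *: "(u / (1 + u))\<^sup>2 \<le> (v / (1 + v))\<^sup>2" using assms by (intro power_mono) auto
  then show "rho u \<le> rho v" using assms by (simp add: rho_def power_divide)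
  have "u * (u / (1 + u))\<^sup>2 \<le> v * (v / (1 + v))\<^sup>2" using * assms by (intro mult_mono) auto
  then show "iota u \<le> iota v"
    using assms by (simp add: iota_def power_divide power2_eq_square power3_eq_cube)
qed

lemma min_mult_le_hub:
  assumes "0 \<le> u" shows "min 2 u * u \<le> 4 * hub u"
proof (cases "u \<le> 1")
  case True
  have "u\<^sup>2 / 2 \<le> u\<^sup>2 / (1 + u)" using assms True by (intro divide_left_mono) auto
  then have "u\<^sup>2 / 2 \<le> hub u" using assms by (simp add: hub_def)
  moreover have "min 2 u * u \<le> u\<^sup>2" using True by (simp add: power2_eq_square)
  moreover have "0 \<le> hub u" by simp
  ultimately show ?thesis by linarith
next
  case False
  have "u\<^sup>2 / (2 * u) \<le> u\<^sup>2 / (1 + u)" using False by (intro divide_left_mono) auto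
  then have "u / 2 \<le> hub u" using False by (simp add: hub_def power2_eq_square)
  moreover have "min 2 u * u \<le> 2 * u" using False by (intro mult_right_mono) auto
  ultimately show ?thesis by linarith
qed

text \<open>The subtracted term is the derivative of \<open>hub (t k)\<close> in \<open>t\<close>,
  because \<open>u hub'(u) = hub u + rho u\<close> for \<open>u > 0\<close>. The remainder is only
  linear in \<open>|k|\<close>, hence integrable although the second moment is infinite.\<close>

lemma hub_taylor:
  assumes "0 < t" "0 < s"
  shows "\<bar>hub (s * k) - hub (t * k) - (s - t) * ((hub (t * k) + rho (t * k)) / t)\<bar> \<le> (s - t)\<^sup>2 * (\<bar>k\<bar> / t)"
proof -
  define y where "y = \<bar>k\<bar>"
  have y: "0 \<le> y" by (simp add: y_def)
  have st: "hub (s * k) = (s * y)\<^sup>2 / (1 + s * y)" "hub (t * k) = (t * y)\<^sup>2 / (1 + t * y)"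
      "rho (t * k) = (t * y)\<^sup>2 / (1 + t * y)\<^sup>2"
    using assms by (auto simp: hub_def rho_def y_def abs_mult power_mult_distrib)
  have p: "0 < 1 + t * y" "0 < 1 + s * y" using assms y by (auto intro: add_pos_nonneg)
  have "hub (s * k) - hub (t * k) - (s - t) * ((hub (t * k) + rho (t * k)) / t)
      = (s - t)\<^sup>2 * (y * (y / ((1 + t * y)\<^sup>2 * (1 + s * y))))"
    unfolding st using p assms by (simp add: divide_simps) algebra
  moreover have "y / ((1 + t * y)\<^sup>2 * (1 + s * y)) \<le> 1 / t"
  proof -
    have "t * y \<le> (1 + t * y) * 1 * 1" by simp
    also have "\<dots> \<le> (1 + t * y) * (1 + t * y) * (1 + s * y)"
      using assms y by (intro mult_mono) auto
    finally show ?thesis using assms p by (simp add: divide_simps power2_eq_square mult.commute)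
  qed
  moreover have "0 \<le> y / ((1 + t * y)\<^sup>2 * (1 + s * y))" using y p by simp
  ultimately have "\<bar>hub (s * k) - hub (t * k) - (s - t) * ((hub (t * k) + rho (t * k)) / t)\<bar>
      = (s - t)\<^sup>2 * (y * (y / ((1 + t * y)\<^sup>2 * (1 + s * y))))"
    using y by (simp only: abs_mult abs_of_nonneg zero_le_power2)
  also have "\<dots> \<le> (s - t)\<^sup>2 * (y * (1 / t))"
    using y \<open>y / ((1 + t * y)\<^sup>2 * (1 + s * y)) \<le> 1 / t\<close> by (intro mult_left_mono) auto
  finally show ?thesis by (simp add: y_def)
qed

lemma norm_le_norm_add: "0 \<le> a \<Longrightarrow> 0 \<le> b \<Longrightarrow> norm a \<le> norm (a + b)" for a b :: real
  by simp

section \<open>Means of the kernels under the step law\<close>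

definition kmean :: "int pmf \<Rightarrow> (real \<Rightarrow> real) \<Rightarrow> int set \<Rightarrow> real \<Rightarrow> real" where
  "kmean p g S t = (\<integral>k. indicator S k * g (t * real_of_int k) \<partial>measure_pmf p)"

lemma integrable_dominated_abs:
  fixes f :: "int \<Rightarrow> 'b::{banach, second_countable_topology}"
  assumes "integrable (measure_pmf p) real_of_int" "\<And>k. norm (f k) \<le> A + B * \<bar>real_of_int k\<bar>"
  shows "integrable (measure_pmf p) f"
proof (rule Bochner_Integration.integrable_bound)
  show "integrable (measure_pmf p) (\<lambda>k. A + B * \<bar>real_of_int k\<bar>)"
    using assms(1) by auto
  show "AE k in measure_pmf p. norm (f k) \<le> norm (A + B * \<bar>real_of_int k\<bar>)"
    using assms(2) by (auto intro!: AE_I2 order_trans[OF assms(2)])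
qed simp

context
  fixes p :: "int pmf"
  assumes int: "integrable (measure_pmf p) real_of_int"
begin

lemma kmean_integrable:
  assumes "g \<in> {hub, rho, iota}"
  shows "integrable (measure_pmf p) (\<lambda>k. indicator S k * g (t * real_of_int k))"
proof (rule integrable_dominated_abs[OF int, where A=0 and B="\<bar>t\<bar>"])
  fix k
  have "0 \<le> g (t * real_of_int k)" "g (t * real_of_int k) \<le> hub (t * real_of_int k)"
    using assms by (auto intro: rho_le_hub iota_le_hub)
  then show "norm (indicator S k * g (t * real_of_int k)) \<le> 0 + \<bar>t\<bar> * \<bar>real_of_int k\<bar>"
    using hub_le_abs[of "t * real_of_int k"] by (auto simp: indicator_def abs_mult)
qed

lemma kmean_nonneg: "g \<in> {hub, rho, iota} \<Longrightarrow> 0 \<le> kmean p g S t"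
  unfolding kmean_def by (intro Bochner_Integration.integral_nonneg) (auto simp: indicator_def)

lemma kmean_mono_set:
  assumes "g \<in> {hub, rho, iota}" "S \<subseteq> T" shows "kmean p g S t \<le> kmean p g T t"
  unfolding kmean_def using assms
  by (intro integral_mono kmean_integrable) (auto simp: indicator_def)

lemma kmean_hub_eq: "kmean p hub S t = kmean p rho S t + kmean p iota S t"
  unfolding kmean_def
  by (subst Bochner_Integration.integral_add[symmetric]) (auto simp: kmean_integrable hub_eq distrib_left)

lemma kmean_hub_split: "kmean p hub UNIV t = kmean p hub {..<0} t + kmean p hub {0<..} t"
proof -
  have I: "integrable (measure_pmf p) (\<lambda>k. indicator S k * hub (t * real_of_int k))" for S
    by (rule kmean_integrable) simp
  show ?thesis
    unfolding kmean_def Bochner_Integration.integral_add[OF I I, symmetric]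
    by (intro Bochner_Integration.integral_cong) (auto simp: indicator_def)
qed

lemma kmean_scale:
  assumes "1 \<le> l"
  shows "l * kmean p hub S t \<le> kmean p hub S (l * t)" "kmean p hub S (l * t) \<le> l\<^sup>2 * kmean p hub S t"
proof -
  have I: "integrable (measure_pmf p) (\<lambda>k. indicator S k * hub (t * real_of_int k))" for t
    by (rule kmean_integrable) simp
  show "l * kmean p hub S t \<le> kmean p hub S (l * t)"
    unfolding kmean_def integral_mult_right_zero[symmetric]
    using hub_scale(1)[OF assms] by (intro integral_mono integrable_mult_right I) (auto simp: indicator_def mult.assoc)
  show "kmean p hub S (l * t) \<le> l\<^sup>2 * kmean p hub S t"
    unfolding kmean_def integral_mult_right_zero[symmetric]
    using hub_scale(2)[OF assms] by (intro integral_mono integrable_mult_right I) (auto simp: indicator_def mult.assoc)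
qed

lemma kmean_mono:
  assumes "0 < s" "s \<le> t" shows "kmean p hub S s \<le> kmean p hub S t"
proof -
  have "1 * kmean p hub S s \<le> (t / s) * kmean p hub S s"
    using assms by (intro mult_right_mono kmean_nonneg) auto
  also have "\<dots> \<le> kmean p hub S ((t / s) * s)" by (rule kmean_scale) (use assms in simp)
  finally show ?thesis using assms by simp
qed

text \<open>Equivalently, the mean of \<open>hub\<close> divided by \<open>t\<close> is
  nondecreasing, and divided by \<open>t^2\<close> nonincreasing.\<close>

lemma kmean_ratio:
  assumes "0 < s" "s \<le> t"
  shows "(t / s) * kmean p hub S s \<le> kmean p hub S t" "kmean p hub S t \<le> (t / s)\<^sup>2 * kmean p hub S s"
  using kmean_scale[of "t / s" S s] assms by auto

lemma kmean_isCont: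
  assumes "g \<in> {hub, rho, iota}"
  shows "isCont (kmean p g S) t"
  unfolding continuous_within sequentially_imp_eventually_within kmean_def
proof (rule iffD2[OF tendsto_at_iff_sequentially], intro allI impI)
  fix X :: "nat \<Rightarrow> real" assume "\<forall>i. X i \<in> UNIV - {t}" and X: "X \<longlonglongrightarrow> t"
  obtain B where B: "\<And>n. \<bar>X n\<bar> \<le> B"
    using convergent_imp_Bseq[of X] X by (metis BseqE real_norm_def convergentI)
  have gc: "isCont g u" for u using assms kernel_cont by (auto simp: continuous_on_eq_continuous_at)
  show "((\<lambda>t. \<integral>k. indicator S k * g (t * real_of_int k) \<partial>measure_pmf p) \<circ> X) \<longlonglongrightarrow>
      (\<integral>k. indicator S k * g (t * real_of_int k) \<partial>measure_pmf p)"
    unfolding o_def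
  proof (rule integral_dominated_convergence[where w="\<lambda>k. B * \<bar>real_of_int k\<bar>"])
    show "integrable (measure_pmf p) (\<lambda>k. B * \<bar>real_of_int k\<bar>)" using int by auto
    show "AE k in measure_pmf p. (\<lambda>i. indicator S k * g (X i * real_of_int k)) \<longlonglongrightarrow> indicator S k * g (t * real_of_int k)"
      by (intro AE_I2 tendsto_mult tendsto_const isCont_tendsto_compose[OF gc] X)
    fix n
    have "norm (indicator S k * g (X n * real_of_int k)) \<le> B * \<bar>real_of_int k\<bar>" for k
    proof -
      have "0 \<le> g (X n * real_of_int k)" "g (X n * real_of_int k) \<le> hub (X n * real_of_int k)"
        using assms by (auto intro: rho_le_hub iota_le_hub)
      moreover have "hub (X n * real_of_int k) \<le> B * \<bar>real_of_int k\<bar>"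
        using hub_le_abs[of "X n * real_of_int k"] mult_right_mono[OF B[of n], of "\<bar>real_of_int k\<bar>"]
        by (simp add: abs_mult)
      ultimately show ?thesis by (auto simp: indicator_def intro: order_trans)
    qed
    then show "AE k in measure_pmf p. norm (indicator S k * g (X n * real_of_int k)) \<le> B * \<bar>real_of_int k\<bar>"
      by simp
  qed simp_all
qed

text \<open>The identity \<open>t J' = J + r\<close> that makes the next two integrals
  computable.\<close>

lemma kmean_deriv:
  assumes t: "0 < t"
  shows "(kmean p hub S has_real_derivative (kmean p hub S t + kmean p rho S t) / t) (at t)"
proof -
  let ?J = "kmean p hub S" and ?D = "(kmean p hub S t + kmean p rho S t) / t"
  let ?C = "(\<integral>k. \<bar>real_of_int k\<bar> / t \<partial>measure_pmf p)"
  have bound: "\<bar>?J s - ?J t - (s - t) * ?D\<bar> \<le> (s - t)\<^sup>2 * ?C" if s: "0 < s" for s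
  proof -
    let ?f = "\<lambda>k. indicator S k * hub (s * real_of_int k) - indicator S k * hub (t * real_of_int k)
       - (s - t) * ((indicator S k * hub (t * real_of_int k) + indicator S k * rho (t * real_of_int k)) / t)"
    have I: "integrable (measure_pmf p) (\<lambda>k. indicator S k * hub (t * real_of_int k))"
      "integrable (measure_pmf p) (\<lambda>k. indicator S k * rho (t * real_of_int k))"
      "integrable (measure_pmf p) (\<lambda>k. indicator S k * hub (s * real_of_int k))"
      by (auto intro!: kmean_integrable)
    have eq: "?J s - ?J t - (s - t) * ?D = (\<integral>k. ?f k \<partial>measure_pmf p)"
      unfolding kmean_def using I by simp
    have le1: "\<bar>\<integral>k. ?f k \<partial>measure_pmf p\<bar> \<le> (\<integral>k. \<bar>?f k\<bar> \<partial>measure_pmf p)"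
      by (rule integral_abs_bound)
    have le2: "(\<integral>k. \<bar>?f k\<bar> \<partial>measure_pmf p) \<le> (\<integral>k. (s - t)\<^sup>2 * (\<bar>real_of_int k\<bar> / t) \<partial>measure_pmf p)"
    proof (rule integral_mono)
      show "integrable (measure_pmf p) (\<lambda>k. \<bar>?f k\<bar>)" using I by auto
      show "integrable (measure_pmf p) (\<lambda>k. (s - t)\<^sup>2 * (\<bar>real_of_int k\<bar> / t))" using int by auto
      show "\<bar>?f k\<bar> \<le> (s - t)\<^sup>2 * (\<bar>real_of_int k\<bar> / t)" for k
        using hub_taylor[OF t s, of "real_of_int k"] t by (cases "k \<in> S") auto
    qed
    show ?thesis using order_trans[OF le1 le2] unfolding eq by simp
  qed
  have "((\<lambda>s. (?J s - ?J t) / (s - t) - ?D) \<longlongrightarrow> 0) (at t)"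
  proof (rule Lim_null_comparison)
    show "((\<lambda>s. \<bar>s - t\<bar> * ?C) \<longlongrightarrow> 0) (at t)"
    proof (rule tendsto_mult_left_zero)
      have "((\<lambda>s. \<bar>s - t\<bar>) \<longlongrightarrow> \<bar>t - t\<bar>) (at t)" by (intro tendsto_intros)
      then show "((\<lambda>s. \<bar>s - t\<bar>) \<longlongrightarrow> 0) (at t)" by simp
    qed
    have "eventually (\<lambda>s. 0 < s) (at t)"
      using t by (intro order_tendstoD[of "\<lambda>x. x"]) auto
    moreover have "eventually (\<lambda>s. s \<noteq> t) (at t)" by (simp add: eventually_at_filter)
    ultimately show "eventually (\<lambda>s. norm ((?J s - ?J t) / (s - t) - ?D) \<le> \<bar>s - t\<bar> * ?C) (at t)"
    proof eventually_elim
      case (elim s)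
      have "\<bar>(?J s - ?J t) / (s - t) - ?D\<bar> = \<bar>?J s - ?J t - (s - t) * ?D\<bar> / \<bar>s - t\<bar>"
        using elim by (simp add: abs_divide[symmetric] diff_divide_distrib)
      also have "\<dots> \<le> ((s - t)\<^sup>2 * ?C) / \<bar>s - t\<bar>"
        using bound[OF elim(1)] by (intro divide_right_mono) auto
      also have "\<dots> = \<bar>s - t\<bar> * ?C"
      proof -
        have "x\<^sup>2 * c / \<bar>x\<bar> = \<bar>x\<bar> * c" if "x \<noteq> 0" for x c :: real
          using that by (auto simp: power2_eq_square abs_if)
        from this[of "s - t" ?C] elim show ?thesis by (simp only: right_minus_eq not_False_eq_True simp_thms)
      qed
      finally show ?case by simp
    qed
  qed
  then show ?thesis
    unfolding has_field_derivative_iff by (simp add: LIM_zero_iff)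
qed

text \<open>\<open>r/J^2\<close> is the derivative of \<open>-t/J\<close>. For the part on
  \<open>S\<close>, the derivative of \<open>t J_S/J^2\<close> is \<open>r_S/J^2\<close> with an
  error \<open>-2 (J_S/J) r/J^2\<close>; subtracting \<open>2 \<epsilon> t/J\<close> adds
  \<open>2 \<epsilon> r/J^2\<close>, which outweighs the error because
  \<open>J_S <= \<epsilon> J\<close>.\<close>

lemma integral_r_over_J_square:
  assumes s: "0 < s" "s < t0" and pos: "\<And>t. 0 < t \<Longrightarrow> 0 < kmean p hub UNIV t"
    and eps: "\<And>t. 0 < t \<Longrightarrow> t \<le> t0 \<Longrightarrow> kmean p hub S t \<le> \<epsilon> * kmean p hub UNIV t"
  shows "set_integrable lborel {s<..<t0} (\<lambda>t. kmean p rho S t / (kmean p hub UNIV t)\<^sup>2)"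
    and "(LINT t:{s<..<t0}|lborel. kmean p rho S t / (kmean p hub UNIV t)\<^sup>2)
       \<le> t0 * kmean p hub S t0 / (kmean p hub UNIV t0)\<^sup>2 + 2 * \<epsilon> * (s / kmean p hub UNIV s)"
proof -
  let ?J = "kmean p hub UNIV" and ?JS = "kmean p hub S" and ?r = "kmean p rho UNIV" and ?rS = "kmean p rho S"
  let ?f = "\<lambda>t. ?rS t / (?J t)\<^sup>2 + 2 * (\<epsilon> - ?JS t / ?J t) * (?r t / (?J t)\<^sup>2)"
  let ?F = "\<lambda>t. t * ?JS t / (?J t)\<^sup>2 - 2 * \<epsilon> * (t / ?J t)"
  have nz: "?J t \<noteq> 0" if "0 < t" for t using pos[OF that] by simp
  have D: "(?F has_real_derivative ?f t) (at t)" if t: "0 < t" for t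
  proof -
    note dJ = kmean_deriv[OF t, of UNIV] and dS = kmean_deriv[OF t, of S]
    have alg: "((1 * A + (A + b) / t * t) * B\<^sup>2 - (t * A) * (of_nat 2 * ((B + d) / t * B ^ (2 - Suc 0)))) / (B\<^sup>2 * B\<^sup>2)
        - 2 * \<epsilon> * ((1 * B - t * ((B + d) / t)) / (B * B)) = b / B\<^sup>2 + 2 * (\<epsilon> - A / B) * (d / B\<^sup>2)"
      if "B \<noteq> 0" for A B b d :: real
      using that t by (simp add: field_simps power2_eq_square)
    show ?thesis
      by (rule DERIV_cong[OF DERIV_diff[OF DERIV_divide[OF DERIV_mult[OF DERIV_ident dS] DERIV_power[OF dJ, of 2]]
         DERIV_cmult[OF DERIV_divide[OF DERIV_ident dJ]]]])
       (use nz[OF t] alg in auto)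
  qed
  have C: "isCont ?f t" if t: "0 < t" for t
    using nz[OF t] by (auto intro!: continuous_intros kmean_isCont)
  have nn: "0 \<le> 2 * (\<epsilon> - ?JS t / ?J t) * (?r t / (?J t)\<^sup>2)" if "0 < t" "t \<le> t0" for t
    using eps[OF that] pos[OF that(1)] by (intro mult_nonneg_nonneg divide_nonneg_nonneg kmean_nonneg) (auto simp: divide_le_eq)
  have rn: "0 \<le> ?rS t / (?J t)\<^sup>2" for t by (intro divide_nonneg_nonneg kmean_nonneg) auto
  have FC: "isCont ?F t" if "0 < t" for t using D[OF that] by (rule DERIV_isCont)
  have e: "einterval (ereal s) (ereal t0) = {s<..<t0}" by (rule einterval_eq_Icc[THEN trans]) auto
  note FTC = interval_integral_FTC_nonneg[of "ereal s" "ereal t0" ?F ?f "?F s" "?F t0"]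
  have A: "set_integrable lborel (einterval (ereal s) (ereal t0)) ?f"
    and B: "(LBINT x=ereal s..ereal t0. ?f x) = ?F t0 - ?F s"
  proof -
    have 1: "((?F \<circ> real_of_ereal) \<longlongrightarrow> ?F s) (at_right (ereal s))"
      unfolding ereal_tendsto_simps using FC[of s] s by (auto simp: isCont_def intro: tendsto_mono[OF at_le])
    have 2: "((?F \<circ> real_of_ereal) \<longlongrightarrow> ?F t0) (at_left (ereal t0))"
      unfolding ereal_tendsto_simps using FC[of t0] s by (auto simp: isCont_def intro: tendsto_mono[OF at_le])
    have 3: "AE x in lborel. ereal s < ereal x \<longrightarrow> ereal x < ereal t0 \<longrightarrow> 0 \<le> ?f x"
      using s nn rn by (intro AE_I2) (auto intro!: add_nonneg_nonneg)
    show "set_integrable lborel (einterval (ereal s) (ereal t0)) ?f"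
      "(LBINT x=ereal s..ereal t0. ?f x) = ?F t0 - ?F s"
      using FTC[OF _ D C 3 1 2] s by auto
  qed
  have I: "set_integrable lborel {s<..<t0} ?f" using A by (simp add: e)
  show J: "set_integrable lborel {s<..<t0} (\<lambda>t. ?rS t / (?J t)\<^sup>2)"
  proof (rule set_integrable_bound[OF I])
    show "set_borel_measurable lborel {s<..<t0} (\<lambda>t. ?rS t / (?J t)\<^sup>2)"
      unfolding set_borel_measurable_def using kmean_isCont
      by (intro borel_measurable_scaleR borel_measurable_divide borel_measurable_power borel_measurable_indicator) 
        (auto intro!: borel_measurable_continuous_onI continuous_at_imp_continuous_on)
    show "AE t in lborel. t \<in> {s<..<t0} \<longrightarrow> norm (?rS t / (?J t)\<^sup>2) \<le> norm (?f t)"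
      using s by (intro AE_I2 impI norm_le_norm_add rn nn) auto
  qed
  have "(LINT t:{s<..<t0}|lborel. ?rS t / (?J t)\<^sup>2) \<le> (LINT t:{s<..<t0}|lborel. ?f t)"
    using nn s by (intro set_integral_mono J I) auto
  also have "\<dots> = ?F t0 - ?F s"
    using B s by (simp add: interval_lebesgue_integral_def e)
  also have "\<dots> \<le> t0 * ?JS t0 / (?J t0)\<^sup>2 + 2 * \<epsilon> * (s / ?J s)"
  proof -
    have "0 \<le> ?JS t0" "0 \<le> ?JS s" by (auto intro!: kmean_nonneg)
    moreover have "0 \<le> \<epsilon>" using eps[of s] pos[of s] s \<open>0 \<le> ?JS s\<close>
      by (metis less_imp_le mult_neg_pos not_less order.trans order_less_le_trans)
    ultimately have "0 \<le> 2 * \<epsilon> * (t0 / ?J t0)" "0 \<le> s * ?JS s / (?J s)\<^sup>2"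
      using s pos[of t0] by auto
    then show ?thesis by linarith
  qed
  finally show "(LINT t:{s<..<t0}|lborel. ?rS t / (?J t)\<^sup>2)
       \<le> t0 * ?JS t0 / (?J t0)\<^sup>2 + 2 * \<epsilon> * (s / ?J s)" .
qed

text \<open>The companion near 0: \<open>t i/J^2\<close> is the derivative of \<open>t^2/J\<close>,
  since \<open>i = J - r\<close>. The boundary term at 0 vanishes because \<open>t^2/J\<close> tends
  to 0.\<close>

lemma integral_i_over_J_square:
  assumes s: "0 < s" and pos: "\<And>t. 0 < t \<Longrightarrow> 0 < kmean p hub UNIV t"
    and lim: "((\<lambda>t. t\<^sup>2 / kmean p hub UNIV t) \<longlongrightarrow> 0) (at_right 0)"
    and eps: "\<And>t. 0 < t \<Longrightarrow> t \<le> s \<Longrightarrow> kmean p hub S t \<le> \<epsilon> * kmean p hub UNIV t"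
  shows "set_integrable lborel {0<..<s} (\<lambda>t. t * kmean p iota S t / (kmean p hub UNIV t)\<^sup>2)"
    and "(LINT t:{0<..<s}|lborel. t * kmean p iota S t / (kmean p hub UNIV t)\<^sup>2)
       \<le> 2 * \<epsilon> * (s\<^sup>2 / kmean p hub UNIV s)"
proof -
  let ?J = "kmean p hub UNIV" and ?JS = "kmean p hub S" and ?i = "kmean p iota UNIV" and ?iS = "kmean p iota S"
  let ?f = "\<lambda>t. t * ?iS t / (?J t)\<^sup>2 + 2 * (\<epsilon> - ?JS t / ?J t) * (t * ?i t / (?J t)\<^sup>2)"
  \<comment> \<open>Differentiating the factor \<open>J_S/J\<close> as well produces
    \<open>t i_S/J^2\<close> and a second copy of \<open>(J_S/J) t i/J^2\<close>; hence the
    coefficient \<open>2 \<epsilon>\<close>.\<close>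
  let ?F = "\<lambda>t. 2 * \<epsilon> * (t\<^sup>2 / ?J t) - (?JS t / ?J t) * (t\<^sup>2 / ?J t)"
  have nz: "?J t \<noteq> 0" if "0 < t" for t using pos[OF that] by simp
  have D: "(?F has_real_derivative ?f t) (at t)" if t: "0 < t" for t
  proof -
    have r: "kmean p rho UNIV t = ?J t - ?i t" "kmean p rho S t = ?JS t - ?iS t"
      by (simp_all add: kmean_hub_eq)
    note dJ = kmean_deriv[OF t, of UNIV, unfolded r] and dS = kmean_deriv[OF t, of S, unfolded r]
    have alg: "2 * \<epsilon> * ((of_nat 2 * (1 * t ^ (2 - Suc 0)) * B - t\<^sup>2 * ((B + (B - d)) / t)) / (B * B)) -
       (((A + (A - b)) / t * B - A * ((B + (B - d)) / t)) / (B * B) * (t\<^sup>2 / B)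
        + (of_nat 2 * (1 * t ^ (2 - Suc 0)) * B - t\<^sup>2 * ((B + (B - d)) / t)) / (B * B) * (A / B))
       = t * b / B\<^sup>2 + 2 * (\<epsilon> - A / B) * (t * d / B\<^sup>2)"
      if "B \<noteq> 0" for A B b d :: real
      using that t by (simp add: field_simps power2_eq_square)
    have dt: "((\<lambda>t. t\<^sup>2 / ?J t) has_real_derivative
        (of_nat 2 * (1 * t ^ (2 - Suc 0)) * ?J t - t\<^sup>2 * ((?J t + (?J t - ?i t)) / t)) / (?J t * ?J t)) (at t)"
      by (rule DERIV_divide[OF DERIV_power[OF DERIV_ident] dJ nz[OF t]])
    show ?thesis
      by (rule DERIV_cong[OF DERIV_diff[OF DERIV_cmult[OF dt] DERIV_mult[OF DERIV_divide[OF dS dJ nz[OF t]] dt]]])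
       (use nz[OF t] alg in auto)
  qed
  have C: "isCont ?f t" if t: "0 < t" for t
    using nz[OF t] by (auto intro!: continuous_intros kmean_isCont)
  have nn: "0 \<le> 2 * (\<epsilon> - ?JS t / ?J t) * (t * ?i t / (?J t)\<^sup>2)" if "0 < t" "t \<le> s" for t
    using eps[OF that] pos[OF that(1)] that by (intro mult_nonneg_nonneg divide_nonneg_nonneg kmean_nonneg) (auto simp: divide_le_eq)
  have rn: "0 \<le> t * ?iS t / (?J t)\<^sup>2" if "0 < t" for t using that by (intro divide_nonneg_nonneg mult_nonneg_nonneg kmean_nonneg) auto
  have FC: "isCont ?F t" if "0 < t" for t using D[OF that] by (rule DERIV_isCont)
  have JSn: "0 \<le> ?JS t" for t by (auto intro!: kmean_nonneg)
  have ratio: "0 \<le> ?JS t / ?J t" "?JS t / ?J t \<le> \<epsilon>" if "0 < t" "t \<le> s" for t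
    using eps[OF that] pos[OF that(1)] JSn[of t] by (auto simp: divide_le_eq)
  have lim0: "(?F \<longlongrightarrow> 0) (at_right 0)"
  proof -
    have "((\<lambda>t. (?JS t / ?J t) * (t\<^sup>2 / ?J t)) \<longlongrightarrow> 0) (at_right 0)"
    proof (rule Lim_null_comparison)
      show "((\<lambda>t. \<epsilon> * (t\<^sup>2 / ?J t)) \<longlongrightarrow> 0) (at_right 0)" using tendsto_mult_right_zero[OF lim] .
      have "eventually (\<lambda>t. t \<in> {0<..<s}) (at_right 0)" using s by (rule eventually_at_right_real)
      then show "eventually (\<lambda>t. norm ((?JS t / ?J t) * (t\<^sup>2 / ?J t)) \<le> \<epsilon> * (t\<^sup>2 / ?J t)) (at_right 0)"
      proof eventually_elim
        case (elim t)
        have "0 \<le> t\<^sup>2 / ?J t" using pos[of t] elim by auto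
        moreover have "0 \<le> ?JS t / ?J t" "?JS t / ?J t \<le> \<epsilon>" using ratio[of t] elim by auto
        ultimately show ?case unfolding real_norm_def abs_mult
          by (intro mult_mono) (simp_all only: abs_of_nonneg abs_ge_zero)
      qed
    qed
    then show ?thesis using tendsto_diff[OF tendsto_mult_right_zero[OF lim]] by fastforce
  qed
  have e: "einterval (ereal 0) (ereal s) = {0<..<s}" by (rule einterval_eq_Icc[THEN trans]) auto
  note FTC = interval_integral_FTC_nonneg[of "ereal 0" "ereal s" ?F ?f 0 "?F s"]
  have A: "set_integrable lborel (einterval (ereal 0) (ereal s)) ?f"
    and B: "(LBINT x=ereal 0..ereal s. ?f x) = ?F s - 0"
  proof -
    have 1: "((?F \<circ> real_of_ereal) \<longlongrightarrow> 0) (at_right (ereal 0))"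
      unfolding ereal_tendsto_simps by (rule lim0)
    have 2: "((?F \<circ> real_of_ereal) \<longlongrightarrow> ?F s) (at_left (ereal s))"
      unfolding ereal_tendsto_simps using FC[of s] s by (auto simp: isCont_def intro: tendsto_mono[OF at_le])
    have 3: "AE x in lborel. ereal 0 < ereal x \<longrightarrow> ereal x < ereal s \<longrightarrow> 0 \<le> ?f x"
      using s nn rn by (intro AE_I2) (auto intro!: add_nonneg_nonneg)
    show "set_integrable lborel (einterval (ereal 0) (ereal s)) ?f"
      "(LBINT x=ereal 0..ereal s. ?f x) = ?F s - 0"
      using FTC[OF _ D C 3 1 2] s by auto
  qed
  have I: "set_integrable lborel {0<..<s} ?f" using A by (simp add: e)
  show J: "set_integrable lborel {0<..<s} (\<lambda>t. t * ?iS t / (?J t)\<^sup>2)"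
  proof (rule set_integrable_bound[OF I])
    show "set_borel_measurable lborel {0<..<s} (\<lambda>t. t * ?iS t / (?J t)\<^sup>2)"
      unfolding set_borel_measurable_def using kmean_isCont
      by (intro borel_measurable_scaleR borel_measurable_divide borel_measurable_times borel_measurable_power borel_measurable_indicator) 
        (auto intro!: borel_measurable_continuous_onI continuous_at_imp_continuous_on)
    show "AE t in lborel. t \<in> {0<..<s} \<longrightarrow> norm (t * ?iS t / (?J t)\<^sup>2) \<le> norm (?f t)"
      by (intro AE_I2 impI norm_le_norm_add rn nn) auto
  qed
  have "(LINT t:{0<..<s}|lborel. t * ?iS t / (?J t)\<^sup>2) \<le> (LINT t:{0<..<s}|lborel. ?f t)"
    using nn s by (intro set_integral_mono J I) auto
  also have "\<dots> = ?F s" using B s by (simp add: interval_lebesgue_integral_def e)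
  also have "\<dots> \<le> 2 * \<epsilon> * (s\<^sup>2 / ?J s)"
  proof -
    have "0 \<le> (?JS s / ?J s) * (s\<^sup>2 / ?J s)"
      using JSn[of s] s pos[of s] by (intro mult_nonneg_nonneg divide_nonneg_nonneg) auto
    then show ?thesis by simp
  qed
  finally show "(LINT t:{0<..<s}|lborel. t * ?iS t / (?J t)\<^sup>2) \<le> 2 * \<epsilon> * (s\<^sup>2 / ?J s)" .
qed

end

section \<open>The characteristic function near the origin\<close>

lemma norm_cis_diff_le: "norm (cis a - cis b) \<le> \<bar>a - b\<bar>"
proof -
  have "cis a - cis b = cis b * (cis (a - b) - 1)" by (simp add: cis_mult algebra_simps)
  then have "norm (cis a - cis b) = norm (exp (\<i> * of_real (a - b)) - 1)"
    by (simp add: norm_mult cis_conv_exp)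
  also have "\<dots> = 2 * \<bar>sin ((a - b) / 2)\<bar>" by (rule dist_exp_i_1)
  also have "\<dots> \<le> \<bar>a - b\<bar>" using abs_sin_x_le_abs_x[of "(a - b) / 2"] by simp
  finally show ?thesis .
qed

lemma norm_cis_minus_1_le: "norm (cis a - 1) \<le> min 2 \<bar>a\<bar>"
  using norm_cis_diff_le[of a 0] norm_triangle_ineq4[of "cis a" 1] by simp

definition psi :: "int pmf \<Rightarrow> real \<Rightarrow> complex" where
  "psi p t = (\<integral>k. 1 - cis (t * real_of_int k) \<partial>measure_pmf p)"

lemma psi_integrable: "integrable (measure_pmf p) (\<lambda>k. 1 - cis (t * real_of_int k))"
proof (rule measure_pmf.integrable_const_bound[where B=2])
  show "AE k in measure_pmf p. norm (1 - cis (t * real_of_int k)) \<le> 2"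
    using norm_cis_minus_1_le by (auto simp: norm_minus_commute)
qed simp

lemma cis_integrable: "integrable (measure_pmf p) (\<lambda>k. cis (t * real_of_int k))"
  by (rule measure_pmf.integrable_const_bound[where B=1]) auto

lemma psi_eq: "psi p t = 1 - (\<integral>k. cis (t * real_of_int k) \<partial>measure_pmf p)"
  unfolding psi_def using cis_integrable[of p t] by simp

lemma trig_integrable:
  "integrable (measure_pmf p) (\<lambda>k. cos (t * real_of_int k))"
  "integrable (measure_pmf p) (\<lambda>k. sin (t * real_of_int k))"
  by (auto intro!: measure_pmf.integrable_const_bound[where B=1])

lemma psi_Re: "Re (psi p t) = (\<integral>k. 1 - cos (t * real_of_int k) \<partial>measure_pmf p)"
  unfolding psi_def using integral_Re[OF psi_integrable[of p t]] by simp

lemma psi_Re_nonneg: "0 \<le> Re (psi p t)"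
  unfolding psi_Re by (intro Bochner_Integration.integral_nonneg) auto

lemma norm_one_minus_psi_le: "norm (1 - psi p t) \<le> 1"
proof -
  have "norm (\<integral>k. cis (t * real_of_int k) \<partial>measure_pmf p) \<le> (\<integral>k. norm (cis (t * real_of_int k)) \<partial>measure_pmf p)"
    by (rule integral_norm_bound)
  then show ?thesis by (simp add: psi_eq)
qed

section \<open>Centered laws with infinite variance\<close>

locale centered_law =
  fixes p :: "int pmf"
  assumes int: "integrable (measure_pmf p) real_of_int"
    and mean_0: "(\<integral>k. real_of_int k \<partial>measure_pmf p) = 0"
    and infinite_variance: "(\<integral>\<^sup>+k. ennreal ((real_of_int k)\<^sup>2) \<partial>measure_pmf p) = \<infinity>"
begin

abbreviation "J \<equiv> kmean p hub UNIV"
abbreviation "Jp \<equiv> kmean p hub {0<..}"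
abbreviation "mabs \<equiv> (\<integral>k. \<bar>real_of_int k\<bar> \<partial>measure_pmf p)"

text \<open>The mean is 0, so the linear term can be inserted; \<open>u - sin u\<close> is of third
  order at 0 and therefore controlled by \<open>iota\<close>.\<close>

lemma psi_Im: "Im (psi p t) = (\<integral>k. t * real_of_int k - sin (t * real_of_int k) \<partial>measure_pmf p)"
proof -
  have "(\<integral>k. t * real_of_int k - sin (t * real_of_int k) \<partial>measure_pmf p) =
      - (\<integral>k. sin (t * real_of_int k) \<partial>measure_pmf p)"
    using int trig_integrable[of p t] mean_0 by simp
  moreover have "Im (psi p t) = (\<integral>k. - sin (t * real_of_int k) \<partial>measure_pmf p)"
    unfolding psi_def using integral_Im[OF psi_integrable[of p t]] by simp
  ultimately show ?thesis by simp
qed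

lemma psi_diff_le: "norm (psi p s - psi p t) \<le> \<bar>s - t\<bar> * mabs"
proof -
  have "psi p s - psi p t = (\<integral>k. cis (t * real_of_int k) - cis (s * real_of_int k) \<partial>measure_pmf p)"
    using cis_integrable by (simp add: psi_eq)
  also have "norm \<dots> \<le> (\<integral>k. norm (cis (t * real_of_int k) - cis (s * real_of_int k)) \<partial>measure_pmf p)"
    by (rule integral_norm_bound)
  also have "(\<integral>k. norm (cis (t * real_of_int k) - cis (s * real_of_int k)) \<partial>measure_pmf p)
      \<le> (\<integral>k. \<bar>s - t\<bar> * \<bar>real_of_int k\<bar> \<partial>measure_pmf p)"
  proof (rule integral_mono)
    show "integrable (measure_pmf p) (\<lambda>k. norm (cis (t * real_of_int k) - cis (s * real_of_int k)))"
      using cis_integrable by (intro integrable_norm Bochner_Integration.integrable_diff)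
    show "integrable (measure_pmf p) (\<lambda>k. \<bar>s - t\<bar> * \<bar>real_of_int k\<bar>)" using int by auto
    show "norm (cis (t * real_of_int k) - cis (s * real_of_int k)) \<le> \<bar>s - t\<bar> * \<bar>real_of_int k\<bar>" for k
      using norm_cis_diff_le[of "t * real_of_int k" "s * real_of_int k"]
      by (simp add: left_diff_distrib[symmetric] abs_mult abs_minus_commute)
  qed
  finally show ?thesis by simp
qed

lemma isCont_psi: "isCont (psi p) t"
proof -
  have "((\<lambda>s. norm (psi p s - psi p t)) \<longlongrightarrow> 0) (at t)"
  proof (rule tendsto_sandwich[OF _ _ tendsto_const])
    have "((\<lambda>s. \<bar>s - t\<bar> * mabs) \<longlongrightarrow> \<bar>t - t\<bar> * mabs) (at t)" by (intro tendsto_intros)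
    then show "((\<lambda>s. \<bar>s - t\<bar> * mabs) \<longlongrightarrow> 0) (at t)" by simp
  qed (auto intro!: always_eventually psi_diff_le)
  then show ?thesis unfolding isCont_def tendsto_norm_zero_iff by (rule LIM_zero_cancel)
qed

lemma psi_0 [simp]: "psi p 0 = 0" by (simp add: psi_def)

lemma continuous_on_psi: "continuous_on A (psi p)"
  using isCont_psi by (simp add: continuous_at_imp_continuous_on)

lemma psi_measurable [measurable]: "psi p \<in> borel_measurable borel"
  by (intro borel_measurable_continuous_onI continuous_on_psi)

lemma psi_Re_le: "Re (psi p t) \<le> 8 * kmean p rho UNIV t"
proof -
  have "Re (psi p t) \<le> (\<integral>k. 8 * (indicator UNIV k * rho (t * real_of_int k)) \<partial>measure_pmf p)"
    unfolding psi_Re using trig_integrable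
    by (intro integral_mono integrable_mult_right kmean_integrable int) (auto simp: one_minus_cos_le_rho)
  then show ?thesis unfolding kmean_def by simp
qed

lemma sin_integrable: "integrable (measure_pmf p) (\<lambda>k. t * real_of_int k - sin (t * real_of_int k))"
  using int trig_integrable[of p t] by auto

lemma psi_Im_le: "\<bar>Im (psi p t)\<bar> \<le> 8 * kmean p iota UNIV t"
proof -
  have "\<bar>Im (psi p t)\<bar> \<le> (\<integral>k. \<bar>t * real_of_int k - sin (t * real_of_int k)\<bar> \<partial>measure_pmf p)"
    unfolding psi_Im by (rule integral_abs_bound)
  also have "\<dots> \<le> (\<integral>k. 8 * (indicator UNIV k * iota (t * real_of_int k)) \<partial>measure_pmf p)"
    using sin_integrable
    by (intro integral_mono integrable_mult_right kmean_integrable int integrable_abs) (auto simp: u_minus_sin_le_iota)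
  finally show ?thesis unfolding kmean_def by simp
qed

lemma norm_psi_le: "norm (psi p t) \<le> 8 * J t"
  using cmod_le[of "psi p t"] psi_Re_le[of t] psi_Im_le[of t] psi_Re_nonneg[of p t] kmean_hub_eq[OF int, of UNIV t]
  by simp

lemma J_pos: assumes "0 < t" shows "0 < J t"
proof (rule ccontr)
  assume "\<not> 0 < J t"
  then have "J t = 0" using kmean_nonneg[OF int, of hub UNIV t] by simp
  then have "AE k in measure_pmf p. indicator UNIV k * hub (t * real_of_int k) = 0"
    unfolding kmean_def
    by (subst (asm) integral_nonneg_eq_0_iff_AE)
      (use kmean_integrable[OF int, of hub UNIV t] in auto)
  moreover have "u = 0" if "hub u = 0" for u
  proof -
    have "1 + \<bar>u\<bar> \<noteq> 0" by linarith
    then show ?thesis using that by (simp add: hub_def)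
  qed
  ultimately have "AE k in measure_pmf p. ennreal ((real_of_int k)\<^sup>2) = 0"
    using assms by (fastforce simp: AE_measure_pmf_iff)
  then have "(\<integral>\<^sup>+k. ennreal ((real_of_int k)\<^sup>2) \<partial>measure_pmf p) = 0"
    by (subst nn_integral_0_iff_AE) auto
  then show False using infinite_variance by simp
qed

lemma truncated_second_moment:
  obtains K :: nat where "M \<le> (\<integral>k. indicator {- int K..int K} k * (real_of_int k)\<^sup>2 \<partial>measure_pmf p)"
proof -
  let ?f = "\<lambda>K k. ennreal (indicator {- int K..int K} k * (real_of_int k)\<^sup>2)"
  have "incseq ?f"
    by (auto simp: incseq_def le_fun_def indicator_def intro!: ennreal_leI)
  then have "(\<integral>\<^sup>+k. (SUP K. ?f K k) \<partial>measure_pmf p) = (SUP K. \<integral>\<^sup>+k. ?f K k \<partial>measure_pmf p)"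
    by (intro nn_integral_monotone_convergence_SUP) auto
  moreover have "(SUP K. ?f K k) = ennreal ((real_of_int k)\<^sup>2)" for k
  proof (rule antisym)
    show "(SUP K. ?f K k) \<le> ennreal ((real_of_int k)\<^sup>2)"
      by (intro SUP_least ennreal_leI) (auto simp: indicator_def)
    show "ennreal ((real_of_int k)\<^sup>2) \<le> (SUP K. ?f K k)"
      by (rule SUP_upper2[of "nat \<bar>k\<bar>"]) (auto simp: indicator_def)
  qed
  ultimately have "(SUP K. \<integral>\<^sup>+k. ?f K k \<partial>measure_pmf p) = \<infinity>"
    using infinite_variance by simp
  then have "ennreal \<bar>M\<bar> < (SUP K. \<integral>\<^sup>+k. ?f K k \<partial>measure_pmf p)" by (simp only: ennreal_less_top infinity_ennreal_def)
  then obtain K where K: "ennreal \<bar>M\<bar> < (\<integral>\<^sup>+k. ?f K k \<partial>measure_pmf p)"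
    by (auto simp: less_SUP_iff)
  have "integrable (measure_pmf p) (\<lambda>k. indicator {- int K..int K} k * (real_of_int k)\<^sup>2)"
  proof (rule measure_pmf.integrable_const_bound[where B="(real K)\<^sup>2"])
    have "norm (indicator {- int K..int K} k * (real_of_int k)\<^sup>2) \<le> (real K)\<^sup>2" for k
    proof (cases "k \<in> {- int K..int K}")
      case True
      then have "\<bar>real_of_int k\<bar> \<le> \<bar>real K\<bar>" by auto
      then have "(real_of_int k)\<^sup>2 \<le> (real K)\<^sup>2" by (simp only: abs_le_square_iff)
      then show ?thesis by (simp add: indicator_def)
    qed simp
    then show "AE k in measure_pmf p. norm (indicator {- int K..int K} k * (real_of_int k)\<^sup>2) \<le> (real K)\<^sup>2" by simp
  qed simp
  then have "(\<integral>\<^sup>+k. ?f K k \<partial>measure_pmf p) = ennreal (\<integral>k. indicator {- int K..int K} k * (real_of_int k)\<^sup>2 \<partial>measure_pmf p)"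
    by (intro nn_integral_eq_integral) auto
  with K have "\<bar>M\<bar> < (\<integral>k. indicator {- int K..int K} k * (real_of_int k)\<^sup>2 \<partial>measure_pmf p)"
    by (simp add: ennreal_less_iff)
  then show thesis by (intro that[of K]) simp
qed

text \<open>Infinite variance: a truncated second moment exceeds \<open>4 M\<close>, and on the
  truncation range \<open>t <= d\<close> keeps \<open>|u| <= 1\<close> for \<open>u = t k\<close>,
  where \<open>1 - cos u\<close> and \<open>hub u\<close> are at least \<open>u^2/4\<close>.\<close>

lemma psi_Re_J_superquadratic:
  obtains d where "0 < d" "\<And>t. 0 < t \<Longrightarrow> t \<le> d \<Longrightarrow> M * t\<^sup>2 \<le> Re (psi p t) \<and> M * t\<^sup>2 \<le> J t"
proof -
  obtain K where K: "4 * M \<le> (\<integral>k. indicator {- int K..int K} k * (real_of_int k)\<^sup>2 \<partial>measure_pmf p)" (is "_ \<le> ?V")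
    using truncated_second_moment by blast
  define d where "d = 1 / (1 + real K)"
  have d: "0 < d" by (simp add: d_def)
  moreover have "M * t\<^sup>2 \<le> Re (psi p t) \<and> M * t\<^sup>2 \<le> J t" if t: "0 < t" "t \<le> d" for t
  proof -
    let ?g = "\<lambda>k. t\<^sup>2 / 4 * (indicator {- int K..int K} k * (real_of_int k)\<^sup>2)"
    have pt: "?g k \<le> 1 - cos (t * real_of_int k)" "?g k \<le> indicator UNIV k * hub (t * real_of_int k)" for k
    proof -
      have *: "?g k \<le> 1 - cos (t * real_of_int k) \<and> ?g k \<le> hub (t * real_of_int k)" if "k \<in> {- int K..int K}"
      proof -
        define u where "u = t * real_of_int k"
        have "\<bar>u\<bar> \<le> t * real K" using that t by (auto simp: u_def abs_mult)
        also have "\<dots> \<le> d * real K" using t by (intro mult_right_mono) auto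
        also have "\<dots> \<le> 1" by (simp add: d_def)
        finally have u: "\<bar>u\<bar> \<le> 1" .
        then have "u\<^sup>2 \<le> 1" by (simp add: abs_square_le_1)
        then have "u\<^sup>2 * u\<^sup>2 \<le> u\<^sup>2 * 1" by (intro mult_left_mono) auto
        moreover have "u\<^sup>2 * u\<^sup>2 = u ^ 4" by simp
        ultimately have 1: "u\<^sup>2 / 4 \<le> 1 - cos u" using one_minus_cos_ge[of u] zero_le_power2[of u] by linarith
        have "u\<^sup>2 / 4 \<le> u\<^sup>2 / (1 + \<bar>u\<bar>)" using u by (intro divide_left_mono) auto
        then have "u\<^sup>2 / 4 \<le> hub u" by (simp add: hub_def)
        with 1 show ?thesis using that by (simp add: u_def power_mult_distrib)
      qed
      show "?g k \<le> 1 - cos (t * real_of_int k)" "?g k \<le> indicator UNIV k * hub (t * real_of_int k)"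
        using * by (cases "k \<in> {- int K..int K}"; simp)+
    qed
    have g: "integrable (measure_pmf p) ?g"
      using trig_integrable[of p t]
      by (intro Bochner_Integration.integrable_bound[of _ "\<lambda>k. 1 - cos (t * real_of_int k)" ?g] AE_I2)
        (use pt(1) in \<open>auto simp: indicator_def abs_of_nonneg\<close>)
    have "t\<^sup>2 * M \<le> t\<^sup>2 * (?V / 4)" using K by (intro mult_left_mono) auto
    also have "\<dots> = (\<integral>k. ?g k \<partial>measure_pmf p)" by simp
    finally have le: "M * t\<^sup>2 \<le> (\<integral>k. ?g k \<partial>measure_pmf p)" by (simp add: mult.commute)
    have "(\<integral>k. ?g k \<partial>measure_pmf p) \<le> Re (psi p t)"
      unfolding psi_Re using g pt(1) trig_integrable by (intro integral_mono) auto
    moreover have "(\<integral>k. ?g k \<partial>measure_pmf p) \<le> J t"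
      unfolding kmean_def using g pt(2) by (intro integral_mono kmean_integrable int) auto
    ultimately show ?thesis using le by linarith
  qed
  ultimately show thesis by (rule that)
qed

lemma square_over_J_tendsto_0: "((\<lambda>t. t\<^sup>2 / J t) \<longlongrightarrow> 0) (at_right 0)"
proof (rule tendstoI)
  fix e :: real assume e: "0 < e"
  obtain d where d: "0 < d" "\<And>t. 0 < t \<Longrightarrow> t \<le> d \<Longrightarrow> (2 / e) * t\<^sup>2 \<le> Re (psi p t) \<and> (2 / e) * t\<^sup>2 \<le> J t"
    using psi_Re_J_superquadratic by blast
  have "eventually (\<lambda>t. t \<in> {0<..<d}) (at_right 0)" using d(1) by (rule eventually_at_right_real)
  then show "eventually (\<lambda>t. dist (t\<^sup>2 / J t) 0 < e) (at_right 0)"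
  proof eventually_elim
    case (elim t)
    then have "t\<^sup>2 * 2 \<le> e * J t" "0 < J t" using d(2)[of t] e J_pos[of t] by (auto simp: field_simps)
    moreover have "0 < t\<^sup>2" using elim by simp
    ultimately have "t\<^sup>2 < e * J t" by linarith
    then show ?case using \<open>0 < J t\<close> by (simp add: divide_less_eq)
  qed
qed

text \<open>Finiteness of the first moment, by dominated convergence. With the previous limit,
  \<open>J\<close> is negligible against \<open>t\<close> and dominates \<open>t^2\<close> near
  0.\<close>

lemma J_over_t_tendsto_0: "((\<lambda>t. J t / t) \<longlongrightarrow> 0) (at_right 0)"
proof -
  define F where "F = (\<lambda>t. \<integral>k. \<bar>real_of_int k\<bar> * (\<bar>t * real_of_int k\<bar> / (1 + \<bar>t * real_of_int k\<bar>)) \<partial>measure_pmf p)"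
  have "isCont F 0" unfolding continuous_within sequentially_imp_eventually_within
  proof (rule iffD2[OF tendsto_at_iff_sequentially], intro allI impI)
    fix X :: "nat \<Rightarrow> real" assume "\<forall>i. X i \<in> UNIV - {0}" and X: "X \<longlonglongrightarrow> 0"
    show "(F \<circ> X) \<longlonglongrightarrow> F 0" unfolding F_def o_def
    proof (rule integral_dominated_convergence[where w="\<lambda>k. \<bar>real_of_int k\<bar>"])
      show "integrable (measure_pmf p) (\<lambda>k. \<bar>real_of_int k\<bar>)" using int by auto
      have "1 + \<bar>u\<bar> \<noteq> 0" for u :: real by linarith
      then show "AE k in measure_pmf p. (\<lambda>i. \<bar>real_of_int k\<bar> * (\<bar>X i * real_of_int k\<bar> / (1 + \<bar>X i * real_of_int k\<bar>)))
          \<longlonglongrightarrow> \<bar>real_of_int k\<bar> * (\<bar>0 * real_of_int k\<bar> / (1 + \<bar>0 * real_of_int k\<bar>))"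
        by (intro AE_I2 tendsto_intros X)
      have "\<bar>u\<bar> / (1 + \<bar>u\<bar>) \<le> 1" for u :: real by (simp add: divide_le_eq)
      then have "\<bar>real_of_int k\<bar> * (\<bar>X i * real_of_int k\<bar> / (1 + \<bar>X i * real_of_int k\<bar>)) \<le> \<bar>real_of_int k\<bar> * 1" for i k
        by (intro mult_left_mono) auto
      then show "AE k in measure_pmf p. norm (\<bar>real_of_int k\<bar> * (\<bar>X i * real_of_int k\<bar> / (1 + \<bar>X i * real_of_int k\<bar>))) \<le> \<bar>real_of_int k\<bar>" for i
        by (intro AE_I2) (simp add: abs_of_nonneg)
    qed simp_all
  qed
  then have "(F \<longlongrightarrow> 0) (at 0)" by (simp add: isCont_def F_def)
  then have "(F \<longlongrightarrow> 0) (at_right 0)" by (rule tendsto_mono[OF at_le, rotated]) simp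
  moreover have "eventually (\<lambda>t. F t = J t / t) (at_right 0)"
  proof -
    have "F t = J t / t" if "0 < t" for t
    proof -
      have "J t / t = (\<integral>k. indicator UNIV k * hub (t * real_of_int k) / t \<partial>measure_pmf p)"
        unfolding kmean_def by simp
      also have "\<dots> = F t" unfolding F_def
        using that by (intro Bochner_Integration.integral_cong) (auto simp: hub_def abs_mult power2_eq_square)
      finally show ?thesis by simp
    qed
    then show ?thesis by (auto intro: eventually_at_rightI[of 0 1])
  qed
  ultimately show ?thesis by (rule Lim_transform_eventually)
qed

text \<open>In the expansion of \<open>|1 - psi|^2\<close> the square of the imaginary part is
  \<open>O(t^2)\<close> and is absorbed by \<open>Re psi\<close>, which eventually exceeds any
  multiple of \<open>t^2\<close>. The estimate later controls powers of the characteristic function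
  uniformly in the exponent.\<close>

lemma one_minus_norm_char_ge:
  obtains d where "0 < d" "\<And>t. 0 < t \<Longrightarrow> t \<le> d \<Longrightarrow> Re (psi p t) / 2 \<le> 1 - norm (1 - psi p t)"
proof -
  obtain d1 where d1: "0 < d1" "\<And>t. 0 < t \<Longrightarrow> t \<le> d1 \<Longrightarrow> (2 * mabs\<^sup>2) * t\<^sup>2 \<le> Re (psi p t) \<and> (2 * mabs\<^sup>2) * t\<^sup>2 \<le> J t"
    using psi_Re_J_superquadratic by blast
  have "mabs \<ge> 0" by simp
  \<comment> \<open>The second bound keeps \<open>|psi| <= t mabs <= 1/2\<close>, so that the square
    of \<open>Re psi\<close> is at most half of \<open>Re psi\<close>.\<close>
  define d where "d = min d1 (1 / (2 * (1 + mabs)))"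
  have "0 < 1 / (2 * (1 + mabs))" using \<open>mabs \<ge> 0\<close> by (intro divide_pos_pos mult_pos_pos add_pos_nonneg) auto
  then have "0 < d" using d1 by (simp add: d_def)
  moreover have "Re (psi p t) / 2 \<le> 1 - norm (1 - psi p t)" if t: "0 < t" "t \<le> d" for t
  proof -
    have n: "norm (psi p t) \<le> t * mabs" using psi_diff_le[of t 0] t by simp
    have Im2: "(Im (psi p t))\<^sup>2 \<le> (t * mabs)\<^sup>2"
      using abs_Im_le_cmod[of "psi p t"] n by (subst abs_le_square_iff[symmetric]) (use t in auto)
    have "t * mabs \<le> 1 / 2"
    proof -
      have "t * mabs \<le> (1 / (2 * (1 + mabs))) * (1 + mabs)"
        using t \<open>mabs \<ge> 0\<close> by (intro mult_mono) (auto simp: d_def)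
      also have "\<dots> = 1 / 2"
      proof -
        have "1 / (2 * (1 + x)) * (1 + x) = 1 / 2" if "0 \<le> x" for x :: real
          using that by (simp add: field_simps)
        then show ?thesis using \<open>mabs \<ge> 0\<close> by blast
      qed
      finally show ?thesis .
    qed
    then have Re1: "Re (psi p t) \<le> 1 / 2" using n complex_Re_le_cmod[of "psi p t"] by linarith
    have Re0: "0 \<le> Re (psi p t)" by (rule psi_Re_nonneg)
    have "(t * mabs)\<^sup>2 \<le> Re (psi p t) / 2" using d1(2)[of t] t by (simp add: d_def power_mult_distrib mult.commute)
    moreover have "Re (psi p t) * Re (psi p t) \<le> (1/2) * Re (psi p t)" using Re0 Re1 by (intro mult_right_mono) auto
    moreover have "(norm (1 - psi p t))\<^sup>2 = 1 - 2 * Re (psi p t) + Re (psi p t) * Re (psi p t) + (Im (psi p t))\<^sup>2"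
      unfolding cmod_power2 by (simp add: power2_eq_square algebra_simps)
    ultimately have "(norm (1 - psi p t))\<^sup>2 \<le> 1 - Re (psi p t)"
      using Im2 by linarith
    also have "\<dots> \<le> (1 - Re (psi p t) / 2)\<^sup>2" by (simp add: power2_eq_square algebra_simps)
    finally have "norm (1 - psi p t) \<le> 1 - Re (psi p t) / 2"
      by (rule power2_le_imp_le) (use Re1 in simp)
    then show ?thesis by simp
  qed
  ultimately show thesis by (rule that)
qed

end

text \<open>\<open>left_dominated\<close> is the hypothesis on \<open>m\<close>, read at
  \<open>x = 1/t\<close>. \<open>psi_nonzero\<close> reflects irreducibility: a zero in
  \<open>(0, pi]\<close> would confine the walk from 0 to a proper subgroup.\<close>

locale left_dominated_law = centered_law +
  assumes psi_nonzero: "\<And>t. 0 < t \<Longrightarrow> t \<le> pi \<Longrightarrow> psi p t \<noteq> 0"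
    and left_dominated: "((\<lambda>t. Jp t / J t) \<longlongrightarrow> 0) (at_right 0)"
begin

lemma Jp_le:
  assumes "0 < e" obtains d where "0 < d" "\<And>t. 0 < t \<Longrightarrow> t \<le> d \<Longrightarrow> Jp t \<le> e * J t"
proof -
  have "eventually (\<lambda>t. Jp t / J t < e) (at_right 0)"
    using left_dominated assms by (rule order_tendstoD)
  then obtain b where b: "0 < b" "\<And>t. 0 < t \<Longrightarrow> t < b \<Longrightarrow> Jp t / J t < e"
    by (auto simp: eventually_at_right_field)
  have "Jp t \<le> e * J t" if "0 < t" "t \<le> b / 2" for t
    using b(2)[of t] that b(1) J_pos[of t] by (simp add: divide_less_eq less_imp_le)
  then show thesis using b(1) by (intro that[of "b / 2"]) auto
qed

text \<open>In \<open>Re psi - Im psi\<close> every negative jump contributes at least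
  \<open>hub/10\<close> and every positive one at least \<open>-8 hub\<close>, which gives
  \<open>J/10 - 9 Jp\<close>. With \<open>Jp <= J/180\<close> this leaves \<open>J/20\<close>, and
  the difference is at most \<open>2 |psi|\<close>.\<close>

lemma norm_psi_ge:
  obtains d where "0 < d" "\<And>t. 0 < t \<Longrightarrow> t \<le> d \<Longrightarrow> J t / 40 \<le> norm (psi p t)"
proof -
  obtain d where d: "0 < d" "\<And>t. 0 < t \<Longrightarrow> t \<le> d \<Longrightarrow> Jp t \<le> (1/180) * J t"
    using Jp_le[of "1/180"] by auto
  have "J t / 40 \<le> norm (psi p t)" if t: "0 < t" "t \<le> d" for t
  proof -
    let ?L = "\<lambda>k. 1/10 * (indicator UNIV k * hub (t * real_of_int k)) - 9 * (indicator {0<..} k * hub (t * real_of_int k))"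
    let ?R = "\<lambda>k. (1 - cos (t * real_of_int k)) - (t * real_of_int k - sin (t * real_of_int k))"
    have I: "integrable (measure_pmf p) (\<lambda>k. indicator S k * hub (t * real_of_int k))" for S
      by (intro kmean_integrable int) auto
    have IR: "integrable (measure_pmf p) ?R" using trig_integrable sin_integrable by auto
    have "?L k \<le> ?R k" for k
    proof (cases "0 < k")
      case True
      have "t * real_of_int k - sin (t * real_of_int k) \<le> 8 * hub (t * real_of_int k)"
        using u_minus_sin_le_iota[of "t * real_of_int k"] iota_le_hub[of "t * real_of_int k"] by linarith
      moreover have "cos (t * real_of_int k) \<le> 1" "0 \<le> hub (t * real_of_int k)" by auto
      ultimately have "(1/10) * hub (t * real_of_int k) - 9 * hub (t * real_of_int k)
          \<le> (1 - cos (t * real_of_int k)) - (t * real_of_int k - sin (t * real_of_int k))" by linarith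
      then show ?thesis using True by simp
    next
      case False
      then have "0 \<le> - (t * real_of_int k)" using t by (simp add: mult_nonneg_nonpos)
      from hub_le_trig[OF this] show ?thesis using False by simp
    qed
    then have "(\<integral>k. ?L k \<partial>measure_pmf p) \<le> (\<integral>k. ?R k \<partial>measure_pmf p)"
      by (rule integral_mono[OF Bochner_Integration.integrable_diff[OF integrable_mult_right[OF I] integrable_mult_right[OF I]] IR])
    moreover have "(\<integral>k. ?L k \<partial>measure_pmf p) = 1/10 * J t - 9 * Jp t"
      unfolding kmean_def
      by (subst Bochner_Integration.integral_diff[OF integrable_mult_right[OF I] integrable_mult_right[OF I]])
        (simp only: integral_mult_right_zero)
    moreover have "(\<integral>k. ?R k \<partial>measure_pmf p) = Re (psi p t) - Im (psi p t)"
      unfolding psi_Re psi_Im using trig_integrable[of p t] sin_integrable[of t]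
      by (intro Bochner_Integration.integral_diff) auto
    ultimately have "J t / 10 - 9 * Jp t \<le> Re (psi p t) - Im (psi p t)" by simp
    moreover have "Re (psi p t) - Im (psi p t) \<le> 2 * norm (psi p t)"
      using abs_Re_le_cmod[of "psi p t"] abs_Im_le_cmod[of "psi p t"] by linarith
    ultimately show ?thesis using d(2)[OF t] by linarith
  qed
  then show thesis using d(1) by (intro that)
qed

text \<open>A crude bound on the whole interval: near 0 from \<open>J >= 40 t^2\<close>, elsewhere
  from the positive minimum of \<open>|psi|\<close> on a compact set.\<close>

lemma norm_psi_ge_square:
  obtains c where "0 < c" "\<And>t. 0 < t \<Longrightarrow> t \<le> pi \<Longrightarrow> c * t\<^sup>2 \<le> norm (psi p t)"
proof -
  obtain d0 where d0: "0 < d0" "\<And>t. 0 < t \<Longrightarrow> t \<le> d0 \<Longrightarrow> J t / 40 \<le> norm (psi p t)" using norm_psi_ge by blast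
  obtain d1 where d1: "0 < d1" "\<And>t. 0 < t \<Longrightarrow> t \<le> d1 \<Longrightarrow> 40 * t\<^sup>2 \<le> Re (psi p t) \<and> 40 * t\<^sup>2 \<le> J t"
    using psi_Re_J_superquadratic by blast
  define d where "d = Min {d0, d1, pi}"
  have d: "0 < d" "d \<le> d0" "d \<le> d1" "d \<le> pi" using d0 d1 by (auto simp: d_def)
  have "\<exists>x\<in>{d..pi}. \<forall>y\<in>{d..pi}. norm (psi p x) \<le> norm (psi p y)"
    using d by (intro continuous_attains_inf continuous_on_norm continuous_on_psi) auto
  then obtain x where x: "x \<in> {d..pi}" "\<And>y. y \<in> {d..pi} \<Longrightarrow> norm (psi p x) \<le> norm (psi p y)" by blast
  have xp: "0 < norm (psi p x)" using psi_nonzero[of x] x(1) d by auto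
  define c where "c = min 1 (norm (psi p x) / pi\<^sup>2)"
  have "c * t\<^sup>2 \<le> norm (psi p t)" if t: "0 < t" "t \<le> pi" for t
  proof (cases "t \<le> d")
    case True
    have "c * t\<^sup>2 \<le> 1 * t\<^sup>2" by (intro mult_right_mono) (auto simp: c_def)
    also have "\<dots> \<le> norm (psi p t)" using d0(2)[of t] d1(2)[of t] True t d by fastforce
    finally show ?thesis .
  next
    case False
    have "c * t\<^sup>2 \<le> norm (psi p x) / pi\<^sup>2 * pi\<^sup>2"
      using t xp by (intro mult_mono power_mono) (auto simp: c_def)
    also have "\<dots> \<le> norm (psi p t)" using x(2)[of t] False t by simp
    finally show ?thesis .
  qed
  then show thesis using xp by (intro that[of c]) (auto simp: c_def)
qed

end

section \<open>Fourier representation of the potential\<close>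

lemma set_integral_FTC_open:
  fixes F f :: "real \<Rightarrow> real"
  assumes ab: "a \<le> b" and D: "\<And>t. a \<le> t \<Longrightarrow> t \<le> b \<Longrightarrow> (F has_real_derivative f t) (at t)"
    and C: "continuous_on {a..b} f"
  shows "set_integrable lborel {a<..<b} f" "(LINT t:{a<..<b}|lborel. f t) = F b - F a"
proof -
  show "set_integrable lborel {a<..<b} f"
    by (rule set_integrable_subset[OF borel_integrable_atLeastAtMost'[OF C]]) auto
  have "(LBINT t=a..b. f t) = F b - F a"
    using ab D C by (intro interval_integral_FTC_finite)
      (auto simp: min_def max_def has_real_derivative_iff_has_vector_derivative[symmetric] intro: has_field_derivative_at_within)
  then show "(LINT t:{a<..<b}|lborel. f t) = F b - F a"
    using ab by (simp add: interval_lebesgue_integral_def)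
qed

text \<open>The integrands are real parts and even in \<open>t\<close>, so Fourier integrals over
  \<open>(-pi, pi)\<close> with factor \<open>1/(2 pi)\<close> become integrals over
  \<open>(0, pi)\<close> with factor \<open>1/pi\<close>. The open interval leaves out the zero of
  \<open>psi\<close> at 0.\<close>

abbreviation lpi :: "real measure" where "lpi \<equiv> restrict_space lborel {0<..<pi}"

lemma space_lpi [simp]: "space lpi = {0<..<pi}" by (simp add: space_restrict_space)

lemma lpi_integrable_iff:
  fixes f :: "real \<Rightarrow> 'b::{banach, second_countable_topology}"
  shows "integrable lpi f \<longleftrightarrow> set_integrable lborel {0<..<pi} f"
  by (simp add: integrable_restrict_space set_integrable_def)

lemma lpi_integral_eq:
  fixes f :: "real \<Rightarrow> 'b::{banach, second_countable_topology}"
  shows "integral\<^sup>L lpi f = (LINT t:{0<..<pi}|lborel. f t)"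
  by (simp add: integral_restrict_space set_lebesgue_integral_def)

lemma emeasure_lpi: "emeasure lpi (space lpi) = ennreal pi"
  by (simp add: emeasure_restrict_space)

interpretation lpi: finite_measure lpi
  by standard (simp add: emeasure_restrict_space)

lemma lpi_integral_const [simp]: "(\<integral>t. c \<partial>lpi) = pi * c" for c :: real
  using emeasure_lpi by (simp add: measure_def)

lemma measure_lpi [simp]: "measure lpi {0<..<pi} = pi"
  using emeasure_lpi by (simp add: measure_def)

lemma borel_measurable_lpi: "f \<in> borel_measurable borel \<Longrightarrow> f \<in> borel_measurable lpi"
  by (intro measurable_restrict_space1) simp

lemma lpi_FTC:
  fixes F f :: "real \<Rightarrow> real"
  assumes "\<And>t. 0 \<le> t \<Longrightarrow> t \<le> pi \<Longrightarrow> (F has_real_derivative f t) (at t)" "continuous_on {0..pi} f"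
  shows "integrable lpi f" "integral\<^sup>L lpi f = F pi - F 0"
  unfolding lpi_integrable_iff lpi_integral_eq
  by (rule set_integral_FTC_open[OF pi_ge_zero assms]; assumption)+

lemma lpi_integral_cos: "(\<integral>t. cos (real_of_int k * t) \<partial>lpi) = (if k = 0 then pi else 0)"
proof (cases "k = 0")
  case False
  have "(\<integral>t. cos (real_of_int k * t) \<partial>lpi) = sin (real_of_int k * pi) / real_of_int k - sin (real_of_int k * 0) / real_of_int k"
    using False by (intro lpi_FTC(2)[where F="\<lambda>t. sin (real_of_int k * t) / real_of_int k"])
      (auto intro!: derivative_eq_intros continuous_intros)
  moreover have "sin (real_of_int k * pi) = 0" by (simp add: sin_zero_iff_int2)
  ultimately show ?thesis using False by simp
qed simp

lemma cis_continuous [continuous_intros]: "continuous_on A f \<Longrightarrow> continuous_on A (\<lambda>t. cis (f t))"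
  unfolding cis_conv_exp by (intro continuous_intros)

lemma cis_measurable [measurable]: "cis \<in> borel_measurable borel"
  by (intro borel_measurable_continuous_onI continuous_intros)

section \<open>Fourier inversion and recurrence\<close>

context centered_law
begin

abbreviation "phi t \<equiv> 1 - psi p t"

lemma char_coeff_integrable: "integrable lpi (\<lambda>t. Re (phi t ^ n * cis (b * t)))"
proof (rule lpi.integrable_const_bound[where B=1])
  show "AE t in lpi. norm (Re (phi t ^ n * cis (b * t))) \<le> 1"
  proof (rule AE_I2)
    fix t
    have "\<bar>Re (phi t ^ n * cis (b * t))\<bar> \<le> norm (phi t ^ n * cis (b * t))" by (rule abs_Re_le_cmod)
    also have "\<dots> \<le> 1" using norm_one_minus_psi_le[of p t] by (simp add: norm_mult norm_power power_le_one)
    finally show "norm (Re (phi t ^ n * cis (b * t))) \<le> 1" by simp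
  qed
qed (auto intro!: borel_measurable_lpi)

text \<open>Inversion by induction on the first step and Fubini; the orthogonality of cosines enters
  at \<open>n = 0\<close>.\<close>

lemma pmf_step_pow_Fourier:
  "pmf (step_pow p n) x = (\<integral>t. Re (phi t ^ n * cis (- real_of_int x * t)) \<partial>lpi) / pi"
proof (induction n arbitrary: x)
  case 0
  have "(\<integral>t. Re (phi t ^ 0 * cis (- real_of_int x * t)) \<partial>lpi) = (\<integral>t. cos (real_of_int x * t) \<partial>lpi)"
    by (intro Bochner_Integration.integral_cong) auto
  then show ?case by (auto simp: lpi_integral_cos pmf_return)
next
  case (Suc n)
  interpret P: pair_sigma_finite "measure_pmf p" lpi
    by (intro pair_sigma_finite.intro lpi.sigma_finite_measure_axioms measure_pmf.sigma_finite_measure_axioms)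
  interpret Q: finite_measure "measure_pmf p \<Otimes>\<^sub>M lpi"
    by (intro finite_measure_pair_measure lpi.finite_measure_axioms measure_pmf.finite_measure_axioms)
  let ?f = "\<lambda>v t. Re (phi t ^ n * cis (- real_of_int (x - v) * t))"
  have bound: "\<bar>?f v t\<bar> \<le> 1" for v t
  proof -
    have "\<bar>?f v t\<bar> \<le> norm (phi t ^ n * cis (- real_of_int (x - v) * t))" by (rule abs_Re_le_cmod)
    also have "\<dots> \<le> 1" using norm_one_minus_psi_le[of p t] by (simp add: norm_mult norm_power power_le_one)
    finally show ?thesis .
  qed
  have "case_prod ?f \<in> borel_measurable (count_space UNIV \<Otimes>\<^sub>M lpi)"
    by (rule measurable_pair_measure_countable1) (auto intro!: borel_measurable_lpi)
  also have "borel_measurable (count_space UNIV \<Otimes>\<^sub>M lpi) = borel_measurable (measure_pmf p \<Otimes>\<^sub>M lpi)"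
    by (intro measurable_cong_sets sets_pair_measure_cong) auto
  finally have m: "case_prod ?f \<in> borel_measurable (measure_pmf p \<Otimes>\<^sub>M lpi)" .
  have I: "integrable (measure_pmf p \<Otimes>\<^sub>M lpi) (case_prod ?f)"
    by (rule Q.integrable_const_bound[where B=1]) (use bound m in auto)
  have inner: "(\<integral>v. ?f v t \<partial>measure_pmf p) = Re (phi t ^ Suc n * cis (- real_of_int x * t))" for t
  proof -
    have e: "?f v t = Re ((phi t ^ n * cis (- real_of_int x * t)) * cis (t * real_of_int v))" for v
    proof -
      have "cis (- real_of_int (x - v) * t) = cis (- real_of_int x * t) * cis (t * real_of_int v)"
        unfolding cis_mult by (simp add: algebra_simps)
      then show ?thesis by (simp only: mult.assoc)
    qed
    have "(\<integral>v. ?f v t \<partial>measure_pmf p) = Re (\<integral>v. (phi t ^ n * cis (- real_of_int x * t)) * cis (t * real_of_int v) \<partial>measure_pmf p)"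
      unfolding e by (intro integral_Re integrable_mult_right cis_integrable)
    also have "(\<integral>v. (phi t ^ n * cis (- real_of_int x * t)) * cis (t * real_of_int v) \<partial>measure_pmf p)
        = (phi t ^ n * cis (- real_of_int x * t)) * phi t"
      by (simp add: psi_eq)
    finally show ?thesis by (simp add: mult_ac)
  qed
  have "pmf (step_pow p (Suc n)) x = (\<integral>v. (\<integral>t. ?f v t \<partial>lpi) / pi \<partial>measure_pmf p)"
    unfolding step_pow_Suc_integral Suc.IH ..
  also have "\<dots> = (\<integral>v. \<integral>t. ?f v t \<partial>lpi \<partial>measure_pmf p) / pi" by simp
  also have "(\<integral>v. \<integral>t. ?f v t \<partial>lpi \<partial>measure_pmf p) = (\<integral>t. \<integral>v. ?f v t \<partial>measure_pmf p \<partial>lpi)"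
    using P.Fubini_integral[OF I] by simp
  also have "\<dots> = (\<integral>t. Re (phi t ^ Suc n * cis (- real_of_int x * t)) \<partial>lpi)"
    unfolding inner ..
  finally show ?case .
qed

text \<open>If \<open>|phi t| = 1\<close>, the values \<open>t k\<close> agree modulo
  \<open>2 pi\<close> on the support. Two distinct support points, which exist because the variance
  is infinite, then leave only countably many \<open>t\<close>. Periodic walks may have such
  \<open>t\<close>, hence the almost everywhere.\<close>

lemma AE_norm_char_less_1: "AE t in lpi. norm (phi t) < 1"
proof -
  obtain i j where ij: "i \<in> set_pmf p" "j \<in> set_pmf p" "i \<noteq> j"
  proof (rule ccontr)
    assume a: "\<not> thesis"
    obtain k where k: "k \<in> set_pmf p" using set_pmf_not_empty[of p] by blast
    have "AE l in measure_pmf p. ennreal ((real_of_int l)\<^sup>2) = ennreal ((real_of_int k)\<^sup>2)"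
      using a that k by (auto simp: AE_measure_pmf_iff)
    then have "(\<integral>\<^sup>+l. ennreal ((real_of_int l)\<^sup>2) \<partial>measure_pmf p) = (\<integral>\<^sup>+l. ennreal ((real_of_int k)\<^sup>2) \<partial>measure_pmf p)"
      by (rule nn_integral_cong_AE)
    then show False using infinite_variance by simp
  qed
  let ?B = "range (\<lambda>n::int. real_of_int n * 2 * pi / real_of_int (i - j))"
  have "norm (phi t) < 1" if t: "t \<notin> ?B" for t
  proof (rule ccontr)
    assume "\<not> norm (phi t) < 1"
    then have n1: "norm (phi t) = 1" using norm_one_minus_psi_le[of p t] by simp
    obtain \<theta> where th: "phi t = cis \<theta>"
      using n1 by (metis complex_norm_eq_1_exp cis_conv_exp)
    have e: "cis (t * real_of_int k) * cis (- \<theta>) = cis (t * real_of_int k - \<theta>)" for k by (simp add: cis_mult)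
    have "(\<integral>k. cis (t * real_of_int k - \<theta>) \<partial>measure_pmf p) = phi t * cis (- \<theta>)"
      unfolding e[symmetric] by (simp add: psi_eq)
    also have "\<dots> = 1" by (simp add: th cis_mult)
    finally have 1: "(\<integral>k. cis (t * real_of_int k - \<theta>) \<partial>measure_pmf p) = 1" .
    have I: "integrable (measure_pmf p) (\<lambda>k. cis (t * real_of_int k - \<theta>))"
      by (rule measure_pmf.integrable_const_bound[where B=1]) auto
    have Ic: "integrable (measure_pmf p) (\<lambda>k. 1 - cos (t * real_of_int k - \<theta>))"
      by (rule measure_pmf.integrable_const_bound[where B=2])
        (auto intro!: AE_I2 abs_leI simp: minus_le_iff le_diff_eq diff_le_eq, smt (verit) cos_ge_minus_one cos_le_one)
    have "(\<integral>k. cos (t * real_of_int k - \<theta>) \<partial>measure_pmf p) = 1"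
      using integral_Re[OF I] 1 by simp
    moreover have "integrable (measure_pmf p) (\<lambda>k. cos (t * real_of_int k - \<theta>))"
      using integrable_Re[OF I] by simp
    ultimately have "(\<integral>k. 1 - cos (t * real_of_int k - \<theta>) \<partial>measure_pmf p) = 0" by simp
    then have "AE k in measure_pmf p. 1 - cos (t * real_of_int k - \<theta>) = 0"
      using Ic by (subst (asm) integral_nonneg_eq_0_iff_AE) auto
    then have "cos (t * real_of_int i - \<theta>) = 1" "cos (t * real_of_int j - \<theta>) = 1"
      using ij by (auto simp: AE_measure_pmf_iff)
    then obtain a b :: int where "t * real_of_int i - \<theta> = real_of_int a * 2 * pi"
        "t * real_of_int j - \<theta> = real_of_int b * 2 * pi"
      unfolding cos_one_2pi_int by blast
    then have "t * real_of_int (i - j) = real_of_int (a - b) * 2 * pi" by (simp add: algebra_simps)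
    then have "t = real_of_int (a - b) * 2 * pi / real_of_int (i - j)"
      using ij(3) by (simp add: eq_divide_eq)
    then show False using t by blast
  qed
  moreover have "AE t in lborel. t \<notin> ?B"
    by (intro AE_not_in countable_imp_null_set_lborel) auto
  ultimately have "AE t in lborel. t \<in> {0<..<pi} \<longrightarrow> norm (phi t) < 1" by auto
  then show ?thesis by (subst AE_restrict_space_iff) auto
qed

lemma step_pow_tendsto_0: "(\<lambda>n. pmf (step_pow p n) x) \<longlonglongrightarrow> 0"
proof -
  have "(\<lambda>n. \<integral>t. Re (phi t ^ n * cis (- real_of_int x * t)) \<partial>lpi) \<longlonglongrightarrow> (\<integral>t. 0 \<partial>lpi)"
  proof (rule integral_dominated_convergence[where w="\<lambda>t. 1"])
    show "AE t in lpi. (\<lambda>n. Re (phi t ^ n * cis (- real_of_int x * t))) \<longlonglongrightarrow> 0"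
      using AE_norm_char_less_1
    proof eventually_elim
      case (elim t)
      have "(\<lambda>n. phi t ^ n * cis (- real_of_int x * t)) \<longlonglongrightarrow> 0 * cis (- real_of_int x * t)"
        using elim by (intro tendsto_mult LIMSEQ_power_zero tendsto_const)
      from tendsto_Re[OF this] show ?case by simp
    qed
    show "AE t in lpi. norm (Re (phi t ^ n * cis (- real_of_int x * t))) \<le> 1" for n
    proof (rule AE_I2)
      fix t
      have "\<bar>Re (phi t ^ n * cis (- real_of_int x * t))\<bar> \<le> norm (phi t ^ n * cis (- real_of_int x * t))" by (rule abs_Re_le_cmod)
      also have "\<dots> \<le> 1" using norm_one_minus_psi_le[of p t] by (simp add: norm_mult norm_power power_le_one)
      finally show "norm (Re (phi t ^ n * cis (- real_of_int x * t))) \<le> 1" by simp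
    qed
  qed (auto intro!: borel_measurable_lpi)
  then have "(\<lambda>n. (\<integral>t. Re (phi t ^ n * cis (- real_of_int x * t)) \<partial>lpi) / pi) \<longlonglongrightarrow> 0 / pi"
    by (intro tendsto_divide tendsto_const) auto
  then show ?thesis by (simp add: pmf_step_pow_Fourier)
qed

lemma green_Fourier:
  assumes s: "0 \<le> s" "s < 1"
  shows "green p s 0 = (\<integral>t. Re (1 / (1 - of_real s * phi t)) \<partial>lpi) / pi"
    and "integrable lpi (\<lambda>t. Re (1 / (1 - of_real s * phi t)))"
proof -
  have n: "norm (of_real s * phi t) \<le> s" for t
    using norm_one_minus_psi_le[of p t] s by (simp add: norm_mult mult_left_le)
  have d: "1 - s \<le> norm (1 - of_real s * phi t)" for t
    using norm_triangle_ineq2[of 1 "of_real s * phi t"] n[of t] by simp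
  have nz: "1 - of_real s * phi t \<noteq> 0" for t using d[of t] s by auto
  let ?g = "\<lambda>N t. Re ((1 - (of_real s * phi t) ^ N) / (1 - of_real s * phi t))"
  have sum: "(\<Sum>n<N. pmf (step_pow p n) 0 * s ^ n) = (\<integral>t. ?g N t \<partial>lpi) / pi" for N
  proof -
    have "(\<Sum>n<N. pmf (step_pow p n) 0 * s ^ n) = (\<Sum>n<N. (\<integral>t. Re (phi t ^ n * cis (0 * t)) * s ^ n \<partial>lpi)) / pi"
      by (simp add: pmf_step_pow_Fourier sum_divide_distrib)
    also have "(\<Sum>n<N. (\<integral>t. Re (phi t ^ n * cis (0 * t)) * s ^ n \<partial>lpi)) = (\<integral>t. (\<Sum>n<N. Re (phi t ^ n * cis (0 * t)) * s ^ n) \<partial>lpi)"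
      by (rule Bochner_Integration.integral_sum[symmetric]) (intro integrable_mult_left char_coeff_integrable)
    also have "\<dots> = (\<integral>t. ?g N t \<partial>lpi)"
    proof (rule Bochner_Integration.integral_cong[OF refl])
      fix t
      have "(\<Sum>n<N. Re (phi t ^ n * cis (0 * t)) * s ^ n) = Re (\<Sum>n<N. (of_real s * phi t) ^ n)"
        by (simp add: power_mult_distrib mult.commute flip: of_real_power)
      also have "(\<Sum>n<N. (of_real s * phi t) ^ n) = (1 - (of_real s * phi t) ^ N) / (1 - of_real s * phi t)"
        using nz[of t] by (subst sum_gp_strict) auto
      finally show "(\<Sum>n<N. Re (phi t ^ n * cis (0 * t)) * s ^ n) = ?g N t" .
    qed
    finally show ?thesis .
  qed
  have lim: "AE t in lpi. (\<lambda>N. ?g N t) \<longlonglongrightarrow> Re (1 / (1 - of_real s * phi t))"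
  proof (rule AE_I2)
    fix t
    have "(\<lambda>N. (1 - (of_real s * phi t) ^ N) / (1 - of_real s * phi t)) \<longlonglongrightarrow> (1 - 0) / (1 - of_real s * phi t)"
      using n[of t] s nz[of t] by (intro tendsto_intros LIMSEQ_power_zero) auto
    from tendsto_Re[OF this] show "(\<lambda>N. ?g N t) \<longlonglongrightarrow> Re (1 / (1 - of_real s * phi t))" by simp
  qed
  have bd: "AE t in lpi. norm (?g N t) \<le> 2 / (1 - s)" for N
  proof (rule AE_I2)
    fix t
    have "norm (?g N t) \<le> norm ((1 - (of_real s * phi t) ^ N) / (1 - of_real s * phi t))"
      unfolding real_norm_def by (rule abs_Re_le_cmod)
    also have "\<dots> \<le> 2 / (1 - s)" unfolding norm_divide
    proof (intro frac_le d)
      have "norm (1 - (of_real s * phi t) ^ N) \<le> 1 + norm (of_real s * phi t) ^ N"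
        using norm_triangle_ineq4[of 1 "(of_real s * phi t) ^ N"] by (simp add: norm_power)
      also have "norm (of_real s * phi t) ^ N \<le> 1" using n[of t] s by (intro power_le_one) auto
      finally show "norm (1 - (of_real s * phi t) ^ N) \<le> 2" by simp
    qed (use s in auto)
    finally show "norm (?g N t) \<le> 2 / (1 - s)" .
  qed
  have m: "?g N \<in> borel_measurable lpi" for N by (intro borel_measurable_lpi) measurable
  have m': "(\<lambda>t. Re (1 / (1 - of_real s * phi t))) \<in> borel_measurable lpi" by (intro borel_measurable_lpi) measurable
  have c: "integrable lpi (\<lambda>t. 2 / (1 - s))" by simp
  show "integrable lpi (\<lambda>t. Re (1 / (1 - of_real s * phi t)))"
    by (rule integrable_dominated_convergence[OF m' m c lim bd])
  have "(\<lambda>N. (\<integral>t. ?g N t \<partial>lpi) / pi) \<longlonglongrightarrow> (\<integral>t. Re (1 / (1 - of_real s * phi t)) \<partial>lpi) / pi"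
    by (intro tendsto_divide tendsto_const integral_dominated_convergence[OF m' m c lim bd]) auto
  moreover have "(\<lambda>N. \<Sum>n<N. pmf (step_pow p n) 0 * s ^ n) \<longlonglongrightarrow> green p s 0"
    unfolding green_def by (rule summable_LIMSEQ[OF summable_green[OF s]])
  ultimately show "green p s 0 = (\<integral>t. Re (1 / (1 - of_real s * phi t)) \<partial>lpi) / pi"
    unfolding sum using LIMSEQ_unique by blast
qed

text \<open>Recurrence in the manner of Chung and Fuchs. Since \<open>J/t\<close> tends to 0,
  \<open>|psi| <= e t\<close> near 0, and with \<open>r = 1 - s\<close> the integrand is at least
  \<open>r/(r + e t)^2\<close>, whose integral over \<open>(0, d)\<close> is
  \<open>d/(r + e d)\<close>. For \<open>r <= e d\<close> this is at least
  \<open>1/(2 e)\<close>.\<close>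

lemma green_ge:
  assumes e: "0 < e"
  obtains d where "0 < d" "\<And>s. 0 \<le> s \<Longrightarrow> s < 1 \<Longrightarrow> 1 - s \<le> d \<Longrightarrow> 1 / (2 * e * pi) \<le> green p s 0"
proof -
  \<comment> \<open>The 8 is the constant of \<open>norm_psi_le\<close>.\<close>
  have "eventually (\<lambda>t. J t / t < e / 8) (at_right 0)"
    using J_over_t_tendsto_0 e by (intro order_tendstoD) auto
  then obtain b where b: "0 < b" "\<And>t. 0 < t \<Longrightarrow> t < b \<Longrightarrow> J t / t < e / 8"
    by (auto simp: eventually_at_right_field)
  define d where "d = min b pi"
  have d: "0 < d" "d \<le> pi" using b(1) by (auto simp: d_def)
  have small: "norm (psi p t) \<le> e * t" if "0 < t" "t < d" for t
    using b(2)[of t] that norm_psi_le[of t] by (simp add: d_def divide_less_eq)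
  have "1 / (2 * e * pi) \<le> green p s 0" if s: "0 \<le> s" "s < 1" "1 - s \<le> e * d" for s
  proof -
    define r where "r = 1 - s"
    have r: "0 < r" "r \<le> e * d" using s by (auto simp: r_def)
    let ?F = "\<lambda>t. t / (r + e * t)" and ?f = "\<lambda>t. r / (r + e * t)\<^sup>2"
    have pos: "0 < r + e * t" if "0 \<le> t" for t using r e that by (intro add_pos_nonneg) auto
    have Fd: "(?F has_real_derivative ?f t) (at t)" if "0 \<le> t" for t
      using pos[OF that] by (auto intro!: derivative_eq_intros simp: power2_eq_square)
    have cf: "continuous_on {0..d} ?f" using pos by (intro continuous_intros) (auto, fastforce)
    have int: "set_integrable lborel {0<..<d} ?f" "(LINT t:{0<..<d}|lborel. ?f t) = ?F d - ?F 0"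
      by (rule set_integral_FTC_open; use d Fd cf in auto)+
    let ?h = "\<lambda>t. Re (1 / (1 - of_real s * phi t))"
    have hI: "set_integrable lborel {0<..<pi} ?h"
      using green_Fourier(2)[OF s(1,2)] unfolding lpi_integrable_iff .
    have zeq: "1 - of_real s * phi t = of_real r + of_real s * psi p t" for t
      by (simp add: r_def algebra_simps)
    have hform: "?h t = (r + s * Re (psi p t)) / (norm (of_real r + of_real s * psi p t))\<^sup>2" for t
      unfolding zeq by (simp add: Re_divide cmod_power2)
    have h0: "0 \<le> ?h t" for t
      unfolding hform using r s psi_Re_nonneg[of p t] by (intro divide_nonneg_nonneg add_nonneg_nonneg mult_nonneg_nonneg) auto
    have hge: "?f t \<le> ?h t" if t: "0 < t" "t < d" for t
      unfolding hform
    proof (rule frac_le)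
      show "r \<le> r + s * Re (psi p t)" using s psi_Re_nonneg[of p t] by simp
      have "norm (of_real r + of_real s * psi p t) \<le> r + s * norm (psi p t)"
        using norm_triangle_ineq[of "of_real r" "of_real s * psi p t"] r s by (simp add: norm_mult)
      also have "s * norm (psi p t) \<le> 1 * (e * t)" using s small[OF t] by (intro mult_mono) auto
      finally show "(norm (of_real r + of_real s * psi p t))\<^sup>2 \<le> (r + e * t)\<^sup>2" by (intro power_mono) auto
      have "Re (of_real r + of_real s * psi p t) > 0"
        using r s psi_Re_nonneg[of p t] by (auto intro!: add_pos_nonneg)
      then have "of_real r + of_real s * psi p t \<noteq> 0" by (metis less_irrefl zero_complex.sel(1))
      then show "0 < (norm (of_real r + of_real s * psi p t))\<^sup>2" by simp
    qed (use r s psi_Re_nonneg[of p t] in auto)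
    have "d / (r + e * d) = (LINT t:{0<..<d}|lborel. ?f t)" using int(2) by simp
    also have "\<dots> \<le> (LINT t:{0<..<d}|lborel. ?h t)"
      using hge d by (intro set_integral_mono int set_integrable_subset[OF hI]) auto
    also have "\<dots> \<le> (LINT t:{0<..<pi}|lborel. ?h t)"
    proof -
      have "set_integrable lborel {0<..<d} ?h" using d by (intro set_integrable_subset[OF hI]) auto
      then show ?thesis using hI h0 d unfolding set_lebesgue_integral_def set_integrable_def
        by (intro integral_mono) (auto simp: indicator_def)
    qed
    also have "\<dots> = pi * green p s 0"
      using green_Fourier(1)[OF s(1,2)] by (simp add: lpi_integral_eq)
    finally have 1: "d / (r + e * d) \<le> pi * green p s 0" .
    have "1 / (2 * e) = d / (2 * (e * d))" using d e by simp
    also have "\<dots> \<le> d / (r + e * d)" using r d e by (intro divide_left_mono) (auto intro!: mult_pos_pos add_pos_pos simp: mult.commute)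
    finally have "1 / (2 * e) \<le> pi * green p s 0" using 1 by linarith
    then have "1 / (2 * e) / pi \<le> pi * green p s 0 / pi" by (intro divide_right_mono) auto
    then show ?thesis by simp
  qed
  then show thesis using d e by (intro that[of "e * d"]) auto
qed

lemma green_at_top: "filterlim (\<lambda>s. green p s 0) at_top (at_left 1)"
  unfolding filterlim_at_top
proof
  fix Z :: real
  define e where "e = 1 / (2 * pi * (\<bar>Z\<bar> + 1))"
  have e: "0 < e" by (simp add: e_def add_nonneg_pos)
  obtain d where d: "0 < d" "\<And>s. 0 \<le> s \<Longrightarrow> s < 1 \<Longrightarrow> 1 - s \<le> d \<Longrightarrow> 1 / (2 * e * pi) \<le> green p s 0"
    using green_ge[OF e] by blast
  have "1 / (2 * e * pi) = \<bar>Z\<bar> + 1"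
    by (simp add: e_def)
  then have "Z \<le> 1 / (2 * e * pi)" by linarith
  then have "Z \<le> green p s 0" if "max 0 (1 - d) < s" "s < 1" for s
    using d(2)[of s] that by auto
  then show "eventually (\<lambda>s. Z \<le> green p s 0) (at_left 1)"
    unfolding eventually_at_left_field using d(1) by (intro exI[of _ "max 0 (1 - d)"]) auto
qed

end

text \<open>With the next lemma this bounds \<open>|Im (phi^n)| (1 - |phi|)\<close> by
  \<open>|Im psi|\<close>, uniformly in \<open>n\<close>.\<close>

lemma Im_power_le: "\<bar>Im (z ^ n)\<bar> \<le> real n * norm z ^ (n - 1) * \<bar>Im z\<bar>" for z :: complex
proof (induction n)
  case (Suc n)
  have "\<bar>Im (z ^ Suc n)\<bar> \<le> \<bar>Re z * Im (z ^ n)\<bar> + \<bar>Im z * Re (z ^ n)\<bar>"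
    using abs_triangle_ineq[of "Re z * Im (z ^ n)" "Im z * Re (z ^ n)"] by (simp add: add.commute)
  also have "\<dots> \<le> norm z * (real n * norm z ^ (n - 1) * \<bar>Im z\<bar>) + \<bar>Im z\<bar> * norm z ^ n"
    unfolding abs_mult using Suc.IH abs_Re_le_cmod[of z] abs_Re_le_cmod[of "z ^ n"]
    by (intro add_mono mult_mono) (auto simp: norm_power)
  also have "norm z * (real n * norm z ^ (n - 1) * \<bar>Im z\<bar>) = real n * norm z ^ n * \<bar>Im z\<bar>"
    by (cases n) auto
  finally show ?case by (simp add: algebra_simps)
qed simp

text \<open>\<open>n y^(n-1)\<close> is at most the geometric sum
  \<open>1 + y + ... + y^(n-1)\<close>, whose product with \<open>1 - y\<close> is
  \<open>1 - y^n\<close>.\<close>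

lemma nat_power_mult_le_1:
  fixes y :: real assumes "0 \<le> y" "y \<le> 1" shows "real n * y ^ (n - 1) * (1 - y) \<le> 1"
proof -
  have "real n * y ^ (n - 1) = (\<Sum>k<n. y ^ (n - 1))" by simp
  also have "\<dots> \<le> (\<Sum>k<n. y ^ k)" using assms by (intro sum_mono power_decreasing) auto
  finally have "real n * y ^ (n - 1) * (1 - y) \<le> (\<Sum>k<n. y ^ k) * (1 - y)"
    using assms by (intro mult_right_mono) auto
  also have "\<dots> = 1 - y ^ n" by (metis mult.commute one_diff_power_eq)
  also have "\<dots> \<le> 1" using assms by simp
  finally show ?thesis .
qed

section \<open>Convergence of the potential series\<close>

context left_dominated_law
begin

definition pot_integrand :: "int \<Rightarrow> real \<Rightarrow> real" where
  "pot_integrand x t = Re ((1 - cis (real_of_int x * t)) / psi p t)"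

definition pot :: "int \<Rightarrow> real" where
  "pot x = (\<integral>t. pot_integrand x t \<partial>lpi) / pi"

abbreviation partial_integrand :: "nat \<Rightarrow> int \<Rightarrow> real \<Rightarrow> real" where
  "partial_integrand N x t \<equiv> Re ((1 - cis (real_of_int x * t)) * ((1 - phi t ^ N) / psi p t))"

text \<open>The crude bound \<open>2/|psi|\<close>, multiplied by \<open>t\<close>, need not be
  integrable at 0. With \<open>Im psi\<close> kept in the numerator, the product with
  \<open>t\<close> is controlled by \<open>t i/J^2\<close>. The 4 collects 2 from
  \<open>Im (phi^N)\<close> and 2 from \<open>Re (1 - phi^N)\<close>.\<close>

lemma Im_geometric_le:
  assumes nz: "psi p t \<noteq> 0" and half: "Re (psi p t) / 2 \<le> 1 - norm (phi t)"
  shows "\<bar>Im ((1 - phi t ^ N) / psi p t)\<bar> \<le> 4 * \<bar>Im (psi p t)\<bar> / (norm (psi p t))\<^sup>2"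
proof -
  let ?z = "phi t ^ N" and ?n = "norm (phi t)"
  have n1: "?n \<le> 1" by (rule norm_one_minus_psi_le)
  have "\<bar>Im ?z\<bar> * Re (psi p t) \<le> (real N * ?n ^ (N - 1) * \<bar>Im (psi p t)\<bar>) * (2 * (1 - ?n))"
    using Im_power_le[of "phi t" N] half psi_Re_nonneg[of p t] by (intro mult_mono) auto
  also have "\<dots> = 2 * \<bar>Im (psi p t)\<bar> * (real N * ?n ^ (N - 1) * (1 - ?n))" by simp
  also have "\<dots> \<le> 2 * \<bar>Im (psi p t)\<bar> * 1" using n1 by (intro mult_left_mono nat_power_mult_le_1) auto
  finally have 1: "\<bar>Im ?z * Re (psi p t)\<bar> \<le> 2 * \<bar>Im (psi p t)\<bar>" using psi_Re_nonneg[of p t] by (simp add: abs_mult)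
  have "\<bar>Re ?z\<bar> \<le> 1" using abs_Re_le_cmod[of ?z] power_le_one[of ?n N] n1 by (simp add: norm_power)
  then have "\<bar>(1 - Re ?z) * Im (psi p t)\<bar> \<le> 2 * \<bar>Im (psi p t)\<bar>"
    unfolding abs_mult by (intro mult_right_mono) auto
  then have "\<bar>Im (1 - ?z) * Re (psi p t) - Re (1 - ?z) * Im (psi p t)\<bar> \<le> 4 * \<bar>Im (psi p t)\<bar>"
    using 1 by simp
  then show ?thesis unfolding Im_divide cmod_power2 abs_divide
    by (simp add: divide_right_mono)
qed

text \<open>A bound uniform in \<open>N\<close> whose integral is at most linear in
  \<open>|x|\<close> yields the convergence of the series and the linear bound on its partial sums
  at once. The cosine part is paired with \<open>Re w\<close>; the sine part, of size
  \<open>|x| t\<close>, with \<open>Im w\<close>.\<close>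

lemma partial_integrand_bound:
  obtains C G where "0 \<le> C" "integrable lpi G"
    "\<And>t. 0 \<le> G t"
    "\<And>N x t. 0 < t \<Longrightarrow> t < pi \<Longrightarrow>
      \<bar>partial_integrand N x t\<bar> \<le> C * ((real_of_int x)\<^sup>2 / (1 + \<bar>real_of_int x\<bar> * t)\<^sup>2) + \<bar>real_of_int x\<bar> * G t"
proof -
  obtain c where c: "0 < c" "\<And>t. 0 < t \<Longrightarrow> t \<le> pi \<Longrightarrow> c * t\<^sup>2 \<le> norm (psi p t)"
    using norm_psi_ge_square by blast
  obtain d0 where d0: "0 < d0" "\<And>t. 0 < t \<Longrightarrow> t \<le> d0 \<Longrightarrow> J t / 40 \<le> norm (psi p t)" using norm_psi_ge by blast
  obtain d1 where d1: "0 < d1" "\<And>t. 0 < t \<Longrightarrow> t \<le> d1 \<Longrightarrow> Re (psi p t) / 2 \<le> 1 - norm (phi t)"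
    using one_minus_norm_char_ge by blast
  define d where "d = Min {d0, d1, pi}"
  have d: "0 < d" "d \<le> d0" "d \<le> d1" "d \<le> pi" using d0 d1 by (auto simp: d_def)
  let ?i = "kmean p iota UNIV"
  have i0: "0 \<le> ?i t" for t by (intro kmean_nonneg int) auto
  \<comment> \<open>\<open>K\<close> covers \<open>t >= d\<close>, where the quadratic lower bound
    on \<open>|psi|\<close> suffices.\<close>
  define K where "K = 2 * pi / (c * d\<^sup>2)"
  \<comment> \<open>\<open>51200 = 4 * 8 * 40^2\<close>, from \<open>Im_geometric_le\<close>,
    \<open>psi_Im_le\<close> and the lower bound \<open>J/40\<close>.\<close>
  define G where "G = (\<lambda>t. 51200 * (indicator {0<..<d} t * (t * ?i t / (J t)\<^sup>2)) + K)"
  have K0: "0 \<le> K" using c d by (simp add: K_def)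
  have "set_integrable lborel {0<..<d} (\<lambda>t. t * ?i t / (J t)\<^sup>2)"
    using integral_i_over_J_square(1)[OF int d(1) J_pos square_over_J_tendsto_0, of UNIV 1] by auto
  then have "integrable lpi (\<lambda>t. indicator {0<..<d} t * (t * ?i t / (J t)\<^sup>2))"
    unfolding lpi_integrable_iff set_integrable_def
    by (rule Bochner_Integration.integrable_cong[THEN iffD1, rotated -1]) (use d in \<open>auto simp: indicator_def\<close>)
  then have GI: "integrable lpi G"
    unfolding G_def by (intro Bochner_Integration.integrable_add integrable_mult_right) auto
  have G0: "0 \<le> G t" for t
    using K0 i0[of t] unfolding G_def by (auto simp: indicator_def intro!: add_nonneg_nonneg)
  have bd: "\<bar>partial_integrand N x t\<bar> \<le> 16 / c * ((real_of_int x)\<^sup>2 / (1 + \<bar>real_of_int x\<bar> * t)\<^sup>2) + \<bar>real_of_int x\<bar> * G t"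
    if t: "0 < t" "t < pi" for N x t
  proof -
    define w where "w = (1 - phi t ^ N) / psi p t"
    define a where "a = real_of_int x * t"
    have nz: "psi p t \<noteq> 0" using psi_nonzero t by auto
    have n1: "norm (phi t) \<le> 1" by (rule norm_one_minus_psi_le)
    have ct: "0 < c * t\<^sup>2" using c t by simp
    have wn: "norm w \<le> 2 / (c * t\<^sup>2)" unfolding w_def norm_divide
    proof (rule frac_le)
      have "norm (1 - phi t ^ N) \<le> 1 + norm (phi t) ^ N"
        using norm_triangle_ineq4[of 1 "phi t ^ N"] by (simp add: norm_power)
      also have "norm (phi t) ^ N \<le> 1" using n1 by (intro power_le_one) auto
      finally show "norm (1 - phi t ^ N) \<le> 2" by simp
    qed (use c(2)[of t] t ct in auto)
    have Imw: "t * \<bar>Im w\<bar> \<le> G t"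
    proof (cases "t < d")
      case True
      have np: "0 < norm (psi p t)" using nz by simp
      have J: "0 < J t" "J t / 40 \<le> norm (psi p t)" using J_pos t d0(2)[of t] True d by auto
      have "\<bar>Im w\<bar> \<le> 4 * \<bar>Im (psi p t)\<bar> / (norm (psi p t))\<^sup>2"
        unfolding w_def using d1(2)[of t] True t d by (intro Im_geometric_le nz) auto
      also have "\<dots> \<le> 4 * (8 * ?i t) / (J t / 40)\<^sup>2"
        using psi_Im_le[of t] J by (intro frac_le power_mono mult_left_mono) auto
      also have "\<dots> = 51200 * (?i t / (J t)\<^sup>2)" by (simp add: power_divide)
      finally have "t * \<bar>Im w\<bar> \<le> t * (51200 * (?i t / (J t)\<^sup>2))" using t by (intro mult_left_mono) auto
      also have "\<dots> = 51200 * (t * ?i t / (J t)\<^sup>2)" by simp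
      also have "\<dots> \<le> G t" using K0 True t unfolding G_def by simp
      finally show ?thesis .
    next
      case False
      have "t * \<bar>Im w\<bar> \<le> pi * (2 / (c * t\<^sup>2))"
        using wn abs_Im_le_cmod[of w] t by (intro mult_mono) auto
      also have "\<dots> \<le> pi * (2 / (c * d\<^sup>2))"
        using False d c t by (intro mult_left_mono divide_left_mono power_mono mult_pos_pos) auto
      also have "\<dots> = K" by (simp add: K_def)
      also have "\<dots> \<le> G t" using False by (simp add: G_def)
      finally show ?thesis .
    qed
    have "partial_integrand N x t = (1 - cos a) * Re w + sin a * Im w"
      unfolding w_def[symmetric] a_def[symmetric] by simp
    then have "\<bar>partial_integrand N x t\<bar> \<le> \<bar>(1 - cos a) * Re w\<bar> + \<bar>sin a * Im w\<bar>"
      by (simp only: abs_triangle_ineq)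
    also have "\<bar>(1 - cos a) * Re w\<bar> \<le> (8 * rho a) * (2 / (c * t\<^sup>2))"
      unfolding abs_mult using one_minus_cos_le_rho[of a] abs_Re_le_cmod[of w] wn
      by (intro mult_mono) auto
    also have "(8 * rho a) * (2 / (c * t\<^sup>2)) = 16 / c * ((real_of_int x)\<^sup>2 / (1 + \<bar>real_of_int x\<bar> * t)\<^sup>2)"
      using t by (simp add: rho_def a_def power_mult_distrib abs_mult)
    also have "\<bar>sin a * Im w\<bar> \<le> \<bar>a\<bar> * \<bar>Im w\<bar>"
      unfolding abs_mult using abs_sin_x_le_abs_x[of a] by (intro mult_right_mono) auto
    also have "\<dots> = \<bar>real_of_int x\<bar> * (t * \<bar>Im w\<bar>)" using t by (simp add: a_def abs_mult)
    also have "\<dots> \<le> \<bar>real_of_int x\<bar> * G t" using Imw by (intro mult_left_mono) auto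
    finally show ?thesis by simp
  qed
  show thesis by (rule that[of "16 / c" G]) (use c GI G0 bd in auto)
qed

lemma inverse_square_integral:
  "integrable lpi (\<lambda>t. x\<^sup>2 / (1 + \<bar>x\<bar> * t)\<^sup>2)" "(\<integral>t. x\<^sup>2 / (1 + \<bar>x\<bar> * t)\<^sup>2 \<partial>lpi) \<le> \<bar>x\<bar>"
proof -
  have pos: "0 < 1 + \<bar>x\<bar> * t" if "0 \<le> t" for t using that by (intro add_pos_nonneg) auto
  have D: "((\<lambda>t. - \<bar>x\<bar> / (1 + \<bar>x\<bar> * t)) has_real_derivative x\<^sup>2 / (1 + \<bar>x\<bar> * t)\<^sup>2) (at t)" if "0 \<le> t" for t
    using pos[OF that] by (auto intro!: derivative_eq_intros simp: power2_eq_square)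
  have C: "continuous_on {0..pi} (\<lambda>t. x\<^sup>2 / (1 + \<bar>x\<bar> * t)\<^sup>2)"
    using pos by (intro continuous_intros) (auto, fastforce)
  show "integrable lpi (\<lambda>t. x\<^sup>2 / (1 + \<bar>x\<bar> * t)\<^sup>2)" by (rule lpi_FTC(1)[OF D C])
  have "(\<integral>t. x\<^sup>2 / (1 + \<bar>x\<bar> * t)\<^sup>2 \<partial>lpi) = - \<bar>x\<bar> / (1 + \<bar>x\<bar> * pi) - (- \<bar>x\<bar> / (1 + \<bar>x\<bar> * 0))"
    by (rule lpi_FTC(2)[OF D C])
  then show "(\<integral>t. x\<^sup>2 / (1 + \<bar>x\<bar> * t)\<^sup>2 \<partial>lpi) \<le> \<bar>x\<bar>" using pos[of pi] by simp
qed

lemma partial_integrand_measurable: "partial_integrand N x \<in> borel_measurable lpi"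
  by (intro borel_measurable_lpi) measurable

lemma pot_integrand_measurable: "pot_integrand x \<in> borel_measurable lpi"
  unfolding pot_integrand_def by (intro borel_measurable_lpi) measurable

lemma partial_sum_Fourier:
  "(\<Sum>n<N. pmf (step_pow p n) 0 - pmf (step_pow p n) (- x)) = (\<integral>t. partial_integrand N x t \<partial>lpi) / pi"
proof -
  let ?c = "\<lambda>n t. Re (phi t ^ n * cis (0 * t)) - Re (phi t ^ n * cis (real_of_int x * t))"
  have "(\<Sum>n<N. pmf (step_pow p n) 0 - pmf (step_pow p n) (- x)) = (\<Sum>n<N. (\<integral>t. ?c n t \<partial>lpi)) / pi"
    using char_coeff_integrable[of _ 0] char_coeff_integrable[of _ "real_of_int x"]
    by (simp add: pmf_step_pow_Fourier sum_divide_distrib diff_divide_distrib)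
  also have "(\<Sum>n<N. (\<integral>t. ?c n t \<partial>lpi)) = (\<integral>t. (\<Sum>n<N. ?c n t) \<partial>lpi)"
    by (rule Bochner_Integration.integral_sum[symmetric]) (intro Bochner_Integration.integrable_diff char_coeff_integrable)
  also have "\<dots> = (\<integral>t. partial_integrand N x t \<partial>lpi)"
  proof (rule Bochner_Integration.integral_cong[OF refl])
    fix t assume "t \<in> space lpi"
    then have nz: "psi p t \<noteq> 0" using psi_nonzero by auto
    have "(\<Sum>n<N. ?c n t) = Re ((1 - cis (real_of_int x * t)) * (\<Sum>n<N. phi t ^ n))"
    proof -
      have "(1 - cis (real_of_int x * t)) * (\<Sum>n<N. phi t ^ n)
          = (\<Sum>n<N. phi t ^ n * cis (0 * t) - phi t ^ n * cis (real_of_int x * t))"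
        unfolding sum_distrib_left by (intro sum.cong) (auto simp: algebra_simps)
      then show ?thesis by (simp only: Re_sum minus_complex.sel)
    qed
    also have "(\<Sum>n<N. phi t ^ n) = (1 - phi t ^ N) / psi p t"
      using nz by (subst sum_gp_strict) auto
    finally show "(\<Sum>n<N. ?c n t) = partial_integrand N x t" .
  qed
  finally show ?thesis .
qed

lemma pot_integrable: "integrable lpi (pot_integrand x)"
  and pot_sums: "(\<lambda>n. pmf (step_pow p n) 0 - pmf (step_pow p n) (- x)) sums pot x"
  and pot_partial_sum_bound: "\<exists>C. \<forall>N x. \<bar>\<Sum>n<N. pmf (step_pow p n) 0 - pmf (step_pow p n) (- x)\<bar> \<le> C * \<bar>real_of_int x\<bar>"
proof -
  obtain C G where CG: "0 \<le> C" "integrable lpi G" "\<And>t. 0 \<le> G t"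
    "\<And>N x t. 0 < t \<Longrightarrow> t < pi \<Longrightarrow>
      \<bar>partial_integrand N x t\<bar> \<le> C * ((real_of_int x)\<^sup>2 / (1 + \<bar>real_of_int x\<bar> * t)\<^sup>2) + \<bar>real_of_int x\<bar> * G t"
    using partial_integrand_bound by blast
  let ?W = "\<lambda>x t. C * ((real_of_int x)\<^sup>2 / (1 + \<bar>real_of_int x\<bar> * t)\<^sup>2) + \<bar>real_of_int x\<bar> * G t"
  have W: "integrable lpi (?W x)" for x
    by (intro Bochner_Integration.integrable_add integrable_mult_right inverse_square_integral CG)
  have bd: "AE t in lpi. norm (partial_integrand N x t) \<le> ?W x t" for N x
    using CG(4) by (intro AE_I2) auto
  have lim: "AE t in lpi. (\<lambda>N. partial_integrand N x t) \<longlonglongrightarrow> pot_integrand x t" for x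
    using AE_norm_char_less_1 AE_space
  proof eventually_elim
    case (elim t)
    then have nz: "psi p t \<noteq> 0" using psi_nonzero by auto
    have "(\<lambda>N. (1 - cis (real_of_int x * t)) * ((1 - phi t ^ N) / psi p t)) \<longlonglongrightarrow>
        (1 - cis (real_of_int x * t)) * ((1 - 0) / psi p t)"
      using elim nz by (intro tendsto_intros LIMSEQ_power_zero) auto
    from tendsto_Re[OF this] show ?case by (simp add: pot_integrand_def)
  qed
  note m = pot_integrand_measurable partial_integrand_measurable
  show "integrable lpi (pot_integrand x)"
    by (rule integrable_dominated_convergence[OF m W lim bd])
  have "(\<lambda>N. (\<integral>t. partial_integrand N x t \<partial>lpi) / pi) \<longlonglongrightarrow> (\<integral>t. pot_integrand x t \<partial>lpi) / pi"
    by (intro tendsto_divide tendsto_const integral_dominated_convergence[OF m W lim bd]) auto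
  then show "(\<lambda>n. pmf (step_pow p n) 0 - pmf (step_pow p n) (- x)) sums pot x"
    unfolding sums_def pot_def partial_sum_Fourier .
  have "\<bar>\<Sum>n<N. pmf (step_pow p n) 0 - pmf (step_pow p n) (- x)\<bar> \<le> ((C + integral\<^sup>L lpi G) / pi) * \<bar>real_of_int x\<bar>" for N x
  proof -
    have I: "integrable lpi (partial_integrand N x)"
      by (rule Bochner_Integration.integrable_bound[OF W m(2)]) (use CG in \<open>auto intro!: AE_I2 simp: abs_of_nonneg\<close>)
    have "\<bar>\<integral>t. partial_integrand N x t \<partial>lpi\<bar> \<le> (\<integral>t. \<bar>partial_integrand N x t\<bar> \<partial>lpi)" by (rule integral_abs_bound)
    also have "\<dots> \<le> (\<integral>t. ?W x t \<partial>lpi)"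
      using CG(4) by (intro integral_mono W integrable_abs I) auto
    also have "\<dots> = C * (\<integral>t. (real_of_int x)\<^sup>2 / (1 + \<bar>real_of_int x\<bar> * t)\<^sup>2 \<partial>lpi) + \<bar>real_of_int x\<bar> * integral\<^sup>L lpi G"
      by (subst Bochner_Integration.integral_add[OF integrable_mult_right[OF inverse_square_integral(1)] integrable_mult_right[OF CG(2)]])
        (simp only: integral_mult_right_zero)
    also have "\<dots> \<le> C * \<bar>real_of_int x\<bar> + \<bar>real_of_int x\<bar> * integral\<^sup>L lpi G"
      using CG(1) by (intro add_mono mult_left_mono inverse_square_integral) auto
    finally show ?thesis unfolding partial_sum_Fourier abs_divide by (simp add: divide_right_mono algebra_simps)
  qed
  then show "\<exists>C. \<forall>N x. \<bar>\<Sum>n<N. pmf (step_pow p n) 0 - pmf (step_pow p n) (- x)\<bar> \<le> C * \<bar>real_of_int x\<bar>" by blast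
qed

end

sublocale left_dominated_law \<subseteq> recurrent_potential p pot
  by standard (fact pot_sums pot_partial_sum_bound green_at_top step_pow_tendsto_0 int)+

context left_dominated_law
begin

text \<open>The sine terms cancel and leave a nonnegative integrand that involves
  \<open>Re (1 / psi)\<close> only.\<close>

lemma pot_sym_sum:
  "pot x + pot (- x) = (\<integral>t. 2 * (1 - cos (real_of_int x * t)) * Re (1 / psi p t) \<partial>lpi) / pi"
proof -
  have "pot x + pot (- x) = (\<integral>t. pot_integrand x t + pot_integrand (- x) t \<partial>lpi) / pi"
    unfolding pot_def using pot_integrable by (simp add: add_divide_distrib)
  also have "(\<integral>t. pot_integrand x t + pot_integrand (- x) t \<partial>lpi)
      = (\<integral>t. 2 * (1 - cos (real_of_int x * t)) * Re (1 / psi p t) \<partial>lpi)"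
  proof (rule Bochner_Integration.integral_cong[OF refl])
    fix t
    have "pot_integrand x t + pot_integrand (- x) t
        = Re (((1 - cis (real_of_int x * t)) + (1 - cis (- (real_of_int x * t)))) * (1 / psi p t))"
      by (simp only: pot_integrand_def distrib_right plus_complex.sel divide_inverse mult_1_left mult_minus_left of_int_minus)
    also have "(1 - cis (real_of_int x * t)) + (1 - cis (- (real_of_int x * t))) = of_real (2 * (1 - cos (real_of_int x * t)))"
      by (simp add: complex_eq_iff)
    also have "Re (of_real (2 * (1 - cos (real_of_int x * t))) * (1 / psi p t)) = 2 * (1 - cos (real_of_int x * t)) * Re (1 / psi p t)"
      by (subst Re_complex_of_real[symmetric, of "Re _"]) (simp only: Re_complex_of_real times_complex.sel Im_complex_of_real mult_zero_left diff_0_right)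
    finally show "pot_integrand x t + pot_integrand (- x) t = 2 * (1 - cos (real_of_int x * t)) * Re (1 / psi p t)" .
  qed
  finally show ?thesis .
qed

text \<open>Near 0 infinite variance gives \<open>|psi| >= (16/e) t^2\<close>, so the integrand is
  at most \<open>e\<close> times a kernel with integral at most \<open>|x|\<close>; away from 0 it
  is bounded. The 16 is twice the 8 of \<open>one_minus_cos_le_rho\<close>. Sublinearity later
  forces the comparison potential to vanish on one side.\<close>

lemma pot_sublinear:
  assumes e: "0 < e"
  obtains C where "\<And>x. pot x + pot (- x) \<le> C + e * \<bar>real_of_int x\<bar>"
proof -
  obtain c where c: "0 < c" "\<And>t. 0 < t \<Longrightarrow> t \<le> pi \<Longrightarrow> c * t\<^sup>2 \<le> norm (psi p t)"
    using norm_psi_ge_square by blast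
  obtain d where d: "0 < d" "\<And>t. 0 < t \<Longrightarrow> t \<le> d \<Longrightarrow> (16 / e) * t\<^sup>2 \<le> Re (psi p t) \<and> (16 / e) * t\<^sup>2 \<le> J t"
    using psi_Re_J_superquadratic by blast
  have bd: "2 * (1 - cos (real_of_int x * t)) * Re (1 / psi p t) \<le> e * ((real_of_int x)\<^sup>2 / (1 + \<bar>real_of_int x\<bar> * t)\<^sup>2) + 4 / (c * d\<^sup>2)"
    if t: "0 < t" "t < pi" for t x
  proof -
    have cc: "0 \<le> 1 - cos (real_of_int x * t)" "1 - cos (real_of_int x * t) \<le> 2" by auto
    have Rn: "Re (1 / psi p t) \<le> 1 / norm (psi p t)" using complex_Re_le_cmod[of "1 / psi p t"] by (simp add: norm_divide)
    have np: "0 < norm (psi p t)" using psi_nonzero[of t] t by simp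
    have q0: "0 \<le> e * ((real_of_int x)\<^sup>2 / (1 + \<bar>real_of_int x\<bar> * t)\<^sup>2)" using e by simp
    show ?thesis
    proof (cases "t \<le> d")
      case True
      have le: "(16 / e) * t\<^sup>2 \<le> norm (psi p t)"
        using d(2)[of t] True t complex_Re_le_cmod[of "psi p t"] by linarith
      have "2 * (1 - cos (real_of_int x * t)) * Re (1 / psi p t) \<le> 2 * (8 * rho (real_of_int x * t)) * (1 / ((16 / e) * t\<^sup>2))"
      proof (rule order_trans[OF mult_left_mono[OF Rn]])
        have "1 / norm (psi p t) \<le> 1 / ((16 / e) * t\<^sup>2)" using le t e np by (intro divide_left_mono mult_pos_pos np) auto
        then show "2 * (1 - cos (real_of_int x * t)) * (1 / norm (psi p t)) \<le> 2 * (8 * rho (real_of_int x * t)) * (1 / ((16 / e) * t\<^sup>2))"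
          using one_minus_cos_le_rho[of "real_of_int x * t"] cc by (intro mult_mono) auto
      qed (use cc in auto)
      also have "\<dots> = e * ((real_of_int x)\<^sup>2 / (1 + \<bar>real_of_int x\<bar> * t)\<^sup>2)"
        using t e by (simp add: rho_def power_mult_distrib abs_mult)
      finally show ?thesis using c d by (simp add: add_increasing2)
    next
      case False
      have "c * d\<^sup>2 \<le> norm (psi p t)"
      proof (rule order_trans[OF _ c(2)])
        show "c * d\<^sup>2 \<le> c * t\<^sup>2" using c d False by (intro mult_left_mono power_mono) auto
      qed (use t in auto)
      then have "1 / norm (psi p t) \<le> 1 / (c * d\<^sup>2)" using c d np by (intro divide_left_mono mult_pos_pos) auto
      then have "2 * (1 - cos (real_of_int x * t)) * Re (1 / psi p t) \<le> (2 * 2) * (1 / (c * d\<^sup>2))"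
        using cc Rn np by (intro order_trans[OF mult_left_mono[OF Rn]] mult_mono) auto
      then show ?thesis using q0 by simp
    qed
  qed
  have "pot x + pot (- x) \<le> 4 / (c * d\<^sup>2) + e * \<bar>real_of_int x\<bar>" for x
  proof -
    let ?f = "\<lambda>t. 2 * (1 - cos (real_of_int x * t)) * Re (1 / psi p t)"
    let ?W = "\<lambda>t. e * ((real_of_int x)\<^sup>2 / (1 + \<bar>real_of_int x\<bar> * t)\<^sup>2) + 4 / (c * d\<^sup>2)"
    have W: "integrable lpi ?W"
      by (intro Bochner_Integration.integrable_add integrable_mult_right inverse_square_integral) auto
    have f0: "0 \<le> ?f t" for t using psi_Re_nonneg[of p t] by (simp add: Re_divide)
    have "?f \<in> borel_measurable lpi" by (intro borel_measurable_lpi) measurable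
    then have fI: "integrable lpi ?f"
      by (rule Bochner_Integration.integrable_bound[OF W])
        (use bd f0 in \<open>auto intro!: AE_I2 simp del: norm_of_real\<close>, smt (verit))
    have "(\<integral>t. ?f t \<partial>lpi) \<le> (\<integral>t. ?W t \<partial>lpi)"
      using bd by (intro integral_mono fI W) auto
    also have "\<dots> = e * (\<integral>t. (real_of_int x)\<^sup>2 / (1 + \<bar>real_of_int x\<bar> * t)\<^sup>2 \<partial>lpi) + pi * (4 / (c * d\<^sup>2))"
      by (subst Bochner_Integration.integral_add[OF integrable_mult_right[OF inverse_square_integral(1)]])
        (simp_all only: integral_mult_right_zero lpi_integral_const lpi.integrable_const)
    also have "\<dots> \<le> e * \<bar>real_of_int x\<bar> + pi * (4 / (c * d\<^sup>2))"
      using e by (intro add_mono mult_left_mono inverse_square_integral) auto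
    also have "\<dots> \<le> e * (\<bar>real_of_int x\<bar> * pi) + pi * (4 / (c * d\<^sup>2))"
    proof -
      have "\<bar>real_of_int x\<bar> * 1 \<le> \<bar>real_of_int x\<bar> * pi" using pi_gt3 by (intro mult_left_mono) auto
      then show ?thesis using e by simp
    qed
    also have "\<dots> = pi * (4 / (c * d\<^sup>2) + e * \<bar>real_of_int x\<bar>)" by (simp add: algebra_simps)
    finally show ?thesis unfolding pot_sym_sum by (simp add: divide_le_eq mult.commute)
  qed
  then show thesis by (rule that)
qed

section \<open>The skip-free comparison walk\<close>

definition up_mean :: real where "up_mean = (\<integral>k. indicator {0<..} k * real_of_int k \<partial>measure_pmf p)"

text \<open>Mass of the modified jumps before normalisation. The atom at 0 is dropped; it
  contributes nothing to \<open>psi\<close>.\<close>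

definition norm_const :: real where "norm_const = measure (measure_pmf p) {..<0} + up_mean"

lemma half_integrable: "integrable (measure_pmf p) (\<lambda>k. indicator S k * real_of_int k)"
  by (rule integrable_dominated_abs[OF int, where A=0 and B=1]) (auto simp: indicator_def)

lemma down_mean: "(\<integral>k. indicator {..<0} k * real_of_int k \<partial>measure_pmf p) = - up_mean"
proof -
  have "(\<integral>k. real_of_int k \<partial>measure_pmf p) = (\<integral>k. indicator {..<0} k * real_of_int k + indicator {0<..} k * real_of_int k \<partial>measure_pmf p)"
    by (intro Bochner_Integration.integral_cong) (auto simp: indicator_def)
  also have "\<dots> = (\<integral>k. indicator {..<0} k * real_of_int k \<partial>measure_pmf p) + up_mean"
    unfolding up_mean_def by (intro Bochner_Integration.integral_add half_integrable)
  finally show ?thesis using mean_0 by simp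
qed

text \<open>If the upward mean vanished, so would the downward one, and the step would be 0 almost
  surely.\<close>

lemma up_mean_pos: "0 < up_mean"
proof (rule ccontr)
  assume "\<not> 0 < up_mean"
  moreover have "0 \<le> up_mean" unfolding up_mean_def by (intro Bochner_Integration.integral_nonneg) (auto simp: indicator_def)
  ultimately have z: "up_mean = 0" by simp
  have "AE k in measure_pmf p. indicator {0<..} k * real_of_int k = 0"
  proof -
    have "AE k in measure_pmf p. 0 \<le> indicator {0<..} k * real_of_int k"
      by (auto simp: indicator_def)
    then show ?thesis
      using z half_integrable[of "{0<..}"] integral_nonneg_eq_0_iff_AE unfolding up_mean_def by blast
  qed
  moreover have "AE k in measure_pmf p. - (indicator {..<0} k * real_of_int k) = 0"
  proof -
    have "(\<integral>k. - (indicator {..<0} k * real_of_int k) \<partial>measure_pmf p) = 0"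
      using down_mean z by simp
    moreover have "integrable (measure_pmf p) (\<lambda>k. - (indicator {..<0} k * real_of_int k))"
      using half_integrable by (intro integrable_minus)
    ultimately show ?thesis by (subst (asm) integral_nonneg_eq_0_iff_AE) (auto simp: indicator_def)
  qed
  ultimately have "AE k in measure_pmf p. ennreal ((real_of_int k)\<^sup>2) = 0"
    by eventually_elim (auto simp: indicator_def split: if_splits)
  then have "(\<integral>\<^sup>+k. ennreal ((real_of_int k)\<^sup>2) \<partial>measure_pmf p) = 0"
    by (subst nn_integral_0_iff_AE) auto
  then show False using infinite_variance by simp
qed

lemma norm_const_pos: "0 < norm_const"
  unfolding norm_const_def using up_mean_pos by (intro add_nonneg_pos) auto

text \<open>
  The positive jumps are replaced by unit jumps carrying the same mean, which keeps the law
  centered after normalisation.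
\<close>

definition comparison_weight :: "int \<Rightarrow> real" where
  "comparison_weight k = (indicator {..<0} k * pmf p k + up_mean * indicator {1} k) / norm_const"

definition comparison :: "int pmf" where
  "comparison = embed_pmf comparison_weight"

lemma comparison_weight_nonneg: "0 \<le> comparison_weight k"
  unfolding comparison_weight_def using up_mean_pos norm_const_pos
  by (intro divide_nonneg_nonneg add_nonneg_nonneg mult_nonneg_nonneg) auto

lemma pmf_comparison: "pmf comparison k = comparison_weight k"
  unfolding comparison_def
proof (rule pmf_embed_pmf[OF comparison_weight_nonneg])
  have "(\<integral>\<^sup>+k. ennreal (comparison_weight k) \<partial>count_space UNIV)
    = (\<integral>\<^sup>+k. ennreal (1 / norm_const) * (ennreal (pmf p k) * indicator {..<0} k + ennreal up_mean * indicator {1} k) \<partial>count_space UNIV)"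
    using up_mean_pos norm_const_pos
    by (intro nn_integral_cong) (auto simp: comparison_weight_def indicator_def ennreal_mult[symmetric])
  also have "\<dots> = ennreal (1 / norm_const) * ((\<integral>\<^sup>+k. ennreal (pmf p k) * indicator {..<0} k \<partial>count_space UNIV) + ennreal up_mean)"
    by (subst nn_integral_cmult) (auto simp: nn_integral_add nn_integral_cmult)
  also have "(\<integral>\<^sup>+k. ennreal (pmf p k) * indicator {..<0} k \<partial>count_space UNIV) = emeasure (measure_pmf p) {..<0}"
    by (simp add: nn_integral_count_space_indicator[symmetric] nn_integral_pmf)
  also have "\<dots> = ennreal (measure (measure_pmf p) {..<0})"
    by (simp add: measure_pmf.emeasure_eq_measure)
  also have "ennreal (1 / norm_const) * (ennreal (measure (measure_pmf p) {..<0}) + ennreal up_mean) = 1"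
    using up_mean_pos norm_const_pos
    by (simp add: ennreal_plus[symmetric] ennreal_mult[symmetric] norm_const_def del: ennreal_plus)
  finally show "(\<integral>\<^sup>+k. ennreal (comparison_weight k) \<partial>count_space UNIV) = 1" .
qed

lemma comparison_support: "k \<in> set_pmf comparison \<Longrightarrow> k \<le> 1"
  by (rule ccontr) (auto simp: set_pmf_iff pmf_comparison comparison_weight_def indicator_def split: if_splits)

lemma comparison_decompose:
  fixes f :: "int \<Rightarrow> 'b::{banach, second_countable_topology}"
  shows "pmf comparison k *\<^sub>R f k = (1 / norm_const) *\<^sub>R (pmf p k *\<^sub>R (indicator {..<0} k *\<^sub>R f k) + indicator {1} k *\<^sub>R (up_mean *\<^sub>R f 1))"
  by (auto simp: pmf_comparison comparison_weight_def indicator_def)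

lemma pmf_integrable_count:
  fixes f :: "int \<Rightarrow> 'b::{banach, second_countable_topology}"
  shows "integrable (measure_pmf q) f \<longleftrightarrow> integrable (count_space UNIV) (\<lambda>k. pmf q k *\<^sub>R f k)"
    "(\<integral>k. f k \<partial>measure_pmf q) = (\<integral>k. pmf q k *\<^sub>R f k \<partial>count_space UNIV)"
  unfolding measure_pmf_eq_density by (auto simp: integrable_density integral_density)

lemma point_mass_count:
  fixes c :: "'b::{banach, second_countable_topology}"
  shows "has_bochner_integral (count_space (UNIV::int set)) (\<lambda>k. indicator {1} k *\<^sub>R c) c"
  using has_bochner_integral_indicator[of "{1::int}" "count_space UNIV" c] by (simp add: measure_count_space)

lemma comparison_integrable_iff:
  fixes f :: "int \<Rightarrow> 'b::{banach, second_countable_topology}"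
  shows "integrable (measure_pmf comparison) f \<longleftrightarrow> integrable (measure_pmf p) (\<lambda>k. indicator {..<0} k *\<^sub>R f k)"
proof
  assume "integrable (measure_pmf comparison) f"
  then have "integrable (count_space UNIV) (\<lambda>k. indicator {..<0} k *\<^sub>R (norm_const *\<^sub>R (pmf comparison k *\<^sub>R f k)))"
    unfolding pmf_integrable_count by (intro integrable_mult_indicator integrable_scaleR_right) auto
  also have "(\<lambda>k. indicator {..<0} k *\<^sub>R (norm_const *\<^sub>R (pmf comparison k *\<^sub>R f k))) = (\<lambda>k. pmf p k *\<^sub>R (indicator {..<0} k *\<^sub>R f k))"
    using norm_const_pos by (auto simp: pmf_comparison comparison_weight_def indicator_def)
  finally show "integrable (measure_pmf p) (\<lambda>k. indicator {..<0} k *\<^sub>R f k)"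
    unfolding pmf_integrable_count .
next
  assume "integrable (measure_pmf p) (\<lambda>k. indicator {..<0} k *\<^sub>R f k)"
  then show "integrable (measure_pmf comparison) f"
    unfolding pmf_integrable_count comparison_decompose
    by (intro integrable_scaleR_right Bochner_Integration.integrable_add point_mass_count[unfolded has_bochner_integral_iff, THEN conjunct1])
qed

lemma comparison_integral:
  fixes f :: "int \<Rightarrow> 'b::{banach, second_countable_topology}"
  assumes "integrable (measure_pmf p) (\<lambda>k. indicator {..<0} k *\<^sub>R f k)"
  shows "(\<integral>k. f k \<partial>measure_pmf comparison)
    = (1 / norm_const) *\<^sub>R ((\<integral>k. indicator {..<0} k *\<^sub>R f k \<partial>measure_pmf p) + up_mean *\<^sub>R f 1)"
proof -
  have "(\<integral>k. f k \<partial>measure_pmf comparison) = (1 / norm_const) *\<^sub>R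
      (\<integral>k. pmf p k *\<^sub>R (indicator {..<0} k *\<^sub>R f k) + indicator {1} k *\<^sub>R (up_mean *\<^sub>R f 1) \<partial>count_space UNIV)"
    unfolding pmf_integrable_count(2) comparison_decompose by (rule integral_scaleR_right)
  also have "(\<integral>k. pmf p k *\<^sub>R (indicator {..<0} k *\<^sub>R f k) + indicator {1} k *\<^sub>R (up_mean *\<^sub>R f 1) \<partial>count_space UNIV)
      = (\<integral>k. indicator {..<0} k *\<^sub>R f k \<partial>measure_pmf p) + up_mean *\<^sub>R f 1"
    using assms unfolding pmf_integrable_count
    using point_mass_count[of "up_mean *\<^sub>R f 1"] unfolding has_bochner_integral_iff
    by (subst Bochner_Integration.integral_add) auto
  finally show ?thesis .
qed

abbreviation "Jm \<equiv> kmean p hub {..<0}"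

lemma Jm_ge:
  obtains d where "0 < d" "\<And>t. 0 < t \<Longrightarrow> t \<le> d \<Longrightarrow> J t / 2 \<le> Jm t"
proof -
  obtain d where d: "0 < d" "\<And>t. 0 < t \<Longrightarrow> t \<le> d \<Longrightarrow> Jp t \<le> (1/2) * J t"
    using Jp_le[of "1/2"] by auto
  have "J t / 2 \<le> Jm t" if "0 < t" "t \<le> d" for t
    using d(2)[OF that] kmean_hub_split[OF int, of t] by simp
  then show thesis using d(1) by (rule that[rotated])
qed

lemma comparison_kmean:
  "kmean comparison hub UNIV t = (Jm t + up_mean * hub t) / norm_const"
  "kmean comparison hub {0<..} t = up_mean * hub t / norm_const"
proof -
  have I: "integrable (measure_pmf p) (\<lambda>k. indicator {..<0} k * hub (t * real_of_int k))"
    by (intro kmean_integrable int) auto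
  show "kmean comparison hub UNIV t = (Jm t + up_mean * hub t) / norm_const"
    unfolding kmean_def using I by (subst comparison_integral) auto
  have e: "indicator {..<0} k *\<^sub>R (indicator {0<..} k * hub (t * real_of_int k)) = 0" for k :: int
    by (auto simp: indicator_def)
  have i1: "indicator {0<..} (1::int) = (1::real)" by simp
  show "kmean comparison hub {0<..} t = up_mean * hub t / norm_const"
    unfolding kmean_def by (subst comparison_integral; simp only: e integrable_zero integral_zero) (simp add: i1)
qed

lemma comparison_psi:
  "psi comparison t = (1 / norm_const) *\<^sub>R ((\<integral>k. indicator {..<0} k *\<^sub>R (1 - cis (t * real_of_int k)) \<partial>measure_pmf p)
     + up_mean *\<^sub>R (1 - cis t))"
  unfolding psi_def
  by (subst comparison_integral) (auto intro!: integrable_mult_indicator psi_integrable)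

lemma comparison_left_dominated: "left_dominated_law comparison"
proof
  show "integrable (measure_pmf comparison) real_of_int"
    unfolding comparison_integrable_iff using half_integrable by simp
  show "(\<integral>k. real_of_int k \<partial>measure_pmf comparison) = 0"
    using half_integrable[of "{..<0}"] down_mean by (subst comparison_integral) auto
  show "(\<integral>\<^sup>+k. ennreal ((real_of_int k)\<^sup>2) \<partial>measure_pmf comparison) = \<infinity>"
  proof (rule ccontr)
    assume "(\<integral>\<^sup>+k. ennreal ((real_of_int k)\<^sup>2) \<partial>measure_pmf comparison) \<noteq> \<infinity>"
    then have "integrable (measure_pmf comparison) (\<lambda>k. (real_of_int k)\<^sup>2)"
      by (intro integrableI_nonneg) (auto simp: less_top)
    then have I: "integrable (measure_pmf p) (\<lambda>k. indicator {..<0} k * (real_of_int k)\<^sup>2)"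
      unfolding comparison_integrable_iff by simp
    \<comment> \<open>A finite second moment \<open>V\<close> of the negative jumps would give
      \<open>Jm <= V t^2\<close>, against \<open>J/2 <= Jm\<close> and
      \<open>J >= (2 V + 2) t^2\<close>.\<close>
    define V where "V = (\<integral>k. indicator {..<0} k * (real_of_int k)\<^sup>2 \<partial>measure_pmf p)"
    have Jmle: "Jm t \<le> t\<^sup>2 * V" for t
    proof -
      have "Jm t \<le> (\<integral>k. t\<^sup>2 * (indicator {..<0} k * (real_of_int k)\<^sup>2) \<partial>measure_pmf p)"
        unfolding kmean_def using I hub_le_square
        by (intro integral_mono kmean_integrable int integrable_mult_right) (auto simp: indicator_def power_mult_distrib[symmetric])
      then show ?thesis by (simp add: V_def)
    qed
    obtain d1 where d1: "0 < d1" "\<And>t. 0 < t \<Longrightarrow> t \<le> d1 \<Longrightarrow> J t / 2 \<le> Jm t" using Jm_ge by blast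
    obtain d2 where d2: "0 < d2" "\<And>t. 0 < t \<Longrightarrow> t \<le> d2 \<Longrightarrow> (2 * V + 2) * t\<^sup>2 \<le> Re (psi p t) \<and> (2 * V + 2) * t\<^sup>2 \<le> J t"
      using psi_Re_J_superquadratic by blast
    define t where "t = min d1 d2"
    have t: "0 < t" "t \<le> d1" "t \<le> d2" using d1 d2 by (auto simp: t_def)
    have "(2 * V + 2) * t\<^sup>2 \<le> 2 * (t\<^sup>2 * V)"
      using d1(2)[OF t(1,2)] d2(2)[OF t(1,3)] Jmle[of t] by linarith
    then have "2 * t\<^sup>2 \<le> 0" by (simp add: algebra_simps)
    moreover have "0 < t\<^sup>2" using t by simp
    ultimately show False by linarith
  qed
  show "psi comparison t \<noteq> 0" if t: "0 < t" "t \<le> pi" for t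
  proof -
    \<comment> \<open>The unit jump alone makes the real part of the new \<open>psi\<close> positive
      on \<open>(0, pi]\<close>.\<close>
    have "cos t < cos 0" using t by (intro cos_monotone_0_pi) auto
    then have c: "0 < up_mean * (1 - cos t)" using up_mean_pos by simp
    have I: "integrable (measure_pmf p) (\<lambda>k. indicator {..<0} k *\<^sub>R (1 - cis (t * real_of_int k)))"
      by (intro integrable_mult_indicator psi_integrable) auto
    have "0 \<le> (\<integral>k. Re (indicator {..<0} k *\<^sub>R (1 - cis (t * real_of_int k))) \<partial>measure_pmf p)"
      by (intro Bochner_Integration.integral_nonneg) (auto simp: indicator_def)
    also have "\<dots> = Re (\<integral>k. indicator {..<0} k *\<^sub>R (1 - cis (t * real_of_int k)) \<partial>measure_pmf p)"
      by (rule integral_Re[OF I])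
    finally have "0 \<le> Re (\<integral>k. indicator {..<0} k *\<^sub>R (1 - cis (t * real_of_int k)) \<partial>measure_pmf p)" .
    then have "0 < Re (psi comparison t)"
      unfolding comparison_psi using c norm_const_pos by (simp add: add_nonneg_pos)
    then show ?thesis by auto
  qed
  show "((\<lambda>t. kmean comparison hub {0<..} t / kmean comparison hub UNIV t) \<longlongrightarrow> 0) (at_right 0)"
  proof (rule tendstoI)
    fix e :: real assume e: "0 < e"
    \<comment> \<open>The positive part is a multiple of the single value
      \<open>hub t <= t^2\<close>, negligible against \<open>Jm\<close>.\<close>
    obtain d1 where d1: "0 < d1" "\<And>t. 0 < t \<Longrightarrow> t \<le> d1 \<Longrightarrow> J t / 2 \<le> Jm t" using Jm_ge by blast
    obtain d2 where d2: "0 < d2" "\<And>t. 0 < t \<Longrightarrow> t \<le> d2 \<Longrightarrow> (4 * up_mean / e) * t\<^sup>2 \<le> Re (psi p t) \<and> (4 * up_mean / e) * t\<^sup>2 \<le> J t"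
      using psi_Re_J_superquadratic by blast
    have "eventually (\<lambda>t. t \<in> {0<..<min d1 d2}) (at_right 0)" using d1(1) d2(1) by (intro eventually_at_right_real) auto
    then show "eventually (\<lambda>t. dist (kmean comparison hub {0<..} t / kmean comparison hub UNIV t) 0 < e) (at_right 0)"
    proof eventually_elim
      case (elim t)
      then have t: "0 < t" "t \<le> d1" "t \<le> d2" by auto
      have Jm: "2 * (up_mean * t\<^sup>2) \<le> e * Jm t"
      proof -
        have "(4 * up_mean / e) * t\<^sup>2 / 2 \<le> J t / 2"
          using d2(2)[OF t(1,3)] by (intro divide_right_mono) auto
        also have "\<dots> \<le> Jm t" by (rule d1(2)[OF t(1,2)])
        finally have "(4 * up_mean / e) * t\<^sup>2 / 2 \<le> Jm t" .
        then have "e * ((4 * up_mean / e) * t\<^sup>2 / 2) \<le> e * Jm t" using e by (intro mult_left_mono) auto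
        then show ?thesis using e by simp
      qed
      have ut: "0 < up_mean * t\<^sup>2" using up_mean_pos t by simp
      have uh: "0 \<le> up_mean * hub t" "up_mean * hub t \<le> up_mean * t\<^sup>2"
        using up_mean_pos hub_le_square[of t] by (auto intro: mult_left_mono)
      have Jmp: "0 < Jm t" using Jm ut e by (metis less_le_trans mult_pos_pos zero_less_mult_pos zero_less_numeral)
      have "up_mean * hub t < e * (Jm t + up_mean * hub t)"
      proof -
        have "up_mean * hub t < e * Jm t" using Jm uh ut by linarith
        also have "\<dots> \<le> e * (Jm t + up_mean * hub t)" using e uh by (intro mult_left_mono) auto
        finally show ?thesis .
      qed
      then have "up_mean * hub t / (Jm t + up_mean * hub t) < e"
        using Jmp uh by (subst divide_less_eq) (auto simp: add_pos_nonneg)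
      then show ?case unfolding comparison_kmean using norm_const_pos uh Jmp by simp
    qed
  qed
qed

section \<open>The potential of the comparison walk\<close>

definition pot0 :: "int \<Rightarrow> real" where "pot0 = left_dominated_law.pot comparison"

interpretation C: left_dominated_law comparison
  rewrites "left_dominated_law.pot comparison = pot0"
  by (fact comparison_left_dominated) (simp add: pot0_def)

text \<open>From \<open>-y < -x\<close> the walk climbs by unit steps and cannot reach 0 before
  \<open>-x\<close>; the hitting formula with probability 1 is the additivity.\<close>

lemma pot0_skip_free:
  assumes "0 < x" "x < y" shows "pot0 (- int y) = pot0 (- int x) + pot0 (- int (y - x))"
proof -
  \<comment> \<open>A supersolution that certifies probability 0: it vanishes below
    \<open>-x\<close>, from where a step ends below or exactly at \<open>-x\<close>, and it is
    infinite elsewhere, where nothing has to be checked.\<close>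
  let ?V = "\<lambda>z. if z < - int x then 0 else (\<top>::ennreal)"
  have "hit_exp comparison 1 {0, - int x} (indicator {0}) (- int y) \<le> ?V (- int y)"
  proof (rule hit_exp_least)
    fix z
    show "1 * (\<integral>\<^sup>+v. (if z + v \<in> {0, - int x} then indicator {0} (z + v) else ?V (z + v)) \<partial>measure_pmf comparison) \<le> ?V z"
    proof (cases "z < - int x")
      case True
      have "AE v in measure_pmf comparison. (if z + v \<in> {0, - int x} then indicator {0} (z + v) else ?V (z + v)) = 0"
      proof (rule AE_pmfI)
        fix v assume "v \<in> set_pmf comparison"
        then have "v \<le> 1" by (rule comparison_support)
        then have "z + v < - int x \<or> z + v = - int x" using True by linarith
        then show "(if z + v \<in> {0, - int x} then indicator {0} (z + v) else ?V (z + v)) = 0"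
          using assms by auto
      qed
      then have "(\<integral>\<^sup>+v. (if z + v \<in> {0, - int x} then indicator {0} (z + v) else ?V (z + v)) \<partial>measure_pmf comparison) = 0"
        by (subst nn_integral_0_iff_AE) auto
      then show ?thesis by simp
    qed simp
  qed
  then have "hit_before comparison {0} {- int x} (- int y) = 0"
    unfolding disc_hit_def using assms by (simp add: insert_commute)
  then have "hit_before comparison {- int x} {0} (- int y) = 1"
    using C.hit_before_total[of "- int x" 0 "- int y"] assms by simp
  moreover have "hit_before comparison {- int x} {0} (- int y) * (pot0 (- int x) + pot0 (- (- int x)))
      = (if - int y = 0 then 1 else 0) + pot0 (- int y) + pot0 (- (- int x)) - pot0 (- int y - (- int x))"
    by (rule C.hit_before_potential) (use assms in auto)
  moreover have "- int y - (- int x) = - int (y - x)" using assms by (simp add: of_nat_diff)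
  moreover have "- int y \<noteq> 0" using assms by simp
  ultimately show ?thesis by (simp only: if_False mult_1_left add_0_left)
qed

text \<open>On the negative half-line the potential is additive, because the walk is skip-free, but sublinear.\<close>

lemma pot0_neg: "pot0 (- int n) = 0"
proof -
  have lin: "pot0 (- int (Suc n)) = real (Suc n) * pot0 (- 1)" for n
  proof (induction n)
    case (Suc n)
    have "pot0 (- int (Suc (Suc n))) = pot0 (- int 1) + pot0 (- int (Suc (Suc n) - 1))"
      by (rule pot0_skip_free) auto
    then show ?case using Suc by (simp add: algebra_simps)
  qed simp
  have "pot0 (- 1) \<le> e" if e: "0 < e" for e
  proof (rule ccontr)
    assume a: "\<not> pot0 (- 1) \<le> e"
    obtain C where C: "\<And>x. pot0 x + pot0 (- x) \<le> C + e * \<bar>real_of_int x\<bar>"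
      using C.pot_sublinear[OF e] by blast
    obtain n where n: "C < real n * (pot0 (- 1) - e)"
      using reals_Archimedean3[of "pot0 (- 1) - e"] a by auto
    have "real (Suc n) * pot0 (- 1) \<le> C + e * real (Suc n)"
      using C[of "- int (Suc n)"] C.potential_nonneg[of "int (Suc n)"] lin[of n] by (simp add: add.commute)
    moreover have "real n * (pot0 (- 1) - e) \<le> real (Suc n) * (pot0 (- 1) - e)"
      using a by (intro mult_right_mono) auto
    ultimately show False using n by (simp add: algebra_simps)
  qed
  then have "pot0 (- 1) \<le> 0" using field_le_epsilon[of "pot0 (-1)" 0] by simp
  then have "pot0 (- 1) = 0" using C.potential_nonneg[of "- 1"] by simp
  then show ?thesis using lin[of "n - 1"] by (cases n) auto
qed

lemma pot0_nonpos: "x \<le> 0 \<Longrightarrow> pot0 x = 0"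
  using pot0_neg[of "nat (- x)"] by simp

text \<open>Subadditivity with a nonpositive increment, whose potential is 0.\<close>

lemma pot0_mono: "x \<le> y \<Longrightarrow> pot0 x \<le> pot0 y"
  using C.potential_subadditive[of y "x - y"] pot0_nonpos[of "x - y"] by simp

text \<open>Abel summation with linearly decreasing weights.\<close>

lemma weighted_telescope:
  fixes g :: "int \<Rightarrow> real"
  shows "(\<Sum>x<N. (real N - real x) * (g (int x) - g (int x - 1))) = (\<Sum>x<N. g (int x)) - real N * g (- 1)"
proof (induction N)
  case (Suc N)
  have tele: "(\<Sum>x<Suc N. (g (int x) - g (int x - 1))) = g (int N) - g (- 1)"
    by (induction N) auto
  have "(\<Sum>x<Suc N. (real (Suc N) - real x) * (g (int x) - g (int x - 1)))
    = (\<Sum>x<Suc N. (real N - real x) * (g (int x) - g (int x - 1))) + (\<Sum>x<Suc N. (g (int x) - g (int x - 1)))"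
    unfolding sum.distrib[symmetric] by (intro sum.cong) (auto simp: algebra_simps)
  also have "(\<Sum>x<Suc N. (real N - real x) * (g (int x) - g (int x - 1))) = (\<Sum>x<N. (real N - real x) * (g (int x) - g (int x - 1)))"
    by simp
  finally show ?case unfolding tele Suc.IH by (simp add: algebra_simps)
qed simp

text \<open>This is the weighted sum for a downward jump \<open>y\<close>, freed of its linear part
  \<open>- y S\<close>. Raising \<open>y\<close> by one changes it by \<open>S\<close> minus a
  shifted sum of the same potential; at most \<open>min (y + 1) N\<close> terms of \<open>S\<close>
  remain uncancelled, each at most \<open>pot0 N\<close>.\<close>

lemma pot0_weighted_bound:
  fixes N y :: nat
  defines "S \<equiv> (\<Sum>z<N. pot0 (int z + 1))"
  shows "(\<Sum>x<N. (real N - real x) * (pot0 (int x - int y) - pot0 (int x))) + real y * S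
    \<le> min (real y) (real N) * real y * pot0 (int N)"
proof -
  have pN: "0 \<le> pot0 (int N)" by (rule C.potential_nonneg)
  have step: "(\<Sum>x<N. (real N - real x) * (pot0 (int x - int (Suc y)) - pot0 (int x - int y))) + S
    \<le> min (real (Suc y)) (real N) * pot0 (int N)" for y
  proof -
    have "(\<Sum>x<N. (real N - real x) * (pot0 (int x - int y) - pot0 (int x - 1 - int y))) = (\<Sum>x<N. pot0 (int x - int y)) - real N * pot0 (- 1 - int y)"
      using weighted_telescope[where g="\<lambda>x. pot0 (x - int y)" and N=N] by simp
    moreover have "pot0 (- 1 - int y) = 0" by (rule pot0_nonpos) simp
    moreover have "(\<Sum>x<N. (real N - real x) * (pot0 (int x - int (Suc y)) - pot0 (int x - int y)))
       = - (\<Sum>x<N. (real N - real x) * (pot0 (int x - int y) - pot0 (int x - 1 - int y)))"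
      unfolding sum_negf[symmetric] by (intro sum.cong) (auto simp: algebra_simps)
    ultimately have e: "(\<Sum>x<N. (real N - real x) * (pot0 (int x - int (Suc y)) - pot0 (int x - int y))) + S
      = S - (\<Sum>x<N. pot0 (int x - int y))" by simp
    have "S - (\<Sum>x<N. pot0 (int x - int y)) \<le> real M * pot0 (int N)" if M: "M = min (Suc y) N" for M
    proof -
      have le: "pot0 (int z) \<le> pot0 (int N)" if "z \<le> N" for z using that by (intro pot0_mono) simp
      show ?thesis
      proof (cases "Suc y \<le> N")
        case True
        then have NM: "N = (N - Suc y) + Suc y" by simp
        have "S = (\<Sum>z<N - Suc y. pot0 (int z + 1)) + (\<Sum>z=N - Suc y..<N. pot0 (int z + 1))"
          unfolding S_def by (metis NM add.commute le_add1 lessThan_atLeast0 sum.atLeastLessThan_concat zero_le)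
        also have "(\<Sum>z=N - Suc y..<N. pot0 (int z + 1)) \<le> (\<Sum>z=N - Suc y..<N. pot0 (int N))"
          by (intro sum_mono pot0_mono) auto
        also have "\<dots> = real M * pot0 (int N)" using True M by simp
        also have "(\<Sum>z<N - Suc y. pot0 (int z + 1)) = (\<Sum>x=Suc y..<N. pot0 (int x - int y))"
        proof -
          have "(\<Sum>x=Suc y..<N. pot0 (int x - int y)) = (\<Sum>x=0 + Suc y..<(N - Suc y) + Suc y. pot0 (int x - int y))"
            using NM by simp
          also have "\<dots> = (\<Sum>z=0..<N - Suc y. pot0 (int (z + Suc y) - int y))" by (rule sum.shift_bounds_nat_ivl)
          finally show ?thesis by (simp add: lessThan_atLeast0 algebra_simps)
        qed
        also have "\<dots> \<le> (\<Sum>x<N. pot0 (int x - int y))"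
          by (intro sum_mono2) (auto intro: C.potential_nonneg)
        finally show ?thesis by simp
      next
        case False
        have "S \<le> (\<Sum>z<N. pot0 (int N))" unfolding S_def by (intro sum_mono pot0_mono) auto
        moreover have "0 \<le> (\<Sum>x<N. pot0 (int x - int y))" by (intro sum_nonneg C.potential_nonneg)
        ultimately show ?thesis using False M by simp
      qed
    qed
    from this[OF refl] show ?thesis unfolding e of_nat_min .
  qed
  show ?thesis
  proof (induction y)
    case (Suc y)
    have "(\<Sum>x<N. (real N - real x) * (pot0 (int x - int (Suc y)) - pot0 (int x))) + real (Suc y) * S
      = ((\<Sum>x<N. (real N - real x) * (pot0 (int x - int y) - pot0 (int x))) + real y * S)
       + ((\<Sum>x<N. (real N - real x) * (pot0 (int x - int (Suc y)) - pot0 (int x - int y))) + S)"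
      by (simp add: sum.distrib[symmetric] algebra_simps)
    also have "\<dots> \<le> min (real y) (real N) * real y * pot0 (int N) + min (real (Suc y)) (real N) * pot0 (int N)"
      by (intro add_mono Suc.IH step)
    also have "\<dots> \<le> min (real (Suc y)) (real N) * real y * pot0 (int N) + min (real (Suc y)) (real N) * pot0 (int N)"
      using pN by (intro add_mono mult_right_mono) auto
    also have "\<dots> = min (real (Suc y)) (real N) * real (Suc y) * pot0 (int N)" by (simp add: algebra_simps)
    finally show ?case .
  qed simp
qed

text \<open>
  Summing the harmonicity of \<open>pot0\<close> over \<open>0 \<le> x < N\<close> with weights \<open>N - x\<close> brings in the mean of
  \<open>min(Y, N) Y\<close> for the downward jump \<open>Y\<close>, which is comparable to \<open>N\<^sup>2 J(1/N)\<close>.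
\<close>

definition bscale :: "nat \<Rightarrow> real" where "bscale n = 1 / (real n * J (1 / real n))"

lemma pot0_ge:
  assumes N: "0 < N" shows "norm_const / 2 * bscale N \<le> pot0 (int N)"
proof -
  define S where "S = (\<Sum>z<N. pot0 (int z + 1))"
  define \<Phi> where "\<Phi> = (\<lambda>k. \<Sum>x<N. (real N - real x) * (pot0 (int x + k) - pot0 (int x)))"
  have I: "integrable (measure_pmf comparison) \<Phi>"
    unfolding \<Phi>_def by (intro Bochner_Integration.integrable_sum integrable_mult_right
        Bochner_Integration.integrable_diff C.potential_harmonic) auto
  \<comment> \<open>\<open>pot0\<close> is harmonic off 0 with excess 1 at 0, and the weight of
    \<open>x = 0\<close> is \<open>N\<close>.\<close>
  have E: "(\<integral>k. \<Phi> k \<partial>measure_pmf comparison) = real N"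
  proof -
    have "(\<integral>k. \<Phi> k \<partial>measure_pmf comparison) = (\<Sum>x<N. (real N - real x) * (if x = 0 then 1 else 0))"
      unfolding \<Phi>_def using C.potential_harmonic
      by (subst Bochner_Integration.integral_sum) (auto intro!: sum.cong)
    also have "\<dots> = real N" using N by (simp add: sum.delta if_distrib cong: if_cong)
    finally show ?thesis .
  qed
  have int0: "integrable (measure_pmf comparison) real_of_int" by (rule C.int)
  \<comment> \<open>Subtracting \<open>k S\<close> leaves the mean unchanged, because the law is
    centered, and makes the contribution of the unit upward jump 0.\<close>
  let ?L = "\<lambda>k. \<Phi> k - real_of_int k * S"
  let ?R = "\<lambda>k. pot0 (int N) * (2 * (real N)\<^sup>2 * hub (1 / real N * real_of_int k))"
  have pN: "0 \<le> pot0 (int N)" by (rule C.potential_nonneg)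
  have up1: "\<Phi> 1 = S"
  proof -
    have "(\<Sum>x<N. (real N - real x) * (pot0 (int x + 1) - pot0 (int x))) = (\<Sum>x<N. pot0 (int x + 1)) - real N * pot0 (- 1 + 1)"
      using weighted_telescope[where g="\<lambda>x. pot0 (x + 1)" and N=N] by simp
    then show ?thesis by (simp add: \<Phi>_def S_def)
  qed
  have down: "?L k \<le> ?R k" if k: "k \<le> 0" for k
  proof -
    define y where "y = nat (- k)"
    have ky: "k = - int y" using k by (simp add: y_def)
    have "?L k \<le> min (real y) (real N) * real y * pot0 (int N)"
      using pot0_weighted_bound[of N y] unfolding ky \<Phi>_def S_def by simp
    also have "min (real y) (real N) * real y \<le> 2 * (real N)\<^sup>2 * hub (1 / real N * real_of_int k)"
    proof -
      define u where "u = real y / real N"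
      have yu: "real y = u * real N" using N by (simp add: u_def)
      have u: "0 \<le> u" by (simp add: u_def)
      have "min (real y) (real N) * real y = (real N)\<^sup>2 * (min u 1 * u)"
      proof -
        have "min (u * real N) (real N) = min u 1 * real N"
          using N by (auto simp: min_def)
        then show ?thesis unfolding yu by (simp add: power2_eq_square)
      qed
      also have "min u 1 * u \<le> 2 * hub u"
      proof (cases "u \<le> 1")
        case True
        have "u\<^sup>2 / 2 \<le> u\<^sup>2 / (1 + u)" using u True by (intro divide_left_mono) auto
        then have "u\<^sup>2 / 2 \<le> hub u" using u by (simp add: hub_def)
        then show ?thesis using True by (simp add: power2_eq_square min_def)
      next
        case False
        have "u\<^sup>2 / (2 * u) \<le> u\<^sup>2 / (1 + u)" using False by (intro divide_left_mono) auto
        then have "u / 2 \<le> hub u" using False by (simp add: hub_def power2_eq_square)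
        then show ?thesis using False by (simp add: min_def)
      qed
      also have "hub u = hub (1 / real N * real_of_int k)"
        using kernel_minus(1)[of u] by (simp add: u_def ky)
      finally show ?thesis by (simp add: mult_left_mono)
    qed
    finally show ?thesis using pN by (simp add: mult_right_mono mult.commute)
  qed
  have le: "AE k in measure_pmf comparison. ?L k \<le> indicator {..<0} k * ?R k"
  proof (rule AE_pmfI)
    fix k assume "k \<in> set_pmf comparison"
    then have "k \<le> 1" "pmf comparison k \<noteq> 0"
      by (rule comparison_support, simp add: set_pmf_iff)
    then have "k = 1 \<or> k < 0" by (cases "k = 0") (auto simp: pmf_comparison comparison_weight_def)
    then show "?L k \<le> indicator {..<0} k * ?R k" using up1 down[of k] by auto
  qed
  have IR: "integrable (measure_pmf p) (\<lambda>k. indicator {..<0} k *\<^sub>R (indicator {..<0} k * ?R k))"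
  proof -
    have "integrable (measure_pmf p) (\<lambda>k. pot0 (int N) * (2 * (real N)\<^sup>2) * (indicator {..<0} k * hub (1 / real N * real_of_int k)))"
      by (intro integrable_mult_right kmean_integrable int) auto
    then show ?thesis by (rule Bochner_Integration.integrable_cong[THEN iffD1, rotated -1]) (auto simp: indicator_def)
  qed
  have IR': "integrable (measure_pmf comparison) (\<lambda>k. indicator {..<0} k * ?R k)"
    unfolding comparison_integrable_iff by (rule IR)
  have "real N = (\<integral>k. ?L k \<partial>measure_pmf comparison)"
    using E I int0 C.mean_0 by simp
  also have "\<dots> \<le> (\<integral>k. indicator {..<0} k * ?R k \<partial>measure_pmf comparison)"
    using I int0 by (intro integral_mono_AE IR' le) auto
  also have "\<dots> = (1 / norm_const) * (\<integral>k. pot0 (int N) * (2 * (real N)\<^sup>2) * (indicator {..<0} k * hub (1 / real N * real_of_int k)) \<partial>measure_pmf p)"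
  proof -
    have e: "indicator {..<0} k *\<^sub>R (indicator {..<0} k * ?R k)
        = pot0 (int N) * (2 * (real N)\<^sup>2) * (indicator {..<0} k * hub (1 / real N * real_of_int k))" for k :: int
      by (auto simp: indicator_def)
    have one: "indicator {..<0} (1::int) = (0::real)" by simp
    show ?thesis unfolding comparison_integral[OF IR] e one by simp
  qed
  also have "\<dots> = (1 / norm_const) * (pot0 (int N) * (2 * (real N)\<^sup>2) * Jm (1 / real N))"
    unfolding kmean_def by simp
  also have "\<dots> \<le> (1 / norm_const) * (pot0 (int N) * (2 * (real N)\<^sup>2) * J (1 / real N))"
    using norm_const_pos pN kmean_mono_set[OF int, of hub "{..<0}" UNIV] by (intro mult_left_mono) auto
  finally have 1: "real N \<le> (1 / norm_const) * (pot0 (int N) * (2 * (real N)\<^sup>2) * J (1 / real N))" .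
  have Jp: "0 < J (1 / real N)" using N by (intro J_pos) simp
  have "norm_const * real N \<le> norm_const * ((1 / norm_const) * (pot0 (int N) * (2 * (real N)\<^sup>2) * J (1 / real N)))"
    using 1 norm_const_pos by (intro mult_left_mono) auto
  also have "\<dots> = real N * (pot0 (int N) * (2 * real N * J (1 / real N)))"
    using norm_const_pos by (simp add: power2_eq_square)
  finally have "norm_const \<le> pot0 (int N) * (2 * real N * J (1 / real N))"
    using N by (simp add: mult.commute)
  then show ?thesis using N Jp by (simp add: bscale_def divide_le_eq mult_ac)
qed

end

context left_dominated_law
begin

section \<open>Comparison of the two potentials\<close>

text \<open>With this normalisation the negative jumps cancel in \<open>psi0 - psi\<close>.\<close>

definition psi0 :: "real \<Rightarrow> complex" where "psi0 t = of_real norm_const * psi comparison t"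

abbreviation "Dpsi t \<equiv> psi0 t - psi p t"
abbreviation "rp \<equiv> kmean p rho {0<..}"
abbreviation "ip \<equiv> kmean p iota {0<..}"
abbreviation "rr \<equiv> kmean p rho UNIV"
abbreviation "ii \<equiv> kmean p iota UNIV"

definition up_prob :: real where "up_prob = measure (measure_pmf p) {0<..}"

lemma up_prob_pos: "0 < up_prob"
proof (rule ccontr)
  assume "\<not> 0 < up_prob"
  then have "measure (measure_pmf p) {0<..} = 0" unfolding up_prob_def using measure_nonneg[of "measure_pmf p" "{0<..}"] by linarith
  then have "set_pmf p \<inter> {0<..} = {}" by (simp add: measure_pmf_zero_iff)
  then have "AE k in measure_pmf p. indicator {0<..} k * real_of_int k = 0"
    by (auto simp: AE_measure_pmf_iff indicator_def)
  then have "up_mean = 0" unfolding up_mean_def by (rule integral_eq_zero_AE)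
  then show False using up_mean_pos by simp
qed

definition up_ratio :: real where "up_ratio = up_mean / up_prob"

lemma up_ratio_pos: "0 < up_ratio" unfolding up_ratio_def using up_mean_pos up_prob_pos by simp

text \<open>Positive jumps are at least 1 and the kernels increase, so the unit jumps of the
  comparison walk are dominated by the original positive jumps. Thus bounds on \<open>Dpsi\<close>
  can be stated through \<open>Jp\<close>, \<open>rp\<close> and \<open>ip\<close>.\<close>

lemma kmean_up_ge:
  assumes t: "0 < t" and g: "g \<in> {hub, rho, iota}"
  shows "up_mean * g t \<le> up_ratio * kmean p g {0<..} t"
proof -
  have le: "g t \<le> g (t * real_of_int k)" if "0 < k" for k
  proof -
    have l: "1 \<le> real_of_int k" using that by simp
    then have "t \<le> t * real_of_int k" using t by simp
    moreover have "hub t \<le> hub (t * real_of_int k)"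
      using hub_scale(1)[OF l, of t] mult_right_mono[OF l, of "hub t"] by (simp add: mult.commute)
    ultimately show ?thesis using g t kernel_mono[of t "t * real_of_int k"] by auto
  qed
  have "up_prob * g t = (\<integral>k. indicator {0<..} k * g t \<partial>measure_pmf p)"
    unfolding up_prob_def by simp
  also have "\<dots> \<le> kmean p g {0<..} t"
    unfolding kmean_def
  proof (rule integral_mono[OF _ kmean_integrable[OF int g]])
    show "integrable (measure_pmf p) (\<lambda>k. indicator {0<..} k * g t)"
      by (rule measure_pmf.integrable_const_bound[where B="\<bar>g t\<bar>"]) (auto simp: indicator_def)
  qed (use le in \<open>auto simp: indicator_def\<close>)
  finally have "up_ratio * (up_prob * g t) \<le> up_ratio * kmean p g {0<..} t"
    using up_ratio_pos by (intro mult_left_mono) auto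
  then show ?thesis using up_prob_pos by (simp add: up_ratio_def)
qed

lemma up_integrable:
  "integrable (measure_pmf p) (\<lambda>k. indicator {0<..} k *\<^sub>R (of_int k * (1 - cis t) :: complex))"
  "integrable (measure_pmf p) (\<lambda>k. indicator {0<..} k *\<^sub>R (1 - cis (t * real_of_int k)))"
proof -
  have "norm (1 - cis t) \<le> 2" using norm_cis_minus_1_le[of t] by (simp add: norm_minus_commute)
  then have "norm (of_int k * (1 - cis t)) \<le> \<bar>real_of_int k\<bar> * 2" for k
    unfolding norm_mult by (intro mult_mono) auto
  then show "integrable (measure_pmf p) (\<lambda>k. indicator {0<..} k *\<^sub>R (of_int k * (1 - cis t) :: complex))"
    by (intro integrable_mult_indicator integrable_dominated_abs[OF int, where A=0 and B=2]) (auto simp: mult.commute)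
  show "integrable (measure_pmf p) (\<lambda>k. indicator {0<..} k *\<^sub>R (1 - cis (t * real_of_int k)))"
    by (intro integrable_mult_indicator psi_integrable) auto
qed

lemma up_split: "indicator {0<..} k *\<^sub>R (of_int k * (1 - cis t) - (1 - cis (t * real_of_int k)))
    = indicator {0<..} k *\<^sub>R (of_int k * (1 - cis t) :: complex) - indicator {0<..} k *\<^sub>R (1 - cis (t * real_of_int k))"
  by (rule scaleR_diff_right)

lemma Dpsi_eq:
  "Dpsi t = (\<integral>k. indicator {0<..} k *\<^sub>R (of_int k * (1 - cis t) - (1 - cis (t * real_of_int k))) \<partial>measure_pmf p)"
proof -
  have I: "integrable (measure_pmf p) (\<lambda>k. indicator S k *\<^sub>R (1 - cis (t * real_of_int k)))" for S
    by (intro integrable_mult_indicator psi_integrable) auto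
  have "psi p t = (\<integral>k. indicator {..<0} k *\<^sub>R (1 - cis (t * real_of_int k)) + indicator {0<..} k *\<^sub>R (1 - cis (t * real_of_int k)) \<partial>measure_pmf p)"
    unfolding psi_def by (intro Bochner_Integration.integral_cong) (auto simp: indicator_def)
  also have "\<dots> = (\<integral>k. indicator {..<0} k *\<^sub>R (1 - cis (t * real_of_int k)) \<partial>measure_pmf p)
      + (\<integral>k. indicator {0<..} k *\<^sub>R (1 - cis (t * real_of_int k)) \<partial>measure_pmf p)"
    by (rule Bochner_Integration.integral_add[OF I I])
  finally have 1: "psi p t = \<dots>" .
  have "(\<integral>k. indicator {0<..} k *\<^sub>R (of_int k * (1 - cis t) :: complex) \<partial>measure_pmf p) =
    (\<integral>k. of_real (indicator {0<..} k * real_of_int k) * (1 - cis t) \<partial>measure_pmf p)"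
    by (intro Bochner_Integration.integral_cong) (auto simp: indicator_def)
  also have "\<dots> = of_real up_mean * (1 - cis t)"
    unfolding up_mean_def by (simp del: of_real_mult)
  finally have 2: "(\<integral>k. indicator {0<..} k *\<^sub>R (of_int k * (1 - cis t) :: complex) \<partial>measure_pmf p) = of_real up_mean * (1 - cis t)" .
  have 3: "psi0 t = (\<integral>k. indicator {..<0} k *\<^sub>R (1 - cis (t * real_of_int k)) \<partial>measure_pmf p) + of_real up_mean * (1 - cis t)"
    unfolding psi0_def comparison_psi using norm_const_pos by (simp add: scaleR_conv_of_real)
  have "(\<integral>k. indicator {0<..} k *\<^sub>R (of_int k * (1 - cis t) - (1 - cis (t * real_of_int k))) \<partial>measure_pmf p)
     = of_real up_mean * (1 - cis t) - (\<integral>k. indicator {0<..} k *\<^sub>R (1 - cis (t * real_of_int k)) \<partial>measure_pmf p)"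
    unfolding up_split 2[symmetric] by (rule Bochner_Integration.integral_diff[OF up_integrable])
  then show ?thesis using 1 3 by simp
qed

lemma Dpsi_integrable:
  "integrable (measure_pmf p) (\<lambda>k. indicator {0<..} k *\<^sub>R (of_int k * (1 - cis t) - (1 - cis (t * real_of_int k))))"
  unfolding up_split by (rule Bochner_Integration.integrable_diff[OF up_integrable])

definition C1 :: real where "C1 = 8 * up_ratio + 8"

lemma C1_pos: "0 < C1" unfolding C1_def using up_ratio_pos by simp

text \<open>\<open>f\<close> stands for the difference between \<open>k\<close> unit jumps and one
  jump of size \<open>k\<close>; both are measured by the same kernel, at \<open>t\<close> with
  weight \<open>k\<close> and at \<open>t k\<close>.\<close>

lemma kmean_up_dominate:
  assumes t: "0 < t" and g: "g \<in> {hub, rho, iota}"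
    and f: "\<And>k. 0 < k \<Longrightarrow> \<bar>f k\<bar> \<le> real_of_int k * (8 * g t) + 8 * g (t * real_of_int k)"
    and fI: "integrable (measure_pmf p) (\<lambda>k. indicator {0<..} k * f k)"
  shows "\<bar>\<integral>k. indicator {0<..} k * f k \<partial>measure_pmf p\<bar> \<le> C1 * kmean p g {0<..} t"
proof -
  have I: "integrable (measure_pmf p) (\<lambda>k. (indicator {0<..} k * real_of_int k) * (8 * g t))"
    "integrable (measure_pmf p) (\<lambda>k. 8 * (indicator {0<..} k * g (t * real_of_int k)))"
    by (intro integrable_mult_left half_integrable, intro integrable_mult_right kmean_integrable[OF int g])
  have "\<bar>\<integral>k. indicator {0<..} k * f k \<partial>measure_pmf p\<bar> \<le> (\<integral>k. \<bar>indicator {0<..} k * f k\<bar> \<partial>measure_pmf p)"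
    by (rule integral_abs_bound)
  also have "\<dots> \<le> (\<integral>k. (indicator {0<..} k * real_of_int k) * (8 * g t) + 8 * (indicator {0<..} k * g (t * real_of_int k)) \<partial>measure_pmf p)"
    using f by (intro integral_mono integrable_abs fI Bochner_Integration.integrable_add I) (auto simp: indicator_def)
  also have "\<dots> = up_mean * (8 * g t) + 8 * kmean p g {0<..} t"
    unfolding Bochner_Integration.integral_add[OF I] integral_mult_left_zero integral_mult_right_zero up_mean_def kmean_def ..
  also have "\<dots> \<le> C1 * kmean p g {0<..} t"
    using kmean_up_ge[OF t g] by (simp add: C1_def algebra_simps)
  finally show ?thesis .
qed

lemma Dpsi_Re_le:
  assumes t: "0 < t" shows "\<bar>Re (Dpsi t)\<bar> \<le> C1 * rp t"
proof -
  have e: "Re (indicator {0<..} k *\<^sub>R (of_int k * (1 - cis t) - (1 - cis (t * real_of_int k))))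
     = indicator {0<..} k * (real_of_int k * (1 - cos t) - (1 - cos (t * real_of_int k)))" for k by simp
  note I = integrable_Re[OF Dpsi_integrable[of t], unfolded e]
  have "\<bar>real_of_int k * (1 - cos t) - (1 - cos (t * real_of_int k))\<bar> \<le> real_of_int k * (8 * rho t) + 8 * rho (t * real_of_int k)"
    if "0 < k" for k
  proof -
    have "0 \<le> real_of_int k * (1 - cos t)" "0 \<le> 1 - cos (t * real_of_int k)" using that by auto
    moreover have "real_of_int k * (1 - cos t) \<le> real_of_int k * (8 * rho t)"
      using that by (intro mult_left_mono one_minus_cos_le_rho) auto
    ultimately show ?thesis using one_minus_cos_le_rho[of "t * real_of_int k"] by linarith
  qed
  from kmean_up_dominate[OF t _ this I] show ?thesis
    unfolding Dpsi_eq integral_Re[OF Dpsi_integrable[of t], symmetric] e by simp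
qed

lemma Dpsi_Im_le:
  assumes t: "0 < t" shows "\<bar>Im (Dpsi t)\<bar> \<le> C1 * ip t"
proof -
  have e: "Im (indicator {0<..} k *\<^sub>R (of_int k * (1 - cis t) - (1 - cis (t * real_of_int k))))
     = indicator {0<..} k * (real_of_int k * (t - sin t) - (t * real_of_int k - sin (t * real_of_int k)))" for k
    by (simp add: algebra_simps)
  note I = integrable_Im[OF Dpsi_integrable[of t], unfolded e]
  have "\<bar>real_of_int k * (t - sin t) - (t * real_of_int k - sin (t * real_of_int k))\<bar> \<le> real_of_int k * (8 * iota t) + 8 * iota (t * real_of_int k)"
    if "0 < k" for k
  proof -
    have "\<bar>real_of_int k * (t - sin t)\<bar> \<le> real_of_int k * (8 * iota t)"
      unfolding abs_mult using that u_minus_sin_le_iota[of t] by (intro mult_mono) auto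
    then show ?thesis using u_minus_sin_le_iota[of "t * real_of_int k"] by linarith
  qed
  from kmean_up_dominate[OF t _ this I] show ?thesis
    unfolding Dpsi_eq integral_Im[OF Dpsi_integrable[of t], symmetric] e by simp
qed

lemma norm_Dpsi_le:
  assumes t: "0 < t" shows "norm (Dpsi t) \<le> C1 * Jp t"
  using cmod_le[of "Dpsi t"] Dpsi_Re_le[OF t] Dpsi_Im_le[OF t] kmean_hub_eq[OF int, of "{0<..}" t]
  by (simp add: distrib_left)

text \<open>The range \<open>h <= 4 t\<close> accommodates the later shift \<open>h = pi/n\<close>
  at \<open>t >= 1/n\<close>.\<close>

lemma kmean_small_shift:
  assumes "0 < t" "0 < h" "h \<le> 4 * t"
  shows "kmean p hub S h \<le> 4 * (h / t) * kmean p hub S t"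
proof -
  have n: "0 \<le> kmean p hub S t" by (intro kmean_nonneg int) auto
  show ?thesis
  proof (cases "t \<le> h")
    case True
    have "kmean p hub S h \<le> (h / t)\<^sup>2 * kmean p hub S t" by (rule kmean_ratio(2)[OF int assms(1) True])
    also have "(h / t)\<^sup>2 \<le> 4 * (h / t)" unfolding power2_eq_square using assms by (intro mult_right_mono) (auto simp: divide_le_eq)
    finally show ?thesis using n by (simp add: mult_right_mono)
  next
    case False
    then have "(t / h) * kmean p hub S h \<le> kmean p hub S t" using assms by (intro kmean_ratio(1)[OF int]) auto
    then have "(h / t) * ((t / h) * kmean p hub S h) \<le> (h / t) * kmean p hub S t" using assms by (intro mult_left_mono) auto
    then have "kmean p hub S h \<le> (h / t) * kmean p hub S t" using assms by simp
    moreover have "0 \<le> (h / t) * kmean p hub S t" using n assms by (intro mult_nonneg_nonneg) auto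
    moreover have "a \<le> 4 * b" if "a \<le> b" "0 \<le> b" for a b :: real using that by linarith
    ultimately show ?thesis unfolding mult.assoc by blast
  qed
qed

text \<open>Only the first factor is capped by 2; the second supplies \<open>h k\<close> and with it
  the gain \<open>h/t\<close>.\<close>

lemma cis_product_bound:
  assumes "0 < t" "0 < h" "0 \<le> k"
  shows "norm ((cis (t * k) - 1) * (cis (h * k) - 1)) \<le> 4 * (h / t) * hub (t * k)"
proof -
  have "norm ((cis (t * k) - 1) * (cis (h * k) - 1)) \<le> min 2 (t * k) * (h * k)"
    unfolding norm_mult using norm_cis_minus_1_le[of "t * k"] norm_cis_minus_1_le[of "h * k"] assms
    by (intro mult_mono) auto
  also have "\<dots> = (h / t) * (min 2 (t * k) * (t * k))" using assms by simp
  also have "\<dots> \<le> (h / t) * (4 * hub (t * k))"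
    using assms by (intro mult_left_mono min_mult_le_hub) auto
  finally show ?thesis by (simp add: mult_ac)
qed

lemma cis_product_bound':
  assumes "0 < t" "0 < h"
  shows "norm ((cis (t * k) - 1) * (cis (h * k) - 1)) \<le> 4 * (h / t) * hub (t * k)"
proof (cases "0 \<le> k")
  case False
  have "norm (cis (- a) - 1) = norm (cis a - 1)" for a
    using complex_mod_cnj[of "cis a - 1"] by (simp add: cis_cnj)
  then have "norm ((cis (t * k) - 1) * (cis (h * k) - 1)) = norm ((cis (t * (- k)) - 1) * (cis (h * (- k)) - 1))"
    by (simp add: norm_mult)
  also have "\<dots> \<le> 4 * (h / t) * hub (t * (- k))" using assms False by (intro cis_product_bound) auto
  finally show ?thesis by simp
qed (use assms cis_product_bound in auto)

lemma cis_product_integral: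
  assumes "0 < t" "0 < h"
  shows "norm (\<integral>k. indicator S k *\<^sub>R ((cis (t * real_of_int k) - 1) * (cis (h * real_of_int k) - 1)) \<partial>measure_pmf p)
      \<le> 4 * (h / t) * kmean p hub S t"
    and "integrable (measure_pmf p) (\<lambda>k. indicator S k *\<^sub>R ((cis (t * real_of_int k) - 1) * (cis (h * real_of_int k) - 1)))"
proof -
  let ?f = "\<lambda>k. indicator S k *\<^sub>R ((cis (t * real_of_int k) - 1) * (cis (h * real_of_int k) - 1))"
  let ?g = "\<lambda>k. 4 * (h / t) * (indicator S k * hub (t * real_of_int k))"
  have g: "integrable (measure_pmf p) ?g" by (intro integrable_mult_right kmean_integrable int) auto
  have b: "norm (?f k) \<le> ?g k" for k
    using cis_product_bound'[OF assms, of "real_of_int k"] by (auto simp: indicator_def)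
  have b': "norm (?f k) \<le> norm (?g k)" for k
    by (rule order_trans[OF b]) (simp only: real_norm_def abs_ge_self)
  show f: "integrable (measure_pmf p) ?f"
    by (rule Bochner_Integration.integrable_bound[OF g]) (use b' in auto)
  have "norm (\<integral>k. ?f k \<partial>measure_pmf p) \<le> (\<integral>k. norm (?f k) \<partial>measure_pmf p)" by (rule integral_norm_bound)
  also have "\<dots> \<le> (\<integral>k. ?g k \<partial>measure_pmf p)" by (intro integral_mono integrable_norm f g b)
  finally show "norm (\<integral>k. ?f k \<partial>measure_pmf p) \<le> 4 * (h / t) * kmean p hub S t"
    by (simp add: kmean_def)
qed

text \<open>The Lipschitz bound \<open>psi_diff_le\<close> gives only a multiple of
  \<open>h\<close>, too much because \<open>J/t\<close> tends to 0. Here the increment of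
  \<open>cis\<close> at \<open>t\<close> is its increment at 0 plus a product of two increments;
  \<open>36 = 8 * 4 + 4\<close> collects the two parts.\<close>

lemma psi_shift_le:
  assumes t: "0 < t" and h: "0 < h" "h \<le> 4 * t"
  shows "norm (psi p (t + h) - psi p t) \<le> 36 * (h / t) * J t"
proof -
  have "psi p (t + h) - psi p t = (\<integral>k. cis (t * real_of_int k) - cis ((t + h) * real_of_int k) \<partial>measure_pmf p)"
    using cis_integrable by (simp add: psi_eq)
  also have "\<dots> = (\<integral>k. (1 - cis (h * real_of_int k)) - indicator UNIV k *\<^sub>R ((cis (t * real_of_int k) - 1) * (cis (h * real_of_int k) - 1)) \<partial>measure_pmf p)"
    by (intro Bochner_Integration.integral_cong refl) (simp add: distrib_right cis_mult[symmetric] algebra_simps)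
  also have "\<dots> = psi p h - (\<integral>k. indicator UNIV k *\<^sub>R ((cis (t * real_of_int k) - 1) * (cis (h * real_of_int k) - 1)) \<partial>measure_pmf p)"
    unfolding psi_def by (intro Bochner_Integration.integral_diff psi_integrable cis_product_integral t h)
  finally have "norm (psi p (t + h) - psi p t) \<le> norm (psi p h)
      + norm (\<integral>k. indicator UNIV k *\<^sub>R ((cis (t * real_of_int k) - 1) * (cis (h * real_of_int k) - 1)) \<partial>measure_pmf p)"
    by (simp only: norm_triangle_ineq4)
  then have "norm (psi p (t + h) - psi p t) \<le> norm (psi p h) + 4 * (h / t) * J t"
    using cis_product_integral(1)[OF t h(1), of UNIV] by linarith
  also have "norm (psi p h) \<le> 8 * (4 * (h / t) * J t)"
    using norm_psi_le[of h] kmean_small_shift[OF t h, of UNIV] by linarith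
  finally show ?thesis by (simp add: algebra_simps)
qed

definition C3 :: real where "C3 = 4 * up_ratio + 4 + 4 * C1"

text \<open>The same decomposition, for the positive jumps and for the unit jumps that replace them;
  having \<open>Jp\<close> in place of \<open>J\<close> makes the bound small.\<close>

lemma Dpsi_shift_le:
  assumes t: "0 < t" and h: "0 < h" "h \<le> 4 * t"
  shows "norm (Dpsi (t + h) - Dpsi t) \<le> C3 * (h / t) * Jp t"
proof -
  let ?A = "\<lambda>k. indicator {0<..} k *\<^sub>R ((cis (t * real_of_int k) - 1) * (cis (h * real_of_int k) - 1))"
  let ?w = "(cis (t * 1) - 1) * (cis (h * 1) - 1)"
  let ?B = "\<lambda>k. of_real (indicator {0<..} k * real_of_int k) * ?w"
  have BI: "integrable (measure_pmf p) ?B"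
    by (intro integrable_mult_left integrable_of_real half_integrable)
  have AI: "integrable (measure_pmf p) ?A" by (rule cis_product_integral[OF t h(1)])
  have "Dpsi (t + h) - Dpsi t = (\<integral>k. indicator {0<..} k *\<^sub>R (of_int k * (1 - cis (t + h)) - (1 - cis ((t + h) * real_of_int k)))
      - indicator {0<..} k *\<^sub>R (of_int k * (1 - cis t) - (1 - cis (t * real_of_int k))) \<partial>measure_pmf p)"
    unfolding Dpsi_eq by (rule Bochner_Integration.integral_diff[symmetric, OF Dpsi_integrable Dpsi_integrable])
  also have "\<dots> = (\<integral>k. indicator {0<..} k *\<^sub>R (of_int k * (1 - cis h) - (1 - cis (h * real_of_int k))) + (?A k - ?B k) \<partial>measure_pmf p)"
    by (intro Bochner_Integration.integral_cong refl) (auto simp: indicator_def distrib_right cis_mult[symmetric] algebra_simps)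
  also have "\<dots> = Dpsi h + ((\<integral>k. ?A k \<partial>measure_pmf p) - (\<integral>k. ?B k \<partial>measure_pmf p))"
    unfolding Dpsi_eq Bochner_Integration.integral_diff[OF AI BI, symmetric]
    by (intro Bochner_Integration.integral_add Dpsi_integrable Bochner_Integration.integrable_diff AI BI)
  also have "(\<integral>k. ?B k \<partial>measure_pmf p) = of_real up_mean * ?w"
    unfolding up_mean_def by (simp del: of_real_mult)
  finally have "norm (Dpsi (t + h) - Dpsi t) \<le> norm (Dpsi h) + (norm (\<integral>k. ?A k \<partial>measure_pmf p) + norm (of_real up_mean * ?w))"
    using norm_triangle_ineq[of "Dpsi h" "(\<integral>k. ?A k \<partial>measure_pmf p) - of_real up_mean * ?w"]
      norm_triangle_ineq4[of "(\<integral>k. ?A k \<partial>measure_pmf p)" "of_real up_mean * ?w"] by simp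
  also have "norm (of_real up_mean * ?w) \<le> 4 * (h / t) * (up_ratio * Jp t)"
  proof -
    have "norm (of_real up_mean * ?w) = up_mean * norm ?w"
      using up_mean_pos by (simp only: norm_mult[of "of_real up_mean"] norm_of_real abs_of_pos)
    also have "\<dots> \<le> up_mean * (4 * (h / t) * hub (t * 1))"
      using up_mean_pos cis_product_bound[OF t h(1), of 1] by (intro mult_left_mono) auto
    also have "\<dots> = 4 * (h / t) * (up_mean * hub t)" by simp
    also have "\<dots> \<le> 4 * (h / t) * (up_ratio * Jp t)" using t h by (intro mult_left_mono kmean_up_ge) auto
    finally show ?thesis .
  qed
  also have "norm (\<integral>k. ?A k \<partial>measure_pmf p) \<le> 4 * (h / t) * Jp t" by (rule cis_product_integral[OF t h(1)])
  also have "norm (Dpsi h) \<le> C1 * (4 * (h / t) * Jp t)"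
    using norm_Dpsi_le[OF h(1)] kmean_small_shift[OF t h, of "{0<..}"] C1_pos
    by (meson less_imp_le mult_left_mono order_trans)
  finally show ?thesis by (simp add: C3_def algebra_simps)
qed

lemma C3_pos: "0 < C3" unfolding C3_def using up_ratio_pos C1_pos by simp

lemma psi0_nonzero: "0 < t \<Longrightarrow> t \<le> pi \<Longrightarrow> psi0 t \<noteq> 0"
  using left_dominated_law.psi_nonzero[OF comparison_left_dominated, of t] norm_const_pos
  by (simp add: psi0_def)

lemma psi0_cont: "continuous_on A psi0"
proof -
  interpret C: left_dominated_law comparison by (rule comparison_left_dominated)
  show ?thesis unfolding psi0_def[abs_def] by (intro continuous_intros C.continuous_on_psi)
qed

text \<open>The Fourier kernel of \<open>pot - pot0 / norm_const\<close>.\<close>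

definition Fd :: "real \<Rightarrow> complex" where "Fd t = 1 / psi p t - 1 / psi0 t"


text \<open>The mixed terms keep the factor \<open>Im w\<close>. For \<open>w = psi * psi0\<close>
  it is at most a multiple of \<open>rr * ii\<close>, so the mixed term can be charged to
  \<open>rr/J^2\<close> or to \<open>ii/J^2\<close>, as required.\<close>

lemma complex_quotient_bounds:
  fixes D w :: complex
  assumes "0 < m" "m \<le> norm w"
  shows "\<bar>Re (D / w)\<bar> \<le> \<bar>Re D\<bar> / m + \<bar>Im D\<bar> * \<bar>Im w\<bar> / m\<^sup>2"
    and "\<bar>Im (D / w)\<bar> \<le> \<bar>Im D\<bar> / m + \<bar>Re D\<bar> * \<bar>Im w\<bar> / m\<^sup>2"
proof -
  have w: "0 < norm w" using assms by linarith
  have key: "\<bar>a * Re w\<bar> / (norm w)\<^sup>2 \<le> \<bar>a\<bar> / m" "\<bar>b * Im w\<bar> / (norm w)\<^sup>2 \<le> \<bar>b\<bar> * \<bar>Im w\<bar> / m\<^sup>2" for a b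
  proof -
    have "\<bar>a * Re w\<bar> / (norm w)\<^sup>2 \<le> (\<bar>a\<bar> * norm w) / (norm w)\<^sup>2"
      unfolding abs_mult using abs_Re_le_cmod[of w] by (intro divide_right_mono mult_left_mono) auto
    also have "\<dots> = \<bar>a\<bar> / norm w" using w by (simp add: power2_eq_square)
    also have "\<dots> \<le> \<bar>a\<bar> / m" using assms by (intro divide_left_mono mult_pos_pos w) auto
    finally show "\<bar>a * Re w\<bar> / (norm w)\<^sup>2 \<le> \<bar>a\<bar> / m" .
    show "\<bar>b * Im w\<bar> / (norm w)\<^sup>2 \<le> \<bar>b\<bar> * \<bar>Im w\<bar> / m\<^sup>2"
      unfolding abs_mult using assms w by (intro divide_left_mono power_mono mult_pos_pos) auto
  qed
  have "\<bar>Re (D / w)\<bar> \<le> \<bar>Re D * Re w\<bar> / (norm w)\<^sup>2 + \<bar>Im D * Im w\<bar> / (norm w)\<^sup>2"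
    unfolding Re_divide cmod_power2[symmetric] abs_divide add_divide_distrib[symmetric]
    using abs_triangle_ineq[of "Re D * Re w" "Im D * Im w"] by (simp add: divide_right_mono)
  also have "\<dots> \<le> \<bar>Re D\<bar> / m + \<bar>Im D\<bar> * \<bar>Im w\<bar> / m\<^sup>2" by (intro add_mono key)
  finally show "\<bar>Re (D / w)\<bar> \<le> \<bar>Re D\<bar> / m + \<bar>Im D\<bar> * \<bar>Im w\<bar> / m\<^sup>2" .
  have "\<bar>Im (D / w)\<bar> \<le> \<bar>Im D * Re w\<bar> / (norm w)\<^sup>2 + \<bar>Re D * Im w\<bar> / (norm w)\<^sup>2"
    unfolding Im_divide cmod_power2[symmetric] abs_divide add_divide_distrib[symmetric]
    using abs_triangle_ineq4[of "Im D * Re w" "Re D * Im w"] by (simp add: divide_right_mono)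
  also have "\<dots> \<le> \<bar>Im D\<bar> / m + \<bar>Re D\<bar> * \<bar>Im w\<bar> / m\<^sup>2" by (intro add_mono key)
  finally show "\<bar>Im (D / w)\<bar> \<le> \<bar>Im D\<bar> / m + \<bar>Re D\<bar> * \<bar>Im w\<bar> / m\<^sup>2" .
qed

text \<open>\<open>C\<close> is independent of \<open>\<epsilon>\<close>; only the neighbourhood
  \<open>d\<close> depends on it. The separate bounds on real and imaginary part avoid integrating
  \<open>1/J\<close>, and the bound on increments serves the oscillating part.\<close>

lemma Fd_local_bounds:
  obtains C where "0 < C" "\<And>\<epsilon>. 0 < \<epsilon> \<Longrightarrow> \<exists>d>0. d \<le> pi \<and> (\<forall>t. 0 < t \<longrightarrow> t \<le> d \<longrightarrow>
      Jp t \<le> \<epsilon> * J t \<and> norm (Fd t) \<le> C * \<epsilon> / J t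
      \<and> \<bar>Re (Fd t)\<bar> \<le> C * (rp t / (J t)\<^sup>2 + \<epsilon> * (rr t / (J t)\<^sup>2))
      \<and> \<bar>Im (Fd t)\<bar> \<le> C * (ip t / (J t)\<^sup>2 + \<epsilon> * (ii t / (J t)\<^sup>2))
      \<and> (\<forall>h. 0 < h \<longrightarrow> h \<le> 4 * t \<longrightarrow> t + h \<le> d \<longrightarrow> norm (Fd (t + h) - Fd t) \<le> C * \<epsilon> * (h / t) / J t))"
proof -
  obtain d0 where d0: "0 < d0" "\<And>t. 0 < t \<Longrightarrow> t \<le> d0 \<Longrightarrow> J t / 40 \<le> norm (psi p t)" using norm_psi_ge by blast
  \<comment> \<open>This makes \<open>|Dpsi| <= J/80\<close>, half of the lower bound
    \<open>J/40\<close> on \<open>|psi|\<close>; hence \<open>|psi0| >= J/80\<close> and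
    \<open>|psi psi0| >= J^2/3200\<close>.\<close>
  define e1 where "e1 = 1 / (80 * C1)"
  have e1: "0 < e1" using C1_pos by (simp add: e1_def)
  obtain d1 where d1: "0 < d1" "\<And>t. 0 < t \<Longrightarrow> t \<le> d1 \<Longrightarrow> Jp t \<le> e1 * J t" using Jp_le[OF e1] by blast
  define K where "K = 3200\<^sup>2 * (16 * (8 + C1)) * C1"
  \<comment> \<open>25 bounds the growth of \<open>J\<close> from \<open>t\<close> to
    \<open>t + h <= 5 t\<close>; 9 and 8 bound \<open>|psi0|/J\<close> and \<open>|psi|/J\<close>;
    36 and \<open>36 + C3\<close> come from the increments of \<open>psi\<close> and
    \<open>psi0\<close>.\<close>
  define K2 where "K2 = 9 * 36 * 25 + 8 * (36 + C3)"
  define C where "C = 3200 * C1 + K + 3200 * C3 + 3200\<^sup>2 * C1 * K2"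
  have K: "0 < K" "0 < K2" using C1_pos C3_pos by (auto simp: K_def K2_def)
  have Cpos: "0 < C" using C1_pos C3_pos K by (auto simp: C_def intro!: add_pos_pos)
  have Cge: "3200 * C1 \<le> C" "K \<le> C" "3200 * C3 + 3200\<^sup>2 * C1 * K2 \<le> C"
    using C1_pos C3_pos K by (auto simp: C_def)
  have "\<exists>d>0. d \<le> pi \<and> (\<forall>t. 0 < t \<longrightarrow> t \<le> d \<longrightarrow>
      Jp t \<le> \<epsilon> * J t \<and> norm (Fd t) \<le> C * \<epsilon> / J t
      \<and> \<bar>Re (Fd t)\<bar> \<le> C * (rp t / (J t)\<^sup>2 + \<epsilon> * (rr t / (J t)\<^sup>2))
      \<and> \<bar>Im (Fd t)\<bar> \<le> C * (ip t / (J t)\<^sup>2 + \<epsilon> * (ii t / (J t)\<^sup>2))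
      \<and> (\<forall>h. 0 < h \<longrightarrow> h \<le> 4 * t \<longrightarrow> t + h \<le> d \<longrightarrow> norm (Fd (t + h) - Fd t) \<le> C * \<epsilon> * (h / t) / J t))"
    if eps: "0 < \<epsilon>" for \<epsilon>
  proof -
    obtain d2 where d2: "0 < d2" "\<And>t. 0 < t \<Longrightarrow> t \<le> d2 \<Longrightarrow> Jp t \<le> \<epsilon> * J t" using Jp_le[OF eps] by blast
    define d where "d = Min {d0, d1, d2, pi}"
    have d: "0 < d" "d \<le> d0" "d \<le> d1" "d \<le> d2" "d \<le> pi" using d0 d1 d2 by (auto simp: d_def)
    let ?w = "\<lambda>t. psi p t * psi0 t"
    have Jt: "0 < J t" if "0 < t" for t using J_pos that .
    have nn: "0 \<le> rp t" "0 \<le> ip t" "0 \<le> rr t" "0 \<le> ii t" "0 \<le> Jp t" for t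
      by (intro kmean_nonneg int; simp)+
    have le: "rp t \<le> Jp t" "ip t \<le> Jp t" "rr t \<le> J t" "ii t \<le> J t" "rp t \<le> rr t" "ip t \<le> ii t" "Jp t \<le> J t" for t
      using kmean_hub_eq[OF int, of "{0<..}" t] kmean_hub_eq[OF int, of UNIV t] nn[of t]
        kmean_mono_set[OF int, of rho "{0<..}" UNIV t] kmean_mono_set[OF int, of iota "{0<..}" UNIV t] kmean_mono_set[OF int, of hub "{0<..}" UNIV t]
      by auto
    have psige: "J t / 40 \<le> norm (psi p t)" if "0 < t" "t \<le> d" for t using d0(2)[of t] that d by simp
    have Dle: "norm (Dpsi t) \<le> J t / 80" if "0 < t" "t \<le> d" for t
    proof -
      have "norm (Dpsi t) \<le> C1 * Jp t" by (rule norm_Dpsi_le[OF that(1)])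
      also have "\<dots> \<le> C1 * (e1 * J t)" using d1(2)[of t] that d C1_pos by (intro mult_left_mono) auto
      also have "\<dots> = J t / 80" using C1_pos by (simp add: e1_def)
      finally show ?thesis .
    qed
    have psi0ge: "J t / 80 \<le> norm (psi0 t)" if "0 < t" "t \<le> d" for t
      using psige[OF that] Dle[OF that] norm_triangle_ineq4[of "psi0 t" "Dpsi t"] by simp
    have psi0le: "norm (psi0 t) \<le> 9 * J t" if "0 < t" "t \<le> d" for t
      using norm_psi_le[of t] Dle[OF that] Jt[OF that(1)] norm_triangle_ineq[of "psi p t" "Dpsi t"] by simp
    have wge: "(J t)\<^sup>2 / 3200 \<le> norm (?w t)" if "0 < t" "t \<le> d" for t
    proof -
      have "(J t / 40) * (J t / 80) \<le> norm (psi p t) * norm (psi0 t)"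
        using psige[OF that] psi0ge[OF that] Jt[OF that(1)] by (intro mult_mono) auto
      then show ?thesis by (simp add: norm_mult power2_eq_square)
    qed
    have nz: "psi p t \<noteq> 0" "psi0 t \<noteq> 0" if "0 < t" "t \<le> d" for t
      using psi_nonzero[of t] psi0_nonzero[of t] that d by auto
    have Fdw: "Fd t = Dpsi t / ?w t" if "0 < t" "t \<le> d" for t
      using nz[OF that] by (simp add: Fd_def field_simps)
    have Imw: "\<bar>Im (?w t)\<bar> \<le> 16 * (8 + C1) * (rr t * ii t)" if t: "0 < t" for t
    proof -
      have R0: "\<bar>Re (psi0 t)\<bar> \<le> (8 + C1) * rr t"
      proof -
        have "\<bar>Re (psi0 t)\<bar> \<le> \<bar>Re (psi p t)\<bar> + \<bar>Re (Dpsi t)\<bar>" by simp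
        also have "\<dots> \<le> 8 * rr t + C1 * rr t"
        proof -
          have "C1 * rp t \<le> C1 * rr t" using le(5)[of t] C1_pos by (intro mult_left_mono) auto
          then show ?thesis using psi_Re_le[of t] psi_Re_nonneg[of p t] Dpsi_Re_le[OF t] by linarith
        qed
        finally show ?thesis by (simp add: distrib_right)
      qed
      have I0: "\<bar>Im (psi0 t)\<bar> \<le> (8 + C1) * ii t"
      proof -
        have "\<bar>Im (psi0 t)\<bar> \<le> \<bar>Im (psi p t)\<bar> + \<bar>Im (Dpsi t)\<bar>" by simp
        also have "\<dots> \<le> 8 * ii t + C1 * ii t"
        proof -
          have "C1 * ip t \<le> C1 * ii t" using le(6)[of t] C1_pos by (intro mult_left_mono) auto
          then show ?thesis using psi_Im_le[of t] Dpsi_Im_le[OF t] by linarith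
        qed
        finally show ?thesis by (simp add: distrib_right)
      qed
      have "\<bar>Im (?w t)\<bar> \<le> \<bar>Re (psi p t) * Im (psi0 t)\<bar> + \<bar>Im (psi p t) * Re (psi0 t)\<bar>"
        using abs_triangle_ineq by simp
      also have "\<dots> \<le> (8 * rr t) * ((8 + C1) * ii t) + (8 * ii t) * ((8 + C1) * rr t)"
        unfolding abs_mult using R0 I0 psi_Re_le[of t] psi_Re_nonneg[of p t] psi_Im_le[of t] nn[of t] C1_pos
        by (intro add_mono mult_mono) auto
      finally show ?thesis by (simp add: algebra_simps)
    qed
    have main: "Jp t \<le> \<epsilon> * J t \<and> norm (Fd t) \<le> C * \<epsilon> / J t
      \<and> \<bar>Re (Fd t)\<bar> \<le> C * (rp t / (J t)\<^sup>2 + \<epsilon> * (rr t / (J t)\<^sup>2))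
      \<and> \<bar>Im (Fd t)\<bar> \<le> C * (ip t / (J t)\<^sup>2 + \<epsilon> * (ii t / (J t)\<^sup>2))
      \<and> (\<forall>h. 0 < h \<longrightarrow> h \<le> 4 * t \<longrightarrow> t + h \<le> d \<longrightarrow> norm (Fd (t + h) - Fd t) \<le> C * \<epsilon> * (h / t) / J t)"
      if t: "0 < t" "t \<le> d" for t
    proof (intro conjI allI impI)
      define m where "m = (J t)\<^sup>2 / 3200"
      have J: "0 < J t" by (rule Jt[OF t(1)])
      have m: "0 < m" "m \<le> norm (?w t)" using wge[OF t] J by (auto simp: m_def)
      show je: "Jp t \<le> \<epsilon> * J t" using d2(2)[of t] t d by simp
      have "norm (Fd t) \<le> (C1 * Jp t) / m"
        unfolding Fdw[OF t] norm_divide using norm_Dpsi_le[OF t(1)] m C1_pos nn[of t] by (intro frac_le) auto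
      also have "\<dots> \<le> (C1 * (\<epsilon> * J t)) / m" using je C1_pos m by (intro divide_right_mono mult_left_mono) auto
      also have "\<dots> = 3200 * C1 * \<epsilon> / J t" using J by (simp add: m_def power2_eq_square)
      also have "\<dots> \<le> C * \<epsilon> / J t" using Cge eps J by (intro divide_right_mono mult_right_mono) auto
      finally show "norm (Fd t) \<le> C * \<epsilon> / J t" .
      \<comment> \<open>The small factor is \<open>Jp <= \<epsilon> J\<close>. Afterwards either
        \<open>rr\<close> or \<open>ii\<close> can be traded for \<open>J\<close>, see
        \<open>rest\<close>.\<close>
      have mixed: "a * \<bar>Im (?w t)\<bar> / m\<^sup>2 \<le> K * \<epsilon> * (rr t * ii t / (J t)^3)" if "0 \<le> a" "a \<le> C1 * Jp t" for a
      proof -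
        have "a * \<bar>Im (?w t)\<bar> / m\<^sup>2 \<le> (C1 * (\<epsilon> * J t)) * (16 * (8 + C1) * (rr t * ii t)) / m\<^sup>2"
        proof -
          have "a \<le> C1 * (\<epsilon> * J t)"
            by (rule order_trans[OF that(2) mult_left_mono[OF je]]) (use C1_pos in simp)
          then show ?thesis using that(1) Imw[OF t(1)] by (intro divide_right_mono mult_mono) auto
        qed
        also have "\<dots> = K * \<epsilon> * (rr t * ii t / (J t)^3)"
          using J by (simp add: m_def K_def power2_eq_square power3_eq_cube) (simp add: field_simps)
        finally show ?thesis .
      qed
      have rest: "rr t * ii t / (J t)^3 \<le> rr t / (J t)\<^sup>2" "rr t * ii t / (J t)^3 \<le> ii t / (J t)\<^sup>2"
      proof -
        have "rr t * ii t / (J t)^3 \<le> rr t * J t / (J t)^3" "rr t * ii t / (J t)^3 \<le> J t * ii t / (J t)^3"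
          using le[of t] nn[of t] J by (auto intro!: divide_right_mono mult_mono)
        then show "rr t * ii t / (J t)^3 \<le> rr t / (J t)\<^sup>2" "rr t * ii t / (J t)^3 \<le> ii t / (J t)\<^sup>2"
          using J by (auto simp: power2_eq_square power3_eq_cube)
      qed
      have first: "C1 * a / m \<le> C * (a / (J t)\<^sup>2)" if "0 \<le> a" for a
      proof -
        have "C1 * a / m = (3200 * C1) * (a / (J t)\<^sup>2)" using J by (simp add: m_def)
        also have "\<dots> \<le> C * (a / (J t)\<^sup>2)" using Cge that by (intro mult_right_mono) auto
        finally show ?thesis .
      qed
      have second: "K * \<epsilon> * b \<le> C * (\<epsilon> * b)" if "0 \<le> b" for b
        using Cge that eps by (simp add: mult_right_mono)
      have ImJ: "\<bar>Im (Dpsi t)\<bar> \<le> C1 * Jp t"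
        by (rule order_trans[OF Dpsi_Im_le[OF t(1)] mult_left_mono[OF le(2)]]) (use C1_pos in simp)
      have ReJ: "\<bar>Re (Dpsi t)\<bar> \<le> C1 * Jp t"
        by (rule order_trans[OF Dpsi_Re_le[OF t(1)] mult_left_mono[OF le(1)]]) (use C1_pos in simp)
      have "\<bar>Re (Fd t)\<bar> \<le> \<bar>Re (Dpsi t)\<bar> / m + \<bar>Im (Dpsi t)\<bar> * \<bar>Im (?w t)\<bar> / m\<^sup>2"
        unfolding Fdw[OF t] by (rule complex_quotient_bounds(1)[OF m])
      also have "\<dots> \<le> C1 * rp t / m + K * \<epsilon> * (rr t * ii t / (J t)^3)"
        using Dpsi_Re_le[OF t(1)] ImJ m
        by (intro add_mono divide_right_mono mixed) auto
      also have "\<dots> \<le> C * (rp t / (J t)\<^sup>2) + C * (\<epsilon> * (rr t / (J t)\<^sup>2))"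
        using nn[of t] rest(1) K eps J
        by (intro add_mono first order_trans[OF _ second] mult_left_mono) auto
      finally show "\<bar>Re (Fd t)\<bar> \<le> C * (rp t / (J t)\<^sup>2 + \<epsilon> * (rr t / (J t)\<^sup>2))" by (simp add: distrib_left)
      have "\<bar>Im (Fd t)\<bar> \<le> \<bar>Im (Dpsi t)\<bar> / m + \<bar>Re (Dpsi t)\<bar> * \<bar>Im (?w t)\<bar> / m\<^sup>2"
        unfolding Fdw[OF t] by (rule complex_quotient_bounds(2)[OF m])
      also have "\<dots> \<le> C1 * ip t / m + K * \<epsilon> * (rr t * ii t / (J t)^3)"
        using Dpsi_Im_le[OF t(1)] ReJ m
        by (intro add_mono divide_right_mono mixed) auto
      also have "\<dots> \<le> C * (ip t / (J t)\<^sup>2) + C * (\<epsilon> * (ii t / (J t)\<^sup>2))"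
        using nn[of t] rest(2) K eps J
        by (intro add_mono first order_trans[OF _ second] mult_left_mono) auto
      finally show "\<bar>Im (Fd t)\<bar> \<le> C * (ip t / (J t)\<^sup>2 + \<epsilon> * (ii t / (J t)\<^sup>2))" by (simp add: distrib_left)
      fix h assume h: "0 < h" "h \<le> 4 * t" "t + h \<le> d"
      have th: "0 < t + h" using t h by simp
      define q where "q = h / t"
      have q: "0 < q" using t h by (simp add: q_def)
      have J25: "J (t + h) \<le> 25 * J t"
      proof -
        have "J (t + h) \<le> ((t + h) / t)\<^sup>2 * J t" using t h by (intro kmean_ratio(2)[OF int]) auto
        also have "((t + h) / t)\<^sup>2 \<le> 5\<^sup>2" using t h by (intro power_mono) (auto simp: divide_le_eq)
        finally show ?thesis using J by (simp add: mult_right_mono)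
      qed
      have Jmon: "J t \<le> J (t + h)" using t h by (intro kmean_mono[OF int]) auto
      have m': "m \<le> norm (?w (t + h))"
      proof -
        have "m \<le> (J (t + h))\<^sup>2 / 3200" unfolding m_def using Jmon J by (intro divide_right_mono power_mono) auto
        then show ?thesis using wge[OF th h(3)] by linarith
      qed
      have dD: "norm (Dpsi (t + h) - Dpsi t) \<le> C3 * q * (\<epsilon> * J t)"
        by (rule order_trans[OF Dpsi_shift_le[OF t(1) h(1,2), folded q_def] mult_left_mono[OF je]]) (rule less_imp_le, rule mult_pos_pos[OF C3_pos q])
      have dD': "norm (Dpsi (t + h) - Dpsi t) \<le> C3 * q * J t"
        by (rule order_trans[OF Dpsi_shift_le[OF t(1) h(1,2), folded q_def] mult_left_mono[OF le(7)]]) (rule less_imp_le, rule mult_pos_pos[OF C3_pos q])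
      have dpsi: "norm (psi p (t + h) - psi p t) \<le> 36 * q * J t" by (rule psi_shift_le[OF t(1) h(1,2), folded q_def])
      have dpsi0: "norm (psi0 (t + h) - psi0 t) \<le> (36 + C3) * q * J t"
      proof -
        have "norm (psi0 (t + h) - psi0 t) = norm ((psi p (t + h) - psi p t) + (Dpsi (t + h) - Dpsi t))" by simp
        also have "\<dots> \<le> 36 * q * J t + C3 * q * J t"
          by (rule order_trans[OF norm_triangle_ineq add_mono[OF dpsi dD']])
        finally show ?thesis by (simp only: distrib_right)
      qed
      have dw: "norm (?w t - ?w (t + h)) \<le> K2 * q * (J t)\<^sup>2"
      proof -
        have "?w t - ?w (t + h) = (psi p t - psi p (t + h)) * psi0 (t + h) + psi p t * (psi0 t - psi0 (t + h))"
          by (simp add: algebra_simps)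
        then have "norm (?w t - ?w (t + h)) \<le> norm (psi p t - psi p (t + h)) * norm (psi0 (t + h)) + norm (psi p t) * norm (psi0 t - psi0 (t + h))"
          unfolding norm_mult[symmetric] by (simp only: norm_triangle_ineq)
        also have "\<dots> \<le> (36 * q * J t) * (9 * (25 * J t)) + (8 * J t) * ((36 + C3) * q * J t)"
          using dpsi dpsi0 psi0le[OF th h(3)] J25 norm_psi_le[of t] J q C3_pos
          by (intro add_mono mult_mono) (auto simp: norm_minus_commute)
        finally show ?thesis by (simp add: K2_def power2_eq_square algebra_simps)
      qed
      have wnz: "?w t \<noteq> 0" "?w (t + h) \<noteq> 0" using nz[OF t] nz[OF th h(3)] by auto
      have "Fd (t + h) - Fd t = (Dpsi (t + h) - Dpsi t) / ?w (t + h) + Dpsi t * (?w t - ?w (t + h)) / (?w t * ?w (t + h))"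
      proof -
        have "b / B - a / A = (b - a) / B + a * (A - B) / (A * B)" if "A \<noteq> 0" "B \<noteq> 0" for a b A B :: complex
          using that by (simp add: field_simps)
        from this[OF wnz] show ?thesis unfolding Fdw[OF t] Fdw[OF th h(3)] .
      qed
      then have "norm (Fd (t + h) - Fd t) \<le> norm (Dpsi (t + h) - Dpsi t) / norm (?w (t + h))
          + norm (Dpsi t) * norm (?w t - ?w (t + h)) / (norm (?w t) * norm (?w (t + h)))"
        unfolding norm_divide[symmetric] norm_mult[symmetric] by (simp only: norm_triangle_ineq)
      also have "\<dots> \<le> (C3 * q * (\<epsilon> * J t)) / m + (C1 * (\<epsilon> * J t)) * (K2 * q * (J t)\<^sup>2) / (m * m)"
      proof (intro add_mono frac_le mult_mono dD dw m m')
        show "norm (Dpsi t) \<le> C1 * (\<epsilon> * J t)"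
          by (rule order_trans[OF norm_Dpsi_le[OF t(1)] mult_left_mono[OF je]]) (use C1_pos in simp)
      qed (use m eps J C1_pos C3_pos K q in auto)
      also have "\<dots> = (3200 * C3 + 3200\<^sup>2 * C1 * K2) * \<epsilon> * q / J t"
        using J t by (simp add: m_def power2_eq_square field_simps)
      also have "\<dots> \<le> C * \<epsilon> * q / J t"
        using Cge eps q J by (intro divide_right_mono mult_right_mono) auto
      finally show "norm (Fd (t + h) - Fd t) \<le> C * \<epsilon> * (h / t) / J t" unfolding q_def .
    qed
    then show ?thesis using d by blast
  qed
  then show thesis using Cpos that by blast
qed

end

section \<open>Estimates of the Fourier integral\<close>

lemma set_norm_bound:
  fixes f :: "real \<Rightarrow> 'b::{banach, second_countable_topology}"
  assumes "set_integrable lborel A f" "set_integrable lborel A g" "\<And>t. t \<in> A \<Longrightarrow> norm (f t) \<le> g t"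
  shows "norm (LINT t:A|lborel. f t) \<le> (LINT t:A|lborel. g t)"
proof -
  have "norm (LINT t:A|lborel. f t) \<le> (\<integral>t. norm (indicator A t *\<^sub>R f t) \<partial>lborel)"
    unfolding set_lebesgue_integral_def by (rule integral_norm_bound)
  also have "\<dots> \<le> (LINT t:A|lborel. g t)"
    unfolding set_lebesgue_integral_def using assms unfolding set_integrable_def
    by (intro integral_mono integrable_norm) (auto simp: indicator_def)
  finally show ?thesis .
qed

lemma set_integral_open_split:
  fixes f :: "real \<Rightarrow> 'b::{banach, second_countable_topology}"
  assumes "a \<le> b" "b \<le> c" "set_integrable lborel {a<..<c} f"
  shows "(LINT t:{a<..<c}|lborel. f t) = (LINT t:{a<..<b}|lborel. f t) + (LINT t:{b<..<c}|lborel. f t)"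
proof -
  have "(LBINT t=ereal a..ereal b. f t) + (LBINT t=ereal b..ereal c. f t) = (LBINT t=ereal a..ereal c. f t)"
    using assms by (intro interval_integral_sum) (auto simp: interval_lebesgue_integrable_def min_def max_def)
  then show ?thesis using assms by (simp add: interval_lebesgue_integral_def)
qed

lemma set_integral_const_open: "a \<le> b \<Longrightarrow> (LINT t:{a<..<b}|lborel. c) = (b - a) * c" for c :: real
  by (simp add: set_lebesgue_integral_def)

lemma set_integrable_const_open: "set_integrable lborel {a<..<b} (\<lambda>t. c)" for a b c :: real
  by (rule set_integrable_subset[OF borel_integrable_atLeastAtMost'[of a b "\<lambda>t. c"]]) auto

lemma set_integrable_open_cont:
  fixes f :: "real \<Rightarrow> 'b::euclidean_space"
  assumes "continuous_on {a..b} f" "A \<subseteq> {a..b}" "A \<in> sets lborel"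
  shows "set_integrable lborel A f"
  by (rule set_integrable_subset[OF borel_integrable_atLeastAtMost'[OF assms(1)] assms(3,2)])

context left_dominated_law
begin

lemma Fd_cont: "0 < a \<Longrightarrow> b \<le> pi \<Longrightarrow> continuous_on {a..b} Fd"
  unfolding Fd_def[abs_def] using psi_nonzero psi0_nonzero
  by (intro continuous_intros continuous_on_psi psi0_cont) auto

abbreviation "dif_integrand x t \<equiv> Re ((1 - cis (real_of_int x * t)) * Fd t)"

lemma pot_difference:
  "pot x - pot0 x / norm_const = (LINT t:{0<..<pi}|lborel. dif_integrand x t) / pi"
  "set_integrable lborel {0<..<pi} (dif_integrand x)"
proof -
  interpret C: left_dominated_law comparison by (rule comparison_left_dominated)
  have e: "dif_integrand x t = pot_integrand x t - C.pot_integrand x t / norm_const" for t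
  proof -
    let ?z = "1 - cis (real_of_int x * t)"
    have gen: "z * (1 / a - 1 / (c * b)) = z / a - (z / b) / c" for z a b c :: complex
      by (simp add: right_diff_distrib mult.commute)
    have "?z * Fd t = ?z / psi p t - (?z / psi comparison t) / of_real norm_const"
      unfolding Fd_def psi0_def by (rule gen)
    then show ?thesis
      unfolding pot_integrand_def C.pot_integrand_def by (simp only: minus_complex.sel Re_divide_of_real)
  qed
  have I: "integrable lpi (\<lambda>t. C.pot_integrand x t / norm_const)"
    using C.pot_integrable by simp
  have "integrable lpi (dif_integrand x)"
    unfolding e by (intro Bochner_Integration.integrable_diff pot_integrable I)
  then show "set_integrable lborel {0<..<pi} (dif_integrand x)" unfolding lpi_integrable_iff .
  have "(LINT t:{0<..<pi}|lborel. dif_integrand x t) = integral\<^sup>L lpi (pot_integrand x) - integral\<^sup>L lpi (C.pot_integrand x) / norm_const"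
    unfolding lpi_integral_eq[symmetric] e
    by (subst Bochner_Integration.integral_diff[OF pot_integrable I]) simp
  then show "pot x - pot0 x / norm_const = (LINT t:{0<..<pi}|lborel. dif_integrand x t) / pi"
    by (simp add: pot_def pot0_def C.pot_def diff_divide_distrib)
qed

lemma square_ratio_mono: "0 < t \<Longrightarrow> t \<le> s \<Longrightarrow> t\<^sup>2 / J t \<le> s\<^sup>2 / J s"
  using kmean_ratio(2)[OF int, of t s UNIV] J_pos[of t] J_pos[of s]
  by (simp add: divide_simps power_divide) (simp add: mult.commute)

text \<open>Shifting \<open>t\<close> by the half period \<open>pi / n\<close> changes the sign of \<open>cis (x t)\<close>.\<close>

lemma oscillating_bound:
  assumes C: "0 < C" and e: "0 < \<epsilon>" and d: "0 < d" "d \<le> pi"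
    and F1: "\<And>t. 0 < t \<Longrightarrow> t \<le> d \<Longrightarrow> norm (Fd t) \<le> C * \<epsilon> / J t"
    and F2: "\<And>t h. 0 < t \<Longrightarrow> 0 < h \<Longrightarrow> h \<le> 4 * t \<Longrightarrow> t + h \<le> d \<Longrightarrow> norm (Fd (t + h) - Fd t) \<le> C * \<epsilon> * (h / t) / J t"
    and n: "0 < n" "12 / d \<le> real n" and x: "\<bar>x\<bar> = int n"
  shows "norm (LINT t:{1 / real n<..<d/2}|lborel. cis (real_of_int x * t) * Fd t) \<le> 4 * (C * \<epsilon> * bscale n) + 2 * d * (C * \<epsilon> / J (d/2))"
proof -
  define s where "s = 1 / real n"
  define h where "h = pi / real n"
  define t0 where "t0 = d / 2"
  have s: "0 < s" "12 * s \<le> d" using n d by (auto simp: s_def field_simps)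
  have hs: "h = pi * s" by (simp add: h_def s_def)
  have h: "0 < h" "h \<le> 4 * s" using s pi_gt_zero pi_less_4 by (auto simp: hs)
  \<comment> \<open>\<open>12 s <= d\<close> leaves room for a shift by \<open>h <= 4 s\<close> at
    both ends.\<close>
  have t0: "s + h < t0" "t0 + h \<le> d" "0 < t0" "t0 \<le> d" using h s d by (auto simp: t0_def)
  have J: "0 < J t" if "0 < t" for t using J_pos that .
  let ?G = "\<lambda>t. cis (real_of_int x * t) * Fd t"
  have Gc: "continuous_on {s..d} ?G"
    using s d by (intro continuous_intros Fd_cont) auto
  have GI: "set_integrable lborel A ?G" if "A \<subseteq> {s..d}" "A \<in> sets lborel" for A
    by (rule set_integrable_open_cont[OF Gc that])
  define X where "X = (LINT t:{s<..<t0}|lborel. ?G t)"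
  define Y where "Y = (LINT t:{s + h<..<t0 + h}|lborel. ?G t)"
  define P where "P = (LINT t:{s<..<s + h}|lborel. ?G t)"
  define M where "M = (LINT t:{s + h<..<t0}|lborel. ?G t)"
  define R where "R = (LINT t:{t0<..<t0 + h}|lborel. ?G t)"
  have XPM: "X = P + M"
    unfolding X_def P_def M_def using t0 h s by (intro set_integral_open_split GI) auto
  have YMR: "Y = M + R"
    unfolding Y_def R_def M_def using t0 h s by (intro set_integral_open_split GI) auto
  have cis_shift: "cis (real_of_int x * (t + h)) = - cis (real_of_int x * t)" for t
  proof -
    have "real_of_int x * h = pi \<or> real_of_int x * h = - pi"
    proof -
      have "x = int n \<or> x = - int n" using x by linarith
      then show ?thesis using n by (auto simp: h_def)
    qed
    then have "cis (real_of_int x * h) = - 1" by (auto simp: cis.ctr complex_eq_iff)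
    then show ?thesis by (simp add: distrib_left cis_mult[symmetric])
  qed
  \<comment> \<open>\<open>X + Y\<close> thus integrates an increment of \<open>Fd\<close> over the
    distance \<open>h\<close>, while \<open>2 X\<close> differs from \<open>X + Y\<close> by the end
    pieces \<open>P\<close> and \<open>R\<close> only.\<close>
  have Yshift: "Y = - (LINT t:{s<..<t0}|lborel. cis (real_of_int x * t) * Fd (t + h))"
  proof -
    have "Y = (\<integral>t. indicator {s + h<..<t0 + h} (h + 1 * t) *\<^sub>R ?G (h + 1 * t) \<partial>lborel)"
      unfolding Y_def set_lebesgue_integral_def
      by (subst lborel_integral_real_affine[of 1 _ h]) auto
    also have "\<dots> = (\<integral>t. - (indicator {s<..<t0} t *\<^sub>R (cis (real_of_int x * t) * Fd (t + h))) \<partial>lborel)"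
    proof (rule Bochner_Integration.integral_cong[OF refl])
      fix t
      have "indicator {s + h<..<t0 + h} (h + 1 * t) = (indicator {s<..<t0} t :: real)"
        by (auto simp: indicator_def)
      moreover have "?G (h + 1 * t) = - (cis (real_of_int x * t) * Fd (t + h))"
        using cis_shift[of t] by (simp add: add.commute)
      ultimately show "indicator {s + h<..<t0 + h} (h + 1 * t) *\<^sub>R ?G (h + 1 * t)
          = - (indicator {s<..<t0} t *\<^sub>R (cis (real_of_int x * t) * Fd (t + h)))" by simp
    qed
    finally show ?thesis by (simp add: set_lebesgue_integral_def)
  qed
  have Fc': "continuous_on {s..t0} (\<lambda>t. Fd (t + h))"
  proof (rule continuous_on_compose2[OF Fd_cont])
    show "0 < s" "d \<le> pi" using s d by auto
    show "continuous_on {s..t0} (\<lambda>t. t + h)" by (intro continuous_intros)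
    show "(\<lambda>t. t + h) ` {s..t0} \<subseteq> {s..d}" using h t0 by auto
  qed
  have I1: "set_integrable lborel {s<..<t0} (\<lambda>t. cis (real_of_int x * t) * Fd (t + h))"
    by (rule set_integrable_open_cont[of s t0]) (auto intro!: continuous_intros Fc')
  have I2: "set_integrable lborel {s<..<t0} ?G" using t0 by (intro GI) auto
  have XY: "X + Y = (LINT t:{s<..<t0}|lborel. ?G t - cis (real_of_int x * t) * Fd (t + h))"
    unfolding X_def Yshift using I1 I2 by (simp add: set_integral_diff)
  \<comment> \<open>\<open>J t >= (t/s) J s\<close> turns the bound on the increment into a multiple
    of \<open>1/t^2\<close>, whose integral is at most \<open>1/s\<close>.\<close>
  let ?g = "\<lambda>t. (C * \<epsilon> * h * (s / J s)) * (1 / t\<^sup>2)"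
  have D: "((\<lambda>t. - 1 / t) has_real_derivative 1 / t\<^sup>2) (at t)" if "s \<le> t" for t
    using that s by (auto intro!: derivative_eq_intros simp: power2_eq_square)
  have ct: "continuous_on {s..t0} (\<lambda>t. 1 / t\<^sup>2)" using s by (intro continuous_intros) auto
  have gI: "set_integrable lborel {s<..<t0} (\<lambda>t. 1 / t\<^sup>2)" "(LINT t:{s<..<t0}|lborel. 1 / t\<^sup>2) = - 1 / t0 - (- 1 / s)"
    by (rule set_integral_FTC_open[of s t0 "\<lambda>t. - 1 / t"]; use t0 h s D ct in simp)+
  have bs: "bscale n = s / J s" by (simp add: bscale_def s_def)
  have "norm (X + Y) \<le> (LINT t:{s<..<t0}|lborel. ?g t)"
    unfolding XY
  proof (rule set_norm_bound)
    show "set_integrable lborel {s<..<t0} (\<lambda>t. ?G t - cis (real_of_int x * t) * Fd (t + h))"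
      using I1 I2 by (intro set_integral_diff)
    show "set_integrable lborel {s<..<t0} ?g" by (intro set_integrable_mult_right) (use gI(1) in blast)
    fix t assume t: "t \<in> {s<..<t0}"
    then have tp: "0 < t" "s \<le> t" using s by auto
    have "norm (?G t - cis (real_of_int x * t) * Fd (t + h)) = norm (Fd (t + h) - Fd t)"
      by (simp add: right_diff_distrib[symmetric] norm_mult norm_minus_commute)
    also have "\<dots> \<le> C * \<epsilon> * (h / t) / J t"
      using t h t0 s by (intro F2) auto
    also have "\<dots> \<le> C * \<epsilon> * (h / t) / ((t / s) * J s)"
      using kmean_ratio(1)[OF int s(1) tp(2), of UNIV] C e h tp J[OF tp(1)] J[OF s(1)] s
      by (intro divide_left_mono mult_pos_pos divide_pos_pos mult_nonneg_nonneg) auto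
    also have "\<dots> = ?g t" using tp s by (simp add: power2_eq_square)
    finally show "norm (?G t - cis (real_of_int x * t) * Fd (t + h)) \<le> ?g t" .
  qed
  also have "\<dots> = (C * \<epsilon> * h * (s / J s)) * (1 / s - 1 / t0)"
    unfolding set_integral_mult_right gI(2) by simp
  also have "\<dots> \<le> (C * \<epsilon> * h * (s / J s)) * (1 / s)"
    using C e h s t0 J[OF s(1)] by (intro mult_left_mono mult_nonneg_nonneg) auto
  also have "\<dots> \<le> 4 * (C * \<epsilon> * (s / J s))"
  proof -
    have "(C * \<epsilon> * h * (s / J s)) * (1 / s) = h * (C * \<epsilon> / J s)" using s by simp
    also have "\<dots> \<le> (4 * s) * (C * \<epsilon> / J s)" using h C e J[OF s(1)] by (intro mult_right_mono) auto
    also have "\<dots> = 4 * (C * \<epsilon> * (s / J s))" by simp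
    finally show ?thesis .
  qed
  finally have b1: "norm (X + Y) \<le> 4 * (C * \<epsilon> * (s / J s))" .
  have piece: "norm (LINT t:{a<..<a + h}|lborel. ?G t) \<le> h * (C * \<epsilon> / J a)" if a: "s \<le> a" "a + h \<le> d" for a
  proof -
    have "norm (LINT t:{a<..<a + h}|lborel. ?G t) \<le> (LINT t:{a<..<a + h}|lborel. C * \<epsilon> / J a)"
    proof (rule set_norm_bound)
      show "set_integrable lborel {a<..<a + h} ?G" using a by (intro GI) auto
      fix t assume t: "t \<in> {a<..<a + h}"
      have "norm (?G t) \<le> C * \<epsilon> / J t" using F1[of t] t a s by (simp add: norm_mult)
      also have "\<dots> \<le> C * \<epsilon> / J a"
        using kmean_mono[OF int, of a t UNIV] a s t C e J[of a] J[of t]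
        by (intro divide_left_mono mult_pos_pos) auto
      finally show "norm (?G t) \<le> C * \<epsilon> / J a" .
    qed (rule set_integrable_const_open)
    also have "\<dots> = h * (C * \<epsilon> / J a)" using h by (subst set_integral_const_open) auto
    finally show ?thesis .
  qed
  have b2: "norm P \<le> 4 * (C * \<epsilon> * (s / J s))"
  proof -
    have "norm P \<le> h * (C * \<epsilon> / J s)" unfolding P_def using t0 h by (intro piece) auto
    also have "\<dots> \<le> (4 * s) * (C * \<epsilon> / J s)" using h C e J[OF s(1)] by (intro mult_right_mono) auto
    also have "\<dots> = 4 * (C * \<epsilon> * (s / J s))" by simp
    finally show ?thesis .
  qed
  have b3: "norm R \<le> 2 * (2 * d * (C * \<epsilon> / J t0))"
  proof -
    have "norm R \<le> h * (C * \<epsilon> / J t0)" unfolding R_def using t0 h s by (intro piece) auto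
    also have "\<dots> \<le> (2 * (2 * d)) * (C * \<epsilon> / J t0)" using h s d C e J[OF t0(3)] by (intro mult_right_mono) auto
    also have "\<dots> = 2 * (2 * d * (C * \<epsilon> / J t0))" by simp
    finally show ?thesis .
  qed
  have "2 * X = (X + Y) + P - R" using XPM YMR by (simp add: algebra_simps)
  then have "norm (2 * X) = norm ((X + Y) + P - R)" by (simp only:)
  also have "\<dots> \<le> norm (X + Y) + norm P + norm R"
    by (rule order_trans[OF norm_triangle_ineq4 add_right_mono[OF norm_triangle_ineq]])
  finally have "norm (2 * X) \<le> norm (X + Y) + norm P + norm R" .
  moreover have "norm (2 * X) = 2 * norm X" by (simp add: norm_mult)
  ultimately have "2 * norm X \<le> 8 * (C * \<epsilon> * (s / J s)) + 2 * (2 * d * (C * \<epsilon> / J t0))"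
    using b1 b2 b3 by linarith
  then show ?thesis unfolding X_def bs by (simp add: s_def t0_def)
qed

text \<open>\<open>K\<close> is universal while \<open>C\<close> and \<open>N\<close> depend on
  \<open>\<epsilon>\<close>; this is enough because \<open>bscale\<close> tends to infinity and
  outgrows \<open>C\<close>. The integral is cut at \<open>1/n\<close>, below which the phase
  \<open>x t\<close> is small, and at the fixed point \<open>d/2\<close>.\<close>

lemma comparison_estimate_aux:
  obtains K where "0 < K" "\<And>\<epsilon>. 0 < \<epsilon> \<Longrightarrow> \<exists>C N. \<forall>x. N \<le> nat \<bar>x\<bar> \<longrightarrow>
     \<bar>pot x - pot0 x / norm_const\<bar> \<le> C + K * \<epsilon> * bscale (nat \<bar>x\<bar>)"
proof -
  obtain C where C: "0 < C" and loc: "\<And>\<epsilon>. 0 < \<epsilon> \<Longrightarrow> \<exists>d>0. d \<le> pi \<and> (\<forall>t. 0 < t \<longrightarrow> t \<le> d \<longrightarrow>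
      Jp t \<le> \<epsilon> * J t \<and> norm (Fd t) \<le> C * \<epsilon> / J t
      \<and> \<bar>Re (Fd t)\<bar> \<le> C * (rp t / (J t)\<^sup>2 + \<epsilon> * (rr t / (J t)\<^sup>2))
      \<and> \<bar>Im (Fd t)\<bar> \<le> C * (ip t / (J t)\<^sup>2 + \<epsilon> * (ii t / (J t)\<^sup>2))
      \<and> (\<forall>h. 0 < h \<longrightarrow> h \<le> 4 * t \<longrightarrow> t + h \<le> d \<longrightarrow> norm (Fd (t + h) - Fd t) \<le> C * \<epsilon> * (h / t) / J t))"
    using Fd_local_bounds by blast
  \<comment> \<open>20 leaves slack over \<open>5 + 4 + 4\<close>: the range below
    \<open>1/n\<close>, then the constant and the oscillating part above it.\<close>
  have "\<exists>C' N. \<forall>x. N \<le> nat \<bar>x\<bar> \<longrightarrow> \<bar>pot x - pot0 x / norm_const\<bar> \<le> C' + (20 * C) * \<epsilon> * bscale (nat \<bar>x\<bar>)"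
    if e: "0 < \<epsilon>" for \<epsilon>
  proof -
    obtain d where d: "0 < d" "d \<le> pi"
      and je: "\<And>t. 0 < t \<Longrightarrow> t \<le> d \<Longrightarrow> Jp t \<le> \<epsilon> * J t"
      and F1: "\<And>t. 0 < t \<Longrightarrow> t \<le> d \<Longrightarrow> norm (Fd t) \<le> C * \<epsilon> / J t"
      and FR: "\<And>t. 0 < t \<Longrightarrow> t \<le> d \<Longrightarrow> \<bar>Re (Fd t)\<bar> \<le> C * (rp t / (J t)\<^sup>2 + \<epsilon> * (rr t / (J t)\<^sup>2))"
      and FI: "\<And>t. 0 < t \<Longrightarrow> t \<le> d \<Longrightarrow> \<bar>Im (Fd t)\<bar> \<le> C * (ip t / (J t)\<^sup>2 + \<epsilon> * (ii t / (J t)\<^sup>2))"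
      and F2: "\<And>t h. 0 < t \<Longrightarrow> 0 < h \<Longrightarrow> h \<le> 4 * t \<Longrightarrow> t + h \<le> d \<Longrightarrow> norm (Fd (t + h) - Fd t) \<le> C * \<epsilon> * (h / t) / J t"
    proof -
      from loc[OF e] obtain d where d: "0 < d" "d \<le> pi" and *: "\<forall>t. 0 < t \<longrightarrow> t \<le> d \<longrightarrow>
      Jp t \<le> \<epsilon> * J t \<and> norm (Fd t) \<le> C * \<epsilon> / J t
      \<and> \<bar>Re (Fd t)\<bar> \<le> C * (rp t / (J t)\<^sup>2 + \<epsilon> * (rr t / (J t)\<^sup>2))
      \<and> \<bar>Im (Fd t)\<bar> \<le> C * (ip t / (J t)\<^sup>2 + \<epsilon> * (ii t / (J t)\<^sup>2))
      \<and> (\<forall>h. 0 < h \<longrightarrow> h \<le> 4 * t \<longrightarrow> t + h \<le> d \<longrightarrow> norm (Fd (t + h) - Fd t) \<le> C * \<epsilon> * (h / t) / J t)"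
        by blast
      show thesis
      proof (rule that[OF d])
        fix t h :: real assume "0 < t" "0 < h" "h \<le> 4 * t" "t + h \<le> d"
        moreover have "t \<le> d" using calculation by linarith
        ultimately show "norm (Fd (t + h) - Fd t) \<le> C * \<epsilon> * (h / t) / J t" using * by blast
      qed (use * in blast)+
    qed
    define t0 where "t0 = d / 2"
    have t0: "0 < t0" "t0 \<le> d" "t0 < pi" using d pi_gt_zero by (auto simp: t0_def)
    have J: "0 < J t" if "0 < t" for t using J_pos that .
    have nn: "0 \<le> rp t" "0 \<le> ip t" "0 \<le> rr t" "0 \<le> ii t" "0 \<le> Jp t" for t
      by (intro kmean_nonneg int; simp)+
    have "\<exists>B. \<forall>t\<in>{t0..pi}. norm (Fd t) \<le> B"
      using compact_imp_bounded[OF compact_continuous_image[OF Fd_cont[OF t0(1), of pi]]]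
      by (auto simp: bounded_iff)
    then obtain B where B': "\<forall>t\<in>{t0..pi}. norm (Fd t) \<le> B" by blast
    have B: "norm (Fd t) \<le> B" if "t0 \<le> t" "t \<le> pi" for t using B' that by simp
    have B0: "0 \<le> B" using B[of t0] t0 by (meson less_imp_le norm_ge_zero order_refl order_trans)
    \<comment> \<open>\<open>Ca\<close> bounds the range above \<open>t0\<close>; \<open>Cb\<close>
      and \<open>Cc\<close> collect the contributions of the fixed end \<open>t0\<close>. None
      depends on \<open>x\<close>.\<close>
    define Ca where "Ca = pi * (2 * B)"
    define Cb where "Cb = C * (t0 * Jp t0 / (J t0)\<^sup>2 + \<epsilon> * (t0 * J t0 / (J t0)\<^sup>2))"
    define Cc where "Cc = 2 * d * (C * \<epsilon> / J t0)"
    have "\<bar>pot x - pot0 x / norm_const\<bar> \<le> (Ca + Cb + Cc) + (20 * C) * \<epsilon> * bscale (nat \<bar>x\<bar>)"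
      if x: "nat \<lceil>12 / d\<rceil> \<le> nat \<bar>x\<bar>" for x
    proof -
      define n where "n = nat \<bar>x\<bar>"
      have n10: "12 / d \<le> real n"
      proof -
        have "12 / d \<le> real_of_int \<lceil>12 / d\<rceil>" by (rule le_of_int_ceiling)
        also have "\<dots> \<le> real (nat \<lceil>12 / d\<rceil>)" by simp
        also have "\<dots> \<le> real n" using x unfolding n_def by (simp only: of_nat_le_iff)
        finally show ?thesis .
      qed
      have "0 < 12 / d" using d by simp
      then have npos: "0 < n" using n10 by (metis less_le_trans of_nat_0_less_iff)
      have xn: "\<bar>x\<bar> = int n" by (simp add: n_def)
      have xr: "\<bar>real_of_int x\<bar> = real n" by (simp add: n_def)
      define s where "s = 1 / real n"
      have s: "0 < s" "12 * s \<le> d" using n10 npos d by (auto simp: s_def field_simps)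
      have ns: "real n * s = 1" using npos by (simp add: s_def)
      have st0: "s < t0" using s d by (simp add: t0_def)
      have bs: "bscale n = s / J s" by (simp add: bscale_def s_def)
      let ?g = "dif_integrand x"
      have gI: "set_integrable lborel A ?g" if "A \<subseteq> {0<..<pi}" "A \<in> sets lborel" for A
        by (rule set_integrable_subset[OF pot_difference(2) that(2,1)])
      have split: "(LINT t:{0<..<pi}|lborel. ?g t) = (LINT t:{0<..<s}|lborel. ?g t) + ((LINT t:{s<..<t0}|lborel. ?g t) + (LINT t:{t0<..<pi}|lborel. ?g t))"
      proof -
        have "(LINT t:{0<..<pi}|lborel. ?g t) = (LINT t:{0<..<s}|lborel. ?g t) + (LINT t:{s<..<pi}|lborel. ?g t)"
          using s st0 t0 by (intro set_integral_open_split gI) auto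
        also have "(LINT t:{s<..<pi}|lborel. ?g t) = (LINT t:{s<..<t0}|lborel. ?g t) + (LINT t:{t0<..<pi}|lborel. ?g t)"
          using s st0 t0 by (intro set_integral_open_split gI) auto
        finally show ?thesis .
      qed
      have i3: "\<bar>LINT t:{t0<..<pi}|lborel. ?g t\<bar> \<le> Ca"
      proof -
        have "norm (LINT t:{t0<..<pi}|lborel. ?g t) \<le> (LINT t:{t0<..<pi}|lborel. 2 * B)"
        proof (rule set_norm_bound)
          show "set_integrable lborel {t0<..<pi} ?g" using t0 by (intro gI) auto
          fix t assume t: "t \<in> {t0<..<pi}"
          have "norm (?g t) \<le> norm ((1 - cis (real_of_int x * t)) * Fd t)"
            unfolding real_norm_def by (rule abs_Re_le_cmod)
          also have "\<dots> \<le> 2 * B" unfolding norm_mult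
            using norm_cis_minus_1_le[of "real_of_int x * t"] B[of t] t B0
            by (intro mult_mono) (auto simp: norm_minus_commute)
          finally show "norm (?g t) \<le> 2 * B" .
        qed (rule set_integrable_const_open)
        also have "\<dots> = (pi - t0) * (2 * B)" using t0 by (simp add: set_integral_const_open)
        also have "\<dots> \<le> Ca" unfolding Ca_def using B0 t0 by (intro mult_right_mono) auto
        finally show ?thesis by simp
      qed
      have i1: "\<bar>LINT t:{0<..<s}|lborel. ?g t\<bar> \<le> 5 * (C * \<epsilon> * (s / J s))"
      proof -
        \<comment> \<open>Below \<open>1/n\<close> the cosine part follows from
          \<open>1 - cos a <= (n t)^2\<close> and the monotonicity of \<open>t^2/J\<close>; the sine
          part calls for the integral of \<open>t i/J^2\<close>.\<close>
        let ?k = "(real n)\<^sup>2 * (C * \<epsilon>) * (s\<^sup>2 / J s)"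
        let ?w = "\<lambda>t. ?k + (real n * C) * (t * ip t / (J t)\<^sup>2) + (real n * C * \<epsilon>) * (t * ii t / (J t)\<^sup>2)"
        have T1: "set_integrable lborel {0<..<s} (\<lambda>t. t * ip t / (J t)\<^sup>2)"
          "(LINT t:{0<..<s}|lborel. t * ip t / (J t)\<^sup>2) \<le> 2 * \<epsilon> * (s\<^sup>2 / J s)"
          by (rule integral_i_over_J_square[OF int s(1) J_pos square_over_J_tendsto_0, where \<epsilon>=\<epsilon>]; use je st0 t0 in auto)+
        have T2: "set_integrable lborel {0<..<s} (\<lambda>t. t * ii t / (J t)\<^sup>2)"
          "(LINT t:{0<..<s}|lborel. t * ii t / (J t)\<^sup>2) \<le> 2 * 1 * (s\<^sup>2 / J s)"
          by (rule integral_i_over_J_square[OF int s(1) J_pos square_over_J_tendsto_0, where \<epsilon>=1]; simp)+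
        have wI: "set_integrable lborel {0<..<s} ?w"
          by (intro set_integral_add set_integrable_const_open set_integrable_mult_right) (use T1 T2 in auto)
        have "norm (LINT t:{0<..<s}|lborel. ?g t) \<le> (LINT t:{0<..<s}|lborel. ?w t)"
        proof (rule set_norm_bound[OF _ wI])
          show "set_integrable lborel {0<..<s} ?g" using st0 t0 by (intro gI) auto
          fix t assume t: "t \<in> {0<..<s}"
          then have tp: "0 < t" "t \<le> s" "t \<le> d" using st0 t0 by auto
          let ?a = "real_of_int x * t"
          have a: "\<bar>?a\<bar> = real n * t" using tp xr by (simp add: abs_mult)
          have "?g t = (1 - cos ?a) * Re (Fd t) + sin ?a * Im (Fd t)" by simp
          then have "\<bar>?g t\<bar> \<le> (1 - cos ?a) * \<bar>Re (Fd t)\<bar> + \<bar>sin ?a\<bar> * \<bar>Im (Fd t)\<bar>"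
            using abs_triangle_ineq[of "(1 - cos ?a) * Re (Fd t)" "sin ?a * Im (Fd t)"] by (simp add: abs_mult)
          also have "(1 - cos ?a) * \<bar>Re (Fd t)\<bar> \<le> (real n * t)\<^sup>2 * (C * \<epsilon> / J t)"
          proof (rule mult_mono)
            have "1 - cos ?a \<le> \<bar>?a\<bar>\<^sup>2 / 2" using one_minus_cos_le[of ?a] by simp
            also have "\<dots> \<le> (real n * t)\<^sup>2" unfolding a by simp
            finally show "1 - cos ?a \<le> (real n * t)\<^sup>2" .
            show "\<bar>Re (Fd t)\<bar> \<le> C * \<epsilon> / J t" using abs_Re_le_cmod[of "Fd t"] F1[OF tp(1,3)] by linarith
          qed auto
          also have "(real n * t)\<^sup>2 * (C * \<epsilon> / J t) = (real n)\<^sup>2 * (C * \<epsilon>) * (t\<^sup>2 / J t)"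
            by (simp add: power_mult_distrib)
          also have "\<dots> \<le> ?k" using square_ratio_mono[OF tp(1,2)] C e by (intro mult_left_mono) auto
          also have "\<bar>sin ?a\<bar> * \<bar>Im (Fd t)\<bar> \<le> (real n * t) * (C * (ip t / (J t)\<^sup>2 + \<epsilon> * (ii t / (J t)\<^sup>2)))"
            using abs_sin_x_le_abs_x[of ?a] FI[OF tp(1,3)] a tp by (intro mult_mono) auto
          finally show "norm (?g t) \<le> ?w t" by (simp add: algebra_simps)
        qed
        also have "\<dots> = (LINT t:{0<..<s}|lborel. ?k) + (real n * C) * (LINT t:{0<..<s}|lborel. t * ip t / (J t)\<^sup>2)
           + (real n * C * \<epsilon>) * (LINT t:{0<..<s}|lborel. t * ii t / (J t)\<^sup>2)"
        proof -
          have a1: "set_integrable lborel {0<..<s} (\<lambda>t. ?k)" by (rule set_integrable_const_open)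
          have a2: "set_integrable lborel {0<..<s} (\<lambda>t. (real n * C) * (t * ip t / (J t)\<^sup>2))"
            by (intro set_integrable_mult_right) (rule T1(1))
          have a3: "set_integrable lborel {0<..<s} (\<lambda>t. (real n * C * \<epsilon>) * (t * ii t / (J t)\<^sup>2))"
            by (intro set_integrable_mult_right) (rule T2(1))
          show ?thesis
            unfolding set_integral_add(2)[OF set_integral_add(1)[OF a1 a2] a3] set_integral_add(2)[OF a1 a2]
              set_integral_mult_right ..
        qed
        also have "\<dots> \<le> s * ?k + (real n * C) * (2 * \<epsilon> * (s\<^sup>2 / J s)) + (real n * C * \<epsilon>) * (2 * 1 * (s\<^sup>2 / J s))"
        proof (intro add_mono mult_left_mono T1(2) T2(2))
          show "(LINT t:{0<..<s}|lborel. ?k) \<le> s * ?k" using s by (subst set_integral_const_open) auto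
        qed (use C e in auto)
        also have "\<dots> = 5 * (C * \<epsilon> * (s / J s))"
        proof -
          have 1: "s * ?k = (real n * s) * (real n * s) * (C * \<epsilon> * (s / J s))" by (simp add: power2_eq_square)
          have 2: "(real n * C) * (2 * \<epsilon> * (s\<^sup>2 / J s)) = (real n * s) * (2 * (C * \<epsilon> * (s / J s)))"
            by (simp add: power2_eq_square)
          have 3: "(real n * C * \<epsilon>) * (2 * 1 * (s\<^sup>2 / J s)) = (real n * s) * (2 * (C * \<epsilon> * (s / J s)))"
            by (simp add: power2_eq_square)
          show ?thesis unfolding 1 2 3 ns by simp
        qed
        finally show ?thesis by simp
      qed
      \<comment> \<open>The integrand is \<open>Re Fd\<close> minus \<open>Re (cis a * Fd)\<close>:
        the first is handled by the integral of \<open>r/J^2\<close>, the second by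
        oscillation.\<close>
      have i2: "\<bar>LINT t:{s<..<t0}|lborel. ?g t\<bar> \<le> (Cb + 4 * (C * \<epsilon> * (s / J s))) + (Cc + 4 * (C * \<epsilon> * (s / J s)))"
      proof -
        let ?G = "\<lambda>t. cis (real_of_int x * t) * Fd t"
        have Gc: "continuous_on {s..t0} ?G" "continuous_on {s..t0} (\<lambda>t. Re (Fd t))"
          using s t0 by (intro continuous_intros Fd_cont; auto)+
        have GI: "set_integrable lborel {s<..<t0} ?G"
          by (rule set_integrable_open_cont[OF Gc(1)]) auto
        have RI: "set_integrable lborel {s<..<t0} (\<lambda>t. Re (Fd t))"
          by (rule set_integrable_open_cont[OF Gc(2)]) auto
        have GRI: "set_integrable lborel {s<..<t0} (\<lambda>t. Re (?G t))"
          by (rule set_integrable_open_cont[OF continuous_on_Re[OF Gc(1)]]) auto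
        have "(LINT t:{s<..<t0}|lborel. ?g t) = (LINT t:{s<..<t0}|lborel. Re (Fd t) - Re (?G t))"
          by (simp add: left_diff_distrib)
        also have "\<dots> = (LINT t:{s<..<t0}|lborel. Re (Fd t)) - (LINT t:{s<..<t0}|lborel. Re (?G t))"
          by (rule set_integral_diff[OF RI GRI])
        also have "(LINT t:{s<..<t0}|lborel. Re (?G t)) = Re (LINT t:{s<..<t0}|lborel. ?G t)"
          using integral_Re[OF GI[unfolded set_integrable_def]] unfolding set_lebesgue_integral_def by simp
        finally have eq: "(LINT t:{s<..<t0}|lborel. ?g t) = (LINT t:{s<..<t0}|lborel. Re (Fd t)) - Re (LINT t:{s<..<t0}|lborel. ?G t)" .
        have osc: "\<bar>Re (LINT t:{s<..<t0}|lborel. ?G t)\<bar> \<le> 4 * (C * \<epsilon> * (s / J s)) + Cc"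
        proof -
          have "norm (LINT t:{1 / real n<..<d/2}|lborel. ?G t) \<le> 4 * (C * \<epsilon> * bscale n) + 2 * d * (C * \<epsilon> / J (d/2))"
            by (rule oscillating_bound[OF C e d F1 F2 npos n10 xn])
          then show ?thesis using abs_Re_le_cmod[of "LINT t:{s<..<t0}|lborel. ?G t"]
            unfolding bs Cc_def s_def[symmetric] t0_def[symmetric] by linarith
        qed
        let ?v = "\<lambda>t. C * (rp t / (J t)\<^sup>2) + (C * \<epsilon>) * (rr t / (J t)\<^sup>2)"
        have T1: "set_integrable lborel {s<..<t0} (\<lambda>t. rp t / (J t)\<^sup>2)"
          "(LINT t:{s<..<t0}|lborel. rp t / (J t)\<^sup>2) \<le> t0 * Jp t0 / (J t0)\<^sup>2 + 2 * \<epsilon> * (s / J s)"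
          by (rule integral_r_over_J_square[OF int s(1) st0 J_pos, where \<epsilon>=\<epsilon>]; use je t0 in auto)+
        have T2: "set_integrable lborel {s<..<t0} (\<lambda>t. rr t / (J t)\<^sup>2)"
          "(LINT t:{s<..<t0}|lborel. rr t / (J t)\<^sup>2) \<le> t0 * J t0 / (J t0)\<^sup>2 + 2 * 1 * (s / J s)"
          by (rule integral_r_over_J_square[OF int s(1) st0 J_pos, of UNIV 1]; simp)+
        have vI: "set_integrable lborel {s<..<t0} (\<lambda>t. C * (rp t / (J t)\<^sup>2))" "set_integrable lborel {s<..<t0} (\<lambda>t. (C * \<epsilon>) * (rr t / (J t)\<^sup>2))"
          by (intro set_integrable_mult_right, rule T1(1), intro set_integrable_mult_right, rule T2(1))
        have "norm (LINT t:{s<..<t0}|lborel. Re (Fd t)) \<le> (LINT t:{s<..<t0}|lborel. ?v t)"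
        proof (rule set_norm_bound[OF RI set_integral_add(1)[OF vI]])
          fix t assume t: "t \<in> {s<..<t0}"
          then have "0 < t" "t \<le> d" using s t0 by auto
          from FR[OF this] show "norm (Re (Fd t)) \<le> ?v t" by (simp add: algebra_simps)
        qed
        also have "\<dots> = C * (LINT t:{s<..<t0}|lborel. rp t / (J t)\<^sup>2) + (C * \<epsilon>) * (LINT t:{s<..<t0}|lborel. rr t / (J t)\<^sup>2)"
          unfolding set_integral_add(2)[OF vI] set_integral_mult_right ..
        also have "\<dots> \<le> C * (t0 * Jp t0 / (J t0)\<^sup>2 + 2 * \<epsilon> * (s / J s)) + (C * \<epsilon>) * (t0 * J t0 / (J t0)\<^sup>2 + 2 * 1 * (s / J s))"
          using T1(2) T2(2) C e by (intro add_mono mult_left_mono) auto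
        also have "\<dots> = Cb + 4 * (C * \<epsilon> * (s / J s))" by (simp add: Cb_def algebra_simps)
        finally show ?thesis unfolding eq using osc by (simp add: abs_le_iff)
      qed
      have "\<bar>LINT t:{0<..<pi}|lborel. ?g t\<bar> \<le> (Ca + Cb + Cc) + 20 * (C * \<epsilon> * (s / J s))"
      proof -
        have "0 \<le> C * \<epsilon> * (s / J s)" using C e s J[OF s(1)] by simp
        then show ?thesis unfolding split using i1 i2 i3 by linarith
      qed
      moreover have "\<bar>pot x - pot0 x / norm_const\<bar> \<le> \<bar>LINT t:{0<..<pi}|lborel. ?g t\<bar>"
      proof -
        have "\<bar>LINT t:{0<..<pi}|lborel. ?g t\<bar> / pi \<le> \<bar>LINT t:{0<..<pi}|lborel. ?g t\<bar> / 1"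
          using pi_gt3 by (intro divide_left_mono) auto
        then show ?thesis unfolding pot_difference(1) by simp
      qed
      ultimately show ?thesis unfolding n_def[symmetric] bs by simp
    qed
    then show ?thesis by blast
  qed
  then show thesis using C by (intro that[of "20 * C"]) auto
qed

text \<open>At \<open>t = 1/n\<close> the scale is \<open>t/J(t)\<close>, the reciprocal of a
  quantity that vanishes because the mean is finite.\<close>

lemma bscale_at_top: "filterlim bscale at_top sequentially"
proof -
  have "filterlim (\<lambda>n. inverse (real n)) (at_right 0) sequentially"
    unfolding filterlim_at using LIMSEQ_inverse_real_of_nat
    by (auto intro!: eventually_sequentiallyI[of 1] lim_inverse_n)
  from filterlim_compose[OF J_over_t_tendsto_0 this]
  have lim: "(\<lambda>n. J (inverse (real n)) / inverse (real n)) \<longlonglongrightarrow> 0" .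
  have pos: "eventually (\<lambda>n. 0 < J (inverse (real n)) / inverse (real n)) sequentially"
    using J_pos by (intro eventually_sequentiallyI[of 1]) auto
  have "filterlim (\<lambda>n. inverse (J (inverse (real n)) / inverse (real n))) at_top sequentially"
    by (rule filterlim_inverse_at_top[OF lim pos])
  moreover have "inverse (J (inverse (real n)) / inverse (real n)) = bscale n" for n
    by (simp add: bscale_def field_simps)
  ultimately show ?thesis by simp
qed

text \<open>\<open>pot0 / norm_const\<close> is 0 at \<open>-n\<close> and at least
  \<open>bscale n / 2\<close> at \<open>n\<close>, and it differs from \<open>pot\<close> by
  \<open>o(bscale n)\<close>.\<close>

lemma pot_ratio_tendsto_0: "(\<lambda>n. pot (- int n) / pot (int n)) \<longlonglongrightarrow> 0"
  and pot_at_top: "filterlim (\<lambda>n. pot (int n)) at_top sequentially"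
proof -
  obtain K where K: "0 < K" and est: "\<And>\<epsilon>. 0 < \<epsilon> \<Longrightarrow> \<exists>C N. \<forall>x. N \<le> nat \<bar>x\<bar> \<longrightarrow>
     \<bar>pot x - pot0 x / norm_const\<bar> \<le> C + K * \<epsilon> * bscale (nat \<bar>x\<bar>)"
    using comparison_estimate_aux by blast
  have ev: "eventually (\<lambda>n. pot (- int n) \<le> \<eta> * bscale n \<and> (1/2 - \<eta>) * bscale n \<le> pot (int n) \<and> 1 \<le> bscale n) sequentially"
    if eta: "0 < \<eta>" for \<eta>
  proof -
    \<comment> \<open>\<open>\<eta>\<close> is split evenly between the constant \<open>C\<close>
      and the multiple of \<open>bscale\<close>.\<close>
    obtain C N where CN: "\<And>x. N \<le> nat \<bar>x\<bar> \<Longrightarrow> \<bar>pot x - pot0 x / norm_const\<bar> \<le> C + K * (\<eta> / (2 * K)) * bscale (nat \<bar>x\<bar>)"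
      using est[of "\<eta> / (2 * K)"] eta K by auto
    have "eventually (\<lambda>n. 2 * C / \<eta> \<le> bscale n) sequentially" "eventually (\<lambda>n. 1 \<le> bscale n) sequentially"
      using bscale_at_top unfolding filterlim_at_top by auto
    moreover have "eventually (\<lambda>n. max N 1 \<le> n) sequentially" by (rule eventually_ge_at_top)
    ultimately show ?thesis
    proof eventually_elim
      case (elim n)
      have C: "C \<le> \<eta> / 2 * bscale n" using elim(1) eta by (simp add: field_simps)
      have e: "K * (\<eta> / (2 * K)) = \<eta> / 2" using K by simp
      have "\<bar>pot (- int n) - 0\<bar> \<le> C + \<eta> / 2 * bscale n"
        using CN[of "- int n"] elim(3) pot0_neg[of n] unfolding e by simp
      then have 1: "pot (- int n) \<le> \<eta> * bscale n" using C by (simp add: algebra_simps)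
      have "\<bar>pot (int n) - pot0 (int n) / norm_const\<bar> \<le> C + \<eta> / 2 * bscale n"
        using CN[of "int n"] elim(3) unfolding e by simp
      moreover have "1/2 * bscale n \<le> pot0 (int n) / norm_const"
        using pot0_ge[of n] elim(3) norm_const_pos by (simp add: field_simps)
      ultimately have "(1/2 - \<eta>) * bscale n \<le> pot (int n)" using C unfolding left_diff_distrib abs_le_iff by linarith
      with 1 elim(2) show ?case by simp
    qed
  qed
  show "filterlim (\<lambda>n. pot (int n)) at_top sequentially"
    unfolding filterlim_at_top
  proof
    fix Z
    have "eventually (\<lambda>n. 4 * Z \<le> bscale n) sequentially" using bscale_at_top unfolding filterlim_at_top by auto
    then show "eventually (\<lambda>n. Z \<le> pot (int n)) sequentially"
      using ev[of "1/4", simplified] by eventually_elim linarith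
  qed
  show "(\<lambda>n. pot (- int n) / pot (int n)) \<longlonglongrightarrow> 0"
  proof (rule tendstoI)
    fix e :: real assume e: "0 < e"
    define \<eta> where "\<eta> = min (1/4) (e / 8)"
    have eta: "0 < \<eta>" "\<eta> \<le> 1/4" "8 * \<eta> \<le> e" using e by (auto simp: \<eta>_def)
    from ev[OF eta(1)] show "eventually (\<lambda>n. dist (pot (- int n) / pot (int n)) 0 < e) sequentially"
    proof eventually_elim
      case (elim n)
      have "1/4 * bscale n \<le> (1/2 - \<eta>) * bscale n" using eta elim by (intro mult_right_mono) auto
      then have p: "1/4 * bscale n \<le> pot (int n)" using elim by linarith
      then have pp: "0 < pot (int n)" using elim by linarith
      have "pot (- int n) < e * pot (int n)"
      proof -
        have "8 * (\<eta> * bscale n) \<le> e * bscale n" using eta elim mult_right_mono[OF eta(3), of "bscale n"] by simp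
        moreover have "e * (1/4 * bscale n) \<le> e * pot (int n)" using p e by (intro mult_left_mono) auto
        moreover have "0 < e * bscale n" using e elim by simp
        ultimately show ?thesis using elim by linarith
      qed
      then show ?case using pp potential_nonneg[of "- int n"] by (simp add: divide_less_eq)
    qed
  qed
qed

end

section \<open>Escape from an interval\<close>

text \<open>Strong Markov property at the first visit to \<open>B\<close> or 0; whatever follows a
  visit to \<open>B\<close> has probability at most 1.\<close>

lemma hit_before_mono:
  assumes "A \<subseteq> B" "0 \<notin> B"
  shows "hit_before p A {0} x \<le> hit_before p B {0} x"
proof -
  have le1: "hit_exp p 1 (A \<union> {0}) (indicator A) z \<le> 1" for z
    by (rule hit_exp_le_1) (auto simp: indicator_def)
  have "hit_exp p 1 (A \<union> {0}) (indicator A) x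
    = hit_exp p 1 (B \<union> {0}) (\<lambda>z. if z \<in> A \<union> {0} then indicator A z else hit_exp p 1 (A \<union> {0}) (indicator A) z) x"
    by (rule hit_exp_strong_markov) (use assms in auto)
  also have "\<dots> \<le> hit_exp p 1 (B \<union> {0}) (indicator B) x"
    using assms le1 by (intro hit_exp_mono) (auto simp: indicator_def)
  finally have "ennreal (hit_before p A {0} x) \<le> ennreal (hit_before p B {0} x)"
    by (simp add: ennreal_disc_hit)
  then show ?thesis by (simp add: disc_hit_nonneg)
qed

text \<open>Adding 0 to the stopping set and paying nothing there restricts the mean to exits that
  precede the return to 0.\<close>

definition exit_mean :: "int pmf \<Rightarrow> int set \<Rightarrow> int \<Rightarrow> (int \<Rightarrow> real) \<Rightarrow> ennreal" where
  "exit_mean p E x f = hit_exp p 1 (E \<union> {0}) (\<lambda>z. if z \<in> E then ennreal (f z) else 0) x"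

lemma exit_mean_add:
  assumes "\<And>z. z \<in> E \<Longrightarrow> 0 \<le> f z" "\<And>z. z \<in> E \<Longrightarrow> 0 \<le> g z"
  shows "exit_mean p E x (\<lambda>z. f z + g z) = exit_mean p E x f + exit_mean p E x g"
  unfolding exit_mean_def hit_exp_add[symmetric] using assms by (intro hit_exp_cong) auto

lemma exit_mean_cmult:
  assumes "0 \<le> c" "\<And>z. z \<in> E \<Longrightarrow> 0 \<le> f z"
  shows "exit_mean p E x (\<lambda>z. c * f z) = ennreal c * exit_mean p E x f"
  unfolding exit_mean_def hit_exp_cmult[symmetric] using assms by (intro hit_exp_cong) (auto simp: ennreal_mult)

lemma exit_mean_mono:
  assumes "\<And>z. z \<in> E \<Longrightarrow> f z \<le> g z"
  shows "exit_mean p E x f \<le> exit_mean p E x g"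
  unfolding exit_mean_def using assms by (intro hit_exp_mono) (auto intro: ennreal_leI)

text \<open>Strong Markov property at the exit: from a point of \<open>E\<close> outside
  \<open>A\<close> the walk still has to find \<open>A\<close> before 0.\<close>

lemma exit_mean_hit_before:
  assumes "A \<subseteq> E" "0 \<notin> E"
  shows "exit_mean p E x (\<lambda>z. if z \<in> A then 1 else hit_before p A {0} z) = ennreal (hit_before p A {0} x)"
proof -
  have "ennreal (hit_before p A {0} x) = hit_exp p 1 (A \<union> {0}) (indicator A) x"
    using ennreal_disc_hit[of 1 p A "{0}" x] by simp
  also have "\<dots> = hit_exp p 1 (E \<union> {0}) (\<lambda>z. if z \<in> A \<union> {0} then indicator A z else hit_exp p 1 (A \<union> {0}) (indicator A) z) x"
    by (rule hit_exp_strong_markov) (use assms in auto)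
  also have "\<dots> = exit_mean p E x (\<lambda>z. if z \<in> A then 1 else hit_before p A {0} z)"
    unfolding exit_mean_def using assms ennreal_disc_hit[of 1 p A "{0}"] by (intro hit_exp_cong) (auto simp: indicator_def)
  finally show ?thesis by simp
qed

text \<open>A jump of size at least 2 rules out upward skip-free walks, whose potential vanishes on
  the negative half-line. It makes the potential positive off 0, so that ratios of its values make
  sense.\<close>

locale escape_law = left_dominated_law +
  assumes big_step: "\<exists>u\<in>set_pmf p. 2 \<le> u"
begin

abbreviation pot_dagger :: "int \<Rightarrow> real" where "pot_dagger x \<equiv> (if x = 0 then 1 else 0) + pot x"

text \<open>A mean of nonnegative values that equals 0 has only zero values on the support.\<close>

lemma pot_zero_propagates:
  assumes "x \<noteq> 0" "pot x = 0" "v \<in> set_pmf p"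
  shows "pot (x + v) = 0"
proof -
  have "(\<integral>v. pot (x + v) \<partial>measure_pmf p) = 0" using potential_harmonic(2)[of x] assms by simp
  then have "AE v in measure_pmf p. pot (x + v) = 0"
    using potential_harmonic(1)[of x] by (subst (asm) integral_nonneg_eq_0_iff_AE) (auto simp: potential_nonneg)
  then show ?thesis using assms(3) by (simp add: AE_measure_pmf_iff)
qed

text \<open>A zero would propagate along \<open>x + j u\<close> to infinity, where the potential
  diverges.\<close>

lemma pot_pos_pos:
  assumes "0 < x" shows "0 < pot x"
proof (rule ccontr)
  assume "\<not> 0 < pot x"
  then have z: "pot x = 0" using potential_nonneg[of x] by simp
  obtain u where u: "u \<in> set_pmf p" "2 \<le> u" using big_step by blast
  have zero: "pot (x + int j * u) = 0" for j
  proof (induction j)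
    case (Suc j)
    have "0 < x + int j * u" using assms u by (simp add: add_pos_nonneg)
    then have "pot (x + int j * u + u) = 0" using Suc u by (intro pot_zero_propagates[of "x + int j * u"]) auto
    then show ?case by (simp add: algebra_simps)
  qed (use z in simp)
  obtain N where N: "\<And>n. N \<le> n \<Longrightarrow> 1 \<le> pot (int n)"
    using pot_at_top unfolding filterlim_at_top eventually_sequentially by blast
  have "int N \<le> int N * u" using u mult_left_mono[of 1 u "int N"] by simp
  then have "N \<le> nat (x + int N * u)" using assms by linarith
  moreover have "0 \<le> x + int N * u" using assms u by simp
  ultimately show False using N[of "nat (x + int N * u)"] zero[of N] by simp
qed

text \<open>Zeros propagate along support jumps and can never enter the positive half-line. At the
  zero \<open>-m0\<close> closest to 0 a positive jump must therefore land exactly on 0, so it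
  equals \<open>m0\<close>. Then all negative zeros, and hence all jumps, are multiples of
  \<open>m0 >= 2\<close>, against irreducibility.\<close>

lemma pot_pos_neg:
  assumes "x < 0" shows "0 < pot x"
proof (rule ccontr)
  define Z where "Z m \<longleftrightarrow> 0 < m \<and> pot (- int m) = 0" for m
  assume "\<not> 0 < pot x"
  then have "pot x = 0" using potential_nonneg[of x] by simp
  then have "Z (nat (- x))" using assms by (simp add: Z_def)
  then have ex: "\<exists>m. Z m" by blast
  define m0 where "m0 = (LEAST m. Z m)"
  have Zm0: "Z m0" and min: "\<And>m. Z m \<Longrightarrow> m0 \<le> m"
    using ex unfolding m0_def by (auto intro: LeastI_ex Least_le)
  have down: "v \<le> int m \<and> (v < int m \<longrightarrow> Z (nat (int m - v)))" if "Z m" "v \<in> set_pmf p" for m v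
  proof -
    have z: "pot (- int m + v) = 0" using that by (intro pot_zero_propagates) (auto simp: Z_def)
    have "v \<le> int m"
    proof (rule ccontr)
      assume "\<not> v \<le> int m"
      then have "0 < pot (- int m + v)" by (intro pot_pos_pos) simp
      then show False using z by simp
    qed
    moreover have "Z (nat (int m - v))" if "v < int m" using z that by (simp add: Z_def)
    ultimately show ?thesis by blast
  qed
  have pos_step: "v = int m0" if "v \<in> set_pmf p" "0 < v" for v
  proof (rule ccontr)
    assume ne: "v \<noteq> int m0"
    with down[OF Zm0 that(1)] have "Z (nat (int m0 - v))" "v < int m0" by auto
    then have "m0 \<le> nat (int m0 - v)" using min by blast
    then show False using that(2) \<open>v < int m0\<close> by linarith
  qed
  obtain u where u: "u \<in> set_pmf p" "2 \<le> u" using big_step by blast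
  have um: "u = int m0" using pos_step u by simp
  have mult: "m0 dvd m" if "Z m" for m
    using that
  proof (induction m rule: less_induct)
    case (less m)
    have "u \<le> int m" "u < int m \<longrightarrow> Z (nat (int m - u))" using down[OF less.prems u(1)] by auto
    show ?case
    proof (cases "u = int m")
      case True then show ?thesis using um by simp
    next
      case False
      then have lt: "u < int m" using \<open>u \<le> int m\<close> by simp
      then have "Z (m - m0)" using \<open>u < int m \<longrightarrow> Z (nat (int m - u))\<close> um by (simp add: nat_diff_distrib)
      moreover have "m - m0 < m" using lt um u by simp
      ultimately have "m0 dvd m - m0" using less.IH by blast
      then have "m0 dvd (m - m0) + m0" by (intro dvd_add) auto
      moreover have "(m - m0) + m0 = m" using lt um by simp
      ultimately show ?thesis by simp
    qed
  qed
  have all: "int m0 dvd v" if v: "v \<in> set_pmf p" for v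
  proof (cases "v = int m0")
    case False
    with down[OF Zm0 v] have "Z (nat (int m0 - v))" by auto
    then have "m0 dvd nat (int m0 - v)" by (rule mult)
    then have "int m0 dvd int (nat (int m0 - v))" by (simp only: of_nat_dvd_iff)
    moreover have "v \<le> int m0" using down[OF Zm0 v] by simp
    ultimately have "int m0 dvd int m0 - v" by simp
    then have "int m0 dvd int m0 - (int m0 - v)" by (rule dvd_diff[OF dvd_refl])
    moreover have "int m0 - (int m0 - v) = v" by simp
    ultimately show ?thesis by (simp only:)
  qed simp
  \<comment> \<open>At this frequency every jump gives \<open>cis (t k) = 1\<close>, so
    \<open>psi\<close> would vanish at \<open>t\<close>; \<open>m0 >= 2\<close> places
    \<open>t\<close> in \<open>(0, pi]\<close>.\<close>
  define t where "t = 2 * pi / real m0"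
  have m2: "2 \<le> m0" using um u by simp
  have t: "0 < t" "t \<le> pi" using m2 by (auto simp: t_def field_simps)
  have "AE k in measure_pmf p. 1 - cis (t * real_of_int k) = 0"
  proof (rule AE_pmfI)
    fix k assume "k \<in> set_pmf p"
    then obtain j where "k = int m0 * j" using all by (auto elim: dvdE)
    then have "t * real_of_int k = 2 * pi * real_of_int j" using m2 by (simp add: t_def)
    then show "1 - cis (t * real_of_int k) = 0" by simp
  qed
  then have "psi p t = 0" unfolding psi_def by (rule integral_eq_zero_AE)
  then show False using psi_nonzero[OF t] by simp
qed

lemma pot_pos: "x \<noteq> 0 \<Longrightarrow> 0 < pot x"
  using pot_pos_pos[of x] pot_pos_neg[of x] by linarith

lemma pot_dagger_pos: "0 < pot_dagger x"
  using pot_pos[of x] by (cases "x = 0") auto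

lemma pot_ratio_bound:
  obtains C where "0 < C" "\<And>j. 0 < j \<Longrightarrow> pot (- j) \<le> C * pot j"
proof -
  have "Bseq (\<lambda>n. pot (- int n) / pot (int n))"
    by (rule convergent_imp_Bseq[OF convergentI[OF pot_ratio_tendsto_0]])
  then obtain B where B': "\<forall>n. norm (pot (- int n) / pot (int n)) \<le> B" by (rule BseqE)
  have B: "\<bar>pot (- int n) / pot (int n)\<bar> \<le> B" for n using B'[rule_format, of n] by simp
  have "pot (- j) \<le> (\<bar>B\<bar> + 1) * pot j" if "0 < j" for j
  proof -
    have "pot (- j) / pot j \<le> B" using order_trans[OF abs_ge_self B[of "nat j"]] that by simp
    then have "pot (- j) \<le> B * pot j" using pot_pos[of j] that by (simp add: divide_le_eq)
    also have "\<dots> \<le> (\<bar>B\<bar> + 1) * pot j" using potential_nonneg[of j] by (intro mult_right_mono) auto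
    finally show ?thesis .
  qed
  then show thesis by (intro that[of "\<bar>B\<bar> + 1"]) auto
qed

lemma pot_ratio_small:
  assumes "0 < e" obtains N :: nat where "\<And>R. N \<le> R \<Longrightarrow> 0 < R \<Longrightarrow> pot (- int R) \<le> e * pot (int R)"
proof -
  have "eventually (\<lambda>n. pot (- int n) / pot (int n) < e) sequentially"
    using pot_ratio_tendsto_0 assms by (rule order_tendstoD)
  then obtain N where N: "\<And>n. N \<le> n \<Longrightarrow> pot (- int n) / pot (int n) < e" by (auto simp: eventually_sequentially)
  have "pot (- int R) \<le> e * pot (int R)" if "N \<le> R" "0 < R" for R
    using N[OF that(1)] pot_pos[of "int R"] that(2) by (simp add: divide_less_eq less_imp_le)
  then show thesis by (rule that)
qed

text \<open>The quantitative core for fixed \<open>Q\<close>, \<open>R\<close> and \<open>x\<close>: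
  \<open>e\<close> bounds the two ratios and the closeness condition, \<open>C\<close> bounds
  \<open>pot (- j) / pot j\<close> for all \<open>j > 0\<close>. The factor on the left reflects the
  missed exits below \<open>-Q\<close>, the one on the right the overshoot above
  \<open>R\<close>.\<close>

lemma escape_comparison:
  fixes Q R :: nat
  assumes C: "0 < C" "\<And>j. 0 < j \<Longrightarrow> pot (- j) \<le> C * pot j"
    and e: "0 < e" "e * C \<le> 1 / 2" "e \<le> 1 / 2"
    and ratio: "pot (- int Q) \<le> e * pot (int Q)" "pot (- int R) \<le> e * pot (int R)"
    and QR: "0 < Q" "0 < R" and x: "- int Q < x" "x < int R"
    and close: "\<bar>(pot (- int R) - pot (- int R + x)) / pot_dagger x\<bar> < e"
  defines "Ph \<equiv> hit_before p {- int Q, int R} {0} x"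
    and "Pe \<equiv> hit_before p (UNIV - {- int Q<..<int R}) {0} x"
  shows "0 < Ph" "Ph \<le> Pe"
    and "Pe * (1 - (1 + C) * e) \<le> Ph * (1 + 2 * (1 + C) * (2 * (1 + C) + 2) * e)"
proof -
  define E where "E = UNIV - {- int Q<..<int R}"
  define A where "A = pot (int R) + pot (- int R)"
  \<comment> \<open>\<open>A\<close> times the probability of hitting \<open>R\<close> before 0 from
    \<open>x\<close>; the closeness condition makes it at least \<open>(1 - e)\<close> times
    \<open>pot_dagger x\<close>.\<close>
  define g where "g = pot_dagger x + pot (- int R) - pot (x - int R)"
  define ad where "ad = pot_dagger x"
  have ad: "0 < ad" unfolding ad_def by (rule pot_dagger_pos)
  have E0: "0 \<notin> E" and Ein: "{- int Q, int R} \<subseteq> E" "{int R} \<subseteq> E" using QR by (auto simp: E_def)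
  have pR: "0 < pot (int R)" "0 < pot (int Q)" using pot_pos QR by auto
  have pm: "0 \<le> pot z" for z by (rule potential_nonneg)
  have Apos: "0 < A" "pot (int R) \<le> A" unfolding A_def using pR pm[of "- int R"] by auto
  show PhPe: "Ph \<le> Pe"
    unfolding Ph_def Pe_def E_def[symmetric] by (rule hit_before_mono[OF Ein(1) E0])
  have Rg: "hit_before p {int R} {0} x * A = g"
    unfolding A_def g_def using QR x by (intro hit_before_potential) auto
  have RPh: "hit_before p {int R} {0} x \<le> Ph"
    unfolding Ph_def by (rule hit_before_mono) (use QR in auto)
  have D: "\<bar>pot (- int R) - pot (x - int R)\<bar> \<le> e * ad"
  proof -
    have "\<bar>pot (- int R) - pot (- int R + x)\<bar> / ad < e"
      using close ad unfolding ad_def by (simp add: abs_divide)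
    then show ?thesis using ad by (simp add: divide_less_eq less_imp_le add.commute)
  qed
  have gge: "(1 - e) * ad \<le> g" using D unfolding g_def ad_def[symmetric] by (simp add: left_diff_distrib abs_le_iff)
  have gpos: "0 < g" using gge ad e by (smt (verit) mult_pos_pos field_sum_of_halves)
  have Ph_ge: "g / A \<le> Ph" using Rg mult_right_mono[OF RPh, of A] Apos by (simp add: divide_le_eq)
  then show Ph_pos: "0 < Ph" using gpos Apos by (meson divide_pos_pos less_le_trans)
  let ?H = "exit_mean p E x"
  have H1: "?H (\<lambda>z. 1) = ennreal Pe"
  proof -
    have "?H (\<lambda>z. 1) = ?H (\<lambda>z. if z \<in> E then 1 else hit_before p E {0} z)"
      unfolding exit_mean_def by (intro hit_exp_cong) auto
    then show ?thesis
      using exit_mean_hit_before[OF subset_refl E0, of p x] unfolding Pe_def E_def[symmetric] by (simp only:)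
  qed
  have Hpot: "?H pot \<le> ennreal ad"
  proof -
    have "?H pot = hit_exp p 1 (E \<union> {0}) (\<lambda>z. if z = 0 then 0 else ennreal (pot z)) x"
      unfolding exit_mean_def using E0 by (intro hit_exp_cong) auto
    also have "\<dots> \<le> ennreal ad" unfolding ad_def by (rule hit_exp_potential_le) simp
    finally show ?thesis .
  qed
  \<comment> \<open>Exit means are extended reals. All functions below are dominated by some
    \<open>b + c * pot\<close>, so their means are finite and can be subtracted.\<close>
  have fin: "?H f < \<top>" if "\<And>z. z \<in> E \<Longrightarrow> f z \<le> b + c * pot z" "0 \<le> b" "0 \<le> c" for f b c
  proof -
    have "?H f \<le> ?H (\<lambda>z. b * 1 + c * pot z)" using that by (intro exit_mean_mono) auto
    also have "\<dots> = ennreal b * ?H (\<lambda>z. 1) + ennreal c * ?H pot"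
      using that pm by (subst exit_mean_add) (auto simp: exit_mean_cmult[symmetric])
    also have "\<dots> \<le> ennreal b * ennreal Pe + ennreal c * ennreal ad"
      unfolding H1 using Hpot by (intro add_mono mult_left_mono) auto
    also have "\<dots> < \<top>" by (simp add: less_top[symmetric] ennreal_mult_eq_top_iff)
    finally show ?thesis .
  qed
  define h where "h f = enn2real (?H f)" for f
  have h_add: "h (\<lambda>z. f z + f' z) = h f + h f'"
    if "\<And>z. z \<in> E \<Longrightarrow> 0 \<le> f z" "\<And>z. z \<in> E \<Longrightarrow> 0 \<le> f' z" "?H f < \<top>" "?H f' < \<top>" for f f'
    unfolding h_def using that by (simp add: exit_mean_add enn2real_plus)
  have h_mult: "h (\<lambda>z. c * f z) = c * h f" if "0 \<le> c" "\<And>z. z \<in> E \<Longrightarrow> 0 \<le> f z" for c f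
    unfolding h_def using that by (simp add: exit_mean_cmult enn2real_mult)
  have h_mono: "h f \<le> h f'" if "\<And>z. z \<in> E \<Longrightarrow> f z \<le> f' z" "?H f' < \<top>" for f f'
    unfolding h_def using that by (intro enn2real_mono exit_mean_mono)
  have h_nonneg: "0 \<le> h f" for f unfolding h_def by simp
  have h1: "h (\<lambda>z. 1) = Pe" unfolding h_def H1 Pe_def by (simp add: disc_hit_nonneg)
  have hpot: "h pot \<le> ad" unfolding h_def using Hpot ad by (intro enn2real_leI) auto
  have h_hit: "h (\<lambda>z. if z \<in> B then 1 else hit_before p B {0} z) = hit_before p B {0} x" if "B \<subseteq> E" for B
    unfolding h_def exit_mean_hit_before[OF that E0] by (simp add: disc_hit_nonneg)
  let ?b = "\<lambda>z. pot (z - int R)"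
  let ?U = "\<lambda>z. indicator {int R..} z :: real" and ?L = "\<lambda>z. indicator {..- int Q} z :: real"
  have UL: "?U z + ?L z = 1" if "z \<in> E" for z using that QR by (auto simp: E_def indicator_def)
  have split: "h f = h (\<lambda>z. ?U z * f z) + h (\<lambda>z. ?L z * f z)"
    if "\<And>z. z \<in> E \<Longrightarrow> 0 \<le> f z" "\<And>z. z \<in> E \<Longrightarrow> f z \<le> b + c * pot z" "0 \<le> b" "0 \<le> c" for f b c
  proof -
    have le: "?U z * f z \<le> b + c * pot z" "?L z * f z \<le> b + c * pot z" if "z \<in> E" for z
      using \<open>0 \<le> b\<close> \<open>0 \<le> c\<close> that \<open>\<And>z. z \<in> E \<Longrightarrow> f z \<le> b + c * pot z\<close>[OF that] pm[of z] by (auto simp: indicator_def)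
    have "h f = h (\<lambda>z. ?U z * f z + ?L z * f z)"
    proof -
      have "f z = ?U z * f z + ?L z * f z" if "z \<in> E" for z
        using UL[OF that] by (simp add: distrib_right[symmetric])
      then have "?H f = ?H (\<lambda>z. ?U z * f z + ?L z * f z)"
        by (intro antisym exit_mean_mono) auto
      then show ?thesis by (simp add: h_def)
    qed
    also have "\<dots> = h (\<lambda>z. ?U z * f z) + h (\<lambda>z. ?L z * f z)"
      using that(1) by (intro h_add fin[OF le(1) that(3,4)] fin[OF le(2) that(3,4)]) auto
    finally show ?thesis .
  qed
  have b_le: "?b z \<le> pot (- int R) + 1 * pot z" for z
    using potential_subadditive[of z "- int R"] by simp
  let ?piR = "\<lambda>z. if z \<in> {int R} then 1 else hit_before p {int R} {0} z"
  have piR: "A * ?piR z = pot z + pot (- int R) - ?b z" if "z \<in> E" for z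
  proof (cases "z = int R")
    case False
    have "z \<noteq> 0" using that E0 by auto
    then show ?thesis using hit_before_potential[of "int R" z] False QR by (simp add: A_def mult.commute)
  qed (simp add: A_def)
  \<comment> \<open>The hitting formula for \<open>R\<close> averaged over the exit position. By the
    strong Markov property the averaged probability is the one from \<open>x\<close>, so its product
    with \<open>A\<close> is \<open>g\<close>; this isolates the mean \<open>h ?b\<close>.\<close>
  have key: "h pot + pot (- int R) * Pe = g + h ?b"
  proof -
    have "h (\<lambda>z. pot z + pot (- int R) * 1) = h pot + pot (- int R) * Pe"
    proof -
      have "h (\<lambda>z. pot z + pot (- int R) * 1) = h pot + h (\<lambda>z. pot (- int R) * 1)"
        by (rule h_add) (auto simp: pm intro: fin[of _ 0 1] fin[of _ "pot (- int R)" 0])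
      also have "h (\<lambda>z. pot (- int R) * 1) = pot (- int R) * h (\<lambda>z. 1)"
        by (rule h_mult) (auto simp: pm)
      finally show ?thesis unfolding h1 .
    qed
    moreover have "h (\<lambda>z. pot z + pot (- int R) * 1) = h (\<lambda>z. A * ?piR z + ?b z)"
    proof -
      have "?H (\<lambda>z. pot z + pot (- int R) * 1) = ?H (\<lambda>z. A * ?piR z + ?b z)"
        using piR by (intro antisym exit_mean_mono) auto
      then show ?thesis by (simp add: h_def)
    qed
    moreover have "h (\<lambda>z. A * ?piR z + ?b z) = h (\<lambda>z. A * ?piR z) + h ?b"
    proof (rule h_add)
      show "?H (\<lambda>z. A * ?piR z) < \<top>"
      proof (rule fin[of _ A 0])
        fix z
        have "?piR z \<le> 1" using disc_hit_le_1[of 1 p "{int R}" "{0}" z] by simp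
        then have "A * ?piR z \<le> A * 1" using Apos by (intro mult_left_mono) auto
        then show "A * ?piR z \<le> A + 0 * pot z" by (simp only: mult_1_right mult_zero_left add_0_right)
      qed (use Apos in auto)
      show "?H ?b < \<top>" using b_le pm by (intro fin[of _ "pot (- int R)" 1]) auto
    qed (use Apos pm disc_hit_nonneg in auto)
    moreover have "h (\<lambda>z. A * ?piR z) = A * hit_before p {int R} {0} x"
    proof -
      have "h (\<lambda>z. A * ?piR z) = A * h ?piR"
        by (rule h_mult) (use Apos in \<open>auto simp: disc_hit_nonneg\<close>)
      then show ?thesis unfolding h_hit[OF Ein(2)] .
    qed
    ultimately show ?thesis using Rg by (simp add: mult.commute)
  qed
  have s1: "Pe = h (\<lambda>z. ?U z * 1) + h (\<lambda>z. ?L z * 1)"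
    unfolding h1[symmetric] by (rule split[of _ 1 0]) auto
  have sb: "h ?b = h (\<lambda>z. ?U z * ?b z) + h (\<lambda>z. ?L z * ?b z)"
    by (rule split[of _ "pot (- int R)" 1]) (use b_le pm in auto)
  have sp: "h pot = h (\<lambda>z. ?U z * pot z) + h (\<lambda>z. ?L z * pot z)"
    by (rule split[of _ 0 1]) (use pm in auto)
  have finU: "?H (\<lambda>z. ?U z * f z) < \<top>" "?H (\<lambda>z. ?L z * f z) < \<top>"
    if "\<And>z. f z \<le> b + c * pot z" "0 \<le> b" "0 \<le> c" for f b c
    using that pm by (auto intro!: fin[of _ b c] simp: indicator_def)
  \<comment> \<open>\<open>pot (- int R) * Pe\<close> need not be small against
    \<open>pot_dagger x\<close>. On exits below \<open>-Q\<close> it is cancelled by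
    \<open>?b\<close> up to \<open>e * pot z\<close>, by
    \<open>potential_increment_le\<close>.\<close>
  have low: "pot (- int R) * h (\<lambda>z. ?L z * 1) \<le> h (\<lambda>z. ?L z * ?b z) + e * h (\<lambda>z. ?L z * pot z)"
  proof -
    have "pot (- int R) * h (\<lambda>z. ?L z * 1) = h (\<lambda>z. pot (- int R) * (?L z * 1))"
      using pm by (intro h_mult[symmetric]) auto
    also have "\<dots> \<le> h (\<lambda>z. ?L z * ?b z + e * (?L z * pot z))"
    proof (rule h_mono)
      fix z assume z: "z \<in> E"
      show "pot (- int R) * (?L z * 1) \<le> ?L z * ?b z + e * (?L z * pot z)"
      proof (cases "z \<le> - int Q")
        case True
        then have zn: "z \<noteq> 0" using QR by auto
        have "(pot (- int R) - pot (z - int R)) * pot (int R) \<le> pot z * pot (- int R)"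
          using QR zn by (intro potential_increment_le) auto
        also have "\<dots> \<le> pot z * (e * pot (int R))" by (intro mult_left_mono ratio pm)
        finally have "(pot (- int R) - pot (z - int R)) * pot (int R) \<le> (e * pot z) * pot (int R)" by (simp add: mult_ac)
        then have "pot (- int R) - pot (z - int R) \<le> e * pot z" using pR by simp
        then show ?thesis using True by simp
      qed simp
    next
      show "?H (\<lambda>z. ?L z * ?b z + e * (?L z * pot z)) < \<top>"
      proof (rule fin[of _ "pot (- int R)" "1 + e"])
        fix z assume "z \<in> E"
        show "?L z * ?b z + e * (?L z * pot z) \<le> pot (- int R) + (1 + e) * pot z"
          using b_le[of z] pm[of z] pm[of "- int R"] e by (auto simp: indicator_def distrib_right)
      qed (use pm e in auto)
    qed
    also have "\<dots> = h (\<lambda>z. ?L z * ?b z) + h (\<lambda>z. e * (?L z * pot z))"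
    proof (rule h_add)
      show "?H (\<lambda>z. ?L z * ?b z) < \<top>"
        by (rule finU(2)[OF b_le]) (use pm in auto)
      show "?H (\<lambda>z. e * (?L z * pot z)) < \<top>"
        using e pm by (intro fin[of _ 0 e]) (auto simp: indicator_def)
    qed (use pm e in auto)
    also have "h (\<lambda>z. e * (?L z * pot z)) = e * h (\<lambda>z. ?L z * pot z)"
      using e pm by (intro h_mult) auto
    finally show ?thesis .
  qed
  \<comment> \<open>\<open>c\<close> measures how far \<open>pot\<close> is from increasing:
    \<open>pot (int R) <= c * pot z\<close> for \<open>z >= int R\<close>. Subadditivity in both
    directions leaves \<open>e * C * pot (int R)\<close> on the right, absorbed because
    \<open>e * C <= 1/2\<close>.\<close>
  define c where "c = 2 * (1 + C)"
  have cpos: "0 < c" using C by (simp add: c_def)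
  have up: "pot (- int R) * h (\<lambda>z. ?U z * 1) \<le> e * c * h (\<lambda>z. ?U z * pot z)"
  proof -
    have potR: "pot (int R) \<le> c * pot z" if "int R \<le> z" for z
    proof (cases "z = int R")
      case True
      have "1 * pot (int R) \<le> c * pot (int R)" using pR C by (intro mult_right_mono) (auto simp: c_def)
      then show ?thesis using True by simp
    next
      case False
      define k where "k = z - int R"
      have k: "0 < k" using False that by (simp add: k_def)
      have 1: "pot (int R) \<le> pot z + pot (- k)" using potential_subadditive[of z "- k"] by (simp add: k_def)
      have 2: "pot k \<le> pot z + pot (- int R)" using potential_subadditive[of z "- int R"] by (simp add: k_def)
      have "pot (- k) \<le> C * pot k" by (rule C(2)[OF k])
      also have "\<dots> \<le> C * (pot z + e * pot (int R))" using 2 ratio(2) C by (intro mult_left_mono) auto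
      also have "\<dots> = C * pot z + (e * C) * pot (int R)" by (simp add: algebra_simps)
      also have "\<dots> \<le> C * pot z + 1/2 * pot (int R)" using e pR by (intro add_left_mono mult_right_mono) auto
      finally have "pot (int R) \<le> (1 + C) * pot z + 1/2 * pot (int R)" using 1 by (simp add: distrib_right)
      then have "pot (int R) \<le> 2 * ((1 + C) * pot z)" by linarith
      then show ?thesis unfolding c_def mult.assoc .
    qed
    have "pot (- int R) * h (\<lambda>z. ?U z * 1) =h (\<lambda>z. pot (- int R) * (?U z * 1))"
      using pm by (intro h_mult[symmetric]) auto
    also have "\<dots> \<le> h (\<lambda>z. (e * c) * (?U z * pot z))"
    proof (rule h_mono)
      fix z
      show "pot (- int R) * (?U z * 1) \<le> (e * c) * (?U z * pot z)"
      proof (cases "int R \<le> z")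
        case True
        have "pot (- int R) \<le> e * (c * pot z)"
          using ratio(2) mult_left_mono[OF potR[OF True], of e] e by linarith
        then show ?thesis using True by simp
      qed simp
      show "?H (\<lambda>z. (e * c) * (?U z * pot z)) < \<top>"
        using e cpos pm by (intro fin[of _ 0 "e * c"]) (auto simp: indicator_def)
    qed
    also have "\<dots> = e * c * h (\<lambda>z. ?U z * pot z)" using e cpos pm by (intro h_mult) auto
    finally show ?thesis .
  qed
  \<comment> \<open>\<open>h pot <= ad\<close> and \<open>g >= (1 - e) * ad\<close> cancel to
    leading order; what remains is of order \<open>e * ad\<close>.\<close>
  have HbU: "h (\<lambda>z. ?U z * ?b z) \<le> (c + 2) * e * ad"
  proof -
    have "h (\<lambda>z. ?U z * ?b z) = h pot + pot (- int R) * h (\<lambda>z. ?U z * 1) + pot (- int R) * h (\<lambda>z. ?L z * 1) - g - h (\<lambda>z. ?L z * ?b z)"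
      using key sb unfolding s1 by (simp add: distrib_left)
    also have "\<dots> \<le> h pot + e * c * h (\<lambda>z. ?U z * pot z) + e * h (\<lambda>z. ?L z * pot z) - g"
      using low up by linarith
    also have "e * c * h (\<lambda>z. ?U z * pot z) \<le> e * c * ad"
      using sp hpot h_nonneg[of "\<lambda>z. ?L z * pot z"] e cpos by (intro mult_left_mono) auto
    also have "e * h (\<lambda>z. ?L z * pot z) \<le> e * ad"
      using sp hpot h_nonneg[of "\<lambda>z. ?U z * pot z"] e by (intro mult_left_mono) auto
    finally have "h (\<lambda>z. ?U z * ?b z) \<le> h pot + e * c * ad + e * ad - g" by simp
    also have "\<dots> \<le> ad + e * c * ad + e * ad - (1 - e) * ad" using hpot gge by linarith
    also have "\<dots> = (c + 2) * e * ad" by (simp add: algebra_simps)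
    finally show ?thesis .
  qed
  let ?pi2 = "\<lambda>z. if z \<in> {- int Q, int R} then 1 else hit_before p {- int Q, int R} {0} z"
  have pi2: "0 \<le> ?pi2 z" "?pi2 z \<le> 1" for z using disc_hit_nonneg disc_hit_le_1[of 1 p] by auto
  have sub: "hit_before p {int R} {0} z \<le> hit_before p {- int Q, int R} {0} z"
    "hit_before p {- int Q} {0} z \<le> hit_before p {- int Q, int R} {0} z" for z
    using QR by (auto intro!: hit_before_mono)
  let ?rem = "\<lambda>z. (1 + C) / A * (?U z * ?b z) + (1 + C) * e * 1"
  \<comment> \<open>\<open>1 - ?pi2 z\<close> is the probability of missing both points before 0
    after an exit at \<open>z\<close>. Above \<open>R\<close> it is at most a multiple of
    \<open>?b z / A\<close>, below \<open>-Q\<close> at most \<open>(1 + C) * e\<close>.\<close>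
  have defect: "1 \<le> ?pi2 z + ?rem z" if z: "z \<in> E" for z
  proof (cases "z \<in> {- int Q, int R}")
    case True
    have "0 \<le> ?rem z" using C Apos pm e by (intro add_nonneg_nonneg mult_nonneg_nonneg divide_nonneg_nonneg) auto
    then show ?thesis using True by simp
  next
    case ne: False
    show ?thesis
    proof (cases "int R \<le> z")
      case True
      then have k: "0 < z - int R" using ne by auto
      have "hit_before p {int R} {0} z * A = pot z + pot (- int R) - ?b z"
        using piR[OF z] ne by (auto simp: mult.commute)
      moreover have "pot (int R) \<le> pot z + C * ?b z"
        using potential_subadditive[of z "- (z - int R)"] C(2)[OF k] by simp
      ultimately have "(1 - hit_before p {int R} {0} z) * A \<le> (1 + C) * ?b z"
        by (simp add: A_def algebra_simps)
      then have "1 - hit_before p {int R} {0} z \<le> (1 + C) / A * ?b z" using Apos by (simp add: le_divide_eq)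
      then have "1 - ?pi2 z \<le> (1 + C) / A * ?b z" using sub(1)[of z] ne by auto
      moreover have "0 \<le> (1 + C) * e" using C e by simp
      moreover have "?U z = 1" using True by simp
      ultimately show ?thesis by simp
    next
      case False
      then have zQ: "z < - int Q" using z ne by (auto simp: E_def)
      have zn: "z \<noteq> 0" using zQ by auto
      define j where "j = - (z + int Q)"
      have j: "0 < j" using zQ by (simp add: j_def)
      have eq: "hit_before p {- int Q} {0} z * (pot (- int Q) + pot (int Q)) = pot z + pot (int Q) - pot (z + int Q)"
        using hit_before_potential[of "- int Q" z] QR zn zQ by simp
      \<comment> \<open>In this use of the increment bound the ratio
        \<open>pot (- j) / pot j\<close> is only known to be at most \<open>C\<close>; the smallness
        comes from \<open>pot (- int Q)\<close>.\<close>
      have "(pot (- j) - pot (- int Q - j)) * pot j \<le> pot (- int Q) * pot (- j)"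
        using QR j by (intro potential_increment_le) auto
      also have "\<dots> \<le> pot (- int Q) * (C * pot j)" using C(2)[OF j] pm by (intro mult_left_mono) auto
      finally have "(pot (- j) - pot (- int Q - j)) * pot j \<le> (C * pot (- int Q)) * pot j" by (simp add: mult_ac)
      then have "pot (- j) - pot (- int Q - j) \<le> C * pot (- int Q)" using pot_pos[of j] j by simp
      then have inc: "pot (z + int Q) - pot z \<le> C * pot (- int Q)" by (simp add: j_def add.commute)
      have "(1 - hit_before p {- int Q} {0} z) * (pot (- int Q) + pot (int Q)) = pot (- int Q) + (pot (z + int Q) - pot z)"
        using eq by (simp add: algebra_simps)
      also have "\<dots> \<le> (1 + C) * pot (- int Q)" using inc by (simp add: distrib_right)
      also have "\<dots> \<le> (1 + C) * (e * pot (int Q))" using C ratio(1) by (intro mult_left_mono) auto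
      also have "\<dots> \<le> ((1 + C) * e) * (pot (- int Q) + pot (int Q))"
        using C e pm[of "- int Q"] by (simp add: mult_left_mono)
      finally have "1 - hit_before p {- int Q} {0} z \<le> (1 + C) * e"
        using pR pm[of "- int Q"] by (simp add: add_nonneg_pos)
      then have "1 - ?pi2 z \<le> (1 + C) * e" using sub(2)[of z] ne by auto
      moreover have "?U z = 0" using False by simp
      ultimately show ?thesis by simp
    qed
  qed
  have fin2: "?H ?pi2 < \<top>" using pi2 by (intro fin[of _ 1 0]) auto
  have finb: "?H (\<lambda>z. (1 + C) / A * (?U z * ?b z)) < \<top>" "?H (\<lambda>z. (1 + C) * e * 1) < \<top>"
  proof -
    have "(1 + C) / A * (?U z * ?b z) \<le> (1 + C) / A * pot (- int R) + (1 + C) / A * pot z" for z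
    proof -
      have "?U z * ?b z \<le> pot (- int R) + pot z" using b_le[of z] pm[of z] pm[of "- int R"] by (auto simp: indicator_def)
      then have "(1 + C) / A * (?U z * ?b z) \<le> (1 + C) / A * (pot (- int R) + pot z)"
        using C Apos by (intro mult_left_mono) auto
      then show ?thesis by (simp add: distrib_left)
    qed
    then show "?H (\<lambda>z. (1 + C) / A * (?U z * ?b z)) < \<top>"
      using C Apos pm by (intro fin[of _ "(1 + C) / A * pot (- int R)" "(1 + C) / A"]) auto
    show "?H (\<lambda>z. (1 + C) * e * 1) < \<top>" using C e by (intro fin[of _ "(1 + C) * e" 0]) auto
  qed
  have nnb: "0 \<le> (1 + C) / A * (?U z * ?b z)" "0 \<le> (1 + C) * e * 1" for z
    using C Apos pm e by (auto intro!: mult_nonneg_nonneg divide_nonneg_nonneg)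
  have "Pe \<le> h (\<lambda>z. ?pi2 z + ?rem z)"
    unfolding h1[symmetric]
  proof (rule h_mono[OF defect])
    show "?H (\<lambda>z. ?pi2 z + ?rem z) < \<top>"
      using fin2 finb pi2 nnb by (subst exit_mean_add; (subst exit_mean_add)?) (auto simp: add_nonneg_nonneg less_top[symmetric])
  qed
  also have "\<dots> = h ?pi2 + h ?rem"
    using pi2 nnb fin2 finb
    by (intro h_add) (auto simp: add_nonneg_nonneg exit_mean_add less_top[symmetric])
  also have "h ?rem = h (\<lambda>z. (1 + C) / A * (?U z * ?b z)) + h (\<lambda>z. (1 + C) * e * 1)"
    by (intro h_add nnb finb)
  also have "h (\<lambda>z. (1 + C) / A * (?U z * ?b z)) = (1 + C) / A * h (\<lambda>z. ?U z * ?b z)"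
    using C Apos pm by (intro h_mult) auto
  also have "h (\<lambda>z. (1 + C) * e * 1) = (1 + C) * e * Pe"
    unfolding h1[symmetric] using C e by (intro h_mult) auto
  also have "h ?pi2 = Ph" unfolding Ph_def by (rule h_hit[OF Ein(1)])
  finally have main: "Pe \<le> Ph + ((1 + C) / A * h (\<lambda>z. ?U z * ?b z) + (1 + C) * e * Pe)" .
  \<comment> \<open>\<open>g / A <= Ph\<close> and \<open>g >= ad / 2\<close> turn the overshoot
    bound into one relative to \<open>Ph\<close>.\<close>
  have adA: "ad / A \<le> 2 * Ph"
  proof -
    have "(1/2) * ad \<le> (1 - e) * ad" using e ad by (intro mult_right_mono) auto
    then have "ad \<le> 2 * g" using gge by linarith
    then have "ad / A \<le> 2 * g / A" using Apos by (intro divide_right_mono) auto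
    then show ?thesis using Ph_ge by simp
  qed
  have "(1 + C) / A * h (\<lambda>z. ?U z * ?b z) \<le> (1 + C) / A * ((c + 2) * e * ad)"
    using HbU C Apos by (intro mult_left_mono) auto
  also have "\<dots> = (1 + C) * (c + 2) * e * (ad / A)" by simp
  also have "\<dots> \<le> (1 + C) * (c + 2) * e * (2 * Ph)"
    using adA C cpos e by (intro mult_left_mono mult_nonneg_nonneg) auto
  finally have "Pe \<le> Ph + ((1 + C) * (c + 2) * e * (2 * Ph) + (1 + C) * e * Pe)" using main by linarith
  then show "Pe * (1 - (1 + C) * e) \<le> Ph * (1 + 2 * (1 + C) * (2 * (1 + C) + 2) * e)"
    unfolding c_def by (simp add: algebra_simps)
qed

lemma escape_probability_asymptotics:
  assumes eps: "0 < \<epsilon>"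
  obtains \<delta> and N :: nat where "0 < \<delta>"
    "\<And>Q R x. 0 < Q \<Longrightarrow> 0 < R \<Longrightarrow> N \<le> min Q R \<Longrightarrow> - int Q < x \<Longrightarrow> x < int R \<Longrightarrow>
      \<bar>(pot (- int R) - pot (- int R + x)) / pot_dagger x\<bar> < \<delta> \<Longrightarrow>
      0 < hit_before p {- int Q, int R} {0} x \<and>
      hit_before p {- int Q, int R} {0} x \<le> hit_before p (UNIV - {- int Q<..<int R}) {0} x \<and>
      hit_before p (UNIV - {- int Q<..<int R}) {0} x \<le> (1 + \<epsilon>) * hit_before p {- int Q, int R} {0} x"
proof -
  obtain C where C: "0 < C" "\<And>j. 0 < j \<Longrightarrow> pot (- j) \<le> C * pot j" using pot_ratio_bound by blast
  define B where "B = 2 * (1 + C) * (2 * (1 + C) + 2)"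
  \<comment> \<open>\<open>D * e <= \<epsilon>\<close> says exactly that
    \<open>1 + B * e <= (1 + \<epsilon>) * (1 - (1 + C) * e)\<close>. The bound
    \<open>1 / (2 * (1 + C))\<close> on \<open>e\<close> keeps the last factor positive, so that it
    can be divided out.\<close>
  define D where "D = B + (1 + \<epsilon>) * (1 + C)"
  define e where "e = min (1 / 2) (min (1 / (2 * (1 + C))) (\<epsilon> / D))"
  have B: "0 < B" using C by (auto simp: B_def)
  have D: "0 < D" using B C eps by (auto simp: D_def intro!: add_pos_pos)
  have e1: "0 < e" using C(1) D eps unfolding e_def min_less_iff_conj by auto
  have e2: "e \<le> 1 / 2" unfolding e_def by (rule min.cobounded1)
  have e3: "e \<le> 1 / (2 * (1 + C))" unfolding e_def by (rule min.coboundedI2, rule min.cobounded1)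
  have e4: "e \<le> \<epsilon> / D" unfolding e_def by (rule min.coboundedI2, rule min.cobounded2)
  note e = e1 e2 e3 e4
  have eC1: "(1 + C) * e \<le> 1 / 2" using e(3) C by (simp add: field_simps)
  then have eC: "e * C \<le> 1 / 2" using e(1) C by (simp add: algebra_simps)
  have De: "D * e \<le> \<epsilon>" using e(4) D by (simp add: field_simps)
  obtain N where N: "\<And>R. N \<le> R \<Longrightarrow> 0 < R \<Longrightarrow> pot (- int R) \<le> e * pot (int R)" using pot_ratio_small[OF e(1)] by blast
  show thesis
  proof (rule that[of e N])
    fix Q R :: nat and x :: int
    assume QR: "0 < Q" "0 < R" "N \<le> min Q R" and x: "- int Q < x" "x < int R"
      and close: "\<bar>(pot (- int R) - pot (- int R + x)) / pot_dagger x\<bar> < e"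
    let ?Ph = "hit_before p {- int Q, int R} {0} x" and ?Pe = "hit_before p (UNIV - {- int Q<..<int R}) {0} x"
    have rQ: "pot (- int Q) \<le> e * pot (int Q)" and rR: "pot (- int R) \<le> e * pot (int R)" using N QR by auto
    note esc = escape_comparison[OF C e(1) eC e(2) rQ rR QR(1,2) x close]
    have "(1 + B * e) \<le> (1 + \<epsilon>) * (1 - (1 + C) * e)" using De by (simp add: D_def algebra_simps)
    then have "?Ph * (1 + B * e) \<le> ?Ph * ((1 + \<epsilon>) * (1 - (1 + C) * e))"
      using esc(1) by (intro mult_left_mono) auto
    then have "?Pe * (1 - (1 + C) * e) \<le> ((1 + \<epsilon>) * ?Ph) * (1 - (1 + C) * e)"
      using esc(3) unfolding B_def by (simp add: mult_ac)
    then have "?Pe \<le> (1 + \<epsilon>) * ?Ph" using eC1 by simp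
    then show "0 < ?Ph \<and> ?Ph \<le> ?Pe \<and> ?Pe \<le> (1 + \<epsilon>) * ?Ph" using esc by simp
  qed (use e in auto)
qed

end

section \<open>From random variables to their law\<close>

lemma measurable_pmf_lborel:
  assumes "\<And>k. f k \<in> borel_measurable lborel"
  shows "case_prod f \<in> borel_measurable (measure_pmf (q :: int pmf) \<Otimes>\<^sub>M lborel)"
proof -
  have "case_prod f \<in> borel_measurable (count_space UNIV \<Otimes>\<^sub>M lborel)"
    by (rule measurable_pair_measure_countable1) (use assms in auto)
  also have "borel_measurable (count_space UNIV \<Otimes>\<^sub>M lborel) = borel_measurable (measure_pmf q \<Otimes>\<^sub>M lborel)"
    by (intro measurable_cong_sets sets_pair_measure_cong) auto
  finally show ?thesis .
qed

lemma pmf_lborel_swap: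
  assumes "\<And>k. f k \<in> borel_measurable lborel"
  shows "(\<integral>\<^sup>+y. \<integral>\<^sup>+k. f k y \<partial>measure_pmf (q :: int pmf) \<partial>lborel) = (\<integral>\<^sup>+k. \<integral>\<^sup>+y. f k y \<partial>lborel \<partial>measure_pmf q)"
proof -
  interpret P: pair_sigma_finite "measure_pmf q" lborel
    by (intro pair_sigma_finite.intro measure_pmf.sigma_finite_measure_axioms lborel.sigma_finite_measure_axioms)
  show ?thesis by (rule P.Fubini'[OF measurable_pmf_lborel[OF assms]])
qed

lemma nn_pmf_measurable:
  assumes "\<And>k. f k \<in> borel_measurable lborel"
  shows "(\<lambda>y. \<integral>\<^sup>+k. f k y \<partial>measure_pmf (q :: int pmf)) \<in> borel_measurable lborel"
  by (rule measure_pmf.borel_measurable_nn_integral)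
    (rule measurable_pair_swap[OF measurable_pmf_lborel[OF assms], simplified])

section \<open>The functions \<open>eta\<close> and \<open>m\<close> through the law of the
  step\<close>

definition upper_eta :: "int pmf \<Rightarrow> real \<Rightarrow> real" where
  "upper_eta q s = (LINT y:{s..}|lborel. measure (measure_pmf q) {k. y < real_of_int k})"

definition upper_m :: "int pmf \<Rightarrow> real \<Rightarrow> real" where
  "upper_m q x = (LINT s:{0..x}|lborel. upper_eta q s)"

context
  fixes q :: "int pmf"
  assumes q: "integrable (measure_pmf q) real_of_int"
begin

lemma excess_integrable: "integrable (measure_pmf q) (\<lambda>k. max 0 (real_of_int k - s))"
  by (rule integrable_dominated_abs[OF q, where A="\<bar>s\<bar>" and B=1]) auto

text \<open>By Tonelli, \<open>eta\<close> is the mean excess over \<open>s\<close>. The finite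
  nonnegative integral also gives the integrability of the tail, without which the integral in
  \<open>upper_eta\<close> would be 0 by default.\<close>

lemma upper_eta_eq: "ennreal (upper_eta q s) = (\<integral>\<^sup>+k. ennreal (max 0 (real_of_int k - s)) \<partial>measure_pmf q)"
proof -
  let ?\<mu> = "\<lambda>y. measure (measure_pmf q) {k. y < real_of_int k}"
  let ?f = "\<lambda>k y. indicator {s..<real_of_int k} y :: ennreal"
  have e: "ennreal (indicator {s..} y * ?\<mu> y) = (\<integral>\<^sup>+k. ?f k y \<partial>measure_pmf q)" for y
  proof -
    have "(\<integral>\<^sup>+k. ?f k y \<partial>measure_pmf q) = (\<integral>\<^sup>+k. indicator {s..} y * indicator {k. y < real_of_int k} k \<partial>measure_pmf q)"
      by (intro nn_integral_cong) (auto simp: indicator_def)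
    also have "\<dots> = indicator {s..} y * emeasure (measure_pmf q) {k. y < real_of_int k}"
      by (subst nn_integral_cmult) auto
    also have "\<dots> = ennreal (indicator {s..} y * ?\<mu> y)"
      by (simp add: measure_pmf.emeasure_eq_measure indicator_def)
    finally show ?thesis by simp
  qed
  have "(\<lambda>y. \<integral>\<^sup>+k. ?f k y \<partial>measure_pmf q) \<in> borel_measurable lborel" by (rule nn_pmf_measurable) simp
  then have "(\<lambda>y. ennreal (indicator {s..} y * ?\<mu> y)) \<in> borel_measurable lborel" unfolding e .
  then have "(\<lambda>y. enn2real (ennreal (indicator {s..} y * ?\<mu> y))) \<in> borel_measurable lborel" by (rule borel_measurable_enn2real)
  then have m: "(\<lambda>y. indicator {s..} y * ?\<mu> y) \<in> borel_measurable lborel" by (simp add: indicator_def)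
  have fin: "(\<integral>\<^sup>+y. ennreal (indicator {s..} y * ?\<mu> y) \<partial>lborel) = (\<integral>\<^sup>+k. ennreal (max 0 (real_of_int k - s)) \<partial>measure_pmf q)"
  proof -
    have "(\<integral>\<^sup>+y. ennreal (indicator {s..} y * ?\<mu> y) \<partial>lborel) = (\<integral>\<^sup>+k. \<integral>\<^sup>+y. ?f k y \<partial>lborel \<partial>measure_pmf q)"
      unfolding e by (rule pmf_lborel_swap) simp
    also have "\<dots> = (\<integral>\<^sup>+k. ennreal (max 0 (real_of_int k - s)) \<partial>measure_pmf q)"
    proof (intro nn_integral_cong)
      fix k
      show "(\<integral>\<^sup>+y. ?f k y \<partial>lborel) = ennreal (max 0 (real_of_int k - s))"
        by (cases "s \<le> real_of_int k") (auto simp: max_def)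
    qed
    finally show ?thesis .
  qed
  have "(\<integral>\<^sup>+k. ennreal (max 0 (real_of_int k - s)) \<partial>measure_pmf q) < \<top>"
    using excess_integrable[of s] by (subst nn_integral_eq_integral) auto
  then have "integrable lborel (\<lambda>y. indicator {s..} y * ?\<mu> y)"
    using m fin by (intro integrableI_nonneg) (auto simp: indicator_def)
  then show ?thesis
    unfolding fin[symmetric] upper_eta_def set_lebesgue_integral_def
    by (subst nn_integral_eq_integral) (auto simp: indicator_def)
qed

text \<open>For \<open>u = k > 0\<close> and \<open>m = min u x\<close> the integral is
  \<open>u m - m^2/2\<close>, while \<open>x^2 hub (u/x) = x u^2/(x + u)\<close>. The cases
  \<open>u <= x\<close> and \<open>u > x\<close> show that they agree up to a factor 2.\<close>

lemma hub_bounds: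
  fixes k :: int and x :: real
  assumes x: "0 < x"
  shows "x\<^sup>2 * (indicator {0<..} k * hub (1 / x * real_of_int k)) \<le> 2 * enn2real (\<integral>\<^sup>+s. ennreal (max 0 (real_of_int k - s)) * indicator {0..x} s \<partial>lborel)"
    and "enn2real (\<integral>\<^sup>+s. ennreal (max 0 (real_of_int k - s)) * indicator {0..x} s \<partial>lborel) \<le> 2 * (x\<^sup>2 * (indicator {0<..} k * hub (1 / x * real_of_int k)))"
    and "(\<integral>\<^sup>+s. ennreal (max 0 (real_of_int k - s)) * indicator {0..x} s \<partial>lborel) < \<top>"
proof -
  let ?I = "\<integral>\<^sup>+s. ennreal (max 0 (real_of_int k - s)) * indicator {0..x} s \<partial>lborel"
  have "x\<^sup>2 * (indicator {0<..} k * hub (1 / x * real_of_int k)) \<le> 2 * enn2real ?I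
    \<and> enn2real ?I \<le> 2 * (x\<^sup>2 * (indicator {0<..} k * hub (1 / x * real_of_int k))) \<and> ?I < \<top>"
  proof (cases "0 < k")
    case False
    have "?I = (\<integral>\<^sup>+(s::real). 0 \<partial>lborel)" by (rule nn_integral_cong) (use False in \<open>auto simp: indicator_def ennreal_eq_0_iff\<close>)
    then show ?thesis using False by simp
  next
    case True
    define u where "u = real_of_int k"
    define m where "m = min u x"
    have u: "0 < u" using True by (simp add: u_def)
    have m: "0 < m" "m \<le> u" "m \<le> x" using u x by (auto simp: m_def)
    have "?I = (\<integral>\<^sup>+s. ennreal (u - s) * indicator {0..m} s \<partial>lborel)"
      unfolding u_def[symmetric] by (intro nn_integral_cong) (auto simp: indicator_def m_def max_def)
    also have "\<dots> = ennreal ((u * m - m\<^sup>2 / 2) - (u * 0 - 0\<^sup>2 / 2))"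
      using m by (intro nn_integral_FTC_Icc[where F="\<lambda>s. u * s - s\<^sup>2 / 2"]) (auto intro!: derivative_eq_intros)
    finally have I: "?I = ennreal (u * m - m\<^sup>2 / 2)" by simp
    have "m\<^sup>2 \<le> u * m" using m by (simp add: power2_eq_square)
    then have nn: "0 \<le> u * m - m\<^sup>2 / 2" using zero_le_power2[of m] by linarith
    have hb: "x\<^sup>2 * hub (1 / x * u) = x * u\<^sup>2 / (x + u)"
    proof -
      have "1 + \<bar>1 / x * u\<bar> = (x + u) / x" using x u by (simp add: field_simps)
      moreover have "x + u \<noteq> 0" using x u by simp
      ultimately show ?thesis using x unfolding hub_def by (simp add: divide_simps power2_eq_square)
    qed
    have "x * u\<^sup>2 / (x + u) \<le> 2 * (u * m - m\<^sup>2 / 2)" "u * m - m\<^sup>2 / 2 \<le> 2 * (x * u\<^sup>2 / (x + u))"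
    proof -
      have xu: "0 < x + u" using x u by simp
      have "x * u\<^sup>2 \<le> (2 * (u * m - m\<^sup>2 / 2)) * (x + u) \<and> (u * m - m\<^sup>2 / 2) * (x + u) \<le> 2 * (x * u\<^sup>2)"
      proof (cases "u \<le> x")
        case le: True
        then have mu: "m = u" by (simp add: m_def)
        have "u\<^sup>2 * u \<le> u\<^sup>2 * x" using le by (intro mult_left_mono) auto
        moreover have "0 \<le> u\<^sup>2 * u" "0 \<le> u\<^sup>2 * x" using u x by auto
        ultimately show ?thesis unfolding mu by (simp add: power2_eq_square algebra_simps)
      next
        case False
        then have mx: "m = x" by (simp add: m_def)
        have a: "x * x * u \<le> x * u * u" using False x u by (intro mult_mono) auto
        have b: "x * x * x \<le> x * x * u" using False x by (intro mult_left_mono) auto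
        have c: "0 \<le> x * x * x" "0 \<le> x * x * u" "0 \<le> x * u * u" using x u by auto
        have "(u * x - x\<^sup>2 / 2) * (x + u) = x * u * u + x * x * u / 2 - x * x * x / 2"
          by (simp add: power2_eq_square algebra_simps add_divide_distrib)
        moreover have "x * u\<^sup>2 = x * u * u" by (simp add: power2_eq_square)
        ultimately show ?thesis unfolding mx mult.assoc[of 2] using a b c by linarith
      qed
      then show "x * u\<^sup>2 / (x + u) \<le> 2 * (u * m - m\<^sup>2 / 2)" "u * m - m\<^sup>2 / 2 \<le> 2 * (x * u\<^sup>2 / (x + u))"
        using xu by (auto simp: divide_le_eq le_divide_eq mult.assoc)
    qed
    then show ?thesis using True nn unfolding I hb[symmetric] by (simp add: u_def)
  qed
  then show "x\<^sup>2 * (indicator {0<..} k * hub (1 / x * real_of_int k)) \<le> 2 * enn2real ?I"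
    "enn2real ?I \<le> 2 * (x\<^sup>2 * (indicator {0<..} k * hub (1 / x * real_of_int k)))" "?I < \<top>" by auto
qed

lemma upper_m_bounds:
  assumes x: "0 < x"
  shows "x\<^sup>2 * kmean q hub {0<..} (1 / x) \<le> 2 * upper_m q x" "upper_m q x \<le> 2 * (x\<^sup>2 * kmean q hub {0<..} (1 / x))"
proof -
  let ?g = "\<lambda>k s. ennreal (max 0 (real_of_int k - s)) * indicator {0..x} s"
  let ?I = "\<lambda>k. \<integral>\<^sup>+s. ?g k s \<partial>lborel"
  let ?h = "\<lambda>k. x\<^sup>2 * (indicator {0<..} k * hub (1 / x * real_of_int k))"
  have en: "0 \<le> upper_eta q s" for s
    unfolding upper_eta_def set_lebesgue_integral_def by (intro Bochner_Integration.integral_nonneg) auto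
  have e: "ennreal (indicator {0..x} s * upper_eta q s) = (\<integral>\<^sup>+k. ?g k s \<partial>measure_pmf q)" for s
  proof -
    have "(\<integral>\<^sup>+k. ?g k s \<partial>measure_pmf q) = (\<integral>\<^sup>+k. ennreal (max 0 (real_of_int k - s)) \<partial>measure_pmf q) * indicator {0..x} s"
      by (rule nn_integral_multc) auto
    then show ?thesis unfolding upper_eta_eq[symmetric] by (simp add: indicator_def)
  qed
  have gm: "?g k \<in> borel_measurable lborel" for k by measurable
  have "(\<lambda>s. \<integral>\<^sup>+k. ?g k s \<partial>measure_pmf q) \<in> borel_measurable lborel" by (rule nn_pmf_measurable[OF gm])
  then have "(\<lambda>s. ennreal (indicator {0..x} s * upper_eta q s)) \<in> borel_measurable lborel" unfolding e .
  then have "(\<lambda>s. enn2real (ennreal (indicator {0..x} s * upper_eta q s))) \<in> borel_measurable lborel"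
    by (rule borel_measurable_enn2real)
  then have m: "(\<lambda>s. indicator {0..x} s * upper_eta q s) \<in> borel_measurable lborel" using en by (simp add: indicator_def)
  have hI: "integrable (measure_pmf q) ?h" by (intro integrable_mult_right kmean_integrable q) auto
  have h0: "0 \<le> ?h k" for k by (auto simp: indicator_def)
  note b = hub_bounds[OF x]
  have II: "integrable (measure_pmf q) (\<lambda>k. enn2real (?I k))"
  proof (rule Bochner_Integration.integrable_bound[OF integrable_mult_right[OF hI, of 2]])
    show "AE k in measure_pmf q. norm (enn2real (?I k)) \<le> norm (2 * ?h k)"
      using b(2) h0 by (intro AE_I2) (simp add: abs_of_nonneg order_trans[OF _ abs_ge_self])
  qed simp
  have nn: "(\<integral>\<^sup>+s. ennreal (indicator {0..x} s * upper_eta q s) \<partial>lborel) = ennreal (\<integral>k. enn2real (?I k) \<partial>measure_pmf q)"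
  proof -
    have "(\<integral>\<^sup>+s. ennreal (indicator {0..x} s * upper_eta q s) \<partial>lborel) = (\<integral>\<^sup>+k. ?I k \<partial>measure_pmf q)"
      unfolding e by (rule pmf_lborel_swap[OF gm])
    also have "\<dots> = (\<integral>\<^sup>+k. ennreal (enn2real (?I k)) \<partial>measure_pmf q)"
      using b(3) by (intro nn_integral_cong) (simp add: less_top)
    also have "\<dots> = ennreal (\<integral>k. enn2real (?I k) \<partial>measure_pmf q)"
      using II by (intro nn_integral_eq_integral) auto
    finally show ?thesis .
  qed
  have "upper_m q x = enn2real (\<integral>\<^sup>+s. ennreal (indicator {0..x} s * upper_eta q s) \<partial>lborel)"
    unfolding upper_m_def set_lebesgue_integral_def using m en
    by (subst integral_eq_nn_integral) auto
  then have eq: "upper_m q x = (\<integral>k. enn2real (?I k) \<partial>measure_pmf q)"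
    unfolding nn by (simp add: Bochner_Integration.integral_nonneg)
  have k: "x\<^sup>2 * kmean q hub {0<..} (1 / x) = (\<integral>k. ?h k \<partial>measure_pmf q)" unfolding kmean_def by simp
  show "x\<^sup>2 * kmean q hub {0<..} (1 / x) \<le> 2 * upper_m q x"
    unfolding eq k integral_mult_right_zero[symmetric]
    using b(1) by (intro integral_mono hI integrable_mult_right II) auto
  show "upper_m q x \<le> 2 * (x\<^sup>2 * kmean q hub {0<..} (1 / x))"
    unfolding eq k integral_mult_right_zero[symmetric]
    using b(2) by (intro integral_mono II integrable_mult_right hI) auto
qed

end

section \<open>Hitting events of step sequences\<close>

fun hits :: "int set \<Rightarrow> int set \<Rightarrow> nat \<Rightarrow> int \<Rightarrow> (nat \<Rightarrow> int) \<Rightarrow> bool" where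
  "hits A B 0 x \<xi> = False"
| "hits A B (Suc n) x \<xi> = (if x + \<xi> 0 \<in> A \<union> B then x + \<xi> 0 \<in> A else hits A B n (x + \<xi> 0) (\<lambda>i. \<xi> (Suc i)))"

text \<open>The recursion matches \<open>hit_upto\<close>, the explicit form the comparison of
  hitting times. Indices are shifted: \<open>\<xi> 0\<close> is the first step.\<close>

lemma hits_iff:
  "hits A B n x \<xi> \<longleftrightarrow> (\<exists>j. 1 \<le> j \<and> j \<le> n \<and> x + (\<Sum>i<j. \<xi> i) \<in> A \<and> (\<forall>l. 1 \<le> l \<longrightarrow> l < j \<longrightarrow> x + (\<Sum>i<l. \<xi> i) \<notin> A \<union> B))"
proof (induction n arbitrary: x \<xi>)
  case (Suc n)
  let ?\<eta> = "\<lambda>i. \<xi> (Suc i)"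
  have shift: "x + (\<Sum>i<Suc j. \<xi> i) = (x + \<xi> 0) + (\<Sum>i<j. ?\<eta> i)" for j
    by (simp add: sum.lessThan_Suc_shift del: sum.lessThan_Suc)
  show ?case
  proof (cases "x + \<xi> 0 \<in> A \<union> B")
    case True
    show ?thesis
    proof
      assume "hits A B (Suc n) x \<xi>"
      then have "x + \<xi> 0 \<in> A" using True by simp
      then show "\<exists>j. 1 \<le> j \<and> j \<le> Suc n \<and> x + (\<Sum>i<j. \<xi> i) \<in> A \<and> (\<forall>l. 1 \<le> l \<longrightarrow> l < j \<longrightarrow> x + (\<Sum>i<l. \<xi> i) \<notin> A \<union> B)"
        by (intro exI[of _ 1]) auto
    next
      assume "\<exists>j. 1 \<le> j \<and> j \<le> Suc n \<and> x + (\<Sum>i<j. \<xi> i) \<in> A \<and> (\<forall>l. 1 \<le> l \<longrightarrow> l < j \<longrightarrow> x + (\<Sum>i<l. \<xi> i) \<notin> A \<union> B)"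
      then obtain j where j: "1 \<le> j" "x + (\<Sum>i<j. \<xi> i) \<in> A" "\<forall>l. 1 \<le> l \<longrightarrow> l < j \<longrightarrow> x + (\<Sum>i<l. \<xi> i) \<notin> A \<union> B" by blast
      have "\<not> 1 < j" using j(3)[rule_format, of 1] True by auto
      then have "j = 1" using j(1) by simp
      then show "hits A B (Suc n) x \<xi>" using j(2) True by simp
    qed
  next
    case False
    have "hits A B (Suc n) x \<xi> \<longleftrightarrow> hits A B n (x + \<xi> 0) ?\<eta>" using False by auto
    also have "\<dots> \<longleftrightarrow> (\<exists>j. 1 \<le> j \<and> j \<le> n \<and> (x + \<xi> 0) + (\<Sum>i<j. ?\<eta> i) \<in> A \<and> (\<forall>l. 1 \<le> l \<longrightarrow> l < j \<longrightarrow> (x + \<xi> 0) + (\<Sum>i<l. ?\<eta> i) \<notin> A \<union> B))"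
      by (rule Suc.IH)
    also have "\<dots> \<longleftrightarrow> (\<exists>j. 1 \<le> j \<and> j \<le> Suc n \<and> x + (\<Sum>i<j. \<xi> i) \<in> A \<and> (\<forall>l. 1 \<le> l \<longrightarrow> l < j \<longrightarrow> x + (\<Sum>i<l. \<xi> i) \<notin> A \<union> B))"
      (is "?l \<longleftrightarrow> ?r")
    proof
      assume ?l
      then obtain j where j: "1 \<le> j" "j \<le> n" "(x + \<xi> 0) + (\<Sum>i<j. ?\<eta> i) \<in> A"
        "\<And>l. 1 \<le> l \<Longrightarrow> l < j \<Longrightarrow> (x + \<xi> 0) + (\<Sum>i<l. ?\<eta> i) \<notin> A \<union> B" by blast
      have "x + (\<Sum>i<l. \<xi> i) \<notin> A \<union> B" if lj: "1 \<le> l" "l < Suc j" for l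
      proof (cases "l = 1")
        case False
        then obtain l' where l': "l = Suc l'" "1 \<le> l'" using lj False by (cases l) auto
        have "(x + \<xi> 0) + (\<Sum>i<l'. ?\<eta> i) \<notin> A \<union> B" by (rule j(4)) (use l' lj in auto)
        then show ?thesis unfolding l'(1) shift .
      qed (use \<open>x + \<xi> 0 \<notin> A \<union> B\<close> in simp)
      then show ?r using j by (intro exI[of _ "Suc j"]) (auto simp: shift simp del: sum.lessThan_Suc)
    next
      assume ?r
      then obtain j where j: "1 \<le> j" "j \<le> Suc n" "x + (\<Sum>i<j. \<xi> i) \<in> A"
        "\<And>l. 1 \<le> l \<Longrightarrow> l < j \<Longrightarrow> x + (\<Sum>i<l. \<xi> i) \<notin> A \<union> B" by blast
      have "j \<noteq> 1" using j(3) False by auto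
      then obtain j' where j': "j = Suc j'" "1 \<le> j'" using j(1) by (cases j) auto
      have "(x + \<xi> 0) + (\<Sum>i<l. ?\<eta> i) \<notin> A \<union> B" if "1 \<le> l" "l < j'" for l
        using j(4)[of "Suc l"] that unfolding shift j' by simp
      then show ?l using j(2,3) j'(2) unfolding j'(1) shift by (intro exI[of _ j']) auto
    qed
    finally show ?thesis .
  qed
qed auto

lemma hits_mono: "hits A B n x \<xi> \<Longrightarrow> n \<le> m \<Longrightarrow> hits A B m x \<xi>"
  unfolding hits_iff by (meson order_trans)

lemma walk_shift: "walk X x n \<omega> = x + (\<Sum>i<n. X (Suc i) \<omega>)"
proof -
  have "(\<Sum>i=1..n. X i \<omega>) = (\<Sum>i<n. X (Suc i) \<omega>)"
    by (rule sum.reindex_bij_witness[of _ Suc "\<lambda>i. i - 1"]) auto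
  then show ?thesis by (simp add: walk_def)
qed

text \<open>Strictness means that a first visit to the union exists and lies in \<open>A\<close>: it
  excludes an infinite hitting time of \<open>A\<close>, and disjointness excludes a simultaneous
  visit to \<open>B\<close>.\<close>

lemma hit_time_less_iff:
  assumes AB: "A \<inter> B = {}"
  shows "hit_time X x A \<omega> < hit_time X x B \<omega> \<longleftrightarrow> (\<exists>n. hits A B n x (\<lambda>i. X (Suc i) \<omega>))"
proof
  let ?S = "\<lambda>n. walk X x n \<omega>"
  assume lt: "hit_time X x A \<omega> < hit_time X x B \<omega>"
  have "\<exists>n. 1 \<le> n \<and> ?S n \<in> A"
  proof (rule ccontr)
    assume "\<not> ?thesis"
    then have "{enat n |n. n \<ge> 1 \<and> ?S n \<in> A} = {}" by auto
    then have "hit_time X x A \<omega> = \<infinity>" unfolding hit_time_def by (simp only: Inf_enat_def simp_thms if_True)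
    then show False using lt by simp
  qed
  then have ex: "\<exists>n. 1 \<le> n \<and> ?S n \<in> A" .
  define j where "j = (LEAST n. 1 \<le> n \<and> ?S n \<in> A)"
  have j: "1 \<le> j" "?S j \<in> A" unfolding j_def using LeastI_ex[OF ex] by blast+
  have jmin: "j \<le> n" if "1 \<le> n" "?S n \<in> A" for n
    unfolding j_def using that by (intro Least_le) simp
  have Aj: "enat j \<le> hit_time X x A \<omega>"
    unfolding hit_time_def using jmin by (intro Inf_greatest) auto
  have "?S l \<notin> A \<union> B" if l: "1 \<le> l" "l < j" for l
  proof -
    have "?S l \<notin> A" using jmin[of l] l by auto
    moreover have "?S l \<notin> B"
    proof
      assume "?S l \<in> B"
      then have "hit_time X x B \<omega> \<le> enat l" unfolding hit_time_def using l by (intro Inf_lower) auto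
      then have "hit_time X x B \<omega> \<le> hit_time X x A \<omega>" using Aj l
        by (meson enat_ord_simps(1) less_imp_le order_trans)
      then show False using lt by simp
    qed
    ultimately show ?thesis by simp
  qed
  then show "\<exists>n. hits A B n x (\<lambda>i. X (Suc i) \<omega>)"
    using j unfolding hits_iff walk_shift by blast
next
  let ?S = "\<lambda>n. walk X x n \<omega>"
  assume "\<exists>n. hits A B n x (\<lambda>i. X (Suc i) \<omega>)"
  then obtain j where j: "1 \<le> j" "?S j \<in> A" "\<And>l. 1 \<le> l \<Longrightarrow> l < j \<Longrightarrow> ?S l \<notin> A \<union> B"
    unfolding hits_iff walk_shift by blast
  have "hit_time X x A \<omega> \<le> enat j" unfolding hit_time_def using j by (intro Inf_lower) auto
  also have "enat j < enat (Suc j)" by simp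
  also have "enat (Suc j) \<le> hit_time X x B \<omega>"
    unfolding hit_time_def
  proof (intro Inf_greatest)
    fix e assume "e \<in> {enat n |n. n \<ge> 1 \<and> ?S n \<in> B}"
    then obtain n where n: "e = enat n" "1 \<le> n" "?S n \<in> B" by auto
    have "\<not> n < j" using j(3)[of n] n by auto
    moreover have "n \<noteq> j" using j(2) n(3) AB by auto
    ultimately show "enat (Suc j) \<le> e" using n(1) by simp
  qed
  finally show "hit_time X x A \<omega> < hit_time X x B \<omega>" .
qed

abbreviation step_seq :: "int pmf \<Rightarrow> (nat \<Rightarrow> int) measure" where
  "step_seq p \<equiv> PiM (UNIV :: nat set) (\<lambda>_. measure_pmf p)"

lemma space_step_seq [simp]: "space (step_seq p) = UNIV"
  by (simp add: space_PiM PiE_UNIV_domain)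

lemma step_seq_shift_measurable [measurable]: "(\<lambda>\<xi> i. \<xi> (Suc i)) \<in> measurable (step_seq p) (step_seq p)"
  by (rule measurable_PiM_single') (auto intro!: measurable_component_singleton)

lemma step_seq_component: "(\<lambda>\<xi>. \<xi> i) \<in> measurable (step_seq p) (count_space UNIV)"
proof -
  have "(\<lambda>\<xi>. \<xi> i) \<in> measurable (step_seq p) (measure_pmf p)" by (rule measurable_component_singleton) simp
  then show ?thesis by simp
qed

text \<open>Under the product measure the first coordinate is independent of the shifted sequence,
  which has the original law. \<open>P\<close> depends on the first coordinate, as the recursion of
  \<open>hits\<close> demands.\<close>

lemma emeasure_step_seq_first:
  assumes m: "\<And>v. {\<xi>. P v \<xi>} \<in> sets (step_seq p)"
  shows "{\<xi>. P (\<xi> 0) (\<lambda>i. \<xi> (Suc i))} \<in> sets (step_seq p)"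
    and "emeasure (step_seq p) {\<xi>. P (\<xi> 0) (\<lambda>i. \<xi> (Suc i))} = (\<integral>\<^sup>+v. emeasure (step_seq p) {\<xi>. P v \<xi>} \<partial>measure_pmf p)"
proof -
  let ?A = "\<lambda>v. (\<lambda>\<xi>. \<xi> 0) -` {v} \<inter> space (step_seq p)"
  let ?B = "\<lambda>v. (\<lambda>\<xi> i. \<xi> (Suc i)) -` {\<xi>. P v \<xi>} \<inter> space (step_seq p)"
  have eq: "{\<xi>. P (\<xi> 0) (\<lambda>i. \<xi> (Suc i))} = (\<Union>v. ?A v \<inter> ?B v)"
    by auto
  have A: "?A v \<in> sets (step_seq p)" for v by (rule measurable_sets[OF step_seq_component]) simp
  have B: "?B v \<in> sets (step_seq p)" for v by (rule measurable_sets[OF step_seq_shift_measurable m])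
  show S: "{\<xi>. P (\<xi> 0) (\<lambda>i. \<xi> (Suc i))} \<in> sets (step_seq p)"
    unfolding eq using A B by (intro sets.countable_UN' sets.Int) auto
  interpret S: sequence_space "measure_pmf p" by standard
  have c: "(\<lambda>(s, \<omega>). case_nat s \<omega>) \<in> measurable (measure_pmf p \<Otimes>\<^sub>M step_seq p) (step_seq p)"
  proof (rule measurable_PiM_single')
    fix i
    show "(\<lambda>\<omega>. (case \<omega> of (s, \<xi>) \<Rightarrow> case_nat s \<xi>) i) \<in> measurable (measure_pmf p \<Otimes>\<^sub>M step_seq p) (measure_pmf p)"
    proof (cases i)
      case 0
      then show ?thesis using measurable_fst by (simp add: case_prod_beta)
    next
      case (Suc j)
      then show ?thesis
        using measurable_compose[OF measurable_snd step_seq_component[of j p], of "measure_pmf p"] by (simp add: case_prod_beta)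
    qed
  qed simp
  have "emeasure (step_seq p) {\<xi>. P (\<xi> 0) (\<lambda>i. \<xi> (Suc i))}
    = emeasure (distr (measure_pmf p \<Otimes>\<^sub>M step_seq p) (step_seq p) (\<lambda>(s, \<omega>). case_nat s \<omega>)) {\<xi>. P (\<xi> 0) (\<lambda>i. \<xi> (Suc i))}"
    by (simp only: S.PiM_iter)
  also have "\<dots> = emeasure (measure_pmf p \<Otimes>\<^sub>M step_seq p) ((\<lambda>(s, \<omega>). case_nat s \<omega>) -` {\<xi>. P (\<xi> 0) (\<lambda>i. \<xi> (Suc i))} \<inter> space (measure_pmf p \<Otimes>\<^sub>M step_seq p))"
    by (rule emeasure_distr[OF c S])
  also have "(\<lambda>(s, \<omega>). case_nat s \<omega>) -` {\<xi>. P (\<xi> 0) (\<lambda>i. \<xi> (Suc i))} \<inter> space (measure_pmf p \<Otimes>\<^sub>M step_seq p) = {(v, \<xi>). P v \<xi>}"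
    by (auto simp: space_pair_measure)
  also have "emeasure (measure_pmf p \<Otimes>\<^sub>M step_seq p) {(v, \<xi>). P v \<xi>} = (\<integral>\<^sup>+v. emeasure (step_seq p) (Pair v -` {(v, \<xi>). P v \<xi>}) \<partial>measure_pmf p)"
  proof (rule S.emeasure_pair_measure_alt)
    have "{(v, \<xi>). P v \<xi>} = (\<Union>v. {v} \<times> {\<xi>. P v \<xi>})" by auto
    also have "\<dots> \<in> sets (measure_pmf p \<Otimes>\<^sub>M step_seq p)"
    proof -
      have "{v} \<times> {\<xi>. P v \<xi>} \<in> sets (measure_pmf p \<Otimes>\<^sub>M step_seq p)" for v
        by (rule pair_measureI[OF _ m]) simp
      then show ?thesis by (intro sets.countable_UN') auto
    qed
    finally show "{(v, \<xi>). P v \<xi>} \<in> sets (measure_pmf p \<Otimes>\<^sub>M step_seq p)" .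
  qed
  finally show "emeasure (step_seq p) {\<xi>. P (\<xi> 0) (\<lambda>i. \<xi> (Suc i))} = (\<integral>\<^sup>+v. emeasure (step_seq p) {\<xi>. P v \<xi>} \<partial>measure_pmf p)"
    by simp
qed

lemma emeasure_hits:
  "{\<xi>. hits A B n x \<xi>} \<in> sets (step_seq p) \<and>
   emeasure (step_seq p) {\<xi>. hits A B n x \<xi>} = hit_upto p 1 (A \<union> B) (indicator A) n x"
proof (induction n arbitrary: x)
  case (Suc n)
  let ?P = "\<lambda>v \<xi>. if x + v \<in> A \<union> B then x + v \<in> A else hits A B n (x + v) \<xi>"
  have m: "{\<xi>. ?P v \<xi>} \<in> sets (step_seq p)" for v
  proof (cases "x + v \<in> A \<union> B")
    case True
    then show ?thesis using sets.top[of "step_seq p"] by (cases "x + v \<in> A") auto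
  next
    case False
    then have "{\<xi>. ?P v \<xi>} = {\<xi>. hits A B n (x + v) \<xi>}" by auto
    then show ?thesis using Suc.IH[of "x + v"] by simp
  qed
  interpret S: sequence_space "measure_pmf p" by standard
  have one: "emeasure (step_seq p) UNIV = 1"
    using S.emeasure_space_1 by simp
  have e: "emeasure (step_seq p) {\<xi>. ?P v \<xi>} = (if x + v \<in> A \<union> B then indicator A (x + v) else hit_upto p 1 (A \<union> B) (indicator A) n (x + v))" for v
  proof (cases "x + v \<in> A \<union> B")
    case True
    then show ?thesis using one by (cases "x + v \<in> A") auto
  next
    case False
    then have "{\<xi>. ?P v \<xi>} = {\<xi>. hits A B n (x + v) \<xi>}" by auto
    then show ?thesis using Suc.IH[of "x + v"] False by simp
  qed
  note first = emeasure_step_seq_first[of ?P p, OF m]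
  have eq: "{\<xi>. hits A B (Suc n) x \<xi>} = {\<xi>. ?P (\<xi> 0) (\<lambda>i. \<xi> (Suc i))}" by auto
  show ?case unfolding eq first(2) e using first(1) by simp
next
  case 0
  have "{\<xi>. hits A B 0 x \<xi>} = {}" by simp
  then show ?case by (simp only: sets.empty_sets emeasure_empty hit_upto.simps simp_thms)
qed

lemma emeasure_walk:
  "{\<xi>. (\<Sum>i<n. \<xi> i) = z} \<in> sets (step_seq p) \<and>
   emeasure (step_seq p) {\<xi>. (\<Sum>i<n. \<xi> i) = z} = ennreal (pmf (step_pow p n) z)"
proof (induction n arbitrary: z)
  case 0
  interpret S: sequence_space "measure_pmf p" by standard
  have one: "emeasure (step_seq p) UNIV = 1"
    using S.emeasure_space_1 by simp
  show ?case using one sets.top[of "step_seq p"] by (cases "z = 0") auto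
next
  case (Suc n)
  let ?P = "\<lambda>v \<xi>. (\<Sum>i<n. \<xi> i) = z - v"
  have m: "{\<xi>. ?P v \<xi>} \<in> sets (step_seq p)" for v using Suc.IH by blast
  note first = emeasure_step_seq_first[of ?P p, OF m]
  have eq: "{\<xi>. (\<Sum>i<Suc n. \<xi> i) = z} = {\<xi>. ?P (\<xi> 0) (\<lambda>i. \<xi> (Suc i))}"
    by (auto simp: sum.lessThan_Suc_shift simp del: sum.lessThan_Suc)
  have ih: "emeasure (step_seq p) {\<xi>. (\<Sum>i<n. \<xi> i) = z} = ennreal (pmf (step_pow p n) z)" for z
    using Suc.IH by blast
  show ?case unfolding eq first(2) ih step_pow_Suc_nn_integral using first(1) by simp
qed

text \<open>On a countable type the points of mass 0 form a countable union of null sets, so the law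
  is carried by its atoms.\<close>

lemma discrete_law_pmf:
  fixes N :: "int measure"
  assumes "prob_space N" "sets N = UNIV"
  shows "measure_pmf (Abs_pmf N) = N"
proof (rule Abs_pmf_inverse, intro CollectI conjI assms)
  interpret N: prob_space N by fact
  have "(\<Union>x\<in>{x. measure N {x} = 0}. {x}) \<in> null_sets N"
    by (rule null_sets_UN') (auto simp: null_sets_def assms(2) N.emeasure_eq_measure)
  then have "AE x in N. x \<notin> (\<Union>x\<in>{x. measure N {x} = 0}. {x})" by (rule AE_not_in)
  then show "AE x in N. measure N {x} \<noteq> 0" by eventually_elim auto
qed

section \<open>The i.i.d. walk and its step law\<close>

locale iid_walk = prob_space M for M :: "'a measure" +
  fixes X :: "nat \<Rightarrow> 'a \<Rightarrow> int"
  assumes iid: "iid_int M X"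
begin

lemma X_measurable [measurable]: "X i \<in> measurable M (count_space UNIV)"
  using iid unfolding iid_int_def indep_vars_def by auto

definition step_law :: "int pmf" where "step_law = Abs_pmf (distr M (count_space UNIV) (X 0))"

lemma step_law: "measure_pmf step_law = distr M (count_space UNIV) (X i)"
proof -
  have "measure_pmf step_law = distr M (count_space UNIV) (X 0)"
    unfolding step_law_def by (intro discrete_law_pmf prob_space_distr) auto
  also have "\<dots> = distr M (count_space UNIV) (X i)" using iid unfolding iid_int_def by metis
  finally show ?thesis .
qed

lemma seq_measurable: "(\<lambda>\<omega> i. X (Suc i) \<omega>) \<in> measurable M (step_seq step_law)"
proof (rule measurable_PiM_single')
  show "(\<lambda>\<omega>. X (Suc i) \<omega>) \<in> measurable M (measure_pmf step_law)" for i by simp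
qed auto

text \<open>The steps are \<open>X 1\<close>, \<open>X 2\<close> and so on; as \<open>Suc\<close> is
  injective, the shifted family inherits independence from the whole family.\<close>

lemma distr_seq: "distr M (step_seq step_law) (\<lambda>\<omega> i. X (Suc i) \<omega>) = step_seq step_law"
proof -
  have X: "indep_sets (\<lambda>i. {X i -` A \<inter> space M |A. A \<in> sets (count_space UNIV)}) UNIV"
    using iid unfolding iid_int_def indep_vars_def2 by auto
  have ind: "indep_vars (\<lambda>_. count_space UNIV) (\<lambda>i. X (Suc i)) UNIV"
    unfolding indep_vars_def2
  proof (intro conjI ballI X_measurable indep_setsI)
    show "{X (Suc i) -` A \<inter> space M |A. A \<in> sets (count_space UNIV)} \<subseteq> events" for i
      using measurable_sets[OF X_measurable[of "Suc i"]] by blast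
  next
    fix A :: "nat \<Rightarrow> 'a set" and J :: "nat set"
    assume J: "J \<noteq> {}" "finite J"
      and A: "\<forall>j\<in>J. A j \<in> {X (Suc j) -` A \<inter> space M |A. A \<in> sets (count_space UNIV)}"
    have "prob (\<Inter>j\<in>Suc ` J. A (j - 1)) = (\<Prod>j\<in>Suc ` J. prob (A (j - 1)))"
      using J A by (intro indep_setsD[OF X]) auto
    then show "prob (\<Inter>j\<in>J. A j) = (\<Prod>j\<in>J. prob (A j))"
      by (simp add: prod.reindex)
  qed
  have "distr M (PiM UNIV (\<lambda>_. count_space UNIV)) (\<lambda>\<omega>. \<lambda>i\<in>UNIV. X (Suc i) \<omega>) = PiM UNIV (\<lambda>i. distr M (count_space UNIV) (X (Suc i)))"
    using ind by (subst (asm) indep_vars_iff_distr_eq_PiM) auto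
  moreover have "PiM UNIV (\<lambda>i. distr M (count_space UNIV) (X (Suc i))) = step_seq step_law"
    by (simp add: step_law[symmetric])
  moreover have "distr M (PiM UNIV (\<lambda>_. count_space UNIV)) (\<lambda>\<omega>. \<lambda>i\<in>UNIV. X (Suc i) \<omega>) = distr M (step_seq step_law) (\<lambda>\<omega> i. X (Suc i) \<omega>)"
    by (intro distr_cong sets_PiM_cong) auto
  ultimately show ?thesis by simp
qed

lemma emeasure_seq:
  assumes "{\<xi>. P \<xi>} \<in> sets (step_seq step_law)"
  shows "{\<omega> \<in> space M. P (\<lambda>i. X (Suc i) \<omega>)} \<in> sets M"
    "emeasure M {\<omega> \<in> space M. P (\<lambda>i. X (Suc i) \<omega>)} = emeasure (step_seq step_law) {\<xi>. P \<xi>}"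
proof -
  have e: "{\<omega> \<in> space M. P (\<lambda>i. X (Suc i) \<omega>)} = (\<lambda>\<omega> i. X (Suc i) \<omega>) -` {\<xi>. P \<xi>} \<inter> space M" by auto
  show "{\<omega> \<in> space M. P (\<lambda>i. X (Suc i) \<omega>)} \<in> sets M"
    unfolding e by (rule measurable_sets[OF seq_measurable assms])
  show "emeasure M {\<omega> \<in> space M. P (\<lambda>i. X (Suc i) \<omega>)} = emeasure (step_seq step_law) {\<xi>. P \<xi>}"
    unfolding e using emeasure_distr[OF seq_measurable assms] by (simp only: distr_seq)
qed

lemma prob_walk: "measure M {\<omega> \<in> space M. walk X 0 n \<omega> = z} = pmf (step_pow step_law n) z"
  using emeasure_seq(2)[OF conjunct1[OF emeasure_walk[of n z]]] unfolding walk_shift conjunct2[OF emeasure_walk]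
  by (simp add: emeasure_eq_measure)

lemma prob_hit_before_eq:
  assumes AB: "A \<inter> B = {}"
  shows "prob_hit_before M X x A B = hit_before step_law A B x"
proof -
  let ?E = "\<lambda>n. {\<omega> \<in> space M. hits A B n x (\<lambda>i. X (Suc i) \<omega>)}"
  have "incseq ?E" using hits_mono by (auto simp: incseq_def)
  then have "(SUP n. emeasure M (?E n)) = emeasure M (\<Union>n. ?E n)"
    using emeasure_seq(1)[OF conjunct1[OF emeasure_hits]] by (intro SUP_emeasure_incseq) auto
  moreover have "(\<Union>n. ?E n) = {\<omega> \<in> space M. hit_time X x A \<omega> < hit_time X x B \<omega>}"
    unfolding hit_time_less_iff[OF AB] by auto
  moreover have "emeasure M (?E n) = hit_upto step_law 1 (A \<union> B) (indicator A) n x" for n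
    using emeasure_seq(2)[OF conjunct1[OF emeasure_hits]] emeasure_hits by simp
  ultimately have "emeasure M {\<omega> \<in> space M. hit_time X x A \<omega> < hit_time X x B \<omega>} = hit_exp step_law 1 (A \<union> B) (indicator A) x"
    by (simp add: hit_exp_def)
  then show ?thesis unfolding prob_hit_before_def disc_hit_def measure_def by simp
qed

text \<open>The lower tail is the upper tail of the reflected law, so a single analysis of
  \<open>upper_m\<close> covers both signs.\<close>

lemma m_plus_eq: "m_plus M (X 0) x = upper_m step_law x"
  and m_minus_eq: "m_minus M (X 0) x = upper_m (map_pmf uminus step_law) x"
proof -
  have p: "mu_plus M (X 0) y = measure (measure_pmf step_law) {k. y < real_of_int k}" for y
    unfolding mu_plus_def step_law[of 0]
    by (subst measure_distr) (auto intro!: arg_cong[where f="measure M"])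
  have n: "mu_minus M (X 0) y = measure (measure_pmf (map_pmf uminus step_law)) {k. y < real_of_int k}" for y
    unfolding mu_minus_def map_pmf_rep_eq
    by (subst measure_distr, simp, simp, unfold step_law[of 0], subst measure_distr) (auto intro!: arg_cong[where f="measure M"])
  show "m_plus M (X 0) x = upper_m step_law x"
    unfolding m_plus_def upper_m_def eta_plus_def upper_eta_def p ..
  show "m_minus M (X 0) x = upper_m (map_pmf uminus step_law) x"
    unfolding m_minus_def upper_m_def eta_minus_def upper_eta_def n ..
qed

end

section \<open>Verification of the hypotheses for the step law\<close>

lemma psi_zero_cis:
  assumes "psi p t = 0" "k \<in> set_pmf p"
  shows "cis (t * real_of_int k) = 1"
proof -
  have I: "integrable (measure_pmf p) (\<lambda>k. 1 - cos (t * real_of_int k))"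
    by (intro Bochner_Integration.integrable_diff trig_integrable) simp
  have "(\<integral>k. 1 - cos (t * real_of_int k) \<partial>measure_pmf p) = 0" using assms(1) psi_Re[of p t] by simp
  then have "AE k in measure_pmf p. 1 - cos (t * real_of_int k) = 0"
    by (subst (asm) integral_nonneg_eq_0_iff_AE[OF I]) auto
  then have c: "cos (t * real_of_int k) = 1" using assms(2) by (simp add: AE_measure_pmf_iff)
  moreover have "sin (t * real_of_int k) = 0"
    using sin_cos_squared_add[of "t * real_of_int k"] unfolding c by simp
  ultimately show ?thesis by (simp add: complex_eq_iff)
qed

text \<open>At a zero of \<open>psi\<close> all jumps satisfy \<open>cis (t k) = 1\<close>, and sums
  inherit this. An irreducible walk reaches 1, which then forces \<open>cis t = 1\<close>.\<close>

lemma psi_zero_cis_step_pow: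
  assumes "psi p t = 0" "z \<in> set_pmf (step_pow p n)"
  shows "cis (t * real_of_int z) = 1"
  using assms(2)
proof (induction n arbitrary: z)
  case (Suc n)
  then obtain v y where "v \<in> set_pmf p" "y \<in> set_pmf (step_pow p n)" "z = v + y" by auto
  then show ?case
    using psi_zero_cis[OF assms(1)] Suc.IH by (simp add: distrib_left cis_mult[symmetric])
qed simp

lemma kmean_uminus: "kmean (map_pmf uminus p) hub {0<..} t = kmean p hub {..<0} t"
  unfolding kmean_def by (simp add: hub_def indicator_def)

text \<open>The two factors 2 are those of \<open>upper_m_bounds\<close>; \<open>a / d\<close>
  becomes \<open>Jp / J\<close> and \<open>b / c\<close> becomes
  \<open>m_plus / m_total\<close>.\<close>

lemma ratio_comparison:
  fixes a b c d :: real
  assumes "0 < c" "a \<le> 2 * b" "c \<le> 2 * d" "0 \<le> b"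
  shows "a / d \<le> 4 * (b / c)"
proof -
  have "a / d \<le> (2 * b) / d" using assms by (intro divide_right_mono) auto
  also have "\<dots> \<le> (2 * b) / (c / 2)" using assms by (intro divide_left_mono) auto
  finally show ?thesis by simp
qed

context iid_walk
begin

lemma escape_law_step_law:
  assumes irr: "irreducible_walk M X"
    and X_int: "integrable M (\<lambda>\<omega>. real_of_int (X 0 \<omega>))"
    and mean: "(\<integral>\<omega>. real_of_int (X 0 \<omega>) \<partial>M) = 0"
    and var: "(\<integral>\<^sup>+\<omega>. ennreal ((real_of_int (X 0 \<omega>))\<^sup>2) \<partial>M) = \<infinity>"
    and two: "measure M {\<omega> \<in> space M. X 0 \<omega> \<ge> 2} > 0"
    and lim: "((\<lambda>x. m_plus M (X 0) x / m_total M (X 0) x) \<longlongrightarrow> 0) at_top"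
  shows "escape_law step_law"
proof -
  interpret centered_law step_law
  proof
    show "integrable (measure_pmf step_law) real_of_int"
      unfolding step_law[of 0] using X_int by (subst integrable_distr_eq) auto
    show "(\<integral>k. real_of_int k \<partial>measure_pmf step_law) = 0"
      unfolding step_law[of 0] using mean by (subst integral_distr) auto
    show "(\<integral>\<^sup>+k. ennreal ((real_of_int k)\<^sup>2) \<partial>measure_pmf step_law) = \<infinity>"
      unfolding step_law[of 0] using var by (subst nn_integral_distr) auto
  qed
  have psi_nonzero: "psi step_law t \<noteq> 0" if t: "0 < t" "t \<le> pi" for t
  proof
    assume z: "psi step_law t = 0"
    obtain n where "measure M {\<omega> \<in> space M. walk X 0 n \<omega> = 1} > 0"
      using irr unfolding irreducible_walk_def by blast
    then have "1 \<in> set_pmf (step_pow step_law n)" unfolding prob_walk by (simp add: set_pmf_iff)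
    then have "cis t = 1" using psi_zero_cis_step_pow[OF z] by fastforce
    then have "cos t = cos 0" by (simp add: complex_eq_iff)
    moreover have "cos t < cos 0" using t by (intro cos_monotone_0_pi) auto
    ultimately show False by simp
  qed
  \<comment> \<open>At \<open>x = 1/t\<close> the two halves of \<open>m\<close> are comparable with
    \<open>x^2\<close> times the two halves of \<open>J\<close>, the negative one through the
    reflected law.\<close>
  have bound: "Jp t / J t \<le> 4 * (m_plus M (X 0) (inverse t) / m_total M (X 0) (inverse t))" if t: "0 < t" for t
  proof -
    define x where "x = inverse t"
    have x: "0 < x" "1 / x = t" using t by (auto simp: x_def divide_inverse)
    have int': "integrable (measure_pmf (map_pmf uminus step_law)) real_of_int"
      using int by simp
    note P = upper_m_bounds[OF int x(1), unfolded x(2)]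
    note N = upper_m_bounds[OF int' x(1), unfolded x(2) kmean_uminus]
    have x2: "0 < x\<^sup>2" using x by simp
    have Jt: "x\<^sup>2 * J t = x\<^sup>2 * kmean step_law hub {..<0} t + x\<^sup>2 * Jp t"
      unfolding kmean_hub_split[OF int] by (simp add: distrib_left)
    have pos: "0 < x\<^sup>2 * J t" using x2 J_pos[OF t] by simp
    have p0: "0 \<le> x\<^sup>2 * Jp t" using kmean_nonneg[OF int] x2 by simp
    have m: "m_total M (X 0) x = upper_m step_law x + upper_m (map_pmf uminus step_law) x"
      unfolding m_total_def m_plus_eq m_minus_eq ..
    have "x\<^sup>2 * Jp t / (x\<^sup>2 * J t) \<le> 4 * (m_plus M (X 0) x / m_total M (X 0) x)"
    proof (rule ratio_comparison)
      show "0 < m_total M (X 0) x" unfolding m using P(1) N(1) Jt pos by linarith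
      show "x\<^sup>2 * Jp t \<le> 2 * m_plus M (X 0) x" unfolding m_plus_eq by (rule P(1))
      show "m_total M (X 0) x \<le> 2 * (x\<^sup>2 * J t)" unfolding m Jt using add_mono[OF P(2) N(2)] by (simp add: algebra_simps)
      show "0 \<le> m_plus M (X 0) x" unfolding m_plus_eq using P(1) p0 by linarith
    qed
    then show ?thesis using x2 unfolding x_def[symmetric] by simp
  qed
  show ?thesis
  proof
    show "psi step_law t \<noteq> 0" if "0 < t" "t \<le> pi" for t by (rule psi_nonzero[OF that])
    have "((\<lambda>t. 4 * (m_plus M (X 0) (inverse t) / m_total M (X 0) (inverse t))) \<longlongrightarrow> 4 * 0) (at_right 0)"
      by (intro tendsto_mult tendsto_const filterlim_compose[OF lim filterlim_inverse_at_top_right])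
    then have up: "((\<lambda>t. 4 * (m_plus M (X 0) (inverse t) / m_total M (X 0) (inverse t))) \<longlongrightarrow> 0) (at_right 0)" by simp
    show "((\<lambda>t. Jp t / J t) \<longlongrightarrow> 0) (at_right 0)"
    proof (rule tendsto_sandwich[OF _ _ tendsto_const up])
      show "\<forall>\<^sub>F t in at_right 0. 0 \<le> Jp t / J t"
        using kmean_nonneg[OF int] by (intro always_eventually) simp
      show "\<forall>\<^sub>F t in at_right 0. Jp t / J t \<le> 4 * (m_plus M (X 0) (inverse t) / m_total M (X 0) (inverse t))"
        using bound by (simp add: eventually_at_filter)
    qed
    show "\<exists>u\<in>set_pmf step_law. 2 \<le> u"
    proof (rule ccontr)
      assume n: "\<not> ?thesis"
      have "measure (measure_pmf step_law) {2..} = measure M {\<omega> \<in> space M. X 0 \<omega> \<ge> 2}"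
        unfolding step_law[of 0] by (subst measure_distr) (auto intro!: arg_cong[where f="measure M"])
      moreover have "measure (measure_pmf step_law) {2..} = 0"
        unfolding measure_pmf_zero_iff using n by auto
      ultimately show False using two by simp
    qed
  qed
qed

end

theorem proposition55:
  fixes M :: "'a measure" and X :: "nat \<Rightarrow> 'a \<Rightarrow> int"
  assumes "prob_space M"
    and "iid_int M X"
    and "irreducible_walk M X"
    and "integrable M (\<lambda>\<omega>. real_of_int (X 0 \<omega>))"
    and "(\<integral>\<omega>. real_of_int (X 0 \<omega>) \<partial>M) = 0"
    and "(\<integral>\<^sup>+\<omega>. ennreal ((real_of_int (X 0 \<omega>))\<^sup>2) \<partial>M) = \<infinity>"
    and "measure M {\<omega> \<in> space M. X 0 \<omega> \<ge> 2} > 0"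
    and "((\<lambda>x. m_plus M (X 0) x / m_total M (X 0) x) \<longlongrightarrow> 0) at_top"
  shows "\<exists>err :: nat \<Rightarrow> nat \<Rightarrow> int \<Rightarrow> real.
     \<forall>\<epsilon>>0. \<exists>\<delta>>0. \<exists>N :: nat. \<forall>Q R :: nat. \<forall>x :: int.
       0 < Q \<longrightarrow> 0 < R \<longrightarrow> N \<le> min Q R \<longrightarrow> - int Q < x \<longrightarrow> x < int R \<longrightarrow>
       \<bar>(potential M X (- int R) - potential M X (- int R + x)) / potential_dagger M X x\<bar> < \<delta> \<longrightarrow>
       \<bar>err Q R x\<bar> < \<epsilon> \<and>
       prob_hit_before M X x (UNIV - {- int Q<..<int R}) {0} =
         prob_hit_before M X x {- int Q, int R} {0} * (1 + err Q R x)"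
proof -
  interpret W: iid_walk M X using assms(1,2) by (simp add: iid_walk_def iid_walk_axioms_def)
  interpret E: escape_law W.step_law by (rule W.escape_law_step_law[OF assms(3-8)])
  have pot: "potential M X x = E.pot x" for x
    unfolding potential_def W.prob_walk using E.pot_sums by (rule sums_unique[symmetric])
  have dag: "potential_dagger M X x = E.pot_dagger x" for x
    unfolding potential_dagger_def pot ..
  define exit hit where "exit Q R x = prob_hit_before M X x (UNIV - {- int Q<..<int R}) {0}"
    and "hit Q R x = prob_hit_before M X x {- int Q, int R} {0}" for Q R x
  \<comment> \<open>Where \<open>hit\<close> is 0 the quotient is 0 by convention and
    \<open>err\<close> carries no information; the conditions expressed by \<open>\<delta>\<close>
    and \<open>N\<close> exclude this case.\<close>
  define err where "err Q R x = exit Q R x / hit Q R x - 1" for Q R x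
  have "\<exists>\<delta>>0. \<exists>N :: nat. \<forall>Q R :: nat. \<forall>x :: int.
       0 < Q \<longrightarrow> 0 < R \<longrightarrow> N \<le> min Q R \<longrightarrow> - int Q < x \<longrightarrow> x < int R \<longrightarrow>
       \<bar>(potential M X (- int R) - potential M X (- int R + x)) / potential_dagger M X x\<bar> < \<delta> \<longrightarrow>
       \<bar>err Q R x\<bar> < \<epsilon> \<and> exit Q R x = hit Q R x * (1 + err Q R x)" if eps: "0 < \<epsilon>" for \<epsilon>
  proof -
    \<comment> \<open>\<open>\<epsilon> / 2\<close> gives the strict inequality for
      \<open>err\<close>.\<close>
    obtain \<delta> and N :: nat where d: "0 < \<delta>" and
      b: "\<And>Q R x. 0 < Q \<Longrightarrow> 0 < R \<Longrightarrow> N \<le> min Q R \<Longrightarrow> - int Q < x \<Longrightarrow> x < int R \<Longrightarrow>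
      \<bar>(E.pot (- int R) - E.pot (- int R + x)) / E.pot_dagger x\<bar> < \<delta> \<Longrightarrow>
      0 < hit_before W.step_law {- int Q, int R} {0} x \<and>
      hit_before W.step_law {- int Q, int R} {0} x \<le> hit_before W.step_law (UNIV - {- int Q<..<int R}) {0} x \<and>
      hit_before W.step_law (UNIV - {- int Q<..<int R}) {0} x \<le> (1 + \<epsilon> / 2) * hit_before W.step_law {- int Q, int R} {0} x"
      using E.escape_probability_asymptotics[of "\<epsilon> / 2"] eps by auto
    have "\<bar>err Q R x\<bar> < \<epsilon> \<and> exit Q R x = hit Q R x * (1 + err Q R x)"
      if QR: "0 < Q" "0 < R" and hyp: "N \<le> min Q R" "- int Q < x" "x < int R"
        "\<bar>(potential M X (- int R) - potential M X (- int R + x)) / potential_dagger M X x\<bar> < \<delta>" for Q R x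
    proof -
      have h: "hit Q R x = hit_before W.step_law {- int Q, int R} {0} x"
        and e: "exit Q R x = hit_before W.step_law (UNIV - {- int Q<..<int R}) {0} x"
        unfolding hit_def exit_def using QR by (auto intro!: W.prob_hit_before_eq)
      have c: "0 < hit Q R x" "hit Q R x \<le> exit Q R x" "exit Q R x \<le> (1 + \<epsilon> / 2) * hit Q R x"
        using b[OF QR hyp(1-3) hyp(4)[unfolded pot dag]] unfolding h e by auto
      have "1 \<le> exit Q R x / hit Q R x" "exit Q R x / hit Q R x \<le> 1 + \<epsilon> / 2"
        using c by (auto simp: le_divide_eq divide_le_eq)
      then have "\<bar>err Q R x\<bar> < \<epsilon>" using eps unfolding err_def by linarith
      moreover have "exit Q R x = hit Q R x * (1 + err Q R x)" using c(1) by (simp add: err_def)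
      ultimately show ?thesis by simp
    qed
    then show ?thesis using d by blast
  qed
  then show ?thesis unfolding exit_def hit_def by blast
qed

end
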